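(* Let $g=C\left(\frac{1}{4F}dz^2+F(\eta^1)^2+(\eta^2)^2+(\eta^3)^2\right)$ with $F=F(z)>0$, $C=C(z)>0$. (a) $g$ is extremal K\"ahler with complex structure $J^+$ if and only if $C=C_0e^{-z}$ for a constant $C_0>0$ and $\mathcal{L}^+(\mathcal{L}^-(F))-1=0$, meaning that for some real constants $C_1,\dots,C_4$ $$F(z)=1+\frac12C_1e^{-2z}+C_2e^{-z}+C_3e^{z}+\frac12C_4e^{2z}.\qquad( * )$$ (b) $g$ is Bach-flat if and only if $F$ has the form $( * )$ with $C_1C_4-C_2C_3=0$. (c) $g$ is K\"ahler-Einstein with complex structure $J^+$ if and only if $C=C_0e^{-z}$ and $F$ has the form $( * )$ with $C_1=C_3=0$. (d) $g$ has $W^\pm=0$ if and only if $\mathcal{L}^\pm(F)-1=0$, meaning, respectively, $F(z)=1+C_3e^{z}+\frac12C_4e^{2z}$ (for $W^+=0$) or $F(z)=1+\frac12C_1e^{-2z}+C_2e^{-z}$ (for $W^-=0$). Consequently: up to homothety, the extremal metrics constitute a 3-parameter family of metrics. Up to homothety and conformal transformation, the Bach-flat metrics constitute a 2-parameter family of metrics which, up to conformal factors, is a subspace of the extremal metrics. Up to homothety and conformal transformation, the metrics with $W^+=0$ (or $W^-=0$) form a 1-parameter subspace of the Bach-flat metrics. The K\"ahler-Einstein metrics also form a 1-parameter subspace of the Bach-flat metrics.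
   Context: Let $\eta^1,\eta^2,\eta^3$ be the left-invariant coframe on $\mathbb{S}^3$ with $d\eta^1=-2\eta^2\wedge\eta^3$ and cyclic permutations, with dual frame $e_1,e_2,e_3$. The metric $g$ lives on $I\times\mathbb{S}^3$, $I$ an interval with coordinate $z$; these are the $U(2)$-invariant metrics considered. Complex structures: $J^\pm=\mp2F\frac{\partial}{\partial z}\otimes\eta^1\pm\frac1{2F}e_1\otimes dz-e_2\otimes\eta^3+e_3\otimes\eta^2$, with $(1,1)$-forms $\omega^\pm=g(J^\pm\cdot,\cdot)$. The orientation is that of $J^+$, so $\omega^\pm\in\bigwedge^\pm$, and $W^\pm$ are the self-dual/anti-self-dual parts of the Weyl tensor. Operators: $\mathcal{L}^+=\left(-\frac12\frac{d}{dz}+1\right)\left(-\frac{d}{dz}+1\right)$, $\mathcal{L}^-=\left(\frac12\frac{d}{dz}+1\right)\left(\frac{d}{dz}+1\right)$. "Extremal" means extremal K\"ahler: $g$ is K\"ahler for the complex structure $J$ and is critical for $\int s^2\,dVol$ under variations preserving the K\"ahler class; equivalently $J\nabla s$ is Killing, $s$ the scalar curvature. Bach-flat means $Bach=0$ where $Bach_{ij}=W_{sijt}{}^{,st}+\frac12W_{sijt}\mathrm{Ric}^{st}$. "Up to homothety" means identifying metrics that differ by a diffeomorphism (in particular translation in $z$) and multiplication of $g$ by a positive constant; this lowers the number of free parameters by two (translation in $z$, scaling of $g$). *)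

theory Defs
  imports "HOL-Analysis.Analysis"
begin

section \<open>Smoothness\<close>

fun iter_deriv :: "('a::real_normed_vector \<Rightarrow> 'b::real_normed_vector) \<Rightarrow> 'a list \<Rightarrow> 'a \<Rightarrow> 'b" where
  "iter_deriv f [] = f"
| "iter_deriv f (v # vs) = (\<lambda>x. frechet_derivative (iter_deriv f vs) (at x) v)"

text \<open>\<open>C\<^sup>\<infinity>\<close> on an open set: every iterated directional derivative is differentiable there.\<close>

definition smooth_on :: "'a::real_normed_vector set \<Rightarrow> ('a \<Rightarrow> 'b::real_normed_vector) \<Rightarrow> bool" where
  "smooth_on U f \<longleftrightarrow> (\<forall>vs. \<forall>x\<in>U. iter_deriv f vs differentiable (at x))"

definition diffeomorphism_on ::
  "(real^4 \<Rightarrow> real^4) \<Rightarrow> (real^4) set \<Rightarrow> (real^4) set \<Rightarrow> bool" where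
  "diffeomorphism_on \<phi> U V \<longleftrightarrow> \<phi> ` U = V \<and> smooth_on U \<phi> \<and>
     (\<exists>\<psi>. \<psi> ` V = U \<and> smooth_on V \<psi> \<and> (\<forall>x\<in>U. \<psi> (\<phi> x) = x) \<and> (\<forall>y\<in>V. \<phi> (\<psi> y) = y))"


section \<open>Riemannian geometry on open subsets of \<open>\<real>\<^sup>4\<close>\<close>

text \<open>
  Everything is expressed in the standard coordinates. A metric is its field of Gram matrices; a
  covariant tensor field of rank \<open>k\<close> is given by its components, indexed by lists of length \<open>k\<close>.
\<close>

type_synonym metric = "real^4 \<Rightarrow> real^4^4"
type_synonym tensor = "4 list \<Rightarrow> real^4 \<Rightarrow> real"

definition pd :: "4 \<Rightarrow> (real^4 \<Rightarrow> real) \<Rightarrow> real^4 \<Rightarrow> real" where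
  "pd i f x = frechet_derivative f (at x) (axis i 1)"

definition ginv :: "metric \<Rightarrow> metric" where
  "ginv g x = matrix_inv (g x)"

definition christoffel :: "metric \<Rightarrow> 4 \<Rightarrow> 4 \<Rightarrow> 4 \<Rightarrow> real^4 \<Rightarrow> real" where
  "christoffel g m i j x = (\<Sum>l\<in>UNIV. ginv g x $ m $ l *
     (pd i (\<lambda>y. g y $ j $ l) x + pd j (\<lambda>y. g y $ i $ l) x - pd l (\<lambda>y. g y $ i $ j) x)) / 2"

text \<open>The differentiation index is appended at the end: \<open>T\<^bsub>ij,a\<^esub> = cov_deriv g T [i, j, a]\<close>.\<close>

definition cov_deriv :: "metric \<Rightarrow> tensor \<Rightarrow> tensor" where
  "cov_deriv g T ks x = (let is = butlast ks; a = last ks in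
     pd a (T is) x -
     (\<Sum>p<length is. \<Sum>m\<in>UNIV. christoffel g m a (is ! p) x * T (is[p := m]) x))"

text \<open>
  \<open>riemann_up g l k i j\<close> is the \<open>l\<close>-th component of
  \<open>R(\<partial>\<^sub>i, \<partial>\<^sub>j) \<partial>\<^sub>k = \<nabla>\<^sub>i \<nabla>\<^sub>j \<partial>\<^sub>k - \<nabla>\<^sub>j \<nabla>\<^sub>i \<partial>\<^sub>k\<close>, and
  \<open>R\<^bsub>sijt\<^esub> = g(R(\<partial>\<^sub>s, \<partial>\<^sub>i) \<partial>\<^sub>j, \<partial>\<^sub>t)\<close>. With this ordering of the indices
  \<open>Ric\<^bsub>ij\<^esub> = g\<^sup>s\<^sup>t R\<^bsub>sijt\<^esub>\<close>, which is positive on round spheres.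
\<close>

definition riemann_up :: "metric \<Rightarrow> 4 \<Rightarrow> 4 \<Rightarrow> 4 \<Rightarrow> 4 \<Rightarrow> real^4 \<Rightarrow> real" where
  "riemann_up g l k i j x =
     pd i (christoffel g l j k) x - pd j (christoffel g l i k) x +
     (\<Sum>m\<in>UNIV. christoffel g l i m x * christoffel g m j k x
               - christoffel g l j m x * christoffel g m i k x)"

definition riemann :: "metric \<Rightarrow> 4 \<Rightarrow> 4 \<Rightarrow> 4 \<Rightarrow> 4 \<Rightarrow> real^4 \<Rightarrow> real" where
  "riemann g s i j t x = (\<Sum>l\<in>UNIV. g x $ t $ l * riemann_up g l j s i x)"

definition ricci :: "metric \<Rightarrow> 4 \<Rightarrow> 4 \<Rightarrow> real^4 \<Rightarrow> real" where
  "ricci g i j x = (\<Sum>s\<in>UNIV. \<Sum>t\<in>UNIV. ginv g x $ s $ t * riemann g s i j t x)"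

definition scalar_curv :: "metric \<Rightarrow> real^4 \<Rightarrow> real" where
  "scalar_curv g x = (\<Sum>i\<in>UNIV. \<Sum>j\<in>UNIV. ginv g x $ i $ j * ricci g i j x)"

text \<open>The totally trace-free part of the curvature tensor, with the constants of dimension four.\<close>

definition weyl :: "metric \<Rightarrow> 4 \<Rightarrow> 4 \<Rightarrow> 4 \<Rightarrow> 4 \<Rightarrow> real^4 \<Rightarrow> real" where
  "weyl g s i j t x = riemann g s i j t x
     - (g x $ s $ t * ricci g i j x + g x $ i $ j * ricci g s t x
        - g x $ s $ j * ricci g i t x - g x $ i $ t * ricci g s j x) / 2
     + scalar_curv g x * (g x $ s $ t * g x $ i $ j - g x $ s $ j * g x $ i $ t) / 6"

definition weyl_tensor :: "metric \<Rightarrow> tensor" where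
  "weyl_tensor g ks = weyl g (ks ! 0) (ks ! 1) (ks ! 2) (ks ! 3)"

definition bach :: "metric \<Rightarrow> 4 \<Rightarrow> 4 \<Rightarrow> real^4 \<Rightarrow> real" where
  "bach g i j x =
     (\<Sum>s\<in>UNIV. \<Sum>t\<in>UNIV. \<Sum>a\<in>UNIV. \<Sum>b\<in>UNIV. ginv g x $ s $ a * ginv g x $ t $ b *
        (cov_deriv g (cov_deriv g (weyl_tensor g)) [s, i, j, t, a, b] x
         + weyl g s i j t x * ricci g a b x / 2))"

definition bach_flat :: "(real^4) set \<Rightarrow> metric \<Rightarrow> bool" where
  "bach_flat U g \<longleftrightarrow> (\<forall>x\<in>U. \<forall>i j. bach g i j x = 0)"

definition einstein :: "(real^4) set \<Rightarrow> metric \<Rightarrow> bool" where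
  "einstein U g \<longleftrightarrow> (\<exists>\<Lambda>. \<forall>x\<in>U. \<forall>i j. ricci g i j x = \<Lambda> * g x $ i $ j)"

text \<open>Volume form of \<open>g\<close> for the standard orientation of \<open>\<real>\<^sup>4\<close>.\<close>

definition vol_form :: "metric \<Rightarrow> 4 \<Rightarrow> 4 \<Rightarrow> 4 \<Rightarrow> 4 \<Rightarrow> real^4 \<Rightarrow> real" where
  "vol_form g i j k l x =
     sqrt (det (g x)) * det (vector [axis i 1, axis j 1, axis k 1, axis l 1] :: real^4^4)"

text \<open>
  Hodge star applied to the first pair of indices of the Weyl tensor, using
  \<open>(*\<alpha>)\<^bsub>ij\<^esub> = 1/2 vol\<^bsub>ijcd\<^esub> \<alpha>\<^sup>c\<^sup>d\<close> on 2-forms. Since this commutes with the curvature operator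
  \<open>W\<close>, the maps \<open>(W \<plusminus> * W) / 2\<close> are the restrictions of \<open>W\<close> to the \<open>\<plusminus>1\<close>-eigenspaces of the star.
\<close>

definition star_weyl :: "metric \<Rightarrow> 4 \<Rightarrow> 4 \<Rightarrow> 4 \<Rightarrow> 4 \<Rightarrow> real^4 \<Rightarrow> real" where
  "star_weyl g i j k l x =
     (\<Sum>a\<in>UNIV. \<Sum>b\<in>UNIV. \<Sum>c\<in>UNIV. \<Sum>d\<in>UNIV.
        vol_form g i j c d x * ginv g x $ c $ a * ginv g x $ d $ b * weyl g a b k l x) / 2"

definition weyl_plus :: "metric \<Rightarrow> 4 \<Rightarrow> 4 \<Rightarrow> 4 \<Rightarrow> 4 \<Rightarrow> real^4 \<Rightarrow> real" where
  "weyl_plus g i j k l x = (weyl g i j k l x + star_weyl g i j k l x) / 2"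

definition weyl_minus :: "metric \<Rightarrow> 4 \<Rightarrow> 4 \<Rightarrow> 4 \<Rightarrow> 4 \<Rightarrow> real^4 \<Rightarrow> real" where
  "weyl_minus g i j k l x = (weyl g i j k l x - star_weyl g i j k l x) / 2"

definition weyl_plus_zero :: "(real^4) set \<Rightarrow> metric \<Rightarrow> bool" where
  "weyl_plus_zero U g \<longleftrightarrow> (\<forall>x\<in>U. \<forall>i j k l. weyl_plus g i j k l x = 0)"

definition weyl_minus_zero :: "(real^4) set \<Rightarrow> metric \<Rightarrow> bool" where
  "weyl_minus_zero U g \<longleftrightarrow> (\<forall>x\<in>U. \<forall>i j k l. weyl_minus g i j k l x = 0)"


section \<open>Kaehler and extremal metrics\<close>

text \<open>An endomorphism field \<open>J\<close> of the tangent bundle has components \<open>J\<^sup>i\<^sub>j = J x $ i $ j\<close>.\<close>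

definition nijenhuis :: "(real^4 \<Rightarrow> real^4^4) \<Rightarrow> 4 \<Rightarrow> 4 \<Rightarrow> 4 \<Rightarrow> real^4 \<Rightarrow> real" where
  "nijenhuis J k i j x =
     (\<Sum>m\<in>UNIV. J x $ m $ i * pd m (\<lambda>y. J y $ k $ j) x - J x $ m $ j * pd m (\<lambda>y. J y $ k $ i) x
       - J x $ k $ m * (pd i (\<lambda>y. J y $ m $ j) x - pd j (\<lambda>y. J y $ m $ i) x))"

definition complex_structure :: "(real^4) set \<Rightarrow> (real^4 \<Rightarrow> real^4^4) \<Rightarrow> bool" where
  "complex_structure U J \<longleftrightarrow> smooth_on U J \<and>
     (\<forall>x\<in>U. J x ** J x = - mat 1 \<and> (\<forall>k i j. nijenhuis J k i j x = 0))"

text \<open>\<open>\<omega> = g(J \<cdot>, \<cdot>)\<close>\<close>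

definition kaehler_form :: "metric \<Rightarrow> (real^4 \<Rightarrow> real^4^4) \<Rightarrow> 4 \<Rightarrow> 4 \<Rightarrow> real^4 \<Rightarrow> real" where
  "kaehler_form g J i j x = (\<Sum>k\<in>UNIV. J x $ k $ i * g x $ k $ j)"

definition kaehler :: "(real^4) set \<Rightarrow> metric \<Rightarrow> (real^4 \<Rightarrow> real^4^4) \<Rightarrow> bool" where
  "kaehler U g J \<longleftrightarrow> complex_structure U J \<and>
     (\<forall>x\<in>U. transpose (J x) ** g x ** J x = g x) \<and>
     (\<forall>x\<in>U. \<forall>i j k. pd i (kaehler_form g J j k) x + pd j (kaehler_form g J k i) x
                     + pd k (kaehler_form g J i j) x = 0)"

definition gradient :: "metric \<Rightarrow> (real^4 \<Rightarrow> real) \<Rightarrow> real^4 \<Rightarrow> real^4" where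
  "gradient g f x = (\<chi> i. \<Sum>j\<in>UNIV. ginv g x $ i $ j * pd j f x)"

text \<open>Vanishing of the Lie derivative of \<open>g\<close> along \<open>X\<close>.\<close>

definition killing :: "(real^4) set \<Rightarrow> metric \<Rightarrow> (real^4 \<Rightarrow> real^4) \<Rightarrow> bool" where
  "killing U g X \<longleftrightarrow> (\<forall>x\<in>U. \<forall>i j.
     (\<Sum>k\<in>UNIV. X x $ k * pd k (\<lambda>y. g y $ i $ j) x + g x $ k $ j * pd i (\<lambda>y. X y $ k) x
              + g x $ i $ k * pd j (\<lambda>y. X y $ k) x) = 0)"

definition extremal_kaehler :: "(real^4) set \<Rightarrow> metric \<Rightarrow> (real^4 \<Rightarrow> real^4^4) \<Rightarrow> bool" where
  "extremal_kaehler U g J \<longleftrightarrow> kaehler U g J \<and>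
     killing U g (\<lambda>x. J x *v gradient g (scalar_curv g) x)"

definition kaehler_einstein :: "(real^4) set \<Rightarrow> metric \<Rightarrow> (real^4 \<Rightarrow> real^4^4) \<Rightarrow> bool" where
  "kaehler_einstein U g J \<longleftrightarrow> kaehler U g J \<and> einstein U g"


section \<open>The manifold \<open>I \<times> S\<^sup>3\<close> and its invariant metrics\<close>

text \<open>
  \<open>I \<times> S\<^sup>3\<close> is identified with an open subset of \<open>\<real>\<^sup>4 - {0}\<close> by \<open>(z, q) \<mapsto> e\<^sup>z q\<close>, where \<open>S\<^sup>3\<close> is
  the group of unit quaternions and \<open>x = (x\<^sub>1, x\<^sub>2, x\<^sub>3, x\<^sub>4)\<close> stands for
  \<open>x\<^sub>1 + x\<^sub>2 i + x\<^sub>3 j + x\<^sub>4 k\<close>. Then \<open>\<partial>/\<partial>z\<close> is the position vector field, and the left-invariant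
  fields \<open>e\<^sub>1, e\<^sub>2, e\<^sub>3\<close> are right multiplication of \<open>x\<close> by \<open>i, j, k\<close>. These four fields are
  pairwise orthogonal and of length \<open>norm x\<close> at \<open>x\<close>, whence the dual coframe.
\<close>

definition zcoord :: "real^4 \<Rightarrow> real" where
  "zcoord x = ln (norm x)"

definition cyl :: "real set \<Rightarrow> (real^4) set" where
  "cyl I = {x. x \<noteq> 0 \<and> zcoord x \<in> I}"

definition e0 :: "real^4 \<Rightarrow> real^4" where "e0 x = x"
definition e1 :: "real^4 \<Rightarrow> real^4" where "e1 x = vector [- x$2, x$1, x$4, - x$3]"
definition e2 :: "real^4 \<Rightarrow> real^4" where "e2 x = vector [- x$3, - x$4, x$1, x$2]"
definition e3 :: "real^4 \<Rightarrow> real^4" where "e3 x = vector [- x$4, x$3, - x$2, x$1]"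

definition dz :: "real^4 \<Rightarrow> real^4" where "dz x = e0 x /\<^sub>R (x \<bullet> x)"
definition eta1 :: "real^4 \<Rightarrow> real^4" where "eta1 x = e1 x /\<^sub>R (x \<bullet> x)"
definition eta2 :: "real^4 \<Rightarrow> real^4" where "eta2 x = e2 x /\<^sub>R (x \<bullet> x)"
definition eta3 :: "real^4 \<Rightarrow> real^4" where "eta3 x = e3 x /\<^sub>R (x \<bullet> x)"

definition ext_deriv :: "(real^4 \<Rightarrow> real^4) \<Rightarrow> 4 \<Rightarrow> 4 \<Rightarrow> real^4 \<Rightarrow> real" where
  "ext_deriv \<alpha> i j x = pd i (\<lambda>y. \<alpha> y $ j) x - pd j (\<lambda>y. \<alpha> y $ i) x"

definition wedge :: "real^4 \<Rightarrow> real^4 \<Rightarrow> 4 \<Rightarrow> 4 \<Rightarrow> real" where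
  "wedge \<alpha> \<beta> i j = \<alpha> $ i * \<beta> $ j - \<alpha> $ j * \<beta> $ i"

lemma vec4_nth:
  "(vector [a, b, c, d] :: real^4) $ 1 = a" "(vector [a, b, c, d] :: real^4) $ 2 = b"
  "(vector [a, b, c, d] :: real^4) $ 3 = c" "(vector [a, b, c, d] :: real^4) $ 4 = d"
  by (simp_all add: vector_def)

lemma inner4: "(x::real^4) \<bullet> y = x$1*y$1+x$2*y$2+x$3*y$3+x$4*y$4"
  by (simp add: inner_vec_def sum_4)

lemma coframe_dual:
  assumes "x \<noteq> 0"
  shows "dz x \<bullet> e0 x = 1" "dz x \<bullet> e1 x = 0" "dz x \<bullet> e2 x = 0" "dz x \<bullet> e3 x = 0"
    "eta1 x \<bullet> e0 x = 0" "eta1 x \<bullet> e1 x = 1" "eta1 x \<bullet> e2 x = 0" "eta1 x \<bullet> e3 x = 0"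
    "eta2 x \<bullet> e0 x = 0" "eta2 x \<bullet> e1 x = 0" "eta2 x \<bullet> e2 x = 1" "eta2 x \<bullet> e3 x = 0"
    "eta3 x \<bullet> e0 x = 0" "eta3 x \<bullet> e1 x = 0" "eta3 x \<bullet> e2 x = 0" "eta3 x \<bullet> e3 x = 1"
proof -
  have "x \<bullet> x \<noteq> 0" using assms by simp
  moreover have "e1 x \<bullet> e1 x = x \<bullet> x" "e2 x \<bullet> e2 x = x \<bullet> x" "e3 x \<bullet> e3 x = x \<bullet> x"
    "x \<bullet> e1 x = 0" "x \<bullet> e2 x = 0" "x \<bullet> e3 x = 0"
    "e1 x \<bullet> e2 x = 0" "e1 x \<bullet> e3 x = 0" "e2 x \<bullet> e3 x = 0"
    by (simp_all add: inner4 e1_def e2_def e3_def vec4_nth algebra_simps)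
  ultimately show "dz x \<bullet> e0 x = 1" "dz x \<bullet> e1 x = 0" "dz x \<bullet> e2 x = 0" "dz x \<bullet> e3 x = 0"
    "eta1 x \<bullet> e0 x = 0" "eta1 x \<bullet> e1 x = 1" "eta1 x \<bullet> e2 x = 0" "eta1 x \<bullet> e3 x = 0"
    "eta2 x \<bullet> e0 x = 0" "eta2 x \<bullet> e1 x = 0" "eta2 x \<bullet> e2 x = 1" "eta2 x \<bullet> e3 x = 0"
    "eta3 x \<bullet> e0 x = 0" "eta3 x \<bullet> e1 x = 0" "eta3 x \<bullet> e2 x = 0" "eta3 x \<bullet> e3 x = 1"
    by (simp_all add: dz_def eta1_def eta2_def eta3_def e0_def inner_commute)
qed

lemma pd_quot:
  assumes "bounded_linear L" "x \<noteq> 0"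
  shows "pd i (\<lambda>y. L y / (y \<bullet> y)) x = (L (axis i 1) * (x \<bullet> x) - 2 * L x * x $ i) / (x \<bullet> x)\<^sup>2"
proof -
  have n: "x \<bullet> x \<noteq> 0" using assms by simp
  have "((\<lambda>y. L y / (y \<bullet> y)) has_derivative (\<lambda>h. (L h * (x \<bullet> x) - L x * (2 * (x \<bullet> h))) / (x \<bullet> x)\<^sup>2)) (at x)"
    using n by (auto intro!: derivative_eq_intros bounded_linear_imp_has_derivative assms(1)
        simp: divide_simps inner_commute power2_eq_square algebra_simps)
  from frechet_derivative_at[OF this, symmetric] show ?thesis
    by (simp add: pd_def inner_axis algebra_simps)
qed

lemma eta_nth:
  "(\<lambda>y. eta1 y $ j) = (\<lambda>y. e1 y $ j / (y \<bullet> y))"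
  "(\<lambda>y. eta2 y $ j) = (\<lambda>y. e2 y $ j / (y \<bullet> y))"
  "(\<lambda>y. eta3 y $ j) = (\<lambda>y. e3 y $ j / (y \<bullet> y))"
  by (auto simp: eta1_def eta2_def eta3_def field_simps)

lemma e_linear: "bounded_linear (\<lambda>y. e1 y $ j)" "bounded_linear (\<lambda>y. e2 y $ j)" "bounded_linear (\<lambda>y. e3 y $ j)"
proof -
  have "\<forall>j. bounded_linear (\<lambda>y. e1 y $ j) \<and> bounded_linear (\<lambda>y. e2 y $ j) \<and> bounded_linear (\<lambda>y. e3 y $ j)"
    unfolding forall_4 e1_def e2_def e3_def vec4_nth
    by (auto intro!: bounded_linear_vec_nth bounded_linear_minus)
  thus "bounded_linear (\<lambda>y. e1 y $ j)" "bounded_linear (\<lambda>y. e2 y $ j)" "bounded_linear (\<lambda>y. e3 y $ j)" by auto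
qed

lemma structure_equations:
  assumes "x \<noteq> 0"
  shows "ext_deriv eta1 i j x = - 2 * wedge (eta2 x) (eta3 x) i j"
    and "ext_deriv eta2 i j x = - 2 * wedge (eta3 x) (eta1 x) i j"
    and "ext_deriv eta3 i j x = - 2 * wedge (eta1 x) (eta2 x) i j"
proof -
  have n: "x \<bullet> x \<noteq> 0" using assms by simp
  have R: "r = - 2 * s" if "r = R / (x \<bullet> x)\<^sup>2" "s = S / (x \<bullet> x)\<^sup>2" "R = - 2 * S" for r s R S :: real
    using that by simp
  have A: "eta1 x $ k = e1 x $ k / (x \<bullet> x)" "eta2 x $ k = e2 x $ k / (x \<bullet> x)"
    "eta3 x $ k = e3 x $ k / (x \<bullet> x)" for k
    by (auto simp: eta1_def eta2_def eta3_def field_simps)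
  have W: "wedge (eta2 x) (eta3 x) i j = wedge (e2 x) (e3 x) i j / (x \<bullet> x)\<^sup>2"
     "wedge (eta3 x) (eta1 x) i j = wedge (e3 x) (e1 x) i j / (x \<bullet> x)\<^sup>2"
     "wedge (eta1 x) (eta2 x) i j = wedge (e1 x) (e2 x) i j / (x \<bullet> x)\<^sup>2" for i j
    by (simp_all add: wedge_def A power2_eq_square diff_divide_distrib)
  note q = ext_deriv_def eta_nth pd_quot[OF e_linear(1) assms] pd_quot[OF e_linear(2) assms]
      pd_quot[OF e_linear(3) assms] diff_divide_distrib[symmetric]
  have "\<forall>i j. (e1 (axis i 1) $ j * (x \<bullet> x) - 2 * e1 x $ j * x $ i)
      - (e1 (axis j 1) $ i * (x \<bullet> x) - 2 * e1 x $ i * x $ j) = - 2 * wedge (e2 x) (e3 x) i j"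
    unfolding forall_4
    by (simp add: e1_def e2_def e3_def vec4_nth inner4 wedge_def axis_def power2_eq_square algebra_simps)
  then have "ext_deriv eta1 i j x = - 2 * wedge (eta2 x) (eta3 x) i j"
    by (intro R[OF _ W(1)]) (simp_all only: q)
  moreover have "\<forall>i j. (e2 (axis i 1) $ j * (x \<bullet> x) - 2 * e2 x $ j * x $ i)
      - (e2 (axis j 1) $ i * (x \<bullet> x) - 2 * e2 x $ i * x $ j) = - 2 * wedge (e3 x) (e1 x) i j"
    unfolding forall_4
    by (simp add: e1_def e2_def e3_def vec4_nth inner4 wedge_def axis_def power2_eq_square algebra_simps)
  then have "ext_deriv eta2 i j x = - 2 * wedge (eta3 x) (eta1 x) i j"
    by (intro R[OF _ W(2)]) (simp_all only: q)
  moreover have "\<forall>i j. (e3 (axis i 1) $ j * (x \<bullet> x) - 2 * e3 x $ j * x $ i)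
      - (e3 (axis j 1) $ i * (x \<bullet> x) - 2 * e3 x $ i * x $ j) = - 2 * wedge (e1 x) (e2 x) i j"
    unfolding forall_4
    by (simp add: e1_def e2_def e3_def vec4_nth inner4 wedge_def axis_def power2_eq_square algebra_simps)
  then have "ext_deriv eta3 i j x = - 2 * wedge (eta1 x) (eta2 x) i j"
    by (intro R[OF _ W(3)]) (simp_all only: q)
  ultimately show "ext_deriv eta1 i j x = - 2 * wedge (eta2 x) (eta3 x) i j"
    and "ext_deriv eta2 i j x = - 2 * wedge (eta3 x) (eta1 x) i j"
    and "ext_deriv eta3 i j x = - 2 * wedge (eta1 x) (eta2 x) i j" by blast+
qed

text \<open>
  The frame \<open>e0, e1, e2, e3\<close> is the standard basis at the quaternion \<open>1\<close>, hence positively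
  oriented everywhere on \<open>\<real>\<^sup>4 - {0}\<close>. Since \<open>Jplus\<close> below maps \<open>e0\<close> to a positive multiple of \<open>e1\<close>
  and \<open>e2\<close> to \<open>e3\<close>, the standard orientation of \<open>\<real>\<^sup>4\<close> is the orientation of \<open>Jplus\<close>.
\<close>

definition u2_metric :: "(real \<Rightarrow> real) \<Rightarrow> (real \<Rightarrow> real) \<Rightarrow> metric" where
  "u2_metric F C x = (let z = zcoord x in \<chi> i j. C z *
     (1 / (4 * F z) * (dz x $ i * dz x $ j) + F z * (eta1 x $ i * eta1 x $ j)
      + eta2 x $ i * eta2 x $ j + eta3 x $ i * eta3 x $ j))"

definition Jplus :: "(real \<Rightarrow> real) \<Rightarrow> real^4 \<Rightarrow> real^4^4" where
  "Jplus F x = (let z = zcoord x in \<chi> i j.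
     - 2 * F z * (e0 x $ i * eta1 x $ j) + 1 / (2 * F z) * (e1 x $ i * dz x $ j)
     - e2 x $ i * eta3 x $ j + e3 x $ i * eta2 x $ j)"

text \<open>The triples \<open>(I, F, C)\<close> that determine one of the metrics under consideration.\<close>

type_synonym u2_triple = "real set \<times> (real \<Rightarrow> real) \<times> (real \<Rightarrow> real)"

definition u2_data :: "u2_triple set" where
  "u2_data = {(I, F, C). I \<noteq> {} \<and> open I \<and> is_interval I \<and> smooth_on I F \<and> smooth_on I C \<and>
     (\<forall>z\<in>I. 0 < F z \<and> 0 < C z)}"

definition extremal_triples :: "u2_triple set" where
  "extremal_triples =
     {(I, F, C) \<in> u2_data. extremal_kaehler (cyl I) (u2_metric F C) (Jplus F)}"

definition kaehler_einstein_triples :: "u2_triple set" where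
  "kaehler_einstein_triples =
     {(I, F, C) \<in> u2_data. kaehler_einstein (cyl I) (u2_metric F C) (Jplus F)}"

definition bach_flat_triples :: "u2_triple set" where
  "bach_flat_triples = {(I, F, C) \<in> u2_data. bach_flat (cyl I) (u2_metric F C)}"

definition weyl_plus_zero_triples :: "u2_triple set" where
  "weyl_plus_zero_triples = {(I, F, C) \<in> u2_data. weyl_plus_zero (cyl I) (u2_metric F C)}"

definition weyl_minus_zero_triples :: "u2_triple set" where
  "weyl_minus_zero_triples = {(I, F, C) \<in> u2_data. weyl_minus_zero (cyl I) (u2_metric F C)}"


section \<open>The differential operators and the explicit solutions\<close>

definition L_plus :: "(real \<Rightarrow> real) \<Rightarrow> real \<Rightarrow> real" where
  "L_plus f = (let h = (\<lambda>z. - deriv f z + f z) in (\<lambda>z. - (1 / 2) * deriv h z + h z))"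

definition L_minus :: "(real \<Rightarrow> real) \<Rightarrow> real \<Rightarrow> real" where
  "L_minus f = (let h = (\<lambda>z. deriv f z + f z) in (\<lambda>z. 1 / 2 * deriv h z + h z))"

definition F_sol :: "real \<Rightarrow> real \<Rightarrow> real \<Rightarrow> real \<Rightarrow> real \<Rightarrow> real" where
  "F_sol C1 C2 C3 C4 z =
     1 + 1 / 2 * C1 * exp (- 2 * z) + C2 * exp (- z) + C3 * exp z + 1 / 2 * C4 * exp (2 * z)"


section \<open>Counting parameters\<close>

definition pullback :: "(real^4 \<Rightarrow> real^4) \<Rightarrow> metric \<Rightarrow> metric" where
  "pullback \<phi> h x =
     (let D = matrix (frechet_derivative \<phi> (at x)) in transpose D ** h (\<phi> x) ** D)"

fun homothetic :: "u2_triple \<Rightarrow> u2_triple \<Rightarrow> bool" where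
  "homothetic (I, F, C) (I', F', C') \<longleftrightarrow>
     (\<exists>\<phi> c. diffeomorphism_on \<phi> (cyl I) (cyl I') \<and> 0 < c \<and>
        (\<forall>x\<in>cyl I. pullback \<phi> (u2_metric F' C') x = c *\<^sub>R u2_metric F C x))"

text \<open>Equivalence under homotheties and conformal changes of the metric taken together.\<close>

fun conformal :: "u2_triple \<Rightarrow> u2_triple \<Rightarrow> bool" where
  "conformal (I, F, C) (I', F', C') \<longleftrightarrow>
     (\<exists>\<phi> u. diffeomorphism_on \<phi> (cyl I) (cyl I') \<and> smooth_on (cyl I) u \<and>
        (\<forall>x\<in>cyl I. 0 < u x \<and> pullback \<phi> (u2_metric F' C') x = u x *\<^sub>R u2_metric F C x))"

text \<open>
  \<open>parameter_family TYPE('k) X R\<close>: up to \<open>R\<close>, the metrics in \<open>X\<close> form a family with exactly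
  \<open>CARD('k)\<close> parameters. There are finitely many families of functions \<open>(F\<^sub>p, C\<^sub>p)\<close>, depending
  smoothly on a parameter \<open>p\<close> in an open subset of \<open>\<real>\<^sup>k\<close>, which yield members of \<open>X\<close> and represent
  every member of \<open>X\<close> up to \<open>R\<close> (so \<open>k\<close> parameters suffice), and on some nonempty open set of
  parameters in one of the families, distinct parameters give inequivalent metrics (so none of the
  \<open>k\<close> parameters is redundant). The interval on which the metric lives is not counted as a
  parameter: the same \<open>(F\<^sub>p, C\<^sub>p)\<close> may be used on any interval on which it defines a member
  of \<open>X\<close>, and inequivalence is required for all choices of such intervals.
\<close>

definition parameter_family ::
  "'k::finite itself \<Rightarrow> u2_triple set \<Rightarrow> (u2_triple \<Rightarrow> u2_triple \<Rightarrow> bool) \<Rightarrow> bool" where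
  "parameter_family _ X R \<longleftrightarrow>
     (\<exists>(N::nat) (P :: nat \<Rightarrow> (real^'k) set) (F :: nat \<Rightarrow> real^'k \<Rightarrow> real \<Rightarrow> real)
        (C :: nat \<Rightarrow> real^'k \<Rightarrow> real \<Rightarrow> real).
        (\<forall>n<N. open (P n) \<and> smooth_on (P n \<times> UNIV) (\<lambda>(p, z). F n p z) \<and>
            smooth_on (P n \<times> UNIV) (\<lambda>(p, z). C n p z) \<and>
            (\<forall>p\<in>P n. \<exists>I. (I, F n p, C n p) \<in> X)) \<and>
        (\<forall>m\<in>X. \<exists>n<N. \<exists>p\<in>P n. \<exists>I. (I, F n p, C n p) \<in> X \<and> R m (I, F n p, C n p)) \<and>
        (\<exists>n<N. \<exists>V\<subseteq>P n. open V \<and> V \<noteq> {} \<and>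
            (\<forall>p\<in>V. \<forall>q\<in>V. \<forall>I I'. (I, F n p, C n p) \<in> X \<longrightarrow> (I', F n q, C n q) \<in> X \<longrightarrow>
               R (I, F n p, C n p) (I', F n q, C n q) \<longrightarrow> p = q)))"

end

theory Submission
  imports Defs
begin

text \<open>
  In the frame \<open>2F \<partial>/\<partial>z, e\<^sub>1, e\<^sub>2, e\<^sub>3\<close> all components of the metric, of its connection and of its
  curvature are functions of \<open>z\<close> alone, so each geometric condition is an ordinary differential equation
  for \<open>F\<close> and \<open>C\<close>. The locale \<open>moving_frame\<close> relates the coordinate definitions of curvature, of the Bach
  tensor and of scalar invariants to expressions in a frame (\<open>riemann_up_frame\<close>, \<open>bach_tens\<close>,
  \<open>tens_zero_iff\<close>).

  By invariance under \<open>U(2)\<close>, each half \<open>W\<^sup>\<plusminus>\<close> of the Weyl tensor is a function times a fixed tensor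
  (\<open>u2_weyl\<close>), and the function is \<open>L_plus F - 1\<close> or \<open>L_minus F - 1\<close>; the factor \<open>C\<close> does not matter by
  conformal invariance. The Bach tensor has two independent components (\<open>u2_bach\<close>): one is
  a multiple of \<open>L_plus (L_minus F) - 1\<close>, whose zeros are the functions \<open>F_sol\<close>, and modulo this the other
  is a quadratic first integral, which on \<open>F_sol\<close> has the value \<open>12 (C1 C4 - C2 C3)\<close>.

  The almost complex structure \<open>J\<^sup>+\<close> is always integrable and compatible with the metric, and \<open>d\<omega> = 0\<close> means
  \<open>C' = - C\<close> (\<open>kaehler_iff\<close>). In that case \<open>J \<nabla>s\<close> is a function \<open>\<phi>(z)\<close> times the Killing field \<open>e\<^sub>1\<close>, so it is
  Killing iff \<open>\<phi>' = 0\<close>, and this is again the equation \<open>L_plus (L_minus F) - 1 = 0\<close> (\<open>killing_iff\<close>,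
  \<open>field_speed_deriv\<close>). The Einstein equation becomes a second-order equation for \<open>F - 1\<close> with the
  exponents \<open>-1\<close> and \<open>2\<close>.

  To count parameters, a translation of \<open>z\<close> multiplies the coefficients of \<open>F_sol\<close> by powers of a positive
  number, which normalizes one of them and bounds the number of parameters from above. For the bound
  from below, scalar invariants show that in suitable families distinct parameters give inequivalent
  metrics. For homotheties of extremal metrics the invariants are the scalar curvature, which is affine
  in \<open>exp (- z)\<close>, and the length of its gradient (\<open>extremal_rigid\<close>). A conformal map becomes an
  isometry when both metrics are rescaled by the norm of their Weyl tensors (\<open>conformal_isometry\<close>).
  After this, in a family of Bach-flat metrics the traces of powers of the Weyl operator determine \<open>z\<close> up
  to sign, and the length of the gradient of \<open>z\<^sup>2\<close> determines the coefficients (\<open>bach_rigid\<close>); if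
  \<open>W\<^sup>+\<close> or \<open>W\<^sup>-\<close> vanishes, the scalar curvature and the length of the divergence of the Weyl tensor at
  one point suffice (\<open>half_flat_rigid\<close>).
\<close>

section \<open>Smooth functions\<close>

text \<open>
  Coinduction: in a set of differentiable functions which is closed under directional derivatives,
  every function is smooth. This spares an induction over iterated derivatives in each of the
  closure properties below.
\<close>

lemma smooth_on_coinduct:
  assumes U: "open U"
    and diff: "\<And>f x. f \<in> S \<Longrightarrow> x \<in> U \<Longrightarrow> f differentiable (at x)"
    and closed: "\<And>f v. f \<in> S \<Longrightarrow> \<exists>h\<in>S. \<forall>x\<in>U. frechet_derivative f (at x) v = h x"
    and f: "f \<in> S"
  shows "smooth_on U f"
proof -
  have *: "\<exists>h\<in>S. \<forall>x\<in>U. iter_deriv f vs x = h x" for vs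
  proof (induction vs)
    case Nil then show ?case using f by auto
  next
    case (Cons v vs)
    then obtain h where h: "h \<in> S" "\<forall>x\<in>U. iter_deriv f vs x = h x" by blast
    obtain k where k: "k \<in> S" "\<forall>x\<in>U. frechet_derivative h (at x) v = k x"
      using closed[OF h(1)] by blast
    have "iter_deriv f (v # vs) x = k x" if x: "x \<in> U" for x
    proof -
      have "(h has_derivative frechet_derivative h (at x)) (at x)"
        using diff[OF h(1) x] frechet_derivative_works by blast
      then have "(iter_deriv f vs has_derivative frechet_derivative h (at x)) (at x)"
        using has_derivative_transform_within_open[OF _ U x] h(2) by metis
      then have "frechet_derivative (iter_deriv f vs) (at x) = frechet_derivative h (at x)"
        by (metis frechet_derivative_at)
      then show ?thesis using k x by simp
    qed
    then show ?case using k by blast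
  qed
  show ?thesis unfolding smooth_on_def
  proof (intro allI ballI)
    fix vs x assume x: "x \<in> U"
    obtain h where h: "h \<in> S" "\<forall>x\<in>U. iter_deriv f vs x = h x" using * by blast
    have "(h has_derivative frechet_derivative h (at x)) (at x)"
      using diff[OF h(1) x] frechet_derivative_works by blast
    then have "(iter_deriv f vs has_derivative frechet_derivative h (at x)) (at x)"
      using has_derivative_transform_within_open[OF _ U x] h(2) by metis
    then show "iter_deriv f vs differentiable (at x)" by (rule differentiableI)
  qed
qed

lemma iter_deriv_snoc:
  "iter_deriv f (vs @ [v]) = iter_deriv (\<lambda>x. frechet_derivative f (at x) v) vs"
  by (induction vs) auto

lemma smooth_on_frechet:
  "smooth_on U f \<Longrightarrow> smooth_on U (\<lambda>x. frechet_derivative f (at x) v)"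
  unfolding smooth_on_def by (metis iter_deriv_snoc)

lemma smooth_on_differentiable: "smooth_on U f \<Longrightarrow> x \<in> U \<Longrightarrow> f differentiable (at x)"
  unfolding smooth_on_def by (metis iter_deriv.simps(1))

lemma smooth_on_has_derivative:
  "smooth_on U f \<Longrightarrow> x \<in> U \<Longrightarrow> (f has_derivative frechet_derivative f (at x)) (at x)"
  using smooth_on_differentiable frechet_derivative_works by blast

lemma smooth_on_subset: "smooth_on U f \<Longrightarrow> V \<subseteq> U \<Longrightarrow> smooth_on V f"
  unfolding smooth_on_def by blast

lemma frechet_derivative_cong_open:
  assumes "open U" "x \<in> U" "\<And>y. y \<in> U \<Longrightarrow> f y = h y"
  shows "frechet_derivative f (at x) = frechet_derivative h (at x)"
proof -
  have "(f has_derivative D) (at x) \<longleftrightarrow> (h has_derivative D) (at x)" for D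
    using has_derivative_transform_within_open[OF _ assms(1,2)] assms(3) by metis
  then show ?thesis unfolding frechet_derivative_def by simp
qed

lemma smooth_on_cong:
  assumes U: "open U" and eq: "\<And>x. x \<in> U \<Longrightarrow> f x = h x" and h: "smooth_on U h"
  shows "smooth_on U f"
proof (rule smooth_on_coinduct[where S="{f. \<exists>h. smooth_on U h \<and> (\<forall>x\<in>U. f x = h x)}"])
  show "f \<in> {f. \<exists>h. smooth_on U h \<and> (\<forall>x\<in>U. f x = h x)}" using eq h by blast
next
  fix f x assume f: "f \<in> {f. \<exists>h. smooth_on U h \<and> (\<forall>x\<in>U. f x = h x)}" and x: "x \<in> U"
  then obtain h where h: "smooth_on U h" "\<forall>x\<in>U. f x = h x" by blast
  show "f differentiable (at x)"
    using has_derivative_transform_within_open[OF smooth_on_has_derivative[OF h(1) x] U x] h(2)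
    by (metis differentiableI)
next
  fix f v assume "f \<in> {f. \<exists>h. smooth_on U h \<and> (\<forall>x\<in>U. f x = h x)}"
  then obtain h where h: "smooth_on U h" "\<forall>x\<in>U. f x = h x" by blast
  have "\<forall>x\<in>U. frechet_derivative f (at x) v = frechet_derivative h (at x) v"
    using frechet_derivative_cong_open[OF U] h(2) by metis
  moreover have "smooth_on U (\<lambda>x. frechet_derivative h (at x) v)"
    using h(1) by (rule smooth_on_frechet)
  ultimately show "\<exists>k\<in>{f. \<exists>h. smooth_on U h \<and> (\<forall>x\<in>U. f x = h x)}.
      \<forall>x\<in>U. frechet_derivative f (at x) v = k x" by (auto intro!: bexI)
qed (use U in auto)

lemma smooth_on_linear:
  assumes "open U" and L: "bounded_linear L" and f: "smooth_on U f"
  shows "smooth_on U (\<lambda>x. L (f x))"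
proof (rule smooth_on_coinduct[where S="{\<lambda>x. L (f x) |f. smooth_on U f}"])
  fix k v assume "k \<in> {\<lambda>x. L (f x) |f. smooth_on U f}"
  then obtain f where f: "smooth_on U f" "k = (\<lambda>x. L (f x))" by auto
  have "\<forall>x\<in>U. frechet_derivative k (at x) v = L (frechet_derivative f (at x) v)"
    unfolding f(2) using frechet_derivative_at[OF bounded_linear.has_derivative[OF L smooth_on_has_derivative[OF f(1)]]]
    by metis
  then show "\<exists>h\<in>{\<lambda>x. L (f x) |f. smooth_on U f}. \<forall>x\<in>U. frechet_derivative k (at x) v = h x"
    using smooth_on_frechet[OF f(1), of v]
    by (intro bexI[of _ "\<lambda>x. L (frechet_derivative f (at x) v)"]) auto
next
  fix k x assume "k \<in> {\<lambda>x. L (f x) |f. smooth_on U f}" "x \<in> U"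
  then show "k differentiable (at x)"
    using bounded_linear.has_derivative[OF L smooth_on_has_derivative] by (auto intro: differentiableI)
qed (use assms in auto)

lemma smooth_on_const: "open U \<Longrightarrow> smooth_on U (\<lambda>x. c)"
  by (rule smooth_on_coinduct[where S="range (\<lambda>c x. c)"]) (auto simp: frechet_derivative_const)

lemma smooth_on_bounded_linear:
  assumes "open U" "bounded_linear L" shows "smooth_on U L"
proof (rule smooth_on_coinduct[where S="insert L (range (\<lambda>c x. c))"])
  fix f v assume "f \<in> insert L (range (\<lambda>c x. c))"
  then show "\<exists>h\<in>insert L (range (\<lambda>c x. c)). \<forall>x\<in>U. frechet_derivative f (at x) v = h x"
    using frechet_derivative_at[OF bounded_linear_imp_has_derivative[OF assms(2)]]
    by (auto simp: frechet_derivative_const)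
qed (use assms in \<open>auto intro: bounded_linear_imp_differentiable\<close>)

text \<open>
  The functions obtained from smooth ones by sums and products form a set which is closed under
  directional derivatives by the product rule, so coinduction applies to all of them at once.
\<close>

inductive_set ring_closure :: "('a \<Rightarrow> real) set \<Rightarrow> ('a \<Rightarrow> real) set" for G where
  gen: "f \<in> G \<Longrightarrow> f \<in> ring_closure G"
| add: "f \<in> ring_closure G \<Longrightarrow> h \<in> ring_closure G \<Longrightarrow> (\<lambda>x. f x + h x) \<in> ring_closure G"
| mul: "f \<in> ring_closure G \<Longrightarrow> h \<in> ring_closure G \<Longrightarrow> (\<lambda>x. f x * h x) \<in> ring_closure G"

lemma smooth_on_ring_closure:
  fixes G :: "('a::real_normed_vector \<Rightarrow> real) set"
  assumes U: "open U"
    and diff: "\<And>f x. f \<in> G \<Longrightarrow> x \<in> U \<Longrightarrow> f differentiable (at x)"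
    and closed: "\<And>f v. f \<in> G \<Longrightarrow>
      \<exists>h\<in>ring_closure G. \<forall>x\<in>U. frechet_derivative f (at x) v = h x"
    and f: "f \<in> ring_closure G"
  shows "smooth_on U f"
proof -
  have *: "(\<forall>x\<in>U. f differentiable (at x)) \<and>
      (\<forall>v. \<exists>h\<in>ring_closure G. \<forall>x\<in>U. frechet_derivative f (at x) v = h x)"
    if "f \<in> ring_closure G" for f
    using that
  proof induction
    case (gen f) then show ?case using diff closed by blast
  next
    case (add f h)
    have d: "\<forall>x\<in>U. f differentiable (at x)" "\<forall>x\<in>U. h differentiable (at x)"
      using add.IH by auto
    have "\<exists>k\<in>ring_closure G. \<forall>x\<in>U. frechet_derivative (\<lambda>x. f x + h x) (at x) v = k x" for v
    proof -
      obtain f' h' where "f' \<in> ring_closure G" "h' \<in> ring_closure G"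
        and e: "\<forall>x\<in>U. frechet_derivative f (at x) v = f' x" "\<forall>x\<in>U. frechet_derivative h (at x) v = h' x"
        using add.IH by metis
      then have "(\<lambda>x. f' x + h' x) \<in> ring_closure G" by (intro ring_closure.add)
      moreover have "frechet_derivative (\<lambda>x. f x + h x) (at x) v = f' x + h' x" if "x \<in> U" for x
      proof -
        have "(f has_derivative frechet_derivative f (at x)) (at x)"
             "(h has_derivative frechet_derivative h (at x)) (at x)"
          using d that frechet_derivative_works by blast+
        from frechet_derivative_at[OF has_derivative_add[OF this], symmetric]
        show ?thesis using e that by simp
      qed
      ultimately show ?thesis by (intro bexI[of _ "\<lambda>x. f' x + h' x"]) auto
    qed
    then show ?case using d by auto
  next
    case (mul f h)
    have d: "\<forall>x\<in>U. f differentiable (at x)" "\<forall>x\<in>U. h differentiable (at x)"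
      using mul.IH by auto
    have "\<exists>k\<in>ring_closure G. \<forall>x\<in>U. frechet_derivative (\<lambda>x. f x * h x) (at x) v = k x" for v
    proof -
      obtain f' h' where m: "f' \<in> ring_closure G" "h' \<in> ring_closure G"
        and e: "\<forall>x\<in>U. frechet_derivative f (at x) v = f' x" "\<forall>x\<in>U. frechet_derivative h (at x) v = h' x"
        using mul.IH by metis
      have "(\<lambda>x. f x * h' x + f' x * h x) \<in> ring_closure G"
        by (intro ring_closure.intros m mul.hyps)
      moreover have "frechet_derivative (\<lambda>x. f x * h x) (at x) v = f x * h' x + f' x * h x" if "x \<in> U" for x
      proof -
        have "(f has_derivative frechet_derivative f (at x)) (at x)"
             "(h has_derivative frechet_derivative h (at x)) (at x)"
          using d that frechet_derivative_works by blast+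
        from frechet_derivative_at[OF has_derivative_mult[OF this], symmetric]
        show ?thesis using e that by simp
      qed
      ultimately show ?thesis by (intro bexI[of _ "\<lambda>x. f x * h' x + f' x * h x"]) auto
    qed
    then show ?case using d by auto
  qed
  show ?thesis by (rule smooth_on_coinduct[OF U _ _ f]) (use * in blast)+
qed

lemma smooth_on_ring_closure_smooth:
  fixes f :: "'a::real_normed_vector \<Rightarrow> real"
  assumes "open U" "f \<in> ring_closure {f. smooth_on U f}" shows "smooth_on U f"
proof (rule smooth_on_ring_closure[OF assms(1) _ _ assms(2)])
  fix f :: "'a \<Rightarrow> real" and v assume "f \<in> {f. smooth_on U f}"
  then have "(\<lambda>x. frechet_derivative f (at x) v) \<in> ring_closure {f. smooth_on U f}"
    by (auto intro: ring_closure.gen smooth_on_frechet)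
  then show "\<exists>h\<in>ring_closure {f. smooth_on U f}. \<forall>x\<in>U. frechet_derivative f (at x) v = h x"
    by (intro bexI[of _ "\<lambda>x. frechet_derivative f (at x) v"]) auto
qed (auto intro: smooth_on_differentiable)

lemma smooth_on_add:
  fixes f h :: "'a::real_normed_vector \<Rightarrow> real"
  assumes "open U" "smooth_on U f" "smooth_on U h"
  shows "smooth_on U (\<lambda>x. f x + h x)"
  using assms by (intro smooth_on_ring_closure_smooth ring_closure.intros) auto

lemma smooth_on_mult:
  fixes f h :: "'a::real_normed_vector \<Rightarrow> real"
  assumes "open U" "smooth_on U f" "smooth_on U h"
  shows "smooth_on U (\<lambda>x. f x * h x)"
  using assms by (intro smooth_on_ring_closure_smooth ring_closure.intros) auto

lemma smooth_on_minus:
  fixes f :: "'a::real_normed_vector \<Rightarrow> real"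
  assumes "open U" "smooth_on U f" shows "smooth_on U (\<lambda>x. - f x)"
  using smooth_on_mult[OF assms(1) smooth_on_const[OF assms(1), of "-1"] assms(2)] by simp

lemma smooth_on_diff:
  fixes f h :: "'a::real_normed_vector \<Rightarrow> real"
  assumes "open U" "smooth_on U f" "smooth_on U h"
  shows "smooth_on U (\<lambda>x. f x - h x)"
  using smooth_on_add[OF assms(1,2) smooth_on_minus[OF assms(1,3)]] by simp

lemma smooth_on_power:
  fixes f :: "'a::real_normed_vector \<Rightarrow> real"
  assumes "open U" "smooth_on U f" shows "smooth_on U (\<lambda>x. f x ^ n)"
  by (induction n) (auto intro: smooth_on_const smooth_on_mult assms)

lemma smooth_on_sum:
  fixes f :: "'i \<Rightarrow> 'a::real_normed_vector \<Rightarrow> real"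
  assumes "open U" "\<And>i. i \<in> A \<Longrightarrow> smooth_on U (f i)"
  shows "smooth_on U (\<lambda>x. \<Sum>i\<in>A. f i x)"
  using assms(2) by (induction A rule: infinite_finite_induct)
    (auto intro: smooth_on_const smooth_on_add assms(1))

lemma frechet_derivative_real:
  fixes h :: "real \<Rightarrow> real"
  assumes "h differentiable (at x)"
  shows "frechet_derivative h (at x) = (\<lambda>v. deriv h x * v)"
proof -
  have "(h has_real_derivative deriv h x) (at x)"
    using assms by (metis DERIV_deriv_iff_real_differentiable)
  then show ?thesis
    by (metis frechet_derivative_at has_field_derivative_def)
qed

lemma smooth_on_deriv:
  fixes h :: "real \<Rightarrow> real"
  assumes "open V" "smooth_on V h" shows "smooth_on V (deriv h)"
proof (rule smooth_on_cong[OF assms(1) _ smooth_on_frechet[OF assms(2), of 1]])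
  fix x assume "x \<in> V"
  then show "deriv h x = frechet_derivative h (at x) 1"
    using frechet_derivative_real smooth_on_differentiable[OF assms(2)] by simp
qed

lemma smooth_on_has_real_derivative:
  fixes h :: "real \<Rightarrow> real"
  assumes "smooth_on V h" "x \<in> V" shows "(h has_real_derivative deriv h x) (at x)"
  using smooth_on_differentiable[OF assms] by (metis DERIV_deriv_iff_real_differentiable)

text \<open>
  Coinduction over the ring generated by the derivatives of \<open>f\<close> and the composites of \<open>f\<close> with
  smooth functions of one variable, which the chain rule maps into itself.
\<close>

lemma smooth_on_compose:
  fixes h :: "real \<Rightarrow> real" and f :: "'a::real_normed_vector \<Rightarrow> real"
  assumes U: "open U" and V: "open V" and h: "smooth_on V h" and f: "smooth_on U f"
    and sub: "\<And>x. x \<in> U \<Longrightarrow> f x \<in> V"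
  shows "smooth_on U (\<lambda>x. h (f x))"
proof -
  let ?G = "{f :: 'a \<Rightarrow> real. smooth_on U f} \<union> {\<lambda>x. h (f x) |h :: real \<Rightarrow> real. smooth_on V h}"
  have d: "((\<lambda>x. h (f x)) has_derivative (\<lambda>v. deriv h (f x) * frechet_derivative f (at x) v)) (at x)"
    if "smooth_on V h" "x \<in> U" for h :: "real \<Rightarrow> real" and x
    using has_derivative_compose[OF smooth_on_has_derivative[OF f that(2)]
        smooth_on_has_real_derivative[OF that(1) sub[OF that(2)], unfolded has_field_derivative_def]]
    by simp
  show ?thesis
  proof (rule smooth_on_ring_closure[OF U, of ?G])
    fix k :: "'a \<Rightarrow> real" and x assume k: "k \<in> ?G" and x: "x \<in> U"
    show "k differentiable (at x)"
    proof (cases "smooth_on U k")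
      case True then show ?thesis using x by (rule smooth_on_differentiable)
    next
      case False
      then obtain h :: "real \<Rightarrow> real" where h: "smooth_on V h" "k = (\<lambda>x. h (f x))" using k by auto
      show ?thesis unfolding h(2) using differentiableI[OF d[OF h(1) x]] .
    qed
  next
    fix k :: "'a \<Rightarrow> real" and v assume "k \<in> ?G"
    then consider "smooth_on U k" | h :: "real \<Rightarrow> real" where "smooth_on V h" "k = (\<lambda>x. h (f x))" by auto
    then show "\<exists>l\<in>ring_closure ?G. \<forall>x\<in>U. frechet_derivative k (at x) v = l x"
    proof cases
      case 1 then show ?thesis using smooth_on_frechet[OF 1, of v]
        by (intro bexI[of _ "\<lambda>x. frechet_derivative k (at x) v"]) (auto intro: ring_closure.gen)
    next
      case (2 h)
      show ?thesis
      proof (rule bexI)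
        show "\<forall>x\<in>U. frechet_derivative k (at x) v = (\<lambda>x. deriv h (f x) * frechet_derivative f (at x) v) x"
          using frechet_derivative_at[OF d[OF 2(1)], symmetric] 2(2) by simp
        show "(\<lambda>x. deriv h (f x) * frechet_derivative f (at x) v) \<in> ring_closure ?G"
          using smooth_on_frechet[OF f, of v] smooth_on_deriv[OF V 2(1)]
          by (intro ring_closure.mul) (auto intro!: ring_closure.gen)
      qed
    qed
  qed (use h in \<open>auto intro: ring_closure.gen\<close>)
qed

text \<open>
  A function whose derivative is a polynomial in the function itself is smooth; this covers \<open>exp\<close>
  and the reciprocal.
\<close>

lemma smooth_on_real_ringI:
  fixes h :: "real \<Rightarrow> real"
  assumes V: "open V" and d: "\<And>x. x \<in> V \<Longrightarrow> (h has_real_derivative h' x) (at x)"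
    and h': "h' \<in> ring_closure (insert h (range (\<lambda>c x. c)))"
  shows "smooth_on V h"
proof (rule smooth_on_ring_closure[OF V, of "insert h (range (\<lambda>c x. c))"])
  fix f v assume f: "f \<in> insert h (range (\<lambda>c (x::real). c))"
  show "\<exists>l\<in>ring_closure (insert h (range (\<lambda>c x. c))). \<forall>x\<in>V. frechet_derivative f (at x) v = l x"
  proof (cases "f = h")
    case True
    have "(\<lambda>x. h' x * v) \<in> ring_closure (insert h (range (\<lambda>c x. c)))"
      by (intro ring_closure.mul h') (auto intro: ring_closure.gen)
    moreover have "\<forall>x\<in>V. frechet_derivative f (at x) v = h' x * v"
      using d True frechet_derivative_at unfolding has_field_derivative_def by metis
    ultimately show ?thesis by (intro bexI[of _ "\<lambda>x. h' x * v"]) auto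
  next
    case False
    then obtain c where "f = (\<lambda>x. c)" using f by auto
    then show ?thesis
      by (intro bexI[of _ "\<lambda>x. 0"]) (auto simp: frechet_derivative_const intro: ring_closure.gen)
  qed
qed (use d in \<open>auto intro: differentiableI[OF has_field_derivative_imp_has_derivative] ring_closure.gen\<close>)

lemma smooth_on_inverse_real: "smooth_on (- {0}) (inverse :: real \<Rightarrow> real)"
proof (rule smooth_on_real_ringI)
  show "(inverse has_real_derivative (-1) * (inverse x * inverse x)) (at x)" if "x \<in> - {0}" for x :: real
    using that by (auto intro!: derivative_eq_intros)
  show "(\<lambda>x::real. (-1) * (inverse x * inverse x)) \<in> ring_closure (insert inverse (range (\<lambda>c x. c)))"
    by (rule ring_closure.mul[OF _ ring_closure.mul]) (auto intro!: ring_closure.gen)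
qed auto

lemma smooth_on_exp_real: "smooth_on UNIV (exp :: real \<Rightarrow> real)"
  by (rule smooth_on_real_ringI[where h'=exp]) (auto intro: ring_closure.gen)

lemma smooth_on_inverse:
  fixes f :: "'a::real_normed_vector \<Rightarrow> real"
  assumes "open U" "smooth_on U f" "\<And>x. x \<in> U \<Longrightarrow> f x \<noteq> 0"
  shows "smooth_on U (\<lambda>x. inverse (f x))"
  by (rule smooth_on_compose[OF assms(1) _ smooth_on_inverse_real assms(2)]) (use assms(3) in auto)

lemma smooth_on_divide:
  fixes f h :: "'a::real_normed_vector \<Rightarrow> real"
  assumes "open U" "smooth_on U f" "smooth_on U h" "\<And>x. x \<in> U \<Longrightarrow> h x \<noteq> 0"
  shows "smooth_on U (\<lambda>x. f x / h x)"
  unfolding divide_inverse by (intro smooth_on_mult smooth_on_inverse assms)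

lemma smooth_on_exp:
  fixes f :: "'a::real_normed_vector \<Rightarrow> real"
  assumes "open U" "smooth_on U f" shows "smooth_on U (\<lambda>x. exp (f x))"
  by (rule smooth_on_compose[OF assms(1) open_UNIV smooth_on_exp_real assms(2)]) auto

lemma smooth_on_ln:
  fixes f :: "'a::real_normed_vector \<Rightarrow> real"
  assumes "open U" "smooth_on U f" "\<And>x. x \<in> U \<Longrightarrow> f x > 0"
  shows "smooth_on U (\<lambda>x. ln (f x))"
proof -
  have "smooth_on {0<..} (ln :: real \<Rightarrow> real)"
  proof (rule smooth_on_ring_closure[of _ "insert ln {f. smooth_on {0<..} f}"])
    fix f :: "real \<Rightarrow> real" and x :: real assume "f \<in> insert ln {f. smooth_on {0<..} f}" "x \<in> {0<..}"
    then show "f differentiable (at x)"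
      by (auto intro: smooth_on_differentiable differentiableI[OF has_field_derivative_imp_has_derivative] DERIV_ln)
  next
    fix f :: "real \<Rightarrow> real" and v
    assume f: "f \<in> insert ln {f. smooth_on {0<..} f}"
    show "\<exists>h\<in>ring_closure (insert ln {f. smooth_on {0<..} f}). \<forall>x\<in>{0<..}. frechet_derivative f (at x) v = h x"
    proof (cases "f = ln")
      case True
      have "smooth_on {0<..} (\<lambda>x::real. inverse x * v)"
        by (intro smooth_on_mult smooth_on_const smooth_on_subset[OF smooth_on_inverse_real]) auto
      moreover have "\<forall>x\<in>{0<..}. frechet_derivative f (at x) v = inverse x * v"
        using True DERIV_ln frechet_derivative_at unfolding has_field_derivative_def
        by (metis greaterThan_iff)
      ultimately show ?thesis by (auto intro!: bexI ring_closure.gen)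
    next
      case False
      then show ?thesis using f smooth_on_frechet[of _ f v]
        by (intro bexI[of _ "\<lambda>x. frechet_derivative f (at x) v"]) (auto intro!: ring_closure.gen)
    qed
  qed (auto intro: ring_closure.gen)
  from smooth_on_compose[OF assms(1) _ this assms(2)] show ?thesis using assms(3) by auto
qed

lemma smooth_on_sqrt:
  fixes f :: "'a::real_normed_vector \<Rightarrow> real"
  assumes "open U" "smooth_on U f" "\<And>x. x \<in> U \<Longrightarrow> f x > 0"
  shows "smooth_on U (\<lambda>x. sqrt (f x))"
proof (rule smooth_on_cong[OF assms(1)])
  show "smooth_on U (\<lambda>x. exp ((1/2) * ln (f x)))"
    by (intro smooth_on_exp smooth_on_mult smooth_on_const smooth_on_ln assms)
  show "sqrt (f x) = exp ((1/2) * ln (f x))" if "x \<in> U" for x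
    using assms(3)[OF that] by (simp add: powr_half_sqrt[symmetric] powr_def)
qed

lemmas smooth_intros = smooth_on_const smooth_on_add smooth_on_diff smooth_on_minus smooth_on_mult
  smooth_on_power smooth_on_sum smooth_on_inverse smooth_on_divide smooth_on_exp

lemma smooth_on_vec:
  fixes f :: "'a::real_normed_vector \<Rightarrow> ('b::euclidean_space)^'n"
  assumes U: "open U" and f: "\<And>i. smooth_on U (\<lambda>x. f x $ i)"
  shows "smooth_on U f"
proof -
  have dv: "(f has_derivative (\<lambda>v. \<chi> i. frechet_derivative (\<lambda>x. f x $ i) (at x) v)) (at x)"
    if "\<And>i. smooth_on U (\<lambda>x. f x $ i)" "x \<in> U" for f :: "'a \<Rightarrow> 'b^'n" and x
  proof -
    have "((\<lambda>x. f x $ i) has_derivative frechet_derivative (\<lambda>x. f x $ i) (at x)) (at x)" for i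
      using smooth_on_has_derivative[OF that(1) that(2)] .
    then have "((\<lambda>x. f x $ i \<bullet> b) has_derivative (\<lambda>v. frechet_derivative (\<lambda>x. f x $ i) (at x) v \<bullet> b)) (at x)" for i b
      by (rule has_derivative_inner_left)
    then show ?thesis
      unfolding has_derivative_componentwise_within[of f]
      by (auto simp: Basis_vec_def inner_axis)
  qed
  show ?thesis
  proof (rule smooth_on_coinduct[OF U, of "{f. \<forall>i. smooth_on U (\<lambda>x. f x $ i)}"])
    fix f :: "'a \<Rightarrow> 'b^'n" and v assume "f \<in> {f. \<forall>i. smooth_on U (\<lambda>x. f x $ i)}"
    then have f: "\<And>i. smooth_on U (\<lambda>x. f x $ i)" by auto
    have "\<forall>x\<in>U. frechet_derivative f (at x) v = (\<chi> i. frechet_derivative (\<lambda>x. f x $ i) (at x) v)"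
      using frechet_derivative_at[OF dv[OF f], symmetric] by simp
    moreover have "(\<lambda>x. \<chi> i. frechet_derivative (\<lambda>x. f x $ i) (at x) v) \<in> {f. \<forall>i. smooth_on U (\<lambda>x. f x $ i)}"
      using smooth_on_frechet[OF f] by simp
    ultimately show "\<exists>h\<in>{f. \<forall>i. smooth_on U (\<lambda>x. f x $ i)}. \<forall>x\<in>U. frechet_derivative f (at x) v = h x"
      by (intro rev_bexI)
  next
    fix k :: "'a \<Rightarrow> 'b^'n" and x assume k: "k \<in> {f. \<forall>i. smooth_on U (\<lambda>x. f x $ i)}" and x: "x \<in> U"
    show "k differentiable (at x)" using k by (intro differentiableI[OF dv[OF _ x]]) auto
  qed (use f in auto)
qed

lemma smooth_on_nth:
  assumes "open U" "smooth_on U f" shows "smooth_on U (\<lambda>x. f x $ i)"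
  by (rule smooth_on_linear[OF assms(1) bounded_linear_vec_nth assms(2)])


section \<open>Partial derivatives\<close>

lemma pd_cong:
  assumes "open U" "x \<in> U" "\<And>y. y \<in> U \<Longrightarrow> f y = h y"
  shows "pd i f x = pd i h x"
  unfolding pd_def using frechet_derivative_cong_open[OF assms] by simp

lemma pd_has_derivative:
  assumes "(f has_derivative f') (at x)" shows "pd i f x = f' (axis i 1)"
  unfolding pd_def using frechet_derivative_at[OF assms] by simp

lemma smooth_on_pd: "smooth_on U f \<Longrightarrow> smooth_on U (pd i f)"
  unfolding pd_def[abs_def] by (rule smooth_on_frechet)

lemma pd_add:
  assumes "f differentiable (at x)" "h differentiable (at x)"
  shows "pd i (\<lambda>y. f y + h y) x = pd i f x + pd i h x"
  using pd_has_derivative[OF has_derivative_add, of f "frechet_derivative f (at x)" x h "frechet_derivative h (at x)" i]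
    assms frechet_derivative_works unfolding pd_def by blast

lemma pd_mult:
  assumes "f differentiable (at x)" "h differentiable (at x)"
  shows "pd i (\<lambda>y. f y * h y) x = pd i f x * h x + f x * pd i h x"
proof -
  have "(f has_derivative frechet_derivative f (at x)) (at x)"
       "(h has_derivative frechet_derivative h (at x)) (at x)"
    using assms frechet_derivative_works by blast+
  from pd_has_derivative[OF has_derivative_mult[OF this]] show ?thesis
    by (simp add: pd_def)
qed

lemma pd_const: "pd i (\<lambda>y. c) x = 0"
  by (simp add: pd_def frechet_derivative_const)

lemma pd_cmult:
  assumes "f differentiable (at x)" shows "pd i (\<lambda>y. c * f y) x = c * pd i f x"
  using pd_mult[OF _ assms, of "\<lambda>y. c"] by (simp add: pd_const)

lemma pd_minus:
  assumes "f differentiable (at x)" shows "pd i (\<lambda>y. - f y) x = - pd i f x"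
  using pd_cmult[OF assms, of i "-1"] by simp

lemma pd_diff:
  assumes "f differentiable (at x)" "h differentiable (at x)"
  shows "pd i (\<lambda>y. f y - h y) x = pd i f x - pd i h x"
  using pd_add[OF assms(1), of "\<lambda>y. - h y"] pd_minus[OF assms(2)] assms(2) by simp

lemma pd_sum:
  assumes "\<And>a. a \<in> A \<Longrightarrow> f a differentiable (at x)"
  shows "pd i (\<lambda>y. \<Sum>a\<in>A. f a y) x = (\<Sum>a\<in>A. pd i (f a) x)"
  using assms
proof (induction A rule: infinite_finite_induct)
  case (insert a A)
  then have "(\<lambda>y. \<Sum>a\<in>A. f a y) differentiable (at x)" by (auto intro: differentiable_sum)
  then show ?case using insert by (simp add: pd_add)
qed (auto simp: pd_const)

text \<open>The chain rule for an outer function of one real variable, as for functions of the coordinate \<open>z\<close>.\<close>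

lemma pd_compose:
  fixes h :: "real \<Rightarrow> real"
  assumes "(h has_real_derivative d) (at (f x))" "f differentiable (at x)"
  shows "pd i (\<lambda>y. h (f y)) x = d * pd i f x"
proof -
  have "(f has_derivative frechet_derivative f (at x)) (at x)"
    using assms frechet_derivative_works by blast
  from pd_has_derivative[OF has_derivative_compose[OF this assms(1)[unfolded has_field_derivative_def]]]
  show ?thesis by (simp add: pd_def)
qed

text \<open>
  The second difference of \<open>f\<close> over a small parallelogram is, by applying the mean value theorem
  twice, a value of either mixed derivative near \<open>x\<close>; continuity gives the equality.
\<close>

lemma second_difference:
  fixes f :: "'a::real_normed_vector \<Rightarrow> real"
  assumes U: "smooth_on U f" and B: "ball x r \<subseteq> U" and s: "0 < s" "s * (norm a + norm b) < r"
  shows "\<exists>y. dist y x \<le> s * (norm a + norm b) \<and>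
    f (x + s *\<^sub>R a + s *\<^sub>R b) - f (x + s *\<^sub>R a) - f (x + s *\<^sub>R b) + f x
      = s * s * frechet_derivative (\<lambda>y. frechet_derivative f (at y) a) (at y) b"
proof -
  let ?fa = "\<lambda>y. frechet_derivative f (at y) a"
  have near: "norm (t *\<^sub>R a + t' *\<^sub>R b) \<le> s * (norm a + norm b)"
    if "0 \<le> t" "t \<le> s" "0 \<le> t'" "t' \<le> s" for t t'
  proof -
    have "norm (t *\<^sub>R a + t' *\<^sub>R b) \<le> t * norm a + t' * norm b"
      using that norm_triangle_ineq[of "t *\<^sub>R a" "t' *\<^sub>R b"] by simp
    also have "\<dots> \<le> s * norm a + s * norm b"
      using that by (intro add_mono mult_right_mono) auto
    finally show ?thesis by (simp add: algebra_simps)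
  qed
  have inU: "x + (t *\<^sub>R a + t' *\<^sub>R b) \<in> U" if "0 \<le> t" "t \<le> s" "0 \<le> t'" "t' \<le> s" for t t'
  proof -
    have "dist (x + (t *\<^sub>R a + t' *\<^sub>R b)) x < r"
      using near[OF that] s(2) by (simp add: dist_norm)
    then have "x + (t *\<^sub>R a + t' *\<^sub>R b) \<in> ball x r" by (simp add: dist_commute)
    then show ?thesis using B by blast
  qed
  define p where "p t = f (x + (t *\<^sub>R a + s *\<^sub>R b)) - f (x + (t *\<^sub>R a + 0 *\<^sub>R b))" for t
  have d1: "((\<lambda>t. f (x + (t *\<^sub>R a + t' *\<^sub>R b))) has_real_derivative ?fa (x + (t *\<^sub>R a + t' *\<^sub>R b))) (at t)"
    if "0 \<le> t" "t \<le> s" "0 \<le> t'" "t' \<le> s" for t t'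
  proof -
    have g: "((\<lambda>t. x + (t *\<^sub>R a + t' *\<^sub>R b)) has_derivative (\<lambda>h. h *\<^sub>R a)) (at t)"
      by (auto intro!: derivative_eq_intros)
    have "linear (frechet_derivative f (at (x + (t *\<^sub>R a + t' *\<^sub>R b))))"
      using has_derivative_linear[OF smooth_on_has_derivative[OF U inU[OF that]]] .
    then show ?thesis
      using has_derivative_compose[OF g smooth_on_has_derivative[OF U inU[OF that]]]
      by (simp add: has_field_derivative_def linear_cmul mult.commute[of _ "?fa _"] fun_eq_iff)
  qed
  have "(p has_real_derivative ?fa (x + (t *\<^sub>R a + s *\<^sub>R b)) - ?fa (x + (t *\<^sub>R a + 0 *\<^sub>R b))) (at t)"
    if "0 \<le> t" "t \<le> s" for t
    unfolding p_def using that s by (intro DERIV_diff d1) auto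
  then obtain t where t: "0 < t" "t < s"
    "p s - p 0 = (s - 0) * (?fa (x + (t *\<^sub>R a + s *\<^sub>R b)) - ?fa (x + (t *\<^sub>R a + 0 *\<^sub>R b)))"
    using MVT2[of 0 s p "\<lambda>t. ?fa (x + (t *\<^sub>R a + s *\<^sub>R b)) - ?fa (x + (t *\<^sub>R a + 0 *\<^sub>R b))"] s by auto
  have d2: "((\<lambda>t'. ?fa (x + (t *\<^sub>R a + t' *\<^sub>R b))) has_real_derivative
      frechet_derivative ?fa (at (x + (t *\<^sub>R a + t' *\<^sub>R b))) b) (at t')"
    if "0 \<le> t'" "t' \<le> s" for t'
  proof -
    have g: "((\<lambda>t'. x + (t *\<^sub>R a + t' *\<^sub>R b)) has_derivative (\<lambda>h. h *\<^sub>R b)) (at t')"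
      by (auto intro!: derivative_eq_intros)
    have i: "x + (t *\<^sub>R a + t' *\<^sub>R b) \<in> U" using t that by (intro inU) auto
    note hd = smooth_on_has_derivative[OF smooth_on_frechet[OF U, of a] i]
    have "linear (frechet_derivative ?fa (at (x + (t *\<^sub>R a + t' *\<^sub>R b))))"
      using has_derivative_linear[OF hd] .
    then show ?thesis
      using has_derivative_compose[OF g hd]
      by (simp add: has_field_derivative_def linear_cmul mult.commute[of _ "frechet_derivative _ _ _"] fun_eq_iff)
  qed
  then obtain t' where t': "0 < t'" "t' < s"
    "?fa (x + (t *\<^sub>R a + s *\<^sub>R b)) - ?fa (x + (t *\<^sub>R a + 0 *\<^sub>R b))
      = (s - 0) * frechet_derivative ?fa (at (x + (t *\<^sub>R a + t' *\<^sub>R b))) b"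
    using MVT2[of 0 s "\<lambda>t'. ?fa (x + (t *\<^sub>R a + t' *\<^sub>R b))"
        "\<lambda>t'. frechet_derivative ?fa (at (x + (t *\<^sub>R a + t' *\<^sub>R b))) b"] s by auto
  have "dist (x + (t *\<^sub>R a + t' *\<^sub>R b)) x \<le> s * (norm a + norm b)"
    using near[of t t'] t t' by (simp add: dist_norm)
  moreover have "f (x + s *\<^sub>R a + s *\<^sub>R b) - f (x + s *\<^sub>R a) - f (x + s *\<^sub>R b) + f x = p s - p 0"
    by (simp add: p_def algebra_simps)
  moreover have "p s - p 0 = s * s * frechet_derivative ?fa (at (x + (t *\<^sub>R a + t' *\<^sub>R b))) b"
    unfolding t(3) t'(3) by simp
  ultimately show ?thesis by (intro exI[of _ "x + (t *\<^sub>R a + t' *\<^sub>R b)"]) simp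
qed

lemma second_derivative_symmetric:
  fixes f :: "'a::real_normed_vector \<Rightarrow> real"
  assumes U: "open U" and f: "smooth_on U f" and x: "x \<in> U"
  shows "frechet_derivative (\<lambda>y. frechet_derivative f (at y) a) (at x) b
       = frechet_derivative (\<lambda>y. frechet_derivative f (at y) b) (at x) a"
proof -
  let ?A = "\<lambda>y. frechet_derivative (\<lambda>y. frechet_derivative f (at y) a) (at y) b"
  let ?B = "\<lambda>y. frechet_derivative (\<lambda>y. frechet_derivative f (at y) b) (at y) a"
  obtain r where r: "r > 0" "ball x r \<subseteq> U" using U x openE by blast
  have cont: "isCont ?A x" "isCont ?B x"
    using smooth_on_differentiable[OF smooth_on_frechet[OF smooth_on_frechet[OF f]] x]
    by (auto intro: differentiable_imp_continuous_within)
  define K where "K = norm a + norm b + 1"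
  have K: "K > 0" by (simp add: K_def add_nonneg_pos)
  have "dist (?A x) (?B x) < e" if e: "e > 0" for e
  proof -
    obtain d1 where d1: "d1 > 0" "\<And>y. dist y x < d1 \<Longrightarrow> dist (?A y) (?A x) < e/2"
      using cont(1) half_gt_zero[OF e] unfolding continuous_at_eps_delta by blast
    obtain d2 where d2: "d2 > 0" "\<And>y. dist y x < d2 \<Longrightarrow> dist (?B y) (?B x) < e/2"
      using cont(2) half_gt_zero[OF e] unfolding continuous_at_eps_delta by blast
    define m where "m = min r (min d1 d2)"
    have m: "m > 0" using r d1 d2 by (simp add: m_def)
    define s where "s = m / K / 2"
    have s: "s > 0" using m K by (simp add: s_def)
    have "s * (norm a + norm b) \<le> s * K" using s by (simp add: K_def)
    also have "\<dots> = m / 2" using K by (simp add: s_def)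
    finally have sm: "s * (norm a + norm b) < m" using m by linarith
    then have sr: "s * (norm a + norm b) < r" "s * (norm b + norm a) < r"
      by (auto simp: m_def add.commute)
    obtain y where y: "dist y x \<le> s * (norm a + norm b)"
      "f (x + s *\<^sub>R a + s *\<^sub>R b) - f (x + s *\<^sub>R a) - f (x + s *\<^sub>R b) + f x = s * s * ?A y"
      using second_difference[OF f r(2) s sr(1)] by blast
    obtain y' where y': "dist y' x \<le> s * (norm b + norm a)"
      "f (x + s *\<^sub>R b + s *\<^sub>R a) - f (x + s *\<^sub>R b) - f (x + s *\<^sub>R a) + f x = s * s * ?B y'"
      using second_difference[OF f r(2) s sr(2)] by blast
    have sw: "x + s *\<^sub>R b + s *\<^sub>R a = x + s *\<^sub>R a + s *\<^sub>R b" by simp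
    have "s * s * ?A y = s * s * ?B y'" using y(2) y'(2)[unfolded sw] by linarith
    then have eq: "?A y = ?B y'" using s by simp
    have "dist y x < d1" "dist y' x < d2"
      using y(1) y'(1) sm by (auto simp: m_def add.commute)
    then have "dist (?A y) (?A x) < e/2" "dist (?B y') (?B x) < e/2" using d1 d2 by blast+
    then show ?thesis using eq unfolding dist_real_def by linarith
  qed
  then have "dist (?A x) (?B x) = 0"
    by (metis dist_not_less_zero less_irrefl linorder_neqE_linordered_idom)
  then show ?thesis by simp
qed

lemma pd_commute:
  assumes "open U" "smooth_on U f" "x \<in> U"
  shows "pd i (pd j f) x = pd j (pd i f) x"
  using second_derivative_symmetric[OF assms] unfolding pd_def[abs_def] by blast

section \<open>Metrics and their Levi-Civita connection\<close>

lemma matrix_diff_ldistrib: "(A::real^'n^'m) ** (B - C) = A ** B - A ** C"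
  by (vector matrix_matrix_mult_def sum_subtractf[symmetric] right_diff_distrib)

lemma matrix_diff_rdistrib: "(B - C) ** (A::real^'n^'m) = B ** A - C ** A"
  by (vector matrix_matrix_mult_def sum_subtractf[symmetric] left_diff_distrib)

lemma matrix_add_rdistrib: "(B + C) ** (A::real^'n^'m) = B ** A + C ** A"
  by (vector matrix_matrix_mult_def sum.distrib[symmetric] distrib_right)

lemma matrix_minus_right: "(A::real^'n^'m) ** (- B) = - (A ** B)"
  by (vector matrix_matrix_mult_def sum_negf)

lemma transpose_add: "transpose (A + B) = transpose A + transpose (B::real^'n^'m)"
  by (vector transpose_def)

lemmas matrix_ring = matrix_add_ldistrib matrix_add_rdistrib matrix_diff_ldistrib
  matrix_diff_rdistrib matrix_mul_assoc

lemma matrix_mult_nth: "(A ** B) $ i $ j = (\<Sum>k\<in>UNIV. A $ i $ k * B $ k $ j)"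
  by (simp add: matrix_matrix_mult_def)

lemma matrix_inv_eqI:
  fixes A :: "real^'n^'n"
  assumes "A ** B = mat 1" shows "matrix_inv A = B"
proof -
  have B: "B ** A = mat 1" using assms matrix_left_right_inverse by blast
  have inv: "A ** matrix_inv A = mat 1"
    using someI[of "\<lambda>C. A ** C = mat 1 \<and> C ** A = mat 1" B] assms B
    unfolding matrix_inv_def by blast
  have "matrix_inv A = (B ** A) ** matrix_inv A" by (simp add: B)
  also have "\<dots> = B ** (A ** matrix_inv A)" by (simp only: matrix_mul_assoc)
  also have "\<dots> = B" by (simp add: inv)
  finally show ?thesis .
qed

text \<open>Matrices of functions are differentiated entry by entry, so that structure equations become matrix identities.\<close>

definition pdm :: "4 \<Rightarrow> (real^4 \<Rightarrow> real^4^4) \<Rightarrow> real^4 \<Rightarrow> real^4^4" where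
  "pdm i M x = (\<chi> a b. pd i (\<lambda>y. M y $ a $ b) x)"

lemma pdm_mult:
  assumes "\<And>a b. (\<lambda>y. A y $ a $ b) differentiable (at x)" "\<And>a b. (\<lambda>y. B y $ a $ b) differentiable (at x)"
  shows "pdm i (\<lambda>y. A y ** B y) x = pdm i A x ** B x + A x ** pdm i B x"
  unfolding vec_eq_iff using assms
  by (auto simp: pdm_def matrix_mult_nth pd_sum pd_mult differentiable_mult sum.distrib)

text \<open>
  A metric enters through its Gram matrix and the inverse matrix, in any signature. Smoothness of
  the inverse is assumed as well, so that Christoffel symbols are smooth by the closure rules.
\<close>

locale smooth_metric =
  fixes U :: "(real^4) set" and g :: metric
  assumes U: "open U"
    and g_smooth: "smooth_on U (\<lambda>x. g x $ i $ j)"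
    and ginv_smooth: "smooth_on U (\<lambda>x. ginv g x $ i $ j)"
    and g_sym: "x \<in> U \<Longrightarrow> g x $ i $ j = g x $ j $ i"
    and g_ginv: "x \<in> U \<Longrightarrow> g x ** ginv g x = mat 1"
begin

lemma ginv_g: "x \<in> U \<Longrightarrow> ginv g x ** g x = mat 1"
  using g_ginv matrix_left_right_inverse by blast

lemma g_ginv_nth: "x \<in> U \<Longrightarrow> (\<Sum>k\<in>UNIV. g x $ i $ k * ginv g x $ k $ j) = (if i = j then 1 else 0)"
  using g_ginv[of x] by (simp add: matrix_mult_nth[symmetric] mat_def)

lemma ginv_g_nth: "x \<in> U \<Longrightarrow> (\<Sum>k\<in>UNIV. ginv g x $ i $ k * g x $ k $ j) = (if i = j then 1 else 0)"
  using ginv_g[of x] by (simp add: matrix_mult_nth[symmetric] mat_def)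

lemma g_transpose: "x \<in> U \<Longrightarrow> transpose (g x) = g x"
  using g_sym by (simp add: vec_eq_iff transpose_def)

lemma ginv_transpose: "x \<in> U \<Longrightarrow> transpose (ginv g x) = ginv g x"
proof -
  assume x: "x \<in> U"
  have "g x ** transpose (ginv g x) = transpose (ginv g x ** g x)"
    by (simp add: matrix_transpose_mul g_transpose[OF x])
  then have "g x ** transpose (ginv g x) = mat 1" by (simp add: ginv_g[OF x])
  from matrix_inv_eqI[OF this] show ?thesis by (simp add: ginv_def)
qed

lemma ginv_sym: "x \<in> U \<Longrightarrow> ginv g x $ i $ j = ginv g x $ j $ i"
  using ginv_transpose[of x] unfolding vec_eq_iff transpose_def by simp

lemma pd_g_sym: "x \<in> U \<Longrightarrow> pd k (\<lambda>y. g y $ i $ j) x = pd k (\<lambda>y. g y $ j $ i) x"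
  by (rule pd_cong[OF U]) (auto simp: g_sym)

lemma christoffel_smooth: "smooth_on U (christoffel g m i j)"
  unfolding christoffel_def[abs_def]
  by (intro smooth_intros U ginv_smooth smooth_on_pd g_smooth) auto

lemma christoffel_sym: "x \<in> U \<Longrightarrow> christoffel g m i j x = christoffel g m j i x"
  unfolding christoffel_def using pd_g_sym[of x] by (simp add: algebra_simps)

lemma christoffel_lower:
  assumes x: "x \<in> U"
  shows "(\<Sum>m\<in>UNIV. christoffel g m i j x * g x $ m $ l) =
    (pd i (\<lambda>y. g y $ j $ l) x + pd j (\<lambda>y. g y $ i $ l) x - pd l (\<lambda>y. g y $ i $ j) x) / 2"
proof -
  define b where "b l = (pd i (\<lambda>y. g y $ j $ l) x + pd j (\<lambda>y. g y $ i $ l) x - pd l (\<lambda>y. g y $ i $ j) x) / 2" for l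
  have chr: "christoffel g m i j x = (\<Sum>k\<in>UNIV. ginv g x $ m $ k * b k)" for m
    by (simp add: christoffel_def b_def sum_divide_distrib)
  have "(\<Sum>m\<in>UNIV. christoffel g m i j x * g x $ m $ l)
      = (\<Sum>m\<in>UNIV. \<Sum>k\<in>UNIV. ginv g x $ m $ k * g x $ m $ l * b k)"
    unfolding chr by (simp add: sum_distrib_right sum_distrib_left mult_ac)
  also have "\<dots> = (\<Sum>k\<in>UNIV. (\<Sum>m\<in>UNIV. ginv g x $ k $ m * g x $ m $ l) * b k)"
    by (subst sum.swap) (simp add: sum_distrib_right ginv_sym[OF x])
  also have "\<dots> = b l" by (simp add: ginv_g_nth[OF x] if_distrib[of "\<lambda>r. r * _"] cong: if_cong)
  finally show ?thesis by (simp add: b_def)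
qed

lemma metric_parallel:
  assumes x: "x \<in> U"
  shows "pd k (\<lambda>y. g y $ i $ j) x =
    (\<Sum>m\<in>UNIV. christoffel g m k i x * g x $ m $ j + christoffel g m k j x * g x $ i $ m)"
proof -
  have "(\<Sum>m\<in>UNIV. christoffel g m k j x * g x $ i $ m) = (\<Sum>m\<in>UNIV. christoffel g m k j x * g x $ m $ i)"
    by (simp add: g_sym[OF x, of i])
  then show ?thesis
    by (simp add: sum.distrib christoffel_lower[OF x] pd_g_sym[OF x, of k j i] field_simps)
qed

text \<open>
  The fundamental theorem of Riemannian geometry. It is the tool that identifies a connection which
  was guessed, in a frame or after a conformal change, as the Levi-Civita connection.
\<close>

lemma christoffel_unique:
  assumes x: "x \<in> U"
    and sym: "\<And>m i j. S m i j = S m j i"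
    and par: "\<And>k i j. pd k (\<lambda>y. g y $ i $ j) x =
      (\<Sum>m\<in>UNIV. S m k i * g x $ m $ j + S m k j * g x $ i $ m)"
  shows "christoffel g k i j x = S k i j"
proof -
  have b: "pd i (\<lambda>y. g y $ j $ l) x + pd j (\<lambda>y. g y $ i $ l) x - pd l (\<lambda>y. g y $ i $ j) x
      = 2 * (\<Sum>m\<in>UNIV. g x $ l $ m * S m i j)" for l
    unfolding par sum.distrib[symmetric] sum_subtractf[symmetric] sum_distrib_left
    by (intro sum.cong refl)
      (simp add: g_sym[OF x, of _ l] g_sym[OF x, of i] g_sym[OF x, of j] sym[of _ l] sym[of _ j i] algebra_simps)
  have "christoffel g k i j x = (\<Sum>l\<in>UNIV. \<Sum>m\<in>UNIV. ginv g x $ k $ l * g x $ l $ m * S m i j)"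
    unfolding christoffel_def b by (simp add: sum_distrib_left sum_divide_distrib algebra_simps)
  also have "\<dots> = (\<Sum>m\<in>UNIV. (\<Sum>l\<in>UNIV. ginv g x $ k $ l * g x $ l $ m) * S m i j)"
    by (subst sum.swap) (simp add: sum_distrib_right)
  also have "\<dots> = S k i j" by (simp add: ginv_g_nth[OF x] if_distrib[of "\<lambda>r. r * _"] cong: if_cong)
  finally show ?thesis .
qed

text \<open>Differentiation of \<open>g\<^sup>-\<^sup>1 g = 1\<close>; hence contractions commute with covariant derivatives.\<close>

lemma inverse_metric_parallel:
  assumes x: "x \<in> U"
  shows "pd k (\<lambda>y. ginv g y $ i $ j) x =
    - (\<Sum>m\<in>UNIV. christoffel g i k m x * ginv g x $ m $ j + christoffel g j k m x * ginv g x $ i $ m)"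
proof -
  define C where "C = (\<chi> m i. christoffel g m k i x)"
  let ?G = "g x" and ?H = "ginv g x" and ?H' = "pdm k (ginv g) x"
  have d: "(\<lambda>y. g y $ a $ b) differentiable (at x)" "(\<lambda>y. ginv g y $ a $ b) differentiable (at x)" for a b
    using smooth_on_differentiable g_smooth ginv_smooth x by blast+
  have G': "pdm k g x = transpose C ** ?G + ?G ** C"
    unfolding vec_eq_iff
    by (simp add: pdm_def C_def metric_parallel[OF x] sum.distrib matrix_mult_nth transpose_def mult.commute)
  have "pdm k (\<lambda>y. g y ** ginv g y) x = 0"
  proof -
    have "pd k (\<lambda>y. (g y ** ginv g y) $ i $ j) x = pd k (\<lambda>y. (mat 1 :: real^4^4) $ i $ j) x" for i j
      by (rule pd_cong[OF U x]) (simp add: g_ginv)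
    then show ?thesis by (simp add: pdm_def vec_eq_iff pd_const)
  qed
  then have "pdm k g x ** ?H + ?G ** ?H' = 0" using pdm_mult[of g x "ginv g" k] d by simp
  then have "?G ** ?H' = - (pdm k g x ** ?H)" by (simp add: eq_neg_iff_add_eq_0 add.commute)
  then have "?H ** (?G ** ?H') = - (?H ** (pdm k g x ** ?H))"
    by (simp add: matrix_minus_right)
  then have "?H' = - (?H ** transpose C ** ?G ** ?H + ?H ** ?G ** C ** ?H)"
    by (simp add: matrix_mul_assoc ginv_g[OF x] G' matrix_ring)
  then have "?H' = - (?H ** transpose C + C ** ?H)"
    by (simp add: matrix_mul_assoc[symmetric] g_ginv[OF x]) (simp add: matrix_mul_assoc ginv_g[OF x])
  then have "?H' $ i $ j = - ((?H ** transpose C) $ i $ j + (C ** ?H) $ i $ j)" by simp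
  then show ?thesis
    by (simp add: pdm_def matrix_mult_nth transpose_def C_def sum.distrib mult.commute)
qed

end


section \<open>Tensor calculus in a moving frame\<close>

text \<open>
  Components with respect to a frame, of covariant derivatives and curvature. Here \<open>D a\<close>
  differentiates along the \<open>a\<close>-th frame vector, and the connection is
  \<open>\<nabla>\<^sub>a e\<^sub>b = \<gamma> c a b e\<^sub>c\<close>. For the coordinate frame these are the usual expressions.
\<close>

definition frame_cov :: "(4 \<Rightarrow> ('b \<Rightarrow> real) \<Rightarrow> 'b \<Rightarrow> real) \<Rightarrow> (4 \<Rightarrow> 4 \<Rightarrow> 4 \<Rightarrow> 'b \<Rightarrow> real) \<Rightarrow>
    4 \<Rightarrow> (4 list \<Rightarrow> 'b \<Rightarrow> real) \<Rightarrow> 4 list \<Rightarrow> 'b \<Rightarrow> real" where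
  "frame_cov D \<gamma> c T as y = D c (T as) y -
     (\<Sum>p<length as. \<Sum>m\<in>UNIV. \<gamma> m c (as ! p) y * T (as[p := m]) y)"

text \<open>
  In contrast to the coordinate formula the last sum occurs, because the commutator of two frame
  fields is \<open>[e\<^sub>a, e\<^sub>b] = (\<gamma> m a b - \<gamma> m b a) e\<^sub>m\<close> for a connection without torsion.
\<close>

definition frame_riemann_up :: "(4 \<Rightarrow> ('b \<Rightarrow> real) \<Rightarrow> 'b \<Rightarrow> real) \<Rightarrow>
    (4 \<Rightarrow> 4 \<Rightarrow> 4 \<Rightarrow> 'b \<Rightarrow> real) \<Rightarrow> 4 \<Rightarrow> 4 \<Rightarrow> 4 \<Rightarrow> 4 \<Rightarrow> 'b \<Rightarrow> real" where
  "frame_riemann_up D \<gamma> d c a b y = D a (\<gamma> d b c) y - D b (\<gamma> d a c) y +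
     (\<Sum>m\<in>UNIV. \<gamma> d a m y * \<gamma> m b c y - \<gamma> d b m y * \<gamma> m a c y)
     - (\<Sum>m\<in>UNIV. (\<gamma> m a b y - \<gamma> m b a y) * \<gamma> d m c y)"

definition frame_riemann :: "(4 \<Rightarrow> ('b \<Rightarrow> real) \<Rightarrow> 'b \<Rightarrow> real) \<Rightarrow> (4 \<Rightarrow> 4 \<Rightarrow> 'b \<Rightarrow> real) \<Rightarrow>
    (4 \<Rightarrow> 4 \<Rightarrow> 4 \<Rightarrow> 'b \<Rightarrow> real) \<Rightarrow> 4 \<Rightarrow> 4 \<Rightarrow> 4 \<Rightarrow> 4 \<Rightarrow> 'b \<Rightarrow> real" where
  "frame_riemann D gf \<gamma> a b c d y = (\<Sum>l\<in>UNIV. gf d l y * frame_riemann_up D \<gamma> l c a b y)"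

text \<open>A field with components \<open>T\<close> in the coframe \<open>\<theta>\<close>, as a field with coordinate components.\<close>

fun tens :: "(4 \<Rightarrow> 4 \<Rightarrow> real^4 \<Rightarrow> real) \<Rightarrow> (real^4 \<Rightarrow> 'b) \<Rightarrow> (4 list \<Rightarrow> 'b \<Rightarrow> real) \<Rightarrow> tensor" where
  "tens \<theta> \<pi> T [] x = T [] (\<pi> x)"
| "tens \<theta> \<pi> T (i # is) x = (\<Sum>a\<in>UNIV. \<theta> a i x * tens \<theta> \<pi> (\<lambda>as. T (a # as)) is x)"

lemma tens_cong:
  "(\<And>as. length as = length is \<Longrightarrow> T as (\<pi> x) = T' as (\<pi> x)) \<Longrightarrow> tens \<theta> \<pi> T is x = tens \<theta> \<pi> T' is x"
proof (induction "is" arbitrary: T T')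
  case (Cons i "is")
  have "tens \<theta> \<pi> (\<lambda>as. T (a # as)) is x = tens \<theta> \<pi> (\<lambda>as. T' (a # as)) is x" for a
    by (rule Cons.IH) (use Cons.prems in auto)
  then show ?case by simp
qed simp

lemma tens_add: "tens \<theta> \<pi> (\<lambda>as y. T as y + T' as y) is x = tens \<theta> \<pi> T is x + tens \<theta> \<pi> T' is x"
  by (induction "is" arbitrary: T T') (auto simp: sum.distrib distrib_left)

lemma tens_diff: "tens \<theta> \<pi> (\<lambda>as y. T as y - T' as y) is x = tens \<theta> \<pi> T is x - tens \<theta> \<pi> T' is x"
  by (induction "is" arbitrary: T T') (auto simp: sum_subtractf right_diff_distrib)

lemma tens_scale: "tens \<theta> \<pi> (\<lambda>as y. k y * T as y) is x = k (\<pi> x) * tens \<theta> \<pi> T is x"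
  by (induction "is" arbitrary: T) (auto simp: sum_distrib_left mult_ac)

lemma tens_sum: "tens \<theta> \<pi> (\<lambda>as y. \<Sum>b\<in>A. T b as y) is x = (\<Sum>b\<in>A. tens \<theta> \<pi> (T b) is x)"
proof (induction "is" arbitrary: T)
  case (Cons i "is")
  then show ?case by (simp add: sum_distrib_left) (rule sum.swap)
qed simp

lemma tens_snoc:
  "tens \<theta> \<pi> T (is @ [i]) x = (\<Sum>a\<in>UNIV. \<theta> a i x * tens \<theta> \<pi> (\<lambda>as. T (as @ [a])) is x)"
proof (induction "is" arbitrary: T)
  case (Cons j "is")
  have "tens \<theta> \<pi> T ((j # is) @ [i]) x =
      (\<Sum>b\<in>UNIV. \<Sum>a\<in>UNIV. \<theta> b j x * (\<theta> a i x * tens \<theta> \<pi> (\<lambda>as. T (b # as @ [a])) is x))"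
    by (simp add: Cons.IH sum_distrib_left)
  also have "\<dots> = (\<Sum>a\<in>UNIV. \<Sum>b\<in>UNIV. \<theta> b j x * (\<theta> a i x * tens \<theta> \<pi> (\<lambda>as. T (b # as @ [a])) is x))"
    by (rule sum.swap)
  finally show ?case by (simp add: sum_distrib_left mult.left_commute)
qed simp

text \<open>
  A frame \<open>e\<close> with dual coframe \<open>\<theta>\<close> such that the components of the metric and of the connection
  are functions on a space \<open>V\<close> to which \<open>U\<close> is mapped by \<open>\<pi>\<close>. There are two instances: the invariant
  frame on \<open>I \<times> S\<^sup>3\<close>, where \<open>\<pi>\<close> is the coordinate \<open>z\<close>, and an isometry onto \<open>V\<close>, where \<open>\<pi>\<close> is that
  isometry and \<open>\<theta>\<close> its differential. The last two assumptions are Cartan's first structure equations.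
\<close>

locale moving_frame = smooth_metric U g
  for U :: "(real^4) set" and g :: metric +
  fixes V :: "'b::real_normed_vector set"
    and \<theta> e :: "4 \<Rightarrow> 4 \<Rightarrow> real^4 \<Rightarrow> real"
    and \<pi> :: "real^4 \<Rightarrow> 'b"
    and D :: "4 \<Rightarrow> ('b \<Rightarrow> real) \<Rightarrow> 'b \<Rightarrow> real"
    and gf gi :: "4 \<Rightarrow> 4 \<Rightarrow> 'b \<Rightarrow> real"
    and \<gamma> :: "4 \<Rightarrow> 4 \<Rightarrow> 4 \<Rightarrow> 'b \<Rightarrow> real"
  assumes base: "x \<in> U \<Longrightarrow> \<pi> x \<in> V"
    and differentiable_base: "smooth_on V f \<Longrightarrow> x \<in> U \<Longrightarrow> (\<lambda>x. f (\<pi> x)) differentiable (at x)"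
    and pd_base: "smooth_on V f \<Longrightarrow> x \<in> U \<Longrightarrow> pd i (\<lambda>x. f (\<pi> x)) x = (\<Sum>a\<in>UNIV. \<theta> a i x * D a f (\<pi> x))"
    and V: "open V"
    and D_smooth: "smooth_on V f \<Longrightarrow> smooth_on V (D a f)"
    and \<theta>_smooth: "smooth_on U (\<theta> a i)"
    and dual: "x \<in> U \<Longrightarrow> (\<Sum>i\<in>UNIV. \<theta> a i x * e b i x) = (if a = b then 1 else 0)"
    and gf_smooth: "smooth_on V (gf a b)"
    and gi_smooth: "smooth_on V (gi a b)"
    and \<gamma>_smooth: "smooth_on V (\<gamma> c a b)"
    and gf_sym: "y \<in> V \<Longrightarrow> gf a b y = gf b a y"
    and gf_gi: "y \<in> V \<Longrightarrow> (\<Sum>b\<in>UNIV. gf a b y * gi b c y) = (if a = c then 1 else 0)"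
    and g_frame: "x \<in> U \<Longrightarrow> g x $ i $ j = (\<Sum>a\<in>UNIV. \<Sum>b\<in>UNIV. gf a b (\<pi> x) * (\<theta> a i x * \<theta> b j x))"
    and metric: "y \<in> V \<Longrightarrow> D a (gf b c) y = (\<Sum>m\<in>UNIV. \<gamma> m a b y * gf m c y + \<gamma> m a c y * gf b m y)"
    and torsion_free: "x \<in> U \<Longrightarrow> pd i (\<theta> c j) x - pd j (\<theta> c i) x =
      - (\<Sum>a\<in>UNIV. \<Sum>b\<in>UNIV. (\<gamma> c a b (\<pi> x) - \<gamma> c b a (\<pi> x)) * (\<theta> a i x * \<theta> b j x))"
begin

text \<open>\<open>A k\<close> is the matrix of connection forms, evaluated on the \<open>k\<close>-th coordinate vector.\<close>

definition \<Theta> :: "real^4 \<Rightarrow> real^4^4" where "\<Theta> x = (\<chi> a i. \<theta> a i x)"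
definition E :: "real^4 \<Rightarrow> real^4^4" where "E x = (\<chi> i a. e a i x)"
definition A :: "4 \<Rightarrow> real^4 \<Rightarrow> real^4^4" where
  "A k x = (\<chi> c b. \<Sum>a\<in>UNIV. \<theta> a k x * \<gamma> c a b (\<pi> x))"

lemma \<Theta>_E: "x \<in> U \<Longrightarrow> \<Theta> x ** E x = mat 1"
  unfolding vec_eq_iff by (simp add: matrix_mult_nth \<Theta>_def E_def dual mat_def)

lemma E_\<Theta>: "x \<in> U \<Longrightarrow> E x ** \<Theta> x = mat 1"
  using \<Theta>_E matrix_left_right_inverse by blast

lemma g_matrix: "x \<in> U \<Longrightarrow> g x = transpose (\<Theta> x) ** (\<chi> a b. gf a b (\<pi> x)) ** \<Theta> x"
  unfolding vec_eq_iff
  by (intro allI, simp add: g_frame matrix_mult_nth transpose_def \<Theta>_def sum_distrib_right)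
     (subst sum.swap, simp add: mult_ac)

lemma ginv_matrix: "x \<in> U \<Longrightarrow> ginv g x = E x ** (\<chi> a b. gi a b (\<pi> x)) ** transpose (E x)"
proof -
  assume x: "x \<in> U"
  let ?G = "(\<chi> a b. gf a b (\<pi> x)) :: real^4^4" and ?I = "(\<chi> a b. gi a b (\<pi> x)) :: real^4^4"
  have GI: "?G ** ?I = mat 1"
    unfolding vec_eq_iff by (simp add: matrix_mult_nth gf_gi[OF base[OF x]] mat_def)
  have "g x ** (E x ** ?I ** transpose (E x))
      = transpose (\<Theta> x) ** (?G ** (\<Theta> x ** E x) ** ?I) ** transpose (E x)"
    by (simp add: g_matrix[OF x] matrix_mul_assoc)
  also have "\<dots> = transpose (E x ** \<Theta> x)" by (simp add: \<Theta>_E[OF x] GI matrix_transpose_mul)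
  finally have "g x ** (E x ** ?I ** transpose (E x)) = mat 1" by (simp add: E_\<Theta>[OF x])
  then show ?thesis unfolding ginv_def by (rule matrix_inv_eqI)
qed

lemma pd_g:
  assumes x: "x \<in> U"
  shows "pdm k g x = transpose (pdm k \<Theta> x) ** (\<chi> a b. gf a b (\<pi> x)) ** \<Theta> x
    + transpose (\<Theta> x) ** (\<chi> a b. \<Sum>c\<in>UNIV. \<theta> c k x * D c (gf a b) (\<pi> x)) ** \<Theta> x
    + transpose (\<Theta> x) ** (\<chi> a b. gf a b (\<pi> x)) ** pdm k \<Theta> x"
proof -
  let ?G = "\<lambda>x. (\<chi> a b. gf a b (\<pi> x)) :: real^4^4"
  have d\<Theta>: "(\<lambda>y. \<Theta> y $ a $ b) differentiable (at x)" "(\<lambda>y. transpose (\<Theta> y) $ a $ b) differentiable (at x)" for a b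
    using smooth_on_differentiable[OF \<theta>_smooth x] by (simp_all add: \<Theta>_def transpose_def)
  have dG: "(\<lambda>y. ?G y $ a $ b) differentiable (at x)" for a b
    using differentiable_base[OF gf_smooth x] by simp
  have dTG: "(\<lambda>y. (transpose (\<Theta> y) ** ?G y) $ a $ b) differentiable (at x)" for a b
    unfolding matrix_mult_nth using d\<Theta> dG by (auto intro!: differentiable_sum differentiable_mult)
  have "pdm k g x = pdm k (\<lambda>x. transpose (\<Theta> x) ** ?G x ** \<Theta> x) x"
    using pd_cong[OF U x, of "\<lambda>y. g y $ _ $ _"] g_matrix
    by (simp add: pdm_def vec_eq_iff)
  also have "\<dots> = pdm k (\<lambda>x. transpose (\<Theta> x) ** ?G x) x ** \<Theta> x + transpose (\<Theta> x) ** ?G x ** pdm k \<Theta> x"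
    by (rule pdm_mult[OF dTG d\<Theta>(1)])
  also have "pdm k (\<lambda>x. transpose (\<Theta> x) ** ?G x) x
      = pdm k (\<lambda>x. transpose (\<Theta> x)) x ** ?G x + transpose (\<Theta> x) ** pdm k ?G x"
    by (rule pdm_mult[OF d\<Theta>(2) dG])
  also have "pdm k (\<lambda>x. transpose (\<Theta> x)) x = transpose (pdm k \<Theta> x)"
    by (simp add: pdm_def transpose_def vec_eq_iff)
  also have "pdm k ?G x = (\<chi> a b. \<Sum>c\<in>UNIV. \<theta> c k x * D c (gf a b) (\<pi> x))"
    by (simp add: pdm_def pd_base[OF gf_smooth x] vec_eq_iff)
  finally show ?thesis by (simp add: matrix_ring)
qed

lemma connection_sym:
  assumes x: "x \<in> U"
  shows "(pdm i \<Theta> x + A i x ** \<Theta> x) $ c $ j = (pdm j \<Theta> x + A j x ** \<Theta> x) $ c $ i"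
proof -
  have A: "(A i x ** \<Theta> x) $ c $ j = (\<Sum>a\<in>UNIV. \<Sum>b\<in>UNIV. \<gamma> c a b (\<pi> x) * (\<theta> a i x * \<theta> b j x))" for i j
    by (simp add: A_def \<Theta>_def matrix_mult_nth sum_distrib_right sum_distrib_left) (subst sum.swap, simp add: mult_ac)
  have "(A j x ** \<Theta> x) $ c $ i = (\<Sum>a\<in>UNIV. \<Sum>b\<in>UNIV. \<gamma> c b a (\<pi> x) * (\<theta> a i x * \<theta> b j x))"
    unfolding A by (subst sum.swap) (simp add: mult_ac)
  moreover have "pdm i \<Theta> x $ c $ j = pd i (\<theta> c j) x" for i j by (simp add: pdm_def \<Theta>_def)
  ultimately show ?thesis using torsion_free[OF x, of i c j]
    by (simp add: A left_diff_distrib sum_subtractf)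
qed

text \<open>
  The connection \<open>\<gamma>\<close> is torsion-free and preserves the metric, so it is the Levi-Civita
  connection.
\<close>

lemma christoffel_frame:
  assumes x: "x \<in> U"
  shows "\<Theta> x ** (\<chi> l k. christoffel g l i k x) = pdm i \<Theta> x + A i x ** \<Theta> x"
proof -
  let ?N = "\<lambda>i. pdm i \<Theta> x + A i x ** \<Theta> x"
  let ?S = "\<lambda>i. E x ** ?N i"
  let ?G = "(\<chi> a b. gf a b (\<pi> x)) :: real^4^4"
  have GT: "transpose ?G = ?G" using gf_sym[OF base[OF x]] by (simp add: vec_eq_iff transpose_def)
  have DG: "(\<chi> a b. \<Sum>c\<in>UNIV. \<theta> c k x * D c (gf a b) (\<pi> x)) = transpose (A k x) ** ?G + ?G ** A k x" for k
  proof -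
    have "(\<Sum>c\<in>UNIV. \<theta> c k x * D c (gf a b) (\<pi> x))
      = (\<Sum>m\<in>UNIV. \<Sum>c\<in>UNIV. \<theta> c k x * (\<gamma> m c a (\<pi> x) * gf m b (\<pi> x) + \<gamma> m c b (\<pi> x) * gf a m (\<pi> x)))" for a b
      unfolding metric[OF base[OF x]] sum_distrib_left by (rule sum.swap)
    then show ?thesis
      by (simp add: vec_eq_iff matrix_mult_nth transpose_def A_def sum_distrib_right sum_distrib_left
          sum.distrib distrib_left mult_ac)
  qed
  have gS: "g x ** ?S k = transpose (\<Theta> x) ** ?G ** ?N k" for k
  proof -
    have "g x ** ?S k = transpose (\<Theta> x) ** ?G ** (\<Theta> x ** E x) ** ?N k"
      by (simp only: g_matrix[OF x] matrix_mul_assoc)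
    then show ?thesis by (simp add: \<Theta>_E[OF x])
  qed
  have par: "pdm k g x = transpose (?S k) ** g x + g x ** ?S k" for k
  proof -
    have "transpose (?S k) ** g x = transpose (g x ** ?S k)"
      by (simp add: matrix_transpose_mul g_transpose[OF x])
    also have "\<dots> = transpose (?N k) ** ?G ** \<Theta> x"
      unfolding gS by (simp add: matrix_transpose_mul GT matrix_mul_assoc)
    finally show ?thesis
      unfolding pd_g[OF x] DG gS by (simp add: matrix_ring transpose_add matrix_transpose_mul add_ac)
  qed
  have "christoffel g l i k x = ?S i $ l $ k" for l i k
  proof (rule christoffel_unique[OF x])
    show "?S i $ m $ j = ?S j $ m $ i" for m i j
      using connection_sym[OF x, of i _ j] by (simp add: matrix_mult_nth[of "E x"])
    show "pd k (\<lambda>y. g y $ i $ j) x = (\<Sum>m\<in>UNIV. ?S k $ m $ i * g x $ m $ j + ?S k $ m $ j * g x $ i $ m)" for k i j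
    proof -
      have "pdm k g x $ i $ j = (transpose (?S k) ** g x + g x ** ?S k) $ i $ j" by (simp only: par)
      also have "\<dots> = (transpose (?S k) ** g x) $ i $ j + (g x ** ?S k) $ i $ j" by simp
      also have "(transpose (?S k) ** g x) $ i $ j = (\<Sum>m\<in>UNIV. ?S k $ m $ i * g x $ m $ j)"
        unfolding matrix_mult_nth[of "transpose _"] by (simp add: transpose_def)
      also have "(g x ** ?S k) $ i $ j = (\<Sum>m\<in>UNIV. ?S k $ m $ j * g x $ i $ m)"
        unfolding matrix_mult_nth[of "g x"] by (simp add: mult.commute)
      finally show ?thesis by (simp add: pdm_def sum.distrib)
    qed
  qed
  then have "(\<chi> l k. christoffel g l i k x) = ?S i" by (simp add: vec_eq_iff)
  then show ?thesis by (simp add: matrix_mul_assoc \<Theta>_E[OF x])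
qed

text \<open>The covariant derivative of the coframe, which turns covariant derivatives in coordinates into those in the frame.\<close>

lemma coframe_derivative:
  assumes x: "x \<in> U"
  shows "pd i (\<theta> c j) x - (\<Sum>m\<in>UNIV. christoffel g m i j x * \<theta> c m x)
    = - (\<Sum>a\<in>UNIV. (\<Sum>b\<in>UNIV. \<theta> b i x * \<gamma> c b a (\<pi> x)) * \<theta> a j x)"
proof -
  have "(\<Theta> x ** (\<chi> l k. christoffel g l i k x)) $ c $ j = (pdm i \<Theta> x + A i x ** \<Theta> x) $ c $ j"
    by (simp add: christoffel_frame[OF x])
  then show ?thesis by (simp add: matrix_mult_nth \<Theta>_def A_def pdm_def mult.commute)
qed

end

section \<open>Curvature and its derivatives in a moving frame\<close>

definition frame_ricci :: "(4 \<Rightarrow> ('b \<Rightarrow> real) \<Rightarrow> 'b \<Rightarrow> real) \<Rightarrow> (4 \<Rightarrow> 4 \<Rightarrow> 'b \<Rightarrow> real) \<Rightarrow> (4 \<Rightarrow> 4 \<Rightarrow> 'b \<Rightarrow> real) \<Rightarrow>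
    (4 \<Rightarrow> 4 \<Rightarrow> 4 \<Rightarrow> 'b \<Rightarrow> real) \<Rightarrow> 4 \<Rightarrow> 4 \<Rightarrow> 'b \<Rightarrow> real" where
  "frame_ricci D gf gi \<gamma> i j y =
     (\<Sum>s\<in>UNIV. \<Sum>t\<in>UNIV. gi s t y * frame_riemann D gf \<gamma> s i j t y)"

definition frame_scalar :: "(4 \<Rightarrow> ('b \<Rightarrow> real) \<Rightarrow> 'b \<Rightarrow> real) \<Rightarrow> (4 \<Rightarrow> 4 \<Rightarrow> 'b \<Rightarrow> real) \<Rightarrow> (4 \<Rightarrow> 4 \<Rightarrow> 'b \<Rightarrow> real) \<Rightarrow>
    (4 \<Rightarrow> 4 \<Rightarrow> 4 \<Rightarrow> 'b \<Rightarrow> real) \<Rightarrow> 'b \<Rightarrow> real" where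
  "frame_scalar D gf gi \<gamma> y = (\<Sum>i\<in>UNIV. \<Sum>j\<in>UNIV. gi i j y * frame_ricci D gf gi \<gamma> i j y)"

definition frame_weyl :: "(4 \<Rightarrow> ('b \<Rightarrow> real) \<Rightarrow> 'b \<Rightarrow> real) \<Rightarrow> (4 \<Rightarrow> 4 \<Rightarrow> 'b \<Rightarrow> real) \<Rightarrow> (4 \<Rightarrow> 4 \<Rightarrow> 'b \<Rightarrow> real) \<Rightarrow>
    (4 \<Rightarrow> 4 \<Rightarrow> 4 \<Rightarrow> 'b \<Rightarrow> real) \<Rightarrow> 4 \<Rightarrow> 4 \<Rightarrow> 4 \<Rightarrow> 4 \<Rightarrow> 'b \<Rightarrow> real" where
  "frame_weyl D gf gi \<gamma> s i j t y = frame_riemann D gf \<gamma> s i j t y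
     - (gf s t y * frame_ricci D gf gi \<gamma> i j y + gf i j y * frame_ricci D gf gi \<gamma> s t y
        - gf s j y * frame_ricci D gf gi \<gamma> i t y - gf i t y * frame_ricci D gf gi \<gamma> s j y) / 2
     + frame_scalar D gf gi \<gamma> y * (gf s t y * gf i j y - gf s j y * gf i t y) / 6"

text \<open>\<open>\<nabla>\<^sup>s W\<^bsub>sijt\<^esub>\<close>; the Bach tensor is the divergence of this tensor plus a curvature term.\<close>

definition weyl_div :: "metric \<Rightarrow> tensor" where
  "weyl_div g is x = (\<Sum>s\<in>UNIV. \<Sum>a\<in>UNIV. ginv g x $ s $ a * cov_deriv g (weyl_tensor g) (s # is @ [a]) x)"

definition frame_div :: "(4 \<Rightarrow> ('b \<Rightarrow> real) \<Rightarrow> 'b \<Rightarrow> real) \<Rightarrow> (4 \<Rightarrow> 4 \<Rightarrow> 'b \<Rightarrow> real) \<Rightarrow>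
    (4 \<Rightarrow> 4 \<Rightarrow> 4 \<Rightarrow> 'b \<Rightarrow> real) \<Rightarrow> (4 list \<Rightarrow> 'b \<Rightarrow> real) \<Rightarrow> 4 list \<Rightarrow> 'b \<Rightarrow> real" where
  "frame_div D gi \<gamma> T as y = (\<Sum>s\<in>UNIV. \<Sum>a\<in>UNIV. gi s a y * frame_cov D \<gamma> a T (s # as) y)"

lemma cov_deriv_snoc:
  "cov_deriv g T (is @ [a]) x = frame_cov pd (christoffel g) a T is x"
  by (simp add: cov_deriv_def frame_cov_def)

lemma sum_rotate3:
  fixes X :: "4 \<Rightarrow> 4 \<Rightarrow> 4 \<Rightarrow> real"
  shows "(\<Sum>m\<in>UNIV. \<Sum>a\<in>UNIV. \<Sum>b\<in>UNIV. X m a b) = (\<Sum>a\<in>UNIV. \<Sum>b\<in>UNIV. \<Sum>m\<in>UNIV. X m a b)"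
  by (subst sum.swap) (intro sum.cong refl sum.swap)

lemma sum_rotate4:
  fixes X :: "4 \<Rightarrow> 4 \<Rightarrow> 4 \<Rightarrow> 4 \<Rightarrow> real"
  shows "(\<Sum>s\<in>UNIV. \<Sum>t\<in>UNIV. \<Sum>a\<in>UNIV. \<Sum>b\<in>UNIV. X s t a b)
    = (\<Sum>a\<in>UNIV. \<Sum>b\<in>UNIV. \<Sum>s\<in>UNIV. \<Sum>t\<in>UNIV. X s t a b)"
proof -
  have "(\<Sum>s\<in>UNIV. \<Sum>t\<in>UNIV. \<Sum>a\<in>UNIV. \<Sum>b\<in>UNIV. X s t a b)
    = (\<Sum>s\<in>UNIV. \<Sum>a\<in>UNIV. \<Sum>b\<in>UNIV. \<Sum>t\<in>UNIV. X s t a b)"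
    by (intro sum.cong refl sum_rotate3)
  also have "\<dots> = (\<Sum>a\<in>UNIV. \<Sum>b\<in>UNIV. \<Sum>s\<in>UNIV. \<Sum>t\<in>UNIV. X s t a b)"
    by (rule sum_rotate3[of "\<lambda>s a b. \<Sum>t\<in>UNIV. X s t a b"])
  finally show ?thesis .
qed

lemma pdm_add:
  assumes "\<And>a b. (\<lambda>y. M y $ a $ b) differentiable (at x)" "\<And>a b. (\<lambda>y. N y $ a $ b) differentiable (at x)"
  shows "pdm i (\<lambda>y. M y + N y) x = pdm i M x + pdm i N x"
  unfolding vec_eq_iff using assms by (auto simp: pdm_def pd_add)

context smooth_metric
begin

lemma riemann_up_smooth: "smooth_on U (riemann_up g l k i j)"
  unfolding riemann_up_def[abs_def]
  by (intro smooth_intros U smooth_on_pd christoffel_smooth)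

lemma riemann_smooth: "smooth_on U (riemann g s i j t)"
  unfolding riemann_def[abs_def] by (intro smooth_intros U riemann_up_smooth g_smooth)

lemma ricci_smooth: "smooth_on U (ricci g i j)"
  unfolding ricci_def[abs_def] by (intro smooth_intros U riemann_smooth ginv_smooth)

lemma scalar_smooth: "smooth_on U (scalar_curv g)"
  unfolding scalar_curv_def[abs_def] by (intro smooth_intros U ricci_smooth ginv_smooth)

lemma weyl_smooth: "smooth_on U (weyl g s i j t)"
  unfolding weyl_def[abs_def]
  by (intro smooth_intros U riemann_smooth ricci_smooth scalar_smooth g_smooth) auto

lemma weyl_tensor_smooth: "smooth_on U (weyl_tensor g is)"
  unfolding weyl_tensor_def[abs_def] by (rule weyl_smooth)

lemma cov_deriv_smooth: "(\<And>is. smooth_on U (T is)) \<Longrightarrow> smooth_on U (cov_deriv g T ks)"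
  unfolding cov_deriv_def[abs_def] Let_def
  by (intro smooth_intros U smooth_on_pd christoffel_smooth)

text \<open>Contraction with the parallel tensor \<open>g\<^sup>-\<^sup>1\<close> commutes with covariant differentiation.\<close>

lemma cov_deriv_contract:
  assumes x: "x \<in> U" and T: "\<And>ks. smooth_on U (T ks)"
  shows "cov_deriv g (\<lambda>ks x. \<Sum>s\<in>UNIV. \<Sum>a\<in>UNIV. ginv g x $ s $ a * T (s # ks @ [a]) x) (ks @ [b]) x
    = (\<Sum>s\<in>UNIV. \<Sum>a\<in>UNIV. ginv g x $ s $ a * cov_deriv g T (s # ks @ [a, b]) x)"
proof -
  let ?\<Gamma> = "\<lambda>m i. christoffel g m b i x" and ?h = "\<lambda>s a. ginv g x $ s $ a"
  let ?mid = "\<lambda>s a. \<Sum>p<length ks. \<Sum>m\<in>UNIV. ?\<Gamma> m (ks ! p) * T (s # ks[p := m] @ [a]) x"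
  have cov: "cov_deriv g T (s # ks @ [a, b]) x = pd b (T (s # ks @ [a])) x
      - (\<Sum>m\<in>UNIV. ?\<Gamma> m s * T (m # ks @ [a]) x) - ?mid s a
      - (\<Sum>m\<in>UNIV. ?\<Gamma> m a * T (s # ks @ [m]) x)" for s a
  proof -
    have "cov_deriv g T (s # ks @ [a, b]) x = cov_deriv g T ((s # ks @ [a]) @ [b]) x" by simp
    also have "\<dots> = pd b (T (s # ks @ [a])) x -
        (\<Sum>p<Suc (Suc (length ks)). \<Sum>m\<in>UNIV. ?\<Gamma> m ((s # ks @ [a]) ! p) * T ((s # ks @ [a])[p := m]) x)"
      unfolding cov_deriv_snoc frame_cov_def by simp
    also have "(\<Sum>p<Suc (Suc (length ks)). \<Sum>m\<in>UNIV. ?\<Gamma> m ((s # ks @ [a]) ! p) * T ((s # ks @ [a])[p := m]) x)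
      = (\<Sum>m\<in>UNIV. ?\<Gamma> m s * T (m # ks @ [a]) x)
        + (\<Sum>p<Suc (length ks). \<Sum>m\<in>UNIV. ?\<Gamma> m ((ks @ [a]) ! p) * T (s # (ks @ [a])[p := m]) x)"
      by (subst sum.lessThan_Suc_shift) simp
    also have "(\<Sum>p<Suc (length ks). \<Sum>m\<in>UNIV. ?\<Gamma> m ((ks @ [a]) ! p) * T (s # (ks @ [a])[p := m]) x)
      = ?mid s a + (\<Sum>m\<in>UNIV. ?\<Gamma> m a * T (s # ks @ [m]) x)"
      by (simp add: nth_append list_update_append)
    finally show ?thesis by simp
  qed
  have d: "(\<lambda>x. ginv g x $ s $ a) differentiable (at x)" "T js differentiable (at x)" for s a js
    using smooth_on_differentiable[OF ginv_smooth x] smooth_on_differentiable[OF T x] by auto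
  have "pd b (\<lambda>x. \<Sum>s\<in>UNIV. \<Sum>a\<in>UNIV. ginv g x $ s $ a * T (s # ks @ [a]) x) x
    = (\<Sum>s\<in>UNIV. \<Sum>a\<in>UNIV. pd b (\<lambda>x. ginv g x $ s $ a) x * T (s # ks @ [a]) x
        + ?h s a * pd b (T (s # ks @ [a])) x)"
    using d by (simp add: pd_sum pd_mult differentiable_sum differentiable_mult)
  also have "\<dots> = (\<Sum>s\<in>UNIV. \<Sum>a\<in>UNIV. ?h s a * pd b (T (s # ks @ [a])) x)
      - (\<Sum>s\<in>UNIV. \<Sum>a\<in>UNIV. \<Sum>m\<in>UNIV. ?\<Gamma> s m * ?h m a * T (s # ks @ [a]) x)
      - (\<Sum>s\<in>UNIV. \<Sum>a\<in>UNIV. \<Sum>m\<in>UNIV. ?\<Gamma> a m * ?h s m * T (s # ks @ [a]) x)"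
    unfolding inverse_metric_parallel[OF x]
    by (simp add: sum.distrib sum_distrib_right sum_distrib_left distrib_right sum_subtractf algebra_simps)
  also have "(\<Sum>s\<in>UNIV. \<Sum>a\<in>UNIV. \<Sum>m\<in>UNIV. ?\<Gamma> s m * ?h m a * T (s # ks @ [a]) x)
      = (\<Sum>s\<in>UNIV. \<Sum>a\<in>UNIV. ?h s a * (\<Sum>m\<in>UNIV. ?\<Gamma> m s * T (m # ks @ [a]) x))"
  proof -
    have "(\<Sum>s\<in>UNIV. \<Sum>a\<in>UNIV. \<Sum>m\<in>UNIV. ?\<Gamma> s m * ?h m a * T (s # ks @ [a]) x)
        = (\<Sum>a\<in>UNIV. \<Sum>m\<in>UNIV. \<Sum>s\<in>UNIV. ?\<Gamma> s m * ?h m a * T (s # ks @ [a]) x)"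
      by (rule sum_rotate3)
    also have "\<dots> = (\<Sum>m\<in>UNIV. \<Sum>a\<in>UNIV. \<Sum>s\<in>UNIV. ?\<Gamma> s m * ?h m a * T (s # ks @ [a]) x)"
      by (rule sum.swap)
    finally show ?thesis by (simp add: sum_distrib_left mult_ac)
  qed
  also have "(\<Sum>s\<in>UNIV. \<Sum>a\<in>UNIV. \<Sum>m\<in>UNIV. ?\<Gamma> a m * ?h s m * T (s # ks @ [a]) x)
      = (\<Sum>s\<in>UNIV. \<Sum>a\<in>UNIV. ?h s a * (\<Sum>m\<in>UNIV. ?\<Gamma> m a * T (s # ks @ [m]) x))"
  proof (rule sum.cong[OF refl])
    fix s
    show "(\<Sum>a\<in>UNIV. \<Sum>m\<in>UNIV. ?\<Gamma> a m * ?h s m * T (s # ks @ [a]) x)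
      = (\<Sum>a\<in>UNIV. ?h s a * (\<Sum>m\<in>UNIV. ?\<Gamma> m a * T (s # ks @ [m]) x))"
      by (subst sum.swap) (simp add: sum_distrib_left mult_ac)
  qed
  finally have P: "pd b (\<lambda>x. \<Sum>s\<in>UNIV. \<Sum>a\<in>UNIV. ginv g x $ s $ a * T (s # ks @ [a]) x) x
    = (\<Sum>s\<in>UNIV. \<Sum>a\<in>UNIV. ?h s a * (pd b (T (s # ks @ [a])) x
      - (\<Sum>m\<in>UNIV. ?\<Gamma> m s * T (m # ks @ [a]) x) - (\<Sum>m\<in>UNIV. ?\<Gamma> m a * T (s # ks @ [m]) x)))"
    by (simp add: right_diff_distrib sum_subtractf)
  have M: "(\<Sum>p<length ks. \<Sum>m\<in>UNIV. ?\<Gamma> m (ks ! p) * (\<Sum>s\<in>UNIV. \<Sum>a\<in>UNIV. ?h s a * T (s # ks[p := m] @ [a]) x))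
      = (\<Sum>s\<in>UNIV. \<Sum>a\<in>UNIV. ?h s a * ?mid s a)"
  proof -
    have "(\<Sum>p<length ks. \<Sum>m\<in>UNIV. ?\<Gamma> m (ks ! p) * (\<Sum>s\<in>UNIV. \<Sum>a\<in>UNIV. ?h s a * T (s # ks[p := m] @ [a]) x))
      = (\<Sum>p<length ks. \<Sum>s\<in>UNIV. \<Sum>a\<in>UNIV. \<Sum>m\<in>UNIV. ?\<Gamma> m (ks ! p) * (?h s a * T (s # ks[p := m] @ [a]) x))"
      unfolding sum_distrib_left by (intro sum.cong refl sum_rotate3)
    also have "\<dots> = (\<Sum>s\<in>UNIV. \<Sum>a\<in>UNIV. \<Sum>p<length ks. \<Sum>m\<in>UNIV. ?\<Gamma> m (ks ! p) * (?h s a * T (s # ks[p := m] @ [a]) x))"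
      by (subst sum.swap) (intro sum.cong refl sum.swap)
    finally show ?thesis by (simp add: sum_distrib_left mult.left_commute)
  qed
  show ?thesis unfolding cov cov_deriv_snoc frame_cov_def P M sum_subtractf[symmetric]
    by (intro sum.cong refl) (simp add: algebra_simps)
qed

text \<open>
  Computing the Bach tensor as an iterated divergence avoids the second covariant derivative of the
  Weyl tensor, which has \<open>4\<^sup>6\<close> components.
\<close>

lemma bach_div:
  assumes x: "x \<in> U"
  shows "bach g i j x = (\<Sum>t\<in>UNIV. \<Sum>b\<in>UNIV. ginv g x $ t $ b * cov_deriv g (weyl_div g) [i, j, t, b] x)
    + (\<Sum>s\<in>UNIV. \<Sum>t\<in>UNIV. \<Sum>a\<in>UNIV. \<Sum>b\<in>UNIV. ginv g x $ s $ a * ginv g x $ t $ b * (weyl g s i j t x * ricci g a b x)) / 2"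
proof -
  let ?h = "\<lambda>s a. ginv g x $ s $ a"
  have W: "smooth_on U (cov_deriv g (weyl_tensor g) ks)" for ks
    by (intro cov_deriv_smooth weyl_tensor_smooth)
  have "cov_deriv g (weyl_div g) [i, j, t, b] x
      = (\<Sum>s\<in>UNIV. \<Sum>a\<in>UNIV. ?h s a * cov_deriv g (cov_deriv g (weyl_tensor g)) [s, i, j, t, a, b] x)" for t b
    using cov_deriv_contract[OF x W, where b=b and ks="[i, j, t]"] unfolding weyl_div_def[abs_def] by simp
  then have "(\<Sum>t\<in>UNIV. \<Sum>b\<in>UNIV. ?h t b * cov_deriv g (weyl_div g) [i, j, t, b] x)
    = (\<Sum>t\<in>UNIV. \<Sum>b\<in>UNIV. \<Sum>s\<in>UNIV. \<Sum>a\<in>UNIV. ?h t b * (?h s a * cov_deriv g (cov_deriv g (weyl_tensor g)) [s, i, j, t, a, b] x))"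
    by (simp add: sum_distrib_left)
  also have "\<dots> = (\<Sum>s\<in>UNIV. \<Sum>a\<in>UNIV. \<Sum>t\<in>UNIV. \<Sum>b\<in>UNIV. ?h t b * (?h s a * cov_deriv g (cov_deriv g (weyl_tensor g)) [s, i, j, t, a, b] x))"
    by (rule sum_rotate4)
  also have "\<dots> = (\<Sum>s\<in>UNIV. \<Sum>t\<in>UNIV. \<Sum>a\<in>UNIV. \<Sum>b\<in>UNIV. ?h t b * (?h s a * cov_deriv g (cov_deriv g (weyl_tensor g)) [s, i, j, t, a, b] x))"
    by (intro sum.cong refl sum.swap)
  finally show ?thesis
    unfolding bach_def by (simp add: distrib_left sum.distrib sum_divide_distrib mult_ac)
qed

end

context moving_frame
begin

lemma tens_differentiable:
  assumes x: "x \<in> U" and T: "\<And>as. length as = length is \<Longrightarrow> smooth_on V (T as)"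
  shows "tens \<theta> \<pi> T is differentiable (at x)"
  using T
proof (induction "is" arbitrary: T)
  case Nil then show ?case using differentiable_base[OF _ x] by simp
next
  case (Cons i "is")
  have "tens \<theta> \<pi> (\<lambda>as. T (a # as)) is differentiable (at x)" for a by (rule Cons.IH) (use Cons.prems in auto)
  then show ?case using smooth_on_differentiable[OF \<theta>_smooth x]
    by (auto intro!: differentiable_sum differentiable_mult)
qed

text \<open>
  By the product rule, differentiating a coframe expansion means differentiating the components
  and the coframe, and the latter derivative is given by \<open>\<gamma>\<close>.
\<close>

lemma frame_cov_tens:
  assumes x: "x \<in> U" and T: "\<And>as. length as = length is \<Longrightarrow> smooth_on V (T as)"
  shows "frame_cov pd (christoffel g) i (tens \<theta> \<pi> T) is x
    = (\<Sum>c\<in>UNIV. \<theta> c i x * tens \<theta> \<pi> (frame_cov D \<gamma> c T) is x)"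
  using T
proof (induction "is" arbitrary: T)
  case Nil
  have "tens \<theta> \<pi> T [] = (\<lambda>y. T [] (\<pi> y))" by auto
  with Nil show ?case by (simp add: frame_cov_def pd_base[OF _ x])
next
  case (Cons j "is")
  define Tb where "Tb b = tens \<theta> \<pi> (\<lambda>as. T (b # as))" for b
  let ?\<Gamma> = "\<lambda>m k. christoffel g m i k x"
  have d: "Tb b is differentiable (at x)" for b
    unfolding Tb_def by (rule tens_differentiable[OF x]) (use Cons.prems in auto)
  have comp: "tens \<theta> \<pi> (frame_cov D \<gamma> c (\<lambda>as. T (a # as))) is x - (\<Sum>b\<in>UNIV. \<gamma> b c a (\<pi> x) * Tb b is x)
     = tens \<theta> \<pi> (\<lambda>as. frame_cov D \<gamma> c T (a # as)) is x" for a c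
  proof -
    have "(\<lambda>as. frame_cov D \<gamma> c T (a # as)) = (\<lambda>as y. frame_cov D \<gamma> c (\<lambda>as. T (a # as)) as y
        - (\<Sum>b\<in>UNIV. \<gamma> b c a y * T (b # as) y))"
      unfolding frame_cov_def list.size add_Suc_right add_0_right sum.lessThan_Suc_shift nth_Cons_0 nth_Cons_Suc
        list_update_code by (simp add: fun_eq_iff)
    then show ?thesis unfolding Tb_def by (simp only: tens_diff tens_sum tens_scale)
  qed
  have IH: "frame_cov pd (christoffel g) i (Tb b) is x
      = (\<Sum>c\<in>UNIV. \<theta> c i x * tens \<theta> \<pi> (frame_cov D \<gamma> c (\<lambda>as. T (b # as))) is x)" for b
    unfolding Tb_def by (rule Cons.IH) (use Cons.prems in auto)
  have t: "tens \<theta> \<pi> T (k # js) = (\<lambda>y. \<Sum>b\<in>UNIV. \<theta> b k y * Tb b js y)" for k js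
    by (auto simp: Tb_def)
  have "frame_cov pd (christoffel g) i (tens \<theta> \<pi> T) (j # is) x
     = (\<Sum>b\<in>UNIV. pd i (\<theta> b j) x * Tb b is x + \<theta> b j x * pd i (Tb b is) x)
       - (\<Sum>m\<in>UNIV. ?\<Gamma> m j * (\<Sum>b\<in>UNIV. \<theta> b m x * Tb b is x))
       - (\<Sum>p<length is. \<Sum>m\<in>UNIV. ?\<Gamma> m (is ! p) * (\<Sum>b\<in>UNIV. \<theta> b j x * Tb b (is[p := m]) x))"
    unfolding frame_cov_def list.size add_Suc_right add_0_right sum.lessThan_Suc_shift nth_Cons_0 nth_Cons_Suc
      list_update_code t
    using d smooth_on_differentiable[OF \<theta>_smooth x]
    by (simp add: pd_sum pd_mult differentiable_mult)
  also have "(\<Sum>m\<in>UNIV. ?\<Gamma> m j * (\<Sum>b\<in>UNIV. \<theta> b m x * Tb b is x))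
     = (\<Sum>b\<in>UNIV. (\<Sum>m\<in>UNIV. ?\<Gamma> m j * \<theta> b m x) * Tb b is x)"
    unfolding sum_distrib_left sum_distrib_right by (subst sum.swap) (simp add: mult_ac)
  also have "(\<Sum>p<length is. \<Sum>m\<in>UNIV. ?\<Gamma> m (is ! p) * (\<Sum>b\<in>UNIV. \<theta> b j x * Tb b (is[p := m]) x))
     = (\<Sum>b\<in>UNIV. \<theta> b j x * (\<Sum>p<length is. \<Sum>m\<in>UNIV. ?\<Gamma> m (is ! p) * Tb b (is[p := m]) x))"
  proof -
    have "(\<Sum>p<length is. \<Sum>m\<in>UNIV. ?\<Gamma> m (is ! p) * (\<Sum>b\<in>UNIV. \<theta> b j x * Tb b (is[p := m]) x))
      = (\<Sum>p<length is. \<Sum>b\<in>UNIV. \<Sum>m\<in>UNIV. ?\<Gamma> m (is ! p) * (\<theta> b j x * Tb b (is[p := m]) x))"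
      unfolding sum_distrib_left by (intro sum.cong refl sum.swap)
    also have "\<dots> = (\<Sum>b\<in>UNIV. \<Sum>p<length is. \<Sum>m\<in>UNIV. ?\<Gamma> m (is ! p) * (\<theta> b j x * Tb b (is[p := m]) x))"
      by (rule sum.swap)
    finally show ?thesis by (simp add: sum_distrib_left mult.left_commute)
  qed
  also have "(\<Sum>b\<in>UNIV. pd i (\<theta> b j) x * Tb b is x + \<theta> b j x * pd i (Tb b is) x)
       - (\<Sum>b\<in>UNIV. (\<Sum>m\<in>UNIV. ?\<Gamma> m j * \<theta> b m x) * Tb b is x)
       - (\<Sum>b\<in>UNIV. \<theta> b j x * (\<Sum>p<length is. \<Sum>m\<in>UNIV. ?\<Gamma> m (is ! p) * Tb b (is[p := m]) x))
     = (\<Sum>b\<in>UNIV. (pd i (\<theta> b j) x - (\<Sum>m\<in>UNIV. ?\<Gamma> m j * \<theta> b m x)) * Tb b is x)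
       + (\<Sum>b\<in>UNIV. \<theta> b j x * frame_cov pd (christoffel g) i (Tb b) is x)"
    unfolding frame_cov_def
    by (simp add: sum.distrib[symmetric] sum_subtractf[symmetric] algebra_simps)
  also have "(\<Sum>b\<in>UNIV. (pd i (\<theta> b j) x - (\<Sum>m\<in>UNIV. ?\<Gamma> m j * \<theta> b m x)) * Tb b is x)
     = - (\<Sum>c\<in>UNIV. \<Sum>a\<in>UNIV. \<Sum>b\<in>UNIV. \<theta> c i x * (\<theta> a j x * (\<gamma> b c a (\<pi> x) * Tb b is x)))"
  proof -
    have "(\<Sum>b\<in>UNIV. (pd i (\<theta> b j) x - (\<Sum>m\<in>UNIV. ?\<Gamma> m j * \<theta> b m x)) * Tb b is x)
      = - (\<Sum>b\<in>UNIV. \<Sum>a\<in>UNIV. \<Sum>c\<in>UNIV. \<theta> c i x * (\<theta> a j x * (\<gamma> b c a (\<pi> x) * Tb b is x)))"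
      unfolding coframe_derivative[OF x]
      by (simp add: sum_distrib_right sum_distrib_left sum_negf mult_ac)
    also have "(\<Sum>b\<in>UNIV. \<Sum>a\<in>UNIV. \<Sum>c\<in>UNIV. \<theta> c i x * (\<theta> a j x * (\<gamma> b c a (\<pi> x) * Tb b is x)))
      = (\<Sum>a\<in>UNIV. \<Sum>c\<in>UNIV. \<Sum>b\<in>UNIV. \<theta> c i x * (\<theta> a j x * (\<gamma> b c a (\<pi> x) * Tb b is x)))"
      by (rule sum_rotate3)
    also have "\<dots> = (\<Sum>c\<in>UNIV. \<Sum>a\<in>UNIV. \<Sum>b\<in>UNIV. \<theta> c i x * (\<theta> a j x * (\<gamma> b c a (\<pi> x) * Tb b is x)))"
      by (rule sum.swap)
    finally show ?thesis .
  qed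
  also have "(\<Sum>b\<in>UNIV. \<theta> b j x * frame_cov pd (christoffel g) i (Tb b) is x)
     = (\<Sum>c\<in>UNIV. \<Sum>a\<in>UNIV. \<theta> c i x * (\<theta> a j x * tens \<theta> \<pi> (frame_cov D \<gamma> c (\<lambda>as. T (a # as))) is x))"
    unfolding IH sum_distrib_left by (subst sum.swap) (simp add: mult_ac)
  also have "- (\<Sum>c\<in>UNIV. \<Sum>a\<in>UNIV. \<Sum>b\<in>UNIV. \<theta> c i x * (\<theta> a j x * (\<gamma> b c a (\<pi> x) * Tb b is x)))
     + (\<Sum>c\<in>UNIV. \<Sum>a\<in>UNIV. \<theta> c i x * (\<theta> a j x * tens \<theta> \<pi> (frame_cov D \<gamma> c (\<lambda>as. T (a # as))) is x))
     = (\<Sum>c\<in>UNIV. \<theta> c i x * (\<Sum>a\<in>UNIV. \<theta> a j x *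
         (tens \<theta> \<pi> (frame_cov D \<gamma> c (\<lambda>as. T (a # as))) is x - (\<Sum>b\<in>UNIV. \<gamma> b c a (\<pi> x) * Tb b is x))))"
    by (simp add: right_diff_distrib sum_subtractf sum_distrib_left)
  finally show ?case by (simp add: comp)
qed

lemma cov_deriv_tens:
  assumes x: "x \<in> U" and T: "\<And>as. length as = length is \<Longrightarrow> smooth_on V (T as)"
    and eq: "\<And>js y. length js = length is \<Longrightarrow> y \<in> U \<Longrightarrow> T' js y = tens \<theta> \<pi> T js y"
  shows "cov_deriv g T' (is @ [i]) x = (\<Sum>c\<in>UNIV. \<theta> c i x * tens \<theta> \<pi> (frame_cov D \<gamma> c T) is x)"
proof -
  have "cov_deriv g T' (is @ [i]) x = frame_cov pd (christoffel g) i (tens \<theta> \<pi> T) is x"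
    unfolding cov_deriv_snoc frame_cov_def using pd_cong[OF U x, of "T' is" "tens \<theta> \<pi> T is" i] eq x
    by simp
  then show ?thesis using frame_cov_tens[OF x T] by simp
qed

text \<open>
  Cartan's second structure equation: the curvature is obtained by differentiating
  the identity of lemma \<open>christoffel_frame\<close>, and second derivatives of the coframe cancel.
\<close>

lemma riemann_up_frame:
  assumes x: "x \<in> U"
  shows "(\<Sum>l\<in>UNIV. \<theta> d l x * riemann_up g l k i j x) =
    (\<Sum>a\<in>UNIV. \<Sum>b\<in>UNIV. \<Sum>c\<in>UNIV. \<theta> a i x * (\<theta> b j x * (\<theta> c k x * frame_riemann_up D \<gamma> d c a b (\<pi> x))))"
proof -
  let ?\<Gamma> = "\<lambda>i x. (\<chi> l k. christoffel g l i k x) :: real^4^4"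
  let ?R = "(\<chi> l k. riemann_up g l k i j x) :: real^4^4"
  have d\<Theta>: "(\<lambda>y. \<Theta> y $ a $ b) differentiable (at x)" for a b
    using smooth_on_differentiable[OF \<theta>_smooth x] by (simp add: \<Theta>_def)
  have d\<Gamma>: "(\<lambda>y. ?\<Gamma> i y $ a $ b) differentiable (at x)" for i a b
    using smooth_on_differentiable[OF christoffel_smooth x] by simp
  have dA: "(\<lambda>y. A i y $ a $ b) differentiable (at x)" for i a b
    using smooth_on_differentiable[OF \<theta>_smooth x] differentiable_base[OF \<gamma>_smooth x]
    by (auto simp: A_def intro!: differentiable_sum differentiable_mult)
  have dA\<Theta>: "(\<lambda>y. (A i y ** \<Theta> y) $ a $ b) differentiable (at x)" for i a b
    unfolding matrix_mult_nth using d\<Theta> dA by (auto intro!: differentiable_sum differentiable_mult)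
  have d\<Theta>': "(\<lambda>y. pdm i \<Theta> y $ a $ b) differentiable (at x)" for i a b
    using smooth_on_differentiable[OF smooth_on_pd[OF \<theta>_smooth] x] by (simp add: \<Theta>_def pdm_def)
  have dd: "pdm i \<Theta> x ** ?\<Gamma> j x + \<Theta> x ** pdm i (?\<Gamma> j) x
      = pdm i (pdm j \<Theta>) x + (pdm i (A j) x ** \<Theta> x + A j x ** pdm i \<Theta> x)" for i j
  proof -
    have "pdm i (\<lambda>y. \<Theta> y ** ?\<Gamma> j y) x = pdm i (\<lambda>y. pdm j \<Theta> y + A j y ** \<Theta> y) x"
      using pd_cong[OF U x, of "\<lambda>y. (\<Theta> y ** ?\<Gamma> j y) $ _ $ _"] christoffel_frame
      by (simp add: pdm_def[of i] vec_eq_iff)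
    then show ?thesis
      using pdm_mult[of \<Theta> x "?\<Gamma> j" i] pdm_mult[of "A j" x \<Theta> i] pdm_add[of "pdm j \<Theta>" x "\<lambda>y. A j y ** \<Theta> y" i]
        d\<Theta> d\<Gamma> dA dA\<Theta> d\<Theta>' by simp
  qed
  have comm: "pdm i (pdm j \<Theta>) x = pdm j (pdm i \<Theta>) x"
    using pd_commute[OF U \<theta>_smooth x, of i j] by (simp add: pdm_def \<Theta>_def)
  have R: "?R = pdm i (?\<Gamma> j) x - pdm j (?\<Gamma> i) x + ?\<Gamma> i x ** ?\<Gamma> j x - ?\<Gamma> j x ** ?\<Gamma> i x"
    by (simp add: vec_eq_iff riemann_up_def pdm_def matrix_mult_nth sum_subtractf)
  have G: "\<Theta> x ** ?\<Gamma> i x ** M = pdm i \<Theta> x ** M + A i x ** \<Theta> x ** M" for i and M :: "real^4^4"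
    by (simp add: christoffel_frame[OF x] matrix_ring)
  have AG: "A i x ** \<Theta> x ** ?\<Gamma> j x = A i x ** pdm j \<Theta> x + A i x ** A j x ** \<Theta> x" for i j
    by (simp only: christoffel_frame[OF x] matrix_ring flip: matrix_mul_assoc)
  have TR: "\<Theta> x ** ?R = (pdm i (A j) x - pdm j (A i) x + A i x ** A j x - A j x ** A i x) ** \<Theta> x"
    unfolding R matrix_ring G AG using dd[of i j] dd[of j i] comm by (simp add: algebra_simps)
  have DA: "pdm i (A j) x $ d $ c = (\<Sum>m\<in>UNIV. pd i (\<theta> m j) x * \<gamma> d m c (\<pi> x))
      + (\<Sum>b\<in>UNIV. \<Sum>a\<in>UNIV. \<theta> b j x * (\<theta> a i x * D a (\<gamma> d b c) (\<pi> x)))" for i j c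
    using smooth_on_differentiable[OF \<theta>_smooth x] differentiable_base[OF \<gamma>_smooth x]
    by (simp add: pdm_def A_def pd_sum pd_mult pd_base[OF \<gamma>_smooth x] differentiable_mult
        sum.distrib sum_distrib_left)
  have DA': "pdm i (A j) x $ d $ c - pdm j (A i) x $ d $ c =
      (\<Sum>a\<in>UNIV. \<Sum>b\<in>UNIV. \<theta> a i x * (\<theta> b j x * (D a (\<gamma> d b c) (\<pi> x) - D b (\<gamma> d a c) (\<pi> x)
        - (\<Sum>m\<in>UNIV. (\<gamma> m a b (\<pi> x) - \<gamma> m b a (\<pi> x)) * \<gamma> d m c (\<pi> x)))))" for c
  proof -
    have "(\<Sum>m\<in>UNIV. pd i (\<theta> m j) x * \<gamma> d m c (\<pi> x)) - (\<Sum>m\<in>UNIV. pd j (\<theta> m i) x * \<gamma> d m c (\<pi> x))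
      = (\<Sum>m\<in>UNIV. (pd i (\<theta> m j) x - pd j (\<theta> m i) x) * \<gamma> d m c (\<pi> x))"
      by (simp add: left_diff_distrib sum_subtractf)
    also have "\<dots> = - (\<Sum>m\<in>UNIV. \<Sum>a\<in>UNIV. \<Sum>b\<in>UNIV.
        \<theta> a i x * (\<theta> b j x * ((\<gamma> m a b (\<pi> x) - \<gamma> m b a (\<pi> x)) * \<gamma> d m c (\<pi> x))))"
      unfolding torsion_free[OF x] by (simp add: sum_distrib_right sum_distrib_left sum_negf mult_ac)
    also have "\<dots> = - (\<Sum>a\<in>UNIV. \<Sum>b\<in>UNIV. \<Sum>m\<in>UNIV.
        \<theta> a i x * (\<theta> b j x * ((\<gamma> m a b (\<pi> x) - \<gamma> m b a (\<pi> x)) * \<gamma> d m c (\<pi> x))))"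
      by (subst sum_rotate3) simp
    finally have 1: "(\<Sum>m\<in>UNIV. pd i (\<theta> m j) x * \<gamma> d m c (\<pi> x)) - (\<Sum>m\<in>UNIV. pd j (\<theta> m i) x * \<gamma> d m c (\<pi> x)) = \<dots>" .
    have 2: "(\<Sum>b\<in>UNIV. \<Sum>a\<in>UNIV. \<theta> b j x * (\<theta> a i x * D a (\<gamma> d b c) (\<pi> x)))
       = (\<Sum>a\<in>UNIV. \<Sum>b\<in>UNIV. \<theta> a i x * (\<theta> b j x * D a (\<gamma> d b c) (\<pi> x)))"
      by (subst sum.swap) (simp add: mult_ac)
    show ?thesis
      unfolding right_diff_distrib sum_subtractf
      using 1 2 by (simp add: DA sum_distrib_left mult_ac)
  qed
  have AA: "(A i x ** A j x) $ d $ c = (\<Sum>a\<in>UNIV. \<Sum>b\<in>UNIV. \<theta> a i x * (\<theta> b j x *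
      (\<Sum>m\<in>UNIV. \<gamma> d a m (\<pi> x) * \<gamma> m b c (\<pi> x))))" for i j c
  proof -
    have "(A i x ** A j x) $ d $ c = (\<Sum>m\<in>UNIV. \<Sum>a\<in>UNIV. \<Sum>b\<in>UNIV.
        \<theta> a i x * (\<theta> b j x * (\<gamma> d a m (\<pi> x) * \<gamma> m b c (\<pi> x))))"
      by (simp add: matrix_mult_nth A_def sum_product mult_ac)
    also note sum_rotate3
    finally show ?thesis by (simp add: sum_distrib_left)
  qed
  have AA': "(A j x ** A i x) $ d $ c = (\<Sum>a\<in>UNIV. \<Sum>b\<in>UNIV. \<theta> a i x * (\<theta> b j x *
      (\<Sum>m\<in>UNIV. \<gamma> d b m (\<pi> x) * \<gamma> m a c (\<pi> x))))" for c
    unfolding AA by (subst sum.swap) (simp add: mult_ac)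
  have K: "(pdm i (A j) x - pdm j (A i) x + A i x ** A j x - A j x ** A i x) $ d $ c
      = (\<Sum>a\<in>UNIV. \<Sum>b\<in>UNIV. \<theta> a i x * (\<theta> b j x * frame_riemann_up D \<gamma> d c a b (\<pi> x)))" for c
  proof -
    have alg: "t * (u * (P - Q - S)) + t * (u * X) - t * (u * Y) = t * (u * (P - Q + (X - Y) - S))"
      for t u P Q S X Y :: real by (simp add: algebra_simps)
    show ?thesis
    proof -
      have "(\<Sum>a\<in>UNIV. \<Sum>b\<in>UNIV. \<theta> a i x * (\<theta> b j x * frame_riemann_up D \<gamma> d c a b (\<pi> x)))
        = (\<Sum>a\<in>UNIV. \<Sum>b\<in>UNIV. \<theta> a i x * (\<theta> b j x * (D a (\<gamma> d b c) (\<pi> x) - D b (\<gamma> d a c) (\<pi> x)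
              - (\<Sum>m\<in>UNIV. (\<gamma> m a b (\<pi> x) - \<gamma> m b a (\<pi> x)) * \<gamma> d m c (\<pi> x))))
            + \<theta> a i x * (\<theta> b j x * (\<Sum>m\<in>UNIV. \<gamma> d a m (\<pi> x) * \<gamma> m b c (\<pi> x)))
            - \<theta> a i x * (\<theta> b j x * (\<Sum>m\<in>UNIV. \<gamma> d b m (\<pi> x) * \<gamma> m a c (\<pi> x))))"
        unfolding alg frame_riemann_up_def by (simp only: sum_subtractf)
      then show ?thesis
        unfolding vector_minus_component vector_add_component DA' AA' AA[of i j]
        by (simp only: sum.distrib sum_subtractf)
    qed
  qed
  have "(\<Theta> x ** ?R) $ d $ k = (\<Sum>l\<in>UNIV. \<theta> d l x * riemann_up g l k i j x)"
    by (simp add: matrix_mult_nth \<Theta>_def)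
  moreover have "(\<Theta> x ** ?R) $ d $ k = (\<Sum>c\<in>UNIV. \<Sum>a\<in>UNIV. \<Sum>b\<in>UNIV.
      \<theta> a i x * (\<theta> b j x * (\<theta> c k x * frame_riemann_up D \<gamma> d c a b (\<pi> x))))"
    unfolding TR matrix_mult_nth[of _ "\<Theta> x"] K by (simp add: \<Theta>_def sum_distrib_left mult_ac)
  moreover note sum_rotate3[of "\<lambda>c a b. \<theta> a i x * (\<theta> b j x * (\<theta> c k x * frame_riemann_up D \<gamma> d c a b (\<pi> x)))"]
  ultimately show ?thesis by (simp only:)
qed

end

section \<open>Tensor equations and scalar invariants in a moving frame\<close>

lemma tens_outer:
  "tens \<theta> \<pi> T (s # is @ [t]) x =
     (\<Sum>a\<in>UNIV. \<theta> a s x * (\<Sum>b\<in>UNIV. \<theta> b t x * tens \<theta> \<pi> (\<lambda>as. T (a # as @ [b])) is x))"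
  by (simp add: tens_snoc)

lemma sum_product4:
  fixes P Q :: "4 \<Rightarrow> 4 \<Rightarrow> real"
  shows "(\<Sum>a\<in>UNIV. \<Sum>b\<in>UNIV. P a b) * (\<Sum>c\<in>UNIV. \<Sum>d\<in>UNIV. Q c d)
    = (\<Sum>a\<in>UNIV. \<Sum>b\<in>UNIV. \<Sum>c\<in>UNIV. \<Sum>d\<in>UNIV. P a b * Q c d)"
  by (simp only: sum_distrib_right) (simp only: sum_distrib_left)

text \<open>
  The inner product of covariant tensors of rank \<open>n\<close>, where \<open>h\<close> is the inverse metric. The recursion
  contracts one pair of indices after the other, so it passes to a frame by induction on \<open>n\<close>.
\<close>

fun tensor_inner :: "(4 \<Rightarrow> 4 \<Rightarrow> 'b \<Rightarrow> real) \<Rightarrow> nat \<Rightarrow> (4 list \<Rightarrow> 'b \<Rightarrow> real) \<Rightarrow> (4 list \<Rightarrow> 'b \<Rightarrow> real) \<Rightarrow> 'b \<Rightarrow> real" where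
  "tensor_inner h 0 T T' y = T [] y * T' [] y"
| "tensor_inner h (Suc n) T T' y = (\<Sum>a\<in>UNIV. \<Sum>b\<in>UNIV. h a b y *
     tensor_inner h n (\<lambda>as. T (a # as)) (\<lambda>as. T' (b # as)) y)"

lemma tensor_inner_cong:
  assumes "\<And>as. length as = n \<Longrightarrow> T as y = S as y" "\<And>as. length as = n \<Longrightarrow> T' as y = S' as y"
  shows "tensor_inner h n T T' y = tensor_inner h n S S' y"
  using assms
proof (induction n arbitrary: T T' S S')
  case (Suc n)
  have "tensor_inner h n (\<lambda>as. T (a # as)) (\<lambda>as. T' (b # as)) y
      = tensor_inner h n (\<lambda>as. S (a # as)) (\<lambda>as. S' (b # as)) y" for a b
    by (rule Suc.IH) (use Suc.prems in auto)
  then show ?case by simp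
qed simp

lemma tensor_inner_sum_left:
  "tensor_inner h n (\<lambda>as y. \<Sum>a\<in>(UNIV::4 set). k a y * T a as y) T' y = (\<Sum>a\<in>UNIV. k a y * tensor_inner h n (T a) T' y)"
proof (induction n arbitrary: T T')
  case 0 show ?case by (simp add: sum_distrib_right sum_distrib_left mult_ac)
next
  case (Suc n)
  let ?X = "\<lambda>p q a. h p q y * (k a y * tensor_inner h n (\<lambda>as. T a (p # as)) (\<lambda>as. T' (q # as)) y)"
  have "tensor_inner h (Suc n) (\<lambda>as y. \<Sum>a\<in>UNIV. k a y * T a as y) T' y = (\<Sum>p\<in>UNIV. \<Sum>q\<in>UNIV. \<Sum>a\<in>UNIV. ?X p q a)"
    by (simp add: Suc.IH sum_distrib_left)
  also have "\<dots> = (\<Sum>a\<in>UNIV. \<Sum>p\<in>UNIV. \<Sum>q\<in>UNIV. ?X p q a)" by (rule sum_rotate3[symmetric])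
  finally show ?case by (simp add: sum_distrib_left mult_ac)
qed

lemma tensor_inner_sum_right:
  "tensor_inner h n T (\<lambda>as y. \<Sum>a\<in>(UNIV::4 set). k a y * T' a as y) y = (\<Sum>a\<in>UNIV. k a y * tensor_inner h n T (T' a) y)"
proof (induction n arbitrary: T T')
  case 0 show ?case by (simp add: sum_distrib_left mult_ac)
next
  case (Suc n)
  let ?X = "\<lambda>p q a. h p q y * (k a y * tensor_inner h n (\<lambda>as. T (p # as)) (\<lambda>as. T' a (q # as)) y)"
  have "tensor_inner h (Suc n) T (\<lambda>as y. \<Sum>a\<in>UNIV. k a y * T' a as y) y = (\<Sum>p\<in>UNIV. \<Sum>q\<in>UNIV. \<Sum>a\<in>UNIV. ?X p q a)"
    by (simp add: Suc.IH sum_distrib_left)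
  also have "\<dots> = (\<Sum>a\<in>UNIV. \<Sum>p\<in>UNIV. \<Sum>q\<in>UNIV. ?X p q a)" by (rule sum_rotate3[symmetric])
  finally show ?case by (simp add: sum_distrib_left mult_ac)
qed

abbreviation inner_of :: "metric \<Rightarrow> nat \<Rightarrow> tensor \<Rightarrow> tensor \<Rightarrow> real^4 \<Rightarrow> real" where
  "inner_of g \<equiv> tensor_inner (\<lambda>i j x. ginv g x $ i $ j)"

text \<open>
  A tensor of rank four as an endomorphism of the 16-dimensional space of tensors of rank two. For
  the Weyl tensor, traces of its powers are scalar invariants, and conformal changes only scale them.
\<close>

definition raise2 :: "(4 \<Rightarrow> 4 \<Rightarrow> 'b \<Rightarrow> real) \<Rightarrow> (4 \<Rightarrow> 4 \<Rightarrow> 4 \<Rightarrow> 4 \<Rightarrow> 'b \<Rightarrow> real) \<Rightarrow> 'b \<Rightarrow> real^(4 \<times> 4)^(4 \<times> 4)" where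
  "raise2 h W y = (\<chi> p q. \<Sum>c\<in>UNIV. \<Sum>d\<in>UNIV. W (fst p) (snd p) c d y * (h c (fst q) y * h d (snd q) y))"

abbreviation weyl_op :: "metric \<Rightarrow> real^4 \<Rightarrow> real^(4 \<times> 4)^(4 \<times> 4)" where
  "weyl_op g \<equiv> raise2 (\<lambda>i j x. ginv g x $ i $ j) (weyl g)"

lemma trace_conjugate:
  fixes S T M :: "real^'n^'n"
  assumes "T ** S = mat 1"
  shows "trace (S ** M ** T) = trace M"
  using trace_mul_sym[of "S ** M" T] assms by (simp add: matrix_mul_assoc)

context moving_frame
begin

lemma tens2: "tens \<theta> \<pi> T [i, j] x = (\<Sum>a\<in>UNIV. \<Sum>b\<in>UNIV. \<theta> a i x * (\<theta> b j x * T [a, b] (\<pi> x)))"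
  by (simp add: sum_distrib_left)

lemma tens4: "tens \<theta> \<pi> T [s, i, j, t] x = (\<Sum>a\<in>UNIV. \<Sum>b\<in>UNIV. \<Sum>c\<in>UNIV. \<Sum>d\<in>UNIV.
    \<theta> a s x * (\<theta> b i x * (\<theta> c j x * (\<theta> d t x * T [a, b, c, d] (\<pi> x)))))"
  by (simp add: sum_distrib_left)

lemma tens_product_outer_inner:
  "tens \<theta> \<pi> P [s, t] x * tens \<theta> \<pi> Q [i, j] x
    = tens \<theta> \<pi> (\<lambda>as y. P [as ! 0, as ! 3] y * Q [as ! 1, as ! 2] y) [s, i, j, t] x"
proof -
  let ?X = "\<lambda>a d b c. \<theta> a s x * (\<theta> d t x * P [a, d] (\<pi> x)) * (\<theta> b i x * (\<theta> c j x * Q [b, c] (\<pi> x)))"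
  have "tens \<theta> \<pi> P [s, t] x * tens \<theta> \<pi> Q [i, j] x = (\<Sum>a\<in>UNIV. \<Sum>d\<in>UNIV. \<Sum>b\<in>UNIV. \<Sum>c\<in>UNIV. ?X a d b c)"
    unfolding tens2 sum_product4 ..
  also have "\<dots> = (\<Sum>a\<in>UNIV. \<Sum>b\<in>UNIV. \<Sum>c\<in>UNIV. \<Sum>d\<in>UNIV. ?X a d b c)"
    by (intro sum.cong refl sum_rotate3)
  also have "\<dots> = tens \<theta> \<pi> (\<lambda>as y. P [as ! 0, as ! 3] y * Q [as ! 1, as ! 2] y) [s, i, j, t] x"
    unfolding tens4 by (intro sum.cong refl) (simp add: mult_ac numeral_eq_Suc)
  finally show ?thesis .
qed

lemma tens_product_crossed:
  "tens \<theta> \<pi> P [s, j] x * tens \<theta> \<pi> Q [i, t] x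
    = tens \<theta> \<pi> (\<lambda>as y. P [as ! 0, as ! 2] y * Q [as ! 1, as ! 3] y) [s, i, j, t] x"
proof -
  let ?X = "\<lambda>a c b d. \<theta> a s x * (\<theta> c j x * P [a, c] (\<pi> x)) * (\<theta> b i x * (\<theta> d t x * Q [b, d] (\<pi> x)))"
  have "tens \<theta> \<pi> P [s, j] x * tens \<theta> \<pi> Q [i, t] x = (\<Sum>a\<in>UNIV. \<Sum>c\<in>UNIV. \<Sum>b\<in>UNIV. \<Sum>d\<in>UNIV. ?X a c b d)"
    unfolding tens2 sum_product4 ..
  also have "\<dots> = (\<Sum>a\<in>UNIV. \<Sum>b\<in>UNIV. \<Sum>c\<in>UNIV. \<Sum>d\<in>UNIV. ?X a c b d)"
    by (intro sum.cong refl sum.swap)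
  also have "\<dots> = tens \<theta> \<pi> (\<lambda>as y. P [as ! 0, as ! 2] y * Q [as ! 1, as ! 3] y) [s, i, j, t] x"
    unfolding tens4 by (intro sum.cong refl) (simp add: mult_ac numeral_eq_Suc)
  finally show ?thesis .
qed

lemma E_dual:
  assumes "x \<in> U" shows "(\<Sum>i\<in>UNIV. e b i x * \<theta> a i x) = (if a = b then 1 else 0)"
  using dual[OF assms, of a b] by (simp add: mult.commute)

text \<open>Evaluation on frame vectors recovers frame components; hence a tensor vanishes iff its frame components do.\<close>

lemma tens_eval:
  assumes "x \<in> U"
  shows "(\<Sum>i\<in>UNIV. e b i x * tens \<theta> \<pi> T (i # is) x) = tens \<theta> \<pi> (\<lambda>as. T (b # as)) is x"
proof -
  have "(\<Sum>i\<in>UNIV. e b i x * tens \<theta> \<pi> T (i # is) x)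
    = (\<Sum>a\<in>UNIV. (\<Sum>i\<in>UNIV. e b i x * \<theta> a i x) * tens \<theta> \<pi> (\<lambda>as. T (a # as)) is x)"
    by (simp add: sum_distrib_left sum_distrib_right mult_ac) (rule sum.swap)
  then show ?thesis by (simp add: E_dual[OF assms] if_distrib[of "\<lambda>r. r * _"] cong: if_cong)
qed

lemma tens_zero_iff:
  assumes x: "x \<in> U"
  shows "(\<forall>is. length is = n \<longrightarrow> tens \<theta> \<pi> T is x = 0) \<longleftrightarrow> (\<forall>as. length as = n \<longrightarrow> T as (\<pi> x) = 0)"
proof (induction n arbitrary: T)
  case 0 then show ?case by simp
next
  case (Suc n)
  have "(\<forall>is. length is = Suc n \<longrightarrow> tens \<theta> \<pi> T is x = 0)
    \<longleftrightarrow> (\<forall>a is. length is = n \<longrightarrow> tens \<theta> \<pi> (\<lambda>as. T (a # as)) is x = 0)"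
  proof
    assume L: "\<forall>is. length is = Suc n \<longrightarrow> tens \<theta> \<pi> T is x = 0"
    show "\<forall>a is. length is = n \<longrightarrow> tens \<theta> \<pi> (\<lambda>as. T (a # as)) is x = 0"
    proof (intro allI impI)
      fix a and "is" :: "4 list" assume "length is = n"
      then have "tens \<theta> \<pi> T (i # is) x = 0" for i using L by (simp del: tens.simps)
      then show "tens \<theta> \<pi> (\<lambda>as. T (a # as)) is x = 0"
        unfolding tens_eval[OF x, symmetric] by simp
    qed
  next
    assume R: "\<forall>a is. length is = n \<longrightarrow> tens \<theta> \<pi> (\<lambda>as. T (a # as)) is x = 0"
    then show "\<forall>is. length is = Suc n \<longrightarrow> tens \<theta> \<pi> T is x = 0"
      by (auto simp: length_Suc_conv)
  qed
  then show ?case using Suc.IH by (auto simp: length_Suc_conv)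
qed

lemma ginv_frame:
  assumes x: "x \<in> U"
  shows "(\<Sum>s\<in>UNIV. \<Sum>t\<in>UNIV. ginv g x $ s $ t * (\<theta> a s x * \<theta> b t x)) = gi a b (\<pi> x)"
proof -
  have "\<Theta> x ** ginv g x ** transpose (\<Theta> x)
      = (\<Theta> x ** E x) ** (\<chi> a b. gi a b (\<pi> x)) ** transpose (\<Theta> x ** E x)"
    by (simp add: ginv_matrix[OF x] matrix_transpose_mul matrix_mul_assoc)
  then have "(\<Theta> x ** ginv g x ** transpose (\<Theta> x)) $ a $ b = gi a b (\<pi> x)"
    by (simp add: \<Theta>_E[OF x])
  moreover have "(\<Theta> x ** ginv g x ** transpose (\<Theta> x)) $ a $ b
      = (\<Sum>t\<in>UNIV. \<Sum>s\<in>UNIV. ginv g x $ s $ t * (\<theta> a s x * \<theta> b t x))"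
    by (simp add: matrix_mult_nth transpose_def \<Theta>_def sum_distrib_left sum_distrib_right mult_ac)
  ultimately show ?thesis by (subst sum.swap) simp
qed

lemma contract_outer:
  assumes x: "x \<in> U"
  shows "(\<Sum>s\<in>UNIV. \<Sum>t\<in>UNIV. ginv g x $ s $ t * tens \<theta> \<pi> T (s # is @ [t]) x)
    = tens \<theta> \<pi> (\<lambda>as y. \<Sum>a\<in>UNIV. \<Sum>b\<in>UNIV. gi a b y * T (a # as @ [b]) y) is x"
proof -
  let ?Y = "\<lambda>a b. tens \<theta> \<pi> (\<lambda>as. T (a # as @ [b])) is x"
  have "(\<Sum>s\<in>UNIV. \<Sum>t\<in>UNIV. ginv g x $ s $ t * tens \<theta> \<pi> T (s # is @ [t]) x)
    = (\<Sum>s\<in>UNIV. \<Sum>t\<in>UNIV. \<Sum>a\<in>UNIV. \<Sum>b\<in>UNIV. ginv g x $ s $ t * (\<theta> a s x * \<theta> b t x) * ?Y a b)"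
    by (simp only: tens_outer sum_distrib_left mult_ac)
  also have "\<dots> = (\<Sum>a\<in>UNIV. \<Sum>b\<in>UNIV. \<Sum>s\<in>UNIV. \<Sum>t\<in>UNIV. ginv g x $ s $ t * (\<theta> a s x * \<theta> b t x) * ?Y a b)"
    by (rule sum_rotate4)
  also have "\<dots> = (\<Sum>a\<in>UNIV. \<Sum>b\<in>UNIV. gi a b (\<pi> x) * ?Y a b)"
    by (simp only: sum_distrib_right[symmetric] ginv_frame[OF x])
  also have "\<dots> = tens \<theta> \<pi> (\<lambda>as y. \<Sum>a\<in>UNIV. \<Sum>b\<in>UNIV. gi a b y * T (a # as @ [b]) y) is x"
    by (simp only: tens_sum tens_scale)
  finally show ?thesis .
qed

lemma contract_last:
  assumes x: "x \<in> U"
  shows "(\<Sum>s\<in>UNIV. \<Sum>t\<in>UNIV. ginv g x $ s $ t * tens \<theta> \<pi> T (is @ [s, t]) x)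
    = tens \<theta> \<pi> (\<lambda>as y. \<Sum>a\<in>UNIV. \<Sum>b\<in>UNIV. gi a b y * T (as @ [a, b]) y) is x"
proof -
  let ?Y = "\<lambda>a b. tens \<theta> \<pi> (\<lambda>as. T (as @ [a, b])) is x"
  have "tens \<theta> \<pi> T (is @ [s, t]) x = (\<Sum>b\<in>UNIV. \<theta> b t x * (\<Sum>a\<in>UNIV. \<theta> a s x * ?Y a b))" for s t
    using tens_snoc[of \<theta> \<pi> T "is @ [s]" t x] by (simp add: tens_snoc)
  then have outer: "tens \<theta> \<pi> T (is @ [s, t]) x = (\<Sum>a\<in>UNIV. \<theta> a s x * (\<Sum>b\<in>UNIV. \<theta> b t x * ?Y a b))" for s t
    by (simp add: sum_distrib_left mult.left_commute) (subst sum.swap, simp add: mult.left_commute)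
  have "(\<Sum>s\<in>UNIV. \<Sum>t\<in>UNIV. ginv g x $ s $ t * tens \<theta> \<pi> T (is @ [s, t]) x)
    = (\<Sum>s\<in>UNIV. \<Sum>t\<in>UNIV. \<Sum>a\<in>UNIV. \<Sum>b\<in>UNIV. ginv g x $ s $ t * (\<theta> a s x * \<theta> b t x) * ?Y a b)"
    by (simp only: outer sum_distrib_left mult_ac)
  also have "\<dots> = (\<Sum>a\<in>UNIV. \<Sum>b\<in>UNIV. \<Sum>s\<in>UNIV. \<Sum>t\<in>UNIV. ginv g x $ s $ t * (\<theta> a s x * \<theta> b t x) * ?Y a b)"
    by (rule sum_rotate4)
  also have "\<dots> = (\<Sum>a\<in>UNIV. \<Sum>b\<in>UNIV. gi a b (\<pi> x) * ?Y a b)"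
    by (simp only: sum_distrib_right[symmetric] ginv_frame[OF x])
  also have "\<dots> = tens \<theta> \<pi> (\<lambda>as y. \<Sum>a\<in>UNIV. \<Sum>b\<in>UNIV. gi a b y * T (as @ [a, b]) y) is x"
    by (simp only: tens_sum tens_scale)
  finally show ?thesis .
qed

abbreviation "Rf \<equiv> frame_riemann D gf \<gamma>"
abbreviation "Ricf \<equiv> frame_ricci D gf gi \<gamma>"
abbreviation "Sf \<equiv> frame_scalar D gf gi \<gamma>"
abbreviation "Wf \<equiv> frame_weyl D gf gi \<gamma>"

lemma metric_tens: "x \<in> U \<Longrightarrow> g x $ i $ j = tens \<theta> \<pi> (\<lambda>as. gf (as ! 0) (as ! 1)) [i, j] x"
  unfolding tens2 by (simp add: g_frame mult_ac)

lemma riemann_tens: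
  assumes x: "x \<in> U"
  shows "riemann g s i j t x = tens \<theta> \<pi> (\<lambda>as. Rf (as ! 0) (as ! 1) (as ! 2) (as ! 3)) [s, i, j, t] x"
proof -
  let ?R = "\<lambda>d c a b. frame_riemann_up D \<gamma> d c a b (\<pi> x)"
  have "riemann g s i j t x = (\<Sum>l\<in>UNIV. \<Sum>p\<in>UNIV. \<Sum>q\<in>UNIV. gf p q (\<pi> x) * (\<theta> p t x * (\<theta> q l x * riemann_up g l j s i x)))"
    by (simp add: riemann_def g_frame[OF x] sum_distrib_right sum_distrib_left mult_ac)
  also have "\<dots> = (\<Sum>p\<in>UNIV. \<Sum>q\<in>UNIV. \<Sum>l\<in>UNIV. gf p q (\<pi> x) * (\<theta> p t x * (\<theta> q l x * riemann_up g l j s i x)))"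
    by (rule sum_rotate3)
  also have "\<dots> = (\<Sum>p\<in>UNIV. \<Sum>q\<in>UNIV. \<Sum>a\<in>UNIV. \<Sum>b\<in>UNIV. \<Sum>c\<in>UNIV.
      gf p q (\<pi> x) * (\<theta> p t x * (\<theta> a s x * (\<theta> b i x * (\<theta> c j x * ?R q c a b)))))"
    by (simp only: sum_distrib_left[symmetric] riemann_up_frame[OF x])
  also have "\<dots> = (\<Sum>p\<in>UNIV. \<Sum>a\<in>UNIV. \<Sum>b\<in>UNIV. \<Sum>c\<in>UNIV. \<Sum>q\<in>UNIV.
      gf p q (\<pi> x) * (\<theta> p t x * (\<theta> a s x * (\<theta> b i x * (\<theta> c j x * ?R q c a b)))))"
  proof (rule sum.cong[OF refl])
    fix p
    let ?X = "\<lambda>q a b c. gf p q (\<pi> x) * (\<theta> p t x * (\<theta> a s x * (\<theta> b i x * (\<theta> c j x * ?R q c a b))))"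
    have "(\<Sum>q\<in>UNIV. \<Sum>a\<in>UNIV. \<Sum>b\<in>UNIV. \<Sum>c\<in>UNIV. ?X q a b c)
        = (\<Sum>a\<in>UNIV. \<Sum>q\<in>UNIV. \<Sum>b\<in>UNIV. \<Sum>c\<in>UNIV. ?X q a b c)" by (rule sum.swap)
    also have "\<dots> = (\<Sum>a\<in>UNIV. \<Sum>b\<in>UNIV. \<Sum>c\<in>UNIV. \<Sum>q\<in>UNIV. ?X q a b c)"
      by (intro sum.cong refl sum_rotate3)
    finally show "(\<Sum>q\<in>UNIV. \<Sum>a\<in>UNIV. \<Sum>b\<in>UNIV. \<Sum>c\<in>UNIV. ?X q a b c)
        = (\<Sum>a\<in>UNIV. \<Sum>b\<in>UNIV. \<Sum>c\<in>UNIV. \<Sum>q\<in>UNIV. ?X q a b c)" .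
  qed
  also have "\<dots> = (\<Sum>p\<in>UNIV. \<Sum>a\<in>UNIV. \<Sum>b\<in>UNIV. \<Sum>c\<in>UNIV.
      \<theta> a s x * (\<theta> b i x * (\<theta> c j x * (\<theta> p t x * Rf a b c p (\<pi> x)))))"
    by (simp add: frame_riemann_def sum_distrib_left mult_ac)
  also have "\<dots> = (\<Sum>a\<in>UNIV. \<Sum>p\<in>UNIV. \<Sum>b\<in>UNIV. \<Sum>c\<in>UNIV.
      \<theta> a s x * (\<theta> b i x * (\<theta> c j x * (\<theta> p t x * Rf a b c p (\<pi> x)))))"
    by (rule sum.swap)
  also have "\<dots> = (\<Sum>a\<in>UNIV. \<Sum>b\<in>UNIV. \<Sum>c\<in>UNIV. \<Sum>p\<in>UNIV.
      \<theta> a s x * (\<theta> b i x * (\<theta> c j x * (\<theta> p t x * Rf a b c p (\<pi> x)))))"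
    by (intro sum.cong refl sum_rotate3)
  also have "\<dots> = tens \<theta> \<pi> (\<lambda>as. Rf (as ! 0) (as ! 1) (as ! 2) (as ! 3)) [s, i, j, t] x"
    unfolding tens4 by (simp add: numeral_eq_Suc)
  finally show ?thesis .
qed

lemma ricci_tens:
  assumes x: "x \<in> U"
  shows "ricci g i j x = tens \<theta> \<pi> (\<lambda>as. Ricf (as ! 0) (as ! 1)) [i, j] x"
proof -
  have "ricci g i j x = (\<Sum>s\<in>UNIV. \<Sum>t\<in>UNIV. ginv g x $ s $ t *
      tens \<theta> \<pi> (\<lambda>as. Rf (as ! 0) (as ! 1) (as ! 2) (as ! 3)) (s # [i, j] @ [t]) x)"
    by (simp only: ricci_def riemann_tens[OF x] append_Cons append_Nil)
  also have "\<dots> = tens \<theta> \<pi> (\<lambda>as. Ricf (as ! 0) (as ! 1)) [i, j] x"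
    unfolding contract_outer[OF x]
    by (intro tens_cong) (auto simp: frame_ricci_def nth_append numeral_eq_Suc)
  finally show ?thesis .
qed

lemma scalar_frame:
  assumes x: "x \<in> U" shows "scalar_curv g x = Sf (\<pi> x)"
proof -
  have "scalar_curv g x = (\<Sum>s\<in>UNIV. \<Sum>t\<in>UNIV. ginv g x $ s $ t *
      tens \<theta> \<pi> (\<lambda>as. Ricf (as ! 0) (as ! 1)) (s # [] @ [t]) x)"
    by (simp only: scalar_curv_def ricci_tens[OF x] append_Nil)
  also have "\<dots> = Sf (\<pi> x)"
    unfolding contract_outer[OF x] by (simp add: frame_scalar_def)
  finally show ?thesis .
qed

lemma weyl_tens4:
  assumes x: "x \<in> U"
  shows "weyl g s i j t x = tens \<theta> \<pi> (\<lambda>as. Wf (as ! 0) (as ! 1) (as ! 2) (as ! 3)) [s, i, j, t] x"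
proof -
  let ?G = "\<lambda>as. gf (as ! 0) (as ! 1)" and ?Ric = "\<lambda>as. Ricf (as ! 0) (as ! 1)"
  let ?t = "\<lambda>P. tens \<theta> \<pi> P [s, i, j, t] x"
  note g = metric_tens[OF x] and r = ricci_tens[OF x]
  have p: "g x $ s $ t * ricci g i j x = ?t (\<lambda>as y. gf (as ! 0) (as ! 3) y * Ricf (as ! 1) (as ! 2) y)"
    "ricci g s t x * g x $ i $ j = ?t (\<lambda>as y. Ricf (as ! 0) (as ! 3) y * gf (as ! 1) (as ! 2) y)"
    "g x $ s $ t * g x $ i $ j = ?t (\<lambda>as y. gf (as ! 0) (as ! 3) y * gf (as ! 1) (as ! 2) y)"
    using tens_product_outer_inner[of ?G s t x ?Ric i j] tens_product_outer_inner[of ?Ric s t x ?G i j]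
      tens_product_outer_inner[of ?G s t x ?G i j]
    by (simp_all only: g r nth_Cons_0 nth_Cons_Suc One_nat_def)
  have c: "g x $ s $ j * ricci g i t x = ?t (\<lambda>as y. gf (as ! 0) (as ! 2) y * Ricf (as ! 1) (as ! 3) y)"
    "ricci g s j x * g x $ i $ t = ?t (\<lambda>as y. Ricf (as ! 0) (as ! 2) y * gf (as ! 1) (as ! 3) y)"
    "g x $ s $ j * g x $ i $ t = ?t (\<lambda>as y. gf (as ! 0) (as ! 2) y * gf (as ! 1) (as ! 3) y)"
    using tens_product_crossed[of ?G s j x ?Ric i t] tens_product_crossed[of ?Ric s j x ?G i t]
      tens_product_crossed[of ?G s j x ?G i t]
    by (simp_all only: g r nth_Cons_0 nth_Cons_Suc One_nat_def)
  have half: "?t P / c = ?t (\<lambda>as y. (1 / c) * P as y)" for P and c :: real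
    using tens_scale[of \<theta> \<pi> "\<lambda>y. 1 / c" P "[s, i, j, t]" x] by simp
  have sc: "scalar_curv g x * ?t P = ?t (\<lambda>as y. Sf y * P as y)" for P
    by (simp only: scalar_frame[OF x] tens_scale)
  show ?thesis
    unfolding weyl_def mult.commute[of "g x $ i $ j" "ricci g s t x"] mult.commute[of "g x $ i $ t" "ricci g s j x"]
      p c riemann_tens[OF x]
    unfolding tens_diff[symmetric] tens_add[symmetric] sc half
    unfolding tens_diff[symmetric] tens_add[symmetric]
    by (intro tens_cong) (simp add: frame_weyl_def field_simps)
qed

lemma length4: "length as = 4 \<longleftrightarrow> (\<exists>a b c d. as = [a, b, c, d])"
  by (auto simp: numeral_eq_Suc length_Suc_conv)

lemma length3: "length as = 3 \<longleftrightarrow> (\<exists>a b c. as = [a, b, c])"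
  by (auto simp: numeral_eq_Suc length_Suc_conv)

lemma length2: "length as = 2 \<longleftrightarrow> (\<exists>a b. as = [a, b])"
  by (auto simp: numeral_eq_Suc length_Suc_conv)

text \<open>
  The frame components of the Weyl tensor, of its divergence and, below, of the Bach tensor, indexed
  by lists as arguments of \<open>tens\<close>.
\<close>

definition weyl_comp :: "4 list \<Rightarrow> 'b \<Rightarrow> real" where "weyl_comp as = Wf (as ! 0) (as ! 1) (as ! 2) (as ! 3)"

lemma weyl_tensor_tens:
  assumes "x \<in> U" "length ks = 4" shows "weyl_tensor g ks x = tens \<theta> \<pi> weyl_comp ks x"
  using assms weyl_tens4 unfolding length4 weyl_tensor_def weyl_comp_def[abs_def]
  by (auto simp: numeral_eq_Suc)

lemma Rf_smooth: "smooth_on V (Rf a b c d)"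
  unfolding frame_riemann_def[abs_def] frame_riemann_up_def
  by (intro smooth_intros V gf_smooth \<gamma>_smooth D_smooth)

lemma Ricf_smooth: "smooth_on V (Ricf a b)"
  unfolding frame_ricci_def[abs_def] by (intro smooth_intros V gi_smooth Rf_smooth)

lemma Sf_smooth: "smooth_on V Sf"
  unfolding frame_scalar_def[abs_def] by (intro smooth_intros V gi_smooth Ricf_smooth)

lemma weyl_comp_smooth: "smooth_on V (weyl_comp as)"
  unfolding weyl_comp_def frame_weyl_def[abs_def]
  by (intro smooth_intros V gf_smooth Rf_smooth Ricf_smooth Sf_smooth) auto

lemma cov_smooth: "(\<And>as. smooth_on V (T as)) \<Longrightarrow> smooth_on V (frame_cov D \<gamma> c T as)"
  unfolding frame_cov_def[abs_def] by (intro smooth_intros V \<gamma>_smooth D_smooth)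

definition div_comp :: "4 list \<Rightarrow> 'b \<Rightarrow> real" where "div_comp = frame_div D gi \<gamma> weyl_comp"

lemma div_comp_smooth: "smooth_on V (div_comp as)"
  unfolding div_comp_def frame_div_def[abs_def] by (intro smooth_intros V gi_smooth cov_smooth weyl_comp_smooth)

lemma weyl_div_tens:
  assumes x: "x \<in> U" and l: "length is = 3"
  shows "weyl_div g is x = tens \<theta> \<pi> div_comp is x"
proof -
  let ?C = "\<lambda>as y. frame_cov D \<gamma> (last as) weyl_comp (butlast as) y"
  have "cov_deriv g (weyl_tensor g) (s # is @ [t]) x = tens \<theta> \<pi> ?C (s # is @ [t]) x" for s t
  proof -
    have "cov_deriv g (weyl_tensor g) ((s # is) @ [t]) x
        = (\<Sum>c\<in>UNIV. \<theta> c t x * tens \<theta> \<pi> (frame_cov D \<gamma> c weyl_comp) (s # is) x)"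
      by (rule cov_deriv_tens[OF x]) (use l weyl_comp_smooth weyl_tensor_tens in auto)
    also have "\<dots> = tens \<theta> \<pi> ?C ((s # is) @ [t]) x" unfolding tens_snoc by simp
    finally show ?thesis by simp
  qed
  then have "weyl_div g is x = tens \<theta> \<pi> (\<lambda>as y. \<Sum>a\<in>UNIV. \<Sum>b\<in>UNIV. gi a b y * ?C (a # as @ [b]) y) is x"
    unfolding weyl_div_def by (simp only: contract_outer[OF x])
  also have "\<dots> = tens \<theta> \<pi> div_comp is x"
  proof (rule tens_cong)
    fix as :: "4 list" assume "length as = length is"
    then have "as \<noteq> []" using l by auto
    then show "(\<Sum>a\<in>UNIV. \<Sum>b\<in>UNIV. gi a b (\<pi> x) * ?C (a # as @ [b]) (\<pi> x)) = div_comp as (\<pi> x)"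
      by (simp add: div_comp_def frame_div_def butlast_append)
  qed
  finally show ?thesis .
qed

definition bach_comp :: "4 list \<Rightarrow> 'b \<Rightarrow> real" where
  "bach_comp as y = (\<Sum>t\<in>UNIV. \<Sum>b\<in>UNIV. gi t b y * frame_cov D \<gamma> b div_comp (as @ [t]) y)
     + (\<Sum>s\<in>UNIV. \<Sum>t\<in>UNIV. \<Sum>a\<in>UNIV. \<Sum>b\<in>UNIV.
          gi s a y * gi t b y * (weyl_comp (s # as @ [t]) y * Ricf a b y)) / 2"

lemma raise_coframe:
  assumes x: "x \<in> U"
  shows "(\<Sum>s\<in>UNIV. ginv g x $ s $ a * \<theta> p s x) = (\<Sum>c\<in>UNIV. gi p c (\<pi> x) * e c a x)"
    proof -
      have "ginv g x ** transpose (\<Theta> x) = E x ** (\<chi> a b. gi a b (\<pi> x)) ** transpose (\<Theta> x ** E x)"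
        by (simp add: ginv_matrix[OF x] matrix_transpose_mul matrix_mul_assoc)
      then have "(ginv g x ** transpose (\<Theta> x)) $ a $ p = (E x ** (\<chi> a b. gi a b (\<pi> x))) $ a $ p"
        by (simp add: \<Theta>_E[OF x])
      moreover have "gi p c (\<pi> x) = gi c p (\<pi> x)" for c
        using ginv_frame[OF x, of p c] ginv_frame[OF x, of c p]
        by (subst (asm) (2) sum.swap) (simp add: ginv_sym[OF x, of _ _] mult_ac)
      ultimately show ?thesis
        by (simp add: matrix_mult_nth transpose_def \<Theta>_def E_def ginv_sym[OF x, of _ a] mult_ac)
    qed

lemma bach_tens:
  assumes x: "x \<in> U" shows "bach g i j x = tens \<theta> \<pi> bach_comp [i, j] x"
proof -
  let ?h = "\<lambda>s a. ginv g x $ s $ a"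
  have "cov_deriv g (weyl_div g) [i, j, t, b] x
      = tens \<theta> \<pi> (\<lambda>as. frame_cov D \<gamma> (last as) div_comp (butlast as)) ([i, j] @ [t, b]) x" for t b
  proof -
    have "cov_deriv g (weyl_div g) ([i, j, t] @ [b]) x
        = (\<Sum>c\<in>UNIV. \<theta> c b x * tens \<theta> \<pi> (frame_cov D \<gamma> c div_comp) [i, j, t] x)"
      by (rule cov_deriv_tens[OF x]) (use div_comp_smooth weyl_div_tens in auto)
    also have "\<dots> = tens \<theta> \<pi> (\<lambda>as. frame_cov D \<gamma> (last as) div_comp (butlast as)) ([i, j, t] @ [b]) x"
      unfolding tens_snoc by simp
    finally show ?thesis by simp
  qed
  then have 1: "(\<Sum>t\<in>UNIV. \<Sum>b\<in>UNIV. ?h t b * cov_deriv g (weyl_div g) [i, j, t, b] x)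
    = tens \<theta> \<pi> (\<lambda>as y. \<Sum>t\<in>UNIV. \<Sum>b\<in>UNIV. gi t b y * frame_cov D \<gamma> b div_comp (as @ [t]) y) [i, j] x"
    by (simp only: contract_last[OF x]) (simp add: butlast_append)
  have 2: "(\<Sum>s\<in>UNIV. \<Sum>t\<in>UNIV. \<Sum>a\<in>UNIV. \<Sum>b\<in>UNIV. ?h s a * ?h t b * (weyl g s i j t x * ricci g a b x))
    = tens \<theta> \<pi> (\<lambda>as y. \<Sum>s\<in>UNIV. \<Sum>t\<in>UNIV. \<Sum>a\<in>UNIV. \<Sum>b\<in>UNIV.
          gi s a y * gi t b y * (weyl_comp (s # as @ [t]) y * Ricf a b y)) [i, j] x"
  proof -
    define R where "R s t = (\<Sum>a\<in>UNIV. \<Sum>b\<in>UNIV. ?h s a * ?h t b * ricci g a b x)" for s t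
    have W: "weyl g s i j t x = (\<Sum>p\<in>UNIV. \<Sum>q\<in>UNIV. \<theta> p s x * \<theta> q t x * tens \<theta> \<pi> (\<lambda>as. weyl_comp (p # as @ [q])) [i, j] x)" for s t
    proof -
      have "weyl g s i j t x = weyl_tensor g (s # [i, j] @ [t]) x"
        by (simp add: weyl_tensor_def numeral_eq_Suc)
      also have "\<dots> = tens \<theta> \<pi> weyl_comp (s # [i, j] @ [t]) x"
        by (rule weyl_tensor_tens[OF x]) simp
      finally show ?thesis unfolding tens_outer by (simp only: sum_distrib_left mult_ac)
    qed
    have R': "(\<Sum>s\<in>UNIV. \<Sum>t\<in>UNIV. \<theta> p s x * \<theta> q t x * R s t)
        = (\<Sum>c\<in>UNIV. \<Sum>d\<in>UNIV. gi p c (\<pi> x) * gi q d (\<pi> x) * Ricf c d (\<pi> x))" for p q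
    proof -
      have "(\<Sum>s\<in>UNIV. \<Sum>t\<in>UNIV. \<theta> p s x * \<theta> q t x * R s t)
        = (\<Sum>s\<in>UNIV. \<Sum>t\<in>UNIV. \<Sum>a\<in>UNIV. \<Sum>b\<in>UNIV. \<theta> p s x * \<theta> q t x * (?h s a * ?h t b * ricci g a b x))"
        by (simp only: R_def sum_distrib_left)
      also have "\<dots> = (\<Sum>a\<in>UNIV. \<Sum>b\<in>UNIV. \<Sum>s\<in>UNIV. \<Sum>t\<in>UNIV. \<theta> p s x * \<theta> q t x * (?h s a * ?h t b * ricci g a b x))"
        by (rule sum_rotate4)
      also have "\<dots> = (\<Sum>a\<in>UNIV. \<Sum>b\<in>UNIV. (\<Sum>s\<in>UNIV. ?h s a * \<theta> p s x) * (\<Sum>t\<in>UNIV. ?h t b * \<theta> q t x) * ricci g a b x)"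
        by (intro sum.cong refl, subst sum_product) (simp only: sum_distrib_right sum_distrib_left mult_ac)
      also have "\<dots> = (\<Sum>a\<in>UNIV. \<Sum>b\<in>UNIV. \<Sum>c\<in>UNIV. \<Sum>d\<in>UNIV.
          gi p c (\<pi> x) * gi q d (\<pi> x) * (e c a x * (e d b x * ricci g a b x)))"
        unfolding raise_coframe[OF x] sum_product by (simp only: sum_distrib_right sum_distrib_left mult_ac)
      also have "\<dots> = (\<Sum>c\<in>UNIV. \<Sum>d\<in>UNIV. \<Sum>a\<in>UNIV. \<Sum>b\<in>UNIV.
          gi p c (\<pi> x) * gi q d (\<pi> x) * (e c a x * (e d b x * ricci g a b x)))"
        by (rule sum_rotate4)
      also have "\<dots> = (\<Sum>c\<in>UNIV. \<Sum>d\<in>UNIV. gi p c (\<pi> x) * gi q d (\<pi> x) * Ricf c d (\<pi> x))"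
      proof (intro sum.cong refl)
        fix c d
        have "(\<Sum>a\<in>UNIV. \<Sum>b\<in>UNIV. e c a x * (e d b x * ricci g a b x)) = Ricf c d (\<pi> x)"
        proof -
          have "(\<Sum>a\<in>UNIV. \<Sum>b\<in>UNIV. e c a x * (e d b x * ricci g a b x))
            = (\<Sum>b\<in>UNIV. e d b x * (\<Sum>a\<in>UNIV. e c a x * tens \<theta> \<pi> (\<lambda>as. Ricf (as ! 0) (as ! 1)) (a # [b]) x))"
            by (subst sum.swap) (simp only: ricci_tens[OF x] sum_distrib_left mult_ac)
          also have "\<dots> = Ricf c d (\<pi> x)" unfolding tens_eval[OF x] by simp
          finally show ?thesis .
        qed
        then show "(\<Sum>a\<in>UNIV. \<Sum>b\<in>UNIV. gi p c (\<pi> x) * gi q d (\<pi> x) * (e c a x * (e d b x * ricci g a b x)))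
          = gi p c (\<pi> x) * gi q d (\<pi> x) * Ricf c d (\<pi> x)"
          by (simp only: sum_distrib_left[symmetric])
      qed
      finally show ?thesis .
    qed
    have "(\<Sum>s\<in>UNIV. \<Sum>t\<in>UNIV. \<Sum>a\<in>UNIV. \<Sum>b\<in>UNIV. ?h s a * ?h t b * (weyl g s i j t x * ricci g a b x))
      = (\<Sum>s\<in>UNIV. \<Sum>t\<in>UNIV. weyl g s i j t x * R s t)"
      by (simp only: R_def sum_distrib_left mult_ac)
    also have "\<dots> = (\<Sum>s\<in>UNIV. \<Sum>t\<in>UNIV. \<Sum>p\<in>UNIV. \<Sum>q\<in>UNIV.
        (\<theta> p s x * \<theta> q t x * R s t) * tens \<theta> \<pi> (\<lambda>as. weyl_comp (p # as @ [q])) [i, j] x)"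
      unfolding W by (simp only: sum_distrib_right sum_distrib_left mult_ac)
    also have "\<dots> = (\<Sum>p\<in>UNIV. \<Sum>q\<in>UNIV. \<Sum>s\<in>UNIV. \<Sum>t\<in>UNIV.
        (\<theta> p s x * \<theta> q t x * R s t) * tens \<theta> \<pi> (\<lambda>as. weyl_comp (p # as @ [q])) [i, j] x)"
      by (rule sum_rotate4)
    also have "\<dots> = (\<Sum>p\<in>UNIV. \<Sum>q\<in>UNIV. (\<Sum>c\<in>UNIV. \<Sum>d\<in>UNIV. gi p c (\<pi> x) * gi q d (\<pi> x) * Ricf c d (\<pi> x))
        * tens \<theta> \<pi> (\<lambda>as. weyl_comp (p # as @ [q])) [i, j] x)"
      by (simp only: sum_distrib_right[symmetric] R')
    also have "\<dots> = tens \<theta> \<pi> (\<lambda>as y. \<Sum>p\<in>UNIV. \<Sum>q\<in>UNIV. (\<Sum>c\<in>UNIV. \<Sum>d\<in>UNIV. gi p c y * gi q d y * Ricf c d y)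
        * weyl_comp (p # as @ [q]) y) [i, j] x"
      by (simp only: tens_sum tens_scale)
    also have "\<dots> = tens \<theta> \<pi> (\<lambda>as y. \<Sum>s\<in>UNIV. \<Sum>t\<in>UNIV. \<Sum>a\<in>UNIV. \<Sum>b\<in>UNIV.
          gi s a y * gi t b y * (weyl_comp (s # as @ [t]) y * Ricf a b y)) [i, j] x"
      by (simp only: sum_distrib_right sum_distrib_left mult_ac)
    finally show ?thesis .
  qed
  have half: "tens \<theta> \<pi> P [i, j] x / 2 = tens \<theta> \<pi> (\<lambda>as y. (1 / 2) * P as y) [i, j] x" for P
    using tens_scale[of \<theta> \<pi> "\<lambda>y. 1 / 2" P "[i, j]" x] by simp
  show ?thesis
    unfolding bach_div[OF x] 1 2 half tens_add[symmetric] by (simp add: bach_comp_def[abs_def])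
qed

lemma bach_zero_iff:
  assumes x: "x \<in> U" shows "(\<forall>i j. bach g i j x = 0) \<longleftrightarrow> (\<forall>a b. bach_comp [a, b] (\<pi> x) = 0)"
  using tens_zero_iff[OF x, of 2 bach_comp] unfolding bach_tens[OF x] length2 by auto

lemma tensor_inner_tens:
  assumes x: "x \<in> U"
  shows "inner_of g n (tens \<theta> \<pi> T) (tens \<theta> \<pi> T') x = tensor_inner gi n T T' (\<pi> x)"
proof (induction n arbitrary: T T')
  case 0 show ?case by simp
next
  case (Suc n)
  let ?I = "\<lambda>a b. tensor_inner gi n (\<lambda>as. T (a # as)) (\<lambda>as. T' (b # as)) (\<pi> x)"
  have t: "(\<lambda>is. tens \<theta> \<pi> S (s # is)) = (\<lambda>is y. \<Sum>a\<in>UNIV. \<theta> a s y * tens \<theta> \<pi> (\<lambda>as. S (a # as)) is y)" for S :: "4 list \<Rightarrow> 'b \<Rightarrow> real" and s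
    by (simp add: fun_eq_iff)
  have "inner_of g (Suc n) (tens \<theta> \<pi> T) (tens \<theta> \<pi> T') x
    = (\<Sum>s\<in>UNIV. \<Sum>t\<in>UNIV. \<Sum>a\<in>UNIV. \<Sum>b\<in>UNIV. ginv g x $ s $ t * (\<theta> a s x * \<theta> b t x) * ?I a b)"
    unfolding tensor_inner.simps t tensor_inner_sum_left tensor_inner_sum_right Suc.IH
    by (simp only: sum_distrib_left mult_ac)
  also have "\<dots> = (\<Sum>a\<in>UNIV. \<Sum>b\<in>UNIV. \<Sum>s\<in>UNIV. \<Sum>t\<in>UNIV. ginv g x $ s $ t * (\<theta> a s x * \<theta> b t x) * ?I a b)"
    by (rule sum_rotate4)
  also have "\<dots> = tensor_inner gi (Suc n) T T' (\<pi> x)"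
    by (simp only: sum_distrib_right[symmetric] ginv_frame[OF x] tensor_inner.simps)
  finally show ?case .
qed

lemma gradient_inner_frame:
  assumes x: "x \<in> U" and f: "smooth_on V f"
  shows "inner_of g 1 (\<lambda>is. pd (hd is) (\<lambda>x. f (\<pi> x))) (\<lambda>is. pd (hd is) (\<lambda>x. f (\<pi> x))) x
    = tensor_inner gi 1 (\<lambda>as. D (hd as) f) (\<lambda>as. D (hd as) f) (\<pi> x)"
proof -
  have "pd (hd is) (\<lambda>x. f (\<pi> x)) x = tens \<theta> \<pi> (\<lambda>as. D (hd as) f) is x" if "length is = 1" for "is"
    using that pd_base[OF f x] by (auto simp: length_Suc_conv)
  then show ?thesis
    unfolding tensor_inner_tens[OF x, symmetric] by (intro tensor_inner_cong) auto
qed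

lemma weyl_div_inner_frame:
  assumes x: "x \<in> U"
  shows "inner_of g 3 (weyl_div g) (weyl_div g) x = tensor_inner gi 3 div_comp div_comp (\<pi> x)"
  unfolding tensor_inner_tens[OF x, symmetric] by (intro tensor_inner_cong weyl_div_tens[OF x])

text \<open>The endomorphisms in the coordinate basis and in the frame are conjugate by the tensor square of the coframe, so they have equal traces.\<close>

lemma weyl_op_frame:
  assumes x: "x \<in> U"
  obtains S T where "T ** S = mat 1" "weyl_op g x = S ** raise2 gi Wf (\<pi> x) ** T"
proof -
  define S :: "real^(4 \<times> 4)^(4 \<times> 4)" where "S = (\<chi> p q. \<theta> (fst q) (fst p) x * \<theta> (snd q) (snd p) x)"
  define T :: "real^(4 \<times> 4)^(4 \<times> 4)" where "T = (\<chi> p q. e (fst p) (fst q) x * e (snd p) (snd q) x)"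
  have pr: "(\<Sum>p\<in>(UNIV :: (4 \<times> 4) set). X p) = (\<Sum>a\<in>UNIV. \<Sum>b\<in>UNIV. X (a, b))" for X :: "4 \<times> 4 \<Rightarrow> real"
    by (simp add: sum.cartesian_product)
  have "(\<Sum>a\<in>UNIV. \<Sum>b\<in>UNIV. e c a x * e d b x * (\<theta> p a x * \<theta> q b x)) = (if p = c then 1 else 0) * (if q = d then 1 else 0)" for c d p q
    unfolding E_dual[OF x, symmetric] sum_product by (simp only: mult_ac)
  then have 1: "T ** S = mat 1"
    by (simp add: vec_eq_iff matrix_mult_nth S_def T_def pr mat_def prod_eq_iff)
  have "weyl_op g x $ (i, j) $ (k, l) = (S ** raise2 gi Wf (\<pi> x) ** T) $ (i, j) $ (k, l)" for i j k l
  proof -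
    let ?w = "\<lambda>a b c d. Wf a b c d (\<pi> x)"
    have "weyl_op g x $ (i, j) $ (k, l) = (\<Sum>t\<in>UNIV. \<Sum>u\<in>UNIV. \<Sum>a\<in>UNIV. \<Sum>b\<in>UNIV. \<Sum>c\<in>UNIV. \<Sum>d\<in>UNIV.
        (\<theta> a i x * \<theta> b j x) * (?w a b c d * ((ginv g x $ t $ k * \<theta> c t x) * (ginv g x $ u $ l * \<theta> d u x))))"
      unfolding raise2_def weyl_tens4[OF x] tens4
      by (simp add: sum_distrib_right sum_distrib_left mult_ac numeral_eq_Suc)
    also have "\<dots> = (\<Sum>a\<in>UNIV. \<Sum>b\<in>UNIV. \<Sum>c\<in>UNIV. \<Sum>d\<in>UNIV. \<Sum>t\<in>UNIV. \<Sum>u\<in>UNIV.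
        (\<theta> a i x * \<theta> b j x) * (?w a b c d * ((ginv g x $ t $ k * \<theta> c t x) * (ginv g x $ u $ l * \<theta> d u x))))"
      by (subst sum_rotate4) (intro sum.cong refl sum_rotate4)
    also have "\<dots> = (\<Sum>a\<in>UNIV. \<Sum>b\<in>UNIV. \<Sum>c\<in>UNIV. \<Sum>d\<in>UNIV.
        (\<theta> a i x * \<theta> b j x) * (?w a b c d * ((\<Sum>p\<in>UNIV. gi c p (\<pi> x) * e p k x) * (\<Sum>q\<in>UNIV. gi d q (\<pi> x) * e q l x))))"
      by (simp only: sum_distrib_left[symmetric] sum_distrib_right[symmetric] raise_coframe[OF x])
    also have "\<dots> = (\<Sum>a\<in>UNIV. \<Sum>b\<in>UNIV. \<Sum>c\<in>UNIV. \<Sum>d\<in>UNIV. \<Sum>p\<in>UNIV. \<Sum>q\<in>UNIV.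
        (\<theta> a i x * \<theta> b j x) * (?w a b c d * (gi c p (\<pi> x) * gi d q (\<pi> x))) * (e p k x * e q l x))"
      by (intro sum.cong refl, subst sum_product) (simp only: sum_distrib_left mult_ac)
    also have "\<dots> = (\<Sum>a\<in>UNIV. \<Sum>b\<in>UNIV. \<Sum>p\<in>UNIV. \<Sum>q\<in>UNIV. \<Sum>c\<in>UNIV. \<Sum>d\<in>UNIV.
        (\<theta> a i x * \<theta> b j x) * (?w a b c d * (gi c p (\<pi> x) * gi d q (\<pi> x))) * (e p k x * e q l x))"
      by (intro sum.cong refl sum_rotate4)
    also have "\<dots> = (\<Sum>p\<in>UNIV. \<Sum>q\<in>UNIV. \<Sum>a\<in>UNIV. \<Sum>b\<in>UNIV. \<Sum>c\<in>UNIV. \<Sum>d\<in>UNIV.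
        (\<theta> a i x * \<theta> b j x) * (?w a b c d * (gi c p (\<pi> x) * gi d q (\<pi> x))) * (e p k x * e q l x))"
      by (rule sum_rotate4)
    also have "\<dots> = (S ** raise2 gi Wf (\<pi> x) ** T) $ (i, j) $ (k, l)"
      by (simp add: matrix_mult_nth S_def T_def pr raise2_def sum_distrib_left sum_distrib_right)
    finally show ?thesis .
  qed
  then have 2: "weyl_op g x = S ** raise2 gi Wf (\<pi> x) ** T"
    by (auto simp: vec_eq_iff)
  from 1 2 show ?thesis by (rule that)
qed

lemma trace_weyl_op_frame:
  assumes x: "x \<in> U"
  shows "trace (weyl_op g x ** weyl_op g x) = trace (raise2 gi Wf (\<pi> x) ** raise2 gi Wf (\<pi> x))" (is ?A)
    and "trace (weyl_op g x ** weyl_op g x ** weyl_op g x)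
      = trace (raise2 gi Wf (\<pi> x) ** raise2 gi Wf (\<pi> x) ** raise2 gi Wf (\<pi> x))" (is ?B)
proof -
  let ?M = "raise2 gi Wf (\<pi> x)"
  obtain S T where ST: "T ** S = mat 1" and W: "weyl_op g x = S ** ?M ** T"
    using weyl_op_frame[OF x] by blast
  have TSM: "T ** (S ** M) = M" for M :: "real^(4 \<times> 4)^(4 \<times> 4)" by (simp add: matrix_mul_assoc ST)
  have 2: "weyl_op g x ** weyl_op g x = S ** (?M ** ?M) ** T"
    by (simp only: W matrix_mul_assoc[symmetric] TSM)
  have 3: "weyl_op g x ** weyl_op g x ** weyl_op g x = S ** (?M ** ?M ** ?M) ** T"
    by (simp only: W matrix_mul_assoc[symmetric] TSM)
  show ?A unfolding 2 by (rule trace_conjugate[OF ST])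
  show ?B unfolding 3 by (rule trace_conjugate[OF ST])
qed

end

section \<open>The frame of the \<open>U(2)\<close>-invariant metrics\<close>

lemma zcoord_alt: "x \<noteq> 0 \<Longrightarrow> zcoord x = (1/2) * ln (x \<bullet> x)"
  by (simp add: zcoord_def norm_eq_sqrt_inner ln_sqrt)

lemma smooth_on_coord: "open U \<Longrightarrow> smooth_on U (\<lambda>x::real^4. x $ i)"
  by (rule smooth_on_bounded_linear[OF _ bounded_linear_vec_nth])

lemma smooth_on_sqnorm: "open U \<Longrightarrow> smooth_on U (\<lambda>x::real^4. x \<bullet> x)"
  unfolding inner4 by (intro smooth_intros smooth_on_coord)

lemma open_cyl: assumes "open I" shows "open (cyl I)"
proof -
  have "continuous_on (- {0}) zcoord"
    unfolding zcoord_def[abs_def] by (intro continuous_intros) auto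
  then have "open (zcoord -` I \<inter> - {0})"
    using assms continuous_on_open_vimage[of "- {0}" zcoord] by auto
  moreover have "cyl I = zcoord -` I \<inter> - {0}" by (auto simp: cyl_def)
  ultimately show ?thesis by simp
qed

lemma smooth_on_zcoord: assumes "open I" shows "smooth_on (cyl I) zcoord"
proof (rule smooth_on_cong[OF open_cyl[OF assms]])
  show "smooth_on (cyl I) (\<lambda>x. (1/2) * ln (x \<bullet> x))"
    by (intro smooth_intros smooth_on_ln smooth_on_sqnorm open_cyl assms) (auto simp: cyl_def)
qed (auto simp: cyl_def zcoord_alt)

lemma smooth_on_zcoord_compose:
  fixes f :: "real \<Rightarrow> real"
  assumes "open I" "smooth_on I f" shows "smooth_on (cyl I) (\<lambda>x. f (zcoord x))"
  using smooth_on_compose[OF open_cyl[OF assms(1)] assms(1) assms(2) smooth_on_zcoord[OF assms(1)]]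
  by (simp add: cyl_def)

lemma pd_zcoord:
  assumes "x \<noteq> 0" shows "pd i zcoord x = dz x $ i"
proof -
  have n: "x \<bullet> x > 0" using assms by simp
  have "((\<lambda>y. (1/2) * ln (y \<bullet> y)) has_derivative (\<lambda>h. (1/2) * ((1 / (x \<bullet> x)) * (x \<bullet> h + h \<bullet> x)))) (at x)"
    using n by (auto intro!: derivative_eq_intros simp: field_simps)
  from pd_has_derivative[OF this] have "pd i (\<lambda>y. (1/2) * ln (y \<bullet> y)) x = dz x $ i"
    using assms by (simp add: dz_def e0_def inner_axis inner_axis' field_simps)
  moreover have "pd i zcoord x = pd i (\<lambda>y. (1/2) * ln (y \<bullet> y)) x"
    by (rule pd_cong[of "- {0}"]) (use assms in \<open>auto simp: zcoord_alt\<close>)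
  ultimately show ?thesis by simp
qed

definition dlog :: "(real \<Rightarrow> real) \<Rightarrow> real \<Rightarrow> real" where "dlog C z = deriv C z / C z"

text \<open>
  The frame is \<open>E\<^sub>1 = 2F \<partial>/\<partial>z, E\<^sub>2 = e\<^sub>1, E\<^sub>3 = e\<^sub>2, E\<^sub>4 = e\<^sub>3\<close>. With this multiple of \<open>\<partial>/\<partial>z\<close> the complex
  structure \<open>J\<^sup>+\<close> maps \<open>E\<^sub>1\<close> to \<open>E\<^sub>2\<close> and \<open>E\<^sub>3\<close> to \<open>E\<^sub>4\<close>, and the connection is polynomial in \<open>F\<close>,
  \<open>F'\<close> and \<open>C'/C\<close>.
\<close>

definition u2_coframe :: "(real \<Rightarrow> real) \<Rightarrow> 4 \<Rightarrow> 4 \<Rightarrow> real^4 \<Rightarrow> real" where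
  "u2_coframe F a i x = (if a = 1 then dz x $ i / (2 * F (zcoord x)) else
     if a = 2 then eta1 x $ i else if a = 3 then eta2 x $ i else eta3 x $ i)"

definition u2_frame :: "(real \<Rightarrow> real) \<Rightarrow> 4 \<Rightarrow> 4 \<Rightarrow> real^4 \<Rightarrow> real" where
  "u2_frame F a i x = (if a = 1 then 2 * F (zcoord x) * e0 x $ i else
     if a = 2 then e1 x $ i else if a = 3 then e2 x $ i else e3 x $ i)"

definition u2_D :: "(real \<Rightarrow> real) \<Rightarrow> 4 \<Rightarrow> (real \<Rightarrow> real) \<Rightarrow> real \<Rightarrow> real" where
  "u2_D F a f = (if a = 1 then (\<lambda>z. 2 * F z * deriv f z) else (\<lambda>z. 0))"

definition u2_gf :: "(real \<Rightarrow> real) \<Rightarrow> (real \<Rightarrow> real) \<Rightarrow> 4 \<Rightarrow> 4 \<Rightarrow> real \<Rightarrow> real" where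
  "u2_gf F C a b = (if a = b then if a = 1 \<or> a = 2 then (\<lambda>z. C z * F z) else C else (\<lambda>z. 0))"

definition u2_gi :: "(real \<Rightarrow> real) \<Rightarrow> (real \<Rightarrow> real) \<Rightarrow> 4 \<Rightarrow> 4 \<Rightarrow> real \<Rightarrow> real" where
  "u2_gi F C a b = (if a = b then if a = 1 \<or> a = 2 then (\<lambda>z. 1 / (C z * F z)) else (\<lambda>z. 1 / C z) else (\<lambda>z. 0))"

text \<open>
  The solution of Cartan's structure equations for this coframe, with
  \<open>\<nabla>\<^bsub>E a\<^esub> E\<^sub>b = u2_gamma c a b E\<^sub>c\<close>; that it is the Levi-Civita connection is verified below.
\<close>

definition u2_gamma :: "(real \<Rightarrow> real) \<Rightarrow> (real \<Rightarrow> real) \<Rightarrow> 4 \<Rightarrow> 4 \<Rightarrow> 4 \<Rightarrow> real \<Rightarrow> real" where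
  "u2_gamma F C c a b =
    (if (c, a, b) \<in> {(1, 1, 1), (2, 1, 2), (2, 2, 1)} then (\<lambda>z. F z * dlog C z + deriv F z) else
     if (c, a, b) = (1, 2, 2) then (\<lambda>z. - (F z * dlog C z) - deriv F z) else
     if (c, a, b) \<in> {(3, 1, 3), (3, 3, 1), (4, 1, 4), (4, 4, 1)} then (\<lambda>z. F z * dlog C z) else
     if (c, a, b) \<in> {(1, 3, 3), (1, 4, 4)} then (\<lambda>z. - dlog C z) else
     if (c, a, b) = (4, 2, 3) then (\<lambda>z. 2 - F z) else if (c, a, b) = (3, 2, 4) then (\<lambda>z. F z - 2) else
     if (c, a, b) = (4, 3, 2) then (\<lambda>z. - F z) else if (c, a, b) = (3, 4, 2) then F else
     if (c, a, b) = (2, 3, 4) then (\<lambda>z. 1) else if (c, a, b) = (2, 4, 3) then (\<lambda>z. -1) else (\<lambda>z. 0))"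

text \<open>The basis element \<open>\<theta>\<^sup>p \<and> \<theta>\<^sup>q\<close> of the 2-forms, in terms of which curvature tensors are expanded.\<close>

definition w2 :: "4 \<Rightarrow> 4 \<Rightarrow> 4 \<Rightarrow> 4 \<Rightarrow> real" where
  "w2 p q a b = (if a = p \<and> b = q then 1 else if a = q \<and> b = p then -1 else 0)"

locale u2 =
  fixes I :: "real set" and F C :: "real \<Rightarrow> real"
  assumes I: "open I" and F_smooth: "smooth_on I F" and C_smooth: "smooth_on I C"
    and F_pos: "z \<in> I \<Longrightarrow> 0 < F z" and C_pos: "z \<in> I \<Longrightarrow> 0 < C z"
begin

lemma F_nz: "z \<in> I \<Longrightarrow> F z \<noteq> 0" and C_nz: "z \<in> I \<Longrightarrow> C z \<noteq> 0"
  using F_pos[of z] C_pos[of z] by auto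

lemma dlog_smooth: "smooth_on I (dlog C)"
  unfolding dlog_def[abs_def] by (intro smooth_intros I smooth_on_deriv C_smooth C_nz)

lemma F1_smooth: "smooth_on I (deriv F)"
  by (intro smooth_on_deriv I F_smooth)

lemma coframe_smooth: "smooth_on (cyl I) (u2_coframe F a i)"
proof -
  note o = open_cyl[OF I]
  have nz: "x \<bullet> x \<noteq> 0" if "x \<in> cyl I" for x using that by (simp add: cyl_def)
  have Fz: "smooth_on (cyl I) (\<lambda>x. F (zcoord x))" by (rule smooth_on_zcoord_compose[OF I F_smooth])
  have Fnz: "2 * F (zcoord x) \<noteq> 0" if "x \<in> cyl I" for x using that F_nz by (simp add: cyl_def)
  have e: "smooth_on (cyl I) (\<lambda>x. e1 x $ i)" "smooth_on (cyl I) (\<lambda>x. e2 x $ i)" "smooth_on (cyl I) (\<lambda>x. e3 x $ i)"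
    by (intro smooth_on_bounded_linear o e_linear)+
  have dz: "dz x $ i = x $ i / (x \<bullet> x)" for x by (simp add: dz_def e0_def field_simps)
  have "u2_coframe F a i \<in> {\<lambda>x. x $ i / (x \<bullet> x) / (2 * F (zcoord x)), \<lambda>x. e1 x $ i / (x \<bullet> x),
      \<lambda>x. e2 x $ i / (x \<bullet> x), \<lambda>x. e3 x $ i / (x \<bullet> x)}"
    using eta_nth[of i]
    by (cases "a = 1"; cases "a = 2"; cases "a = 3"; simp add: u2_coframe_def[abs_def] dz fun_eq_iff)
  moreover have "smooth_on (cyl I) (\<lambda>x. x $ i / (x \<bullet> x) / (2 * F (zcoord x)))"
    by (intro smooth_intros o smooth_on_coord smooth_on_sqnorm Fz nz Fnz) auto
  moreover have "smooth_on (cyl I) (\<lambda>x. e1 x $ i / (x \<bullet> x))" "smooth_on (cyl I) (\<lambda>x. e2 x $ i / (x \<bullet> x))"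
    "smooth_on (cyl I) (\<lambda>x. e3 x $ i / (x \<bullet> x))"
    by (intro smooth_intros o e smooth_on_sqnorm nz; simp)+
  ultimately show ?thesis by auto
qed

lemma frame_smooth: "smooth_on (cyl I) (u2_frame F a i)"
proof -
  note o = open_cyl[OF I]
  have Fz: "smooth_on (cyl I) (\<lambda>x. F (zcoord x))" by (rule smooth_on_zcoord_compose[OF I F_smooth])
  have e: "smooth_on (cyl I) (\<lambda>x. e1 x $ i)" "smooth_on (cyl I) (\<lambda>x. e2 x $ i)" "smooth_on (cyl I) (\<lambda>x. e3 x $ i)"
    by (intro smooth_on_bounded_linear o e_linear)+
  have "u2_frame F a i \<in> {\<lambda>x. 2 * F (zcoord x) * x $ i, \<lambda>x. e1 x $ i, \<lambda>x. e2 x $ i, \<lambda>x. e3 x $ i}"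
    by (cases "a = 1"; cases "a = 2"; cases "a = 3"; simp add: u2_frame_def[abs_def] e0_def fun_eq_iff)
  moreover have "smooth_on (cyl I) (\<lambda>x. 2 * F (zcoord x) * x $ i)"
    by (intro smooth_intros o smooth_on_coord Fz)
  ultimately show ?thesis using e by auto
qed

lemma dual_frame:
  assumes "x \<in> cyl I"
  shows "(\<Sum>i\<in>UNIV. u2_coframe F a i x * u2_frame F b i x) = (if a = b then 1 else 0)"
proof -
  have x: "x \<noteq> 0" and F: "F (zcoord x) \<noteq> 0" using assms F_nz by (auto simp: cyl_def)
  have r: "a * (2 * F (zcoord x) * b) = 2 * F (zcoord x) * (a * b)" for a b by simp
  have "\<forall>a b. (\<Sum>i\<in>UNIV. u2_coframe F a i x * u2_frame F b i x) = (if a = b then 1 else 0)"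
    using coframe_dual[OF x] F
    unfolding forall_4 inner_vec_def
    by (simp add: u2_coframe_def u2_frame_def r sum_distrib_left[symmetric] sum_divide_distrib[symmetric])
  then show ?thesis by blast
qed

lemma u2_metric_frame:
  assumes "x \<in> cyl I"
  shows "u2_metric F C x $ i $ j = (\<Sum>a\<in>UNIV. \<Sum>b\<in>UNIV. u2_gf F C a b (zcoord x) * (u2_coframe F a i x * u2_coframe F b j x))"
proof -
  have F: "F (zcoord x) \<noteq> 0" using assms F_nz by (auto simp: cyl_def)
  then show ?thesis
    by (simp add: u2_metric_def Let_def sum_4 u2_gf_def u2_coframe_def field_simps power2_eq_square)
qed

lemma u2_ginv:
  assumes x: "x \<in> cyl I"
  shows "u2_metric F C x ** (\<chi> i j. \<Sum>a\<in>UNIV. \<Sum>b\<in>UNIV. u2_gi F C a b (zcoord x) * (u2_frame F a i x * u2_frame F b j x)) = mat 1"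
    (is "_ ** ?H = _")
proof -
  define \<Theta> :: "real^4^4" where "\<Theta> = (\<chi> a i. u2_coframe F a i x)"
  define E :: "real^4^4" where "E = (\<chi> i a. u2_frame F a i x)"
  define G :: "real^4^4" where "G = (\<chi> a b. u2_gf F C a b (zcoord x))"
  define H :: "real^4^4" where "H = (\<chi> a b. u2_gi F C a b (zcoord x))"
  have \<Theta>E: "\<Theta> ** E = mat 1"
    unfolding vec_eq_iff by (simp add: matrix_mult_nth \<Theta>_def E_def dual_frame[OF x] mat_def)
  then have E\<Theta>: "E ** \<Theta> = mat 1" using matrix_left_right_inverse by blast
  have nz: "F (zcoord x) \<noteq> 0" "C (zcoord x) \<noteq> 0" using x F_nz C_nz by (auto simp: cyl_def)
  have GH: "G ** H = mat 1"
    unfolding vec_eq_iff forall_4 using nz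
    by (simp add: matrix_mult_nth G_def H_def mat_def sum_4 u2_gf_def u2_gi_def)
  have g: "u2_metric F C x = transpose \<Theta> ** G ** \<Theta>"
    unfolding vec_eq_iff
    by (intro allI, simp add: u2_metric_frame[OF x] matrix_mult_nth transpose_def \<Theta>_def G_def sum_distrib_right)
      (subst sum.swap, simp add: mult_ac)
  have h: "?H = E ** H ** transpose E"
    unfolding vec_eq_iff
    by (intro allI, simp add: matrix_mult_nth transpose_def E_def H_def sum_distrib_right)
      (subst sum.swap, simp add: mult_ac)
  have "u2_metric F C x ** ?H = transpose \<Theta> ** (G ** (\<Theta> ** E) ** H) ** transpose E"
    unfolding g h by (simp only: matrix_mul_assoc)
  also have "\<dots> = transpose (E ** \<Theta>)" by (simp add: \<Theta>E GH matrix_transpose_mul)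
  finally show ?thesis by (simp add: E\<Theta>)
qed

lemma gf_smooth: "smooth_on I (u2_gf F C a b)"
  unfolding u2_gf_def by (simp, intro conjI impI smooth_intros I F_smooth C_smooth)

lemma gi_smooth: "smooth_on I (u2_gi F C a b)"
  unfolding u2_gi_def by (simp, intro conjI impI smooth_intros I F_smooth C_smooth) (auto simp: F_nz C_nz)

lemma gamma_smooth: "smooth_on I (u2_gamma F C c a b)"
  unfolding u2_gamma_def by (simp only: split: if_split)
    (intro conjI impI smooth_intros I F_smooth F1_smooth dlog_smooth)

lemma F_deriv: "z \<in> I \<Longrightarrow> (F has_real_derivative deriv F z) (at z)"
  and C_deriv: "z \<in> I \<Longrightarrow> (C has_real_derivative deriv C z) (at z)"
  by (rule smooth_on_has_real_derivative[OF F_smooth] smooth_on_has_real_derivative[OF C_smooth], assumption)+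

text \<open>
  For \<open>\<theta>\<^sup>1\<close> this says that \<open>dz / 2F\<close> is closed, by symmetry of the second derivatives of \<open>z\<close>; for the
  others it is the Maurer-Cartan equation of \<open>S\<^sup>3\<close>.
\<close>

lemma torsion_u2:
  assumes x: "x \<in> cyl I"
  shows "pd i (u2_coframe F c j) x - pd j (u2_coframe F c i) x =
      - (\<Sum>a\<in>UNIV. \<Sum>b\<in>UNIV. (u2_gamma F C c a b (zcoord x) - u2_gamma F C c b a (zcoord x))
          * (u2_coframe F a i x * u2_coframe F b j x))"
proof -
  have x0: "x \<noteq> 0" using x by (simp add: cyl_def)
  have 1: "pd i (u2_coframe F 1 j) x - pd j (u2_coframe F 1 i) x = 0"
  proof -
    define h where "h z = 1 / (2 * F z)" for z
    have h: "smooth_on I h" unfolding h_def[abs_def] by (intro smooth_intros I F_smooth) (simp add: F_nz)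
    have hd: "(\<lambda>x. h (zcoord x)) differentiable (at x)"
      by (rule smooth_on_differentiable[OF smooth_on_zcoord_compose[OF I h] x])
    have zd: "pd j zcoord differentiable (at x)" for j
      by (rule smooth_on_differentiable[OF smooth_on_pd[OF smooth_on_zcoord[OF I]] x])
    have zI: "zcoord x \<in> I" using x by (simp add: cyl_def)
    have "pd i (u2_coframe F 1 j) x = deriv h (zcoord x) * pd i zcoord x * pd j zcoord x + h (zcoord x) * pd i (pd j zcoord) x" for i j
    proof -
      have "pd i (u2_coframe F 1 j) x = pd i (\<lambda>y. h (zcoord y) * pd j zcoord y) x"
        by (rule pd_cong[OF open_cyl[OF I] x])
          (simp add: u2_coframe_def h_def pd_zcoord cyl_def)
      also have "\<dots> = pd i (\<lambda>y. h (zcoord y)) x * pd j zcoord x + h (zcoord x) * pd i (pd j zcoord) x"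
        by (rule pd_mult[OF hd zd])
      also have "pd i (\<lambda>y. h (zcoord y)) x = deriv h (zcoord x) * pd i zcoord x"
        by (rule pd_compose[OF smooth_on_has_real_derivative[OF h zI]
              smooth_on_differentiable[OF smooth_on_zcoord[OF I] x]])
      finally show ?thesis .
    qed
    then show ?thesis using pd_commute[OF open_cyl[OF I] smooth_on_zcoord[OF I] x, of i j] by simp
  qed
  have eta: "pd i (u2_coframe F 2 j) x - pd j (u2_coframe F 2 i) x = - 2 * wedge (eta2 x) (eta3 x) i j"
    "pd i (u2_coframe F 3 j) x - pd j (u2_coframe F 3 i) x = - 2 * wedge (eta3 x) (eta1 x) i j"
    "pd i (u2_coframe F 4 j) x - pd j (u2_coframe F 4 i) x = - 2 * wedge (eta1 x) (eta2 x) i j"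
    using structure_equations[OF x0, of i j] by (simp_all add: ext_deriv_def u2_coframe_def[abs_def])
  have "\<forall>c. pd i (u2_coframe F c j) x - pd j (u2_coframe F c i) x =
      - (\<Sum>a\<in>UNIV. \<Sum>b\<in>UNIV. (u2_gamma F C c a b (zcoord x) - u2_gamma F C c b a (zcoord x))
          * (u2_coframe F a i x * u2_coframe F b j x))"
    unfolding forall_4 1 eta
    by (simp add: sum_4 u2_gamma_def wedge_def) (simp add: u2_coframe_def algebra_simps)
  then show ?thesis by blast
qed

lemma gf_table:
  "u2_gf F C 1 1 = (\<lambda>z. C z * F z)" "u2_gf F C 2 2 = (\<lambda>z. C z * F z)" "u2_gf F C 3 3 = C" "u2_gf F C 4 4 = C"
  "a \<noteq> b \<Longrightarrow> u2_gf F C a b = (\<lambda>z. 0)"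
  by (simp_all add: u2_gf_def)

lemma metric_u2:
  assumes z: "z \<in> I"
  shows "u2_D F a (u2_gf F C b c) z
    = (\<Sum>m\<in>UNIV. u2_gamma F C m a b z * u2_gf F C m c z + u2_gamma F C m a c z * u2_gf F C b m z)"
proof -
  have d: "deriv C z = dlog C z * C z" using C_nz[OF z] by (simp add: dlog_def)
  have d2: "deriv (\<lambda>z. C z * F z) z = dlog C z * C z * F z + C z * deriv F z"
    using DERIV_imp_deriv[OF DERIV_mult[OF C_deriv[OF z] F_deriv[OF z]]] d by simp
  have "\<forall>a b c. u2_D F a (u2_gf F C b c) z
    = (\<Sum>m\<in>UNIV. u2_gamma F C m a b z * u2_gf F C m c z + u2_gamma F C m a c z * u2_gf F C b m z)"
    unfolding forall_4
    by (simp add: sum_4 u2_gamma_def gf_table u2_D_def d d2) (simp add: algebra_simps)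
  then show ?thesis by blast
qed

sublocale moving_frame "cyl I" "u2_metric F C" I "u2_coframe F" "u2_frame F" zcoord "u2_D F"
  "u2_gf F C" "u2_gi F C" "u2_gamma F C"
proof unfold_locales
  note o = open_cyl[OF I]
  show "open (cyl I)" by (rule o)
  show "smooth_on (cyl I) (\<lambda>x. u2_metric F C x $ i $ j)" for i j
    by (rule smooth_on_cong[OF o u2_metric_frame])
      (auto intro!: smooth_intros o coframe_smooth smooth_on_zcoord_compose[OF I gf_smooth])
  have H: "ginv (u2_metric F C) x $ i $ j = (\<Sum>a\<in>UNIV. \<Sum>b\<in>UNIV. u2_gi F C a b (zcoord x) * (u2_frame F a i x * u2_frame F b j x))"
    if "x \<in> cyl I" for x i j
    unfolding ginv_def matrix_inv_eqI[OF u2_ginv[OF that]] by simp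
  show "smooth_on (cyl I) (\<lambda>x. ginv (u2_metric F C) x $ i $ j)" for i j
    by (rule smooth_on_cong[OF o H])
      (auto intro!: smooth_intros o frame_smooth smooth_on_zcoord_compose[OF I gi_smooth])
  show "u2_metric F C x $ i $ j = u2_metric F C x $ j $ i" for x i j
    by (simp add: u2_metric_def Let_def mult.commute)
  show "u2_metric F C x ** ginv (u2_metric F C) x = mat 1" if "x \<in> cyl I" for x
    unfolding ginv_def matrix_inv_eqI[OF u2_ginv[OF that]] by (rule u2_ginv[OF that])
  show "zcoord x \<in> I" if "x \<in> cyl I" for x using that by (simp add: cyl_def)
  show "(\<lambda>x. f (zcoord x)) differentiable (at x)" if "smooth_on I f" "x \<in> cyl I" for f :: "real \<Rightarrow> real" and x
    by (rule smooth_on_differentiable[OF smooth_on_zcoord_compose[OF I that(1)] that(2)])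
  show "pd i (\<lambda>x. f (zcoord x)) x = (\<Sum>a\<in>UNIV. u2_coframe F a i x * u2_D F a f (zcoord x))"
    if "smooth_on I f" "x \<in> cyl I" for f :: "real \<Rightarrow> real" and x i
  proof -
    have z: "zcoord x \<in> I" and x0: "x \<noteq> 0" using that by (auto simp: cyl_def)
    have "pd i (\<lambda>x. f (zcoord x)) x = deriv f (zcoord x) * dz x $ i"
      using pd_compose[OF smooth_on_has_real_derivative[OF that(1) z]
          smooth_on_differentiable[OF smooth_on_zcoord[OF I] that(2)]] pd_zcoord[OF x0] by simp
    then show ?thesis using F_nz[OF z] by (simp add: sum_4 u2_D_def u2_coframe_def)
  qed
  show "open I" by (rule I)
  show "smooth_on I (u2_D F a f)" if "smooth_on I f" for a and f :: "real \<Rightarrow> real"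
    unfolding u2_D_def by (simp, intro conjI impI smooth_intros I F_smooth smooth_on_deriv that)
  show "smooth_on (cyl I) (u2_coframe F a i)" for a i by (rule coframe_smooth)
  show "(\<Sum>i\<in>UNIV. u2_coframe F a i x * u2_frame F b i x) = (if a = b then 1 else 0)" if "x \<in> cyl I" for x a b
    by (rule dual_frame[OF that])
  show "smooth_on I (u2_gf F C a b)" "smooth_on I (u2_gi F C a b)" for a b by (rule gf_smooth gi_smooth)+
  show "smooth_on I (u2_gamma F C c a b)" for c a b by (rule gamma_smooth)
  show "u2_gf F C a b y = u2_gf F C b a y" for a b y by (simp add: u2_gf_def)
  show "(\<Sum>b\<in>UNIV. u2_gf F C a b y * u2_gi F C b c y) = (if a = c then 1 else 0)" if "y \<in> I" for a c y
  proof -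
    have "\<forall>a c. (\<Sum>b\<in>UNIV. u2_gf F C a b y * u2_gi F C b c y) = (if a = c then 1 else 0)"
      unfolding forall_4 using F_nz[OF that] C_nz[OF that] by (simp add: sum_4 u2_gf_def u2_gi_def)
    then show ?thesis by blast
  qed
qed (rule u2_metric_frame metric_u2 torsion_u2; assumption)+

text \<open>The 64 coefficients, evaluated once, so that curvature computations need not decide index equations.\<close>

lemmas gamma_table =
  u2_gamma_def[of F C 1 1 1, simplified] u2_gamma_def[of F C 1 1 2, simplified] u2_gamma_def[of F C 1 1 3, simplified] u2_gamma_def[of F C 1 1 4, simplified]
  u2_gamma_def[of F C 1 2 1, simplified] u2_gamma_def[of F C 1 2 2, simplified] u2_gamma_def[of F C 1 2 3, simplified] u2_gamma_def[of F C 1 2 4, simplified]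
  u2_gamma_def[of F C 1 3 1, simplified] u2_gamma_def[of F C 1 3 2, simplified] u2_gamma_def[of F C 1 3 3, simplified] u2_gamma_def[of F C 1 3 4, simplified]
  u2_gamma_def[of F C 1 4 1, simplified] u2_gamma_def[of F C 1 4 2, simplified] u2_gamma_def[of F C 1 4 3, simplified] u2_gamma_def[of F C 1 4 4, simplified]
  u2_gamma_def[of F C 2 1 1, simplified] u2_gamma_def[of F C 2 1 2, simplified] u2_gamma_def[of F C 2 1 3, simplified] u2_gamma_def[of F C 2 1 4, simplified]
  u2_gamma_def[of F C 2 2 1, simplified] u2_gamma_def[of F C 2 2 2, simplified] u2_gamma_def[of F C 2 2 3, simplified] u2_gamma_def[of F C 2 2 4, simplified]
  u2_gamma_def[of F C 2 3 1, simplified] u2_gamma_def[of F C 2 3 2, simplified] u2_gamma_def[of F C 2 3 3, simplified] u2_gamma_def[of F C 2 3 4, simplified]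
  u2_gamma_def[of F C 2 4 1, simplified] u2_gamma_def[of F C 2 4 2, simplified] u2_gamma_def[of F C 2 4 3, simplified] u2_gamma_def[of F C 2 4 4, simplified]
  u2_gamma_def[of F C 3 1 1, simplified] u2_gamma_def[of F C 3 1 2, simplified] u2_gamma_def[of F C 3 1 3, simplified] u2_gamma_def[of F C 3 1 4, simplified]
  u2_gamma_def[of F C 3 2 1, simplified] u2_gamma_def[of F C 3 2 2, simplified] u2_gamma_def[of F C 3 2 3, simplified] u2_gamma_def[of F C 3 2 4, simplified]
  u2_gamma_def[of F C 3 3 1, simplified] u2_gamma_def[of F C 3 3 2, simplified] u2_gamma_def[of F C 3 3 3, simplified] u2_gamma_def[of F C 3 3 4, simplified]
  u2_gamma_def[of F C 3 4 1, simplified] u2_gamma_def[of F C 3 4 2, simplified] u2_gamma_def[of F C 3 4 3, simplified] u2_gamma_def[of F C 3 4 4, simplified]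
  u2_gamma_def[of F C 4 1 1, simplified] u2_gamma_def[of F C 4 1 2, simplified] u2_gamma_def[of F C 4 1 3, simplified] u2_gamma_def[of F C 4 1 4, simplified]
  u2_gamma_def[of F C 4 2 1, simplified] u2_gamma_def[of F C 4 2 2, simplified] u2_gamma_def[of F C 4 2 3, simplified] u2_gamma_def[of F C 4 2 4, simplified]
  u2_gamma_def[of F C 4 3 1, simplified] u2_gamma_def[of F C 4 3 2, simplified] u2_gamma_def[of F C 4 3 3, simplified] u2_gamma_def[of F C 4 3 4, simplified]
  u2_gamma_def[of F C 4 4 1, simplified] u2_gamma_def[of F C 4 4 2, simplified] u2_gamma_def[of F C 4 4 3, simplified] u2_gamma_def[of F C 4 4 4, simplified]

lemma deriv_table:
  assumes z: "z \<in> I"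
  shows "deriv (\<lambda>z. F z * dlog C z + deriv F z) z = F z * deriv (dlog C) z + deriv F z * dlog C z + deriv (deriv F) z"
    "deriv (\<lambda>z. - (F z * dlog C z) - deriv F z) z = - (F z * deriv (dlog C) z + deriv F z * dlog C z + deriv (deriv F) z)"
    "deriv (\<lambda>z. F z * dlog C z) z = F z * deriv (dlog C) z + deriv F z * dlog C z"
    "deriv (\<lambda>z. - dlog C z) z = - deriv (dlog C) z"
    "deriv (\<lambda>z. 2 - F z) z = - deriv F z" "deriv (\<lambda>z. F z - 2) z = deriv F z" "deriv (\<lambda>z. - F z) z = - deriv F z"
proof -
  note d = F_deriv[OF z] smooth_on_has_real_derivative[OF dlog_smooth z] smooth_on_has_real_derivative[OF F1_smooth z]
  show "deriv (\<lambda>z. F z * dlog C z + deriv F z) z = F z * deriv (dlog C) z + deriv F z * dlog C z + deriv (deriv F) z"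
    "deriv (\<lambda>z. - (F z * dlog C z) - deriv F z) z = - (F z * deriv (dlog C) z + deriv F z * dlog C z + deriv (deriv F) z)"
    "deriv (\<lambda>z. F z * dlog C z) z = F z * deriv (dlog C) z + deriv F z * dlog C z"
    "deriv (\<lambda>z. - dlog C z) z = - deriv (dlog C) z"
    "deriv (\<lambda>z. 2 - F z) z = - deriv F z" "deriv (\<lambda>z. F z - 2) z = deriv F z" "deriv (\<lambda>z. - F z) z = - deriv F z"
    by (rule DERIV_imp_deriv, auto intro!: derivative_eq_intros d)+
qed

end

section \<open>Curvature of the \<open>U(2)\<close>-invariant metrics\<close>

context u2
begin

lemma u2_riemann:
  assumes z: "z \<in> I"
  shows "Rf a b c d z = C z * (
      2 * F z ^ 2 * (deriv F z * dlog C z + deriv (deriv F) z + F z * deriv (dlog C) z) * (w2 1 2 a b * w2 1 2 c d)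
    + F z * (deriv F z * dlog C z + 2 * F z * deriv (dlog C) z) * (w2 1 3 a b * w2 1 3 c d + w2 1 4 a b * w2 1 4 c d)
    + F z * (deriv F z * dlog C z - F z + F z * dlog C z ^ 2) * (w2 2 3 a b * w2 2 3 c d + w2 2 4 a b * w2 2 4 c d)
    + (3 * F z + F z * dlog C z ^ 2 - 4) * (w2 3 4 a b * w2 3 4 c d)
    - 2 * F z * deriv F z * (w2 1 2 a b * w2 3 4 c d + w2 3 4 a b * w2 1 2 c d)
    - F z * deriv F z * (w2 1 3 a b * w2 2 4 c d + w2 2 4 a b * w2 1 3 c d
                         - w2 1 4 a b * w2 2 3 c d - w2 2 3 a b * w2 1 4 c d))"
  (is "_ = ?K a b c d")
proof -
  have up: "Rf a b c d z = - Rf b a c d z" for a b c d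
    by (simp add: frame_riemann_def frame_riemann_up_def sum_subtractf sum_negf[symmetric] algebra_simps sum.distrib)
  note defs = frame_riemann_def frame_riemann_up_def
  note tab = sum_4 gamma_table gf_table u2_D_def deriv_table[OF z] w2_def
  note alg = algebra_simps power2_eq_square power3_eq_cube
  have 12: "\<forall>c d. Rf 1 2 c d z = ?K 1 2 c d"
    unfolding forall_4 defs by (intro conjI; simp add: tab; simp add: alg)
  have 13: "\<forall>c d. Rf 1 3 c d z = ?K 1 3 c d"
    unfolding forall_4 defs by (intro conjI; simp add: tab; simp add: alg)
  have 14: "\<forall>c d. Rf 1 4 c d z = ?K 1 4 c d"
    unfolding forall_4 defs by (intro conjI; simp add: tab; simp add: alg)
  have 23: "\<forall>c d. Rf 2 3 c d z = ?K 2 3 c d"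
    unfolding forall_4 defs by (intro conjI; simp add: tab; simp add: alg)
  have 24: "\<forall>c d. Rf 2 4 c d z = ?K 2 4 c d"
    unfolding forall_4 defs by (intro conjI; simp add: tab; simp add: alg)
  have 34: "\<forall>c d. Rf 3 4 c d z = ?K 3 4 c d"
    unfolding forall_4 defs by (intro conjI; simp add: tab; simp add: alg)
  have diag: "Rf a a c d z = 0" for a c d using up[of a a c d] by simp
  have "\<forall>a b. Rf a b c d z = ?K a b c d"
    unfolding forall_4
    using 12 13 14 23 24 34
    by (simp add: diag up[of 2 1] up[of 3 1] up[of 4 1] up[of 3 2] up[of 4 2] up[of 4 3] w2_def)
  then show ?thesis by blast
qed

lemma gi_table:
  "u2_gi F C 1 1 = (\<lambda>z. 1 / (C z * F z))" "u2_gi F C 2 2 = (\<lambda>z. 1 / (C z * F z))"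
  "u2_gi F C 3 3 = (\<lambda>z. 1 / C z)" "u2_gi F C 4 4 = (\<lambda>z. 1 / C z)"
  "a \<noteq> b \<Longrightarrow> u2_gi F C a b = (\<lambda>z. 0)"
  by (simp_all add: u2_gi_def)

lemma gi_sum: "(\<Sum>b\<in>UNIV. u2_gi F C a b z * X b) = u2_gi F C a a z * X a"
proof -
  have "(\<Sum>b\<in>UNIV. u2_gi F C a b z * X b) = (\<Sum>b\<in>UNIV. if b = a then u2_gi F C a a z * X a else 0)"
    by (intro sum.cong refl) (auto simp: gi_table(5))
  then show ?thesis by simp
qed

lemma u2_ricci:
  assumes z: "z \<in> I"
  shows "Ricf a b z = (if a \<noteq> b then 0 else
    if a = 1 then - 4 * F z * deriv F z * dlog C z - 2 * F z * deriv (deriv F) z - 6 * F z ^ 2 * deriv (dlog C) z else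
    if a = 2 then - 4 * F z * deriv F z * dlog C z - 2 * F z * deriv (deriv F) z + 2 * F z ^ 2
       - 2 * F z ^ 2 * dlog C z ^ 2 - 2 * F z ^ 2 * deriv (dlog C) z else
    4 - 2 * F z - 2 * F z * dlog C z ^ 2 - 2 * F z * deriv (dlog C) z - 2 * deriv F z * dlog C z)"
  (is "_ = ?K a b")
proof -
  have "\<forall>a b. Ricf a b z = ?K a b"
    unfolding forall_4 frame_ricci_def gi_sum u2_riemann[OF z] using C_nz[OF z] F_nz[OF z]
    by (intro conjI; simp add: sum_4 gi_table w2_def; simp add: field_simps power2_eq_square)
  then show ?thesis by blast
qed

lemma u2_scalar:
  assumes z: "z \<in> I"
  shows "Sf z = (8 - 2 * F z - 6 * F z * dlog C z ^ 2 - 12 * F z * deriv (dlog C) z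
    - 12 * deriv F z * dlog C z - 4 * deriv (deriv F) z) / C z"
  unfolding frame_scalar_def gi_sum using C_nz[OF z] F_nz[OF z]
  by (simp add: u2_ricci[OF z] sum_4 gi_table; simp add: field_simps power2_eq_square)

end

lemma w2_swap: "w2 p q b a = - w2 p q a b" if "p \<noteq> q"
  using that by (auto simp: w2_def)

lemma w2_swaps:
  "w2 1 2 a b = - w2 1 2 b a" "w2 1 3 a b = - w2 1 3 b a" "w2 1 4 a b = - w2 1 4 b a"
  "w2 2 3 a b = - w2 2 3 b a" "w2 2 4 a b = - w2 2 4 b a" "w2 3 4 a b = - w2 3 4 b a"
  by (rule w2_swap; simp)+

text \<open>Antisymmetry in both pairs of indices reduces an identity of curvature tensors to 36 of the 256 components.\<close>

lemma bivector_ext: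
  fixes X Y :: "4 \<Rightarrow> 4 \<Rightarrow> 4 \<Rightarrow> 4 \<Rightarrow> real"
  assumes X: "\<And>a b c d. X b a c d = - X a b c d" "\<And>a b c d. X a b d c = - X a b c d"
    and Y: "\<And>a b c d. Y b a c d = - Y a b c d" "\<And>a b c d. Y a b d c = - Y a b c d"
    and eq: "\<And>a b c d. (a, b) \<in> {(1, 2), (1, 3), (1, 4), (2, 3), (2, 4), (3, 4)} \<Longrightarrow>
      (c, d) \<in> {(1, 2), (1, 3), (1, 4), (2, 3), (2, 4), (3, 4)} \<Longrightarrow> X a b c d = Y a b c d"
  shows "X a b c d = Y a b c d"
proof -
  let ?P = "{(1, 2), (1, 3), (1, 4), (2, 3), (2, 4), (3, 4)} :: (4 \<times> 4) set"
  have trichotomy: "a = b \<or> (a, b) \<in> ?P \<or> (b, a) \<in> ?P" for a b :: 4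
    using exhaust_4[of a] exhaust_4[of b] by auto
  have 0: "X a a c d = 0" "X a b c c = 0" "Y a a c d = 0" "Y a b c c = 0" for a b c d
    using X(1)[of a a c d] X(2)[of a b c c] Y(1)[of a a c d] Y(2)[of a b c c] by auto
  have 1: "X a b c d = Y a b c d" if "(a, b) \<in> ?P" for a b c d
    using trichotomy[of c d] eq[OF that, of c d] eq[OF that, of d c] X(2)[of a b c d] Y(2)[of a b c d] 0
    by (metis minus_minus)
  show ?thesis
    using trichotomy[of a b] 1[of a b c d] 1[of b a c d] X(1)[of a b c d] Y(1)[of a b c d] 0
    by (metis minus_minus)
qed

text \<open>
  By \<open>U(2)\<close>-invariance the self-dual and the anti-self-dual part of the Weyl tensor have a double
  eigenvalue and no trace, so each is determined by one function. These functions do not involve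
  \<open>C\<close>, and they turn out to be \<open>L_plus F - 1\<close> and \<open>L_minus F - 1\<close>.
\<close>

definition w_plus :: "(real \<Rightarrow> real) \<Rightarrow> real \<Rightarrow> real" where
  "w_plus F z = deriv (deriv F) z / 2 - 3 / 2 * deriv F z + F z - 1"

definition w_minus :: "(real \<Rightarrow> real) \<Rightarrow> real \<Rightarrow> real" where
  "w_minus F z = deriv (deriv F) z / 2 + 3 / 2 * deriv F z + F z - 1"

text \<open>
  Up to a factor, \<open>weyl_diag + weyl_mixed\<close> and \<open>weyl_diag - weyl_mixed\<close> are the trace-free operators with a
  double eigenvalue on the self-dual and on the anti-self-dual 2-forms: \<open>weyl_diag\<close> contains the products of
  a basis 2-form with itself, \<open>weyl_mixed\<close> those with its dual. The parameter \<open>f\<close> is \<open>F z\<close>, as \<open>E\<^sub>1\<close> and \<open>E\<^sub>2\<close> have length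
  \<open>sqrt f\<close> relative to \<open>E\<^sub>3\<close> and \<open>E\<^sub>4\<close>.
\<close>

definition weyl_diag :: "real \<Rightarrow> 4 \<Rightarrow> 4 \<Rightarrow> 4 \<Rightarrow> 4 \<Rightarrow> real" where
  "weyl_diag f a b c d = 2 / 3 * f ^ 2 * (w2 1 2 a b * w2 1 2 c d)
     - f / 3 * (w2 1 3 a b * w2 1 3 c d + w2 1 4 a b * w2 1 4 c d + w2 2 3 a b * w2 2 3 c d + w2 2 4 a b * w2 2 4 c d)
     + 2 / 3 * (w2 3 4 a b * w2 3 4 c d)"

definition weyl_mixed :: "real \<Rightarrow> 4 \<Rightarrow> 4 \<Rightarrow> 4 \<Rightarrow> 4 \<Rightarrow> real" where
  "weyl_mixed f a b c d = 2 / 3 * f * (w2 1 2 a b * w2 3 4 c d + w2 3 4 a b * w2 1 2 c d)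
     + f / 3 * (w2 1 3 a b * w2 2 4 c d + w2 2 4 a b * w2 1 3 c d - w2 1 4 a b * w2 2 3 c d - w2 2 3 a b * w2 1 4 c d)"

context u2
begin

lemma u2_weyl:
  assumes z: "z \<in> I"
  shows "Wf a b c d z = C z * ((w_plus F z + w_minus F z) * weyl_diag (F z) a b c d
    + (w_plus F z - w_minus F z) * weyl_mixed (F z) a b c d)"
  (is "_ = ?K a b c d")
proof (rule bivector_ext[of "\<lambda>a b c d. Wf a b c d z" ?K])
  have R: "Rf b a c d z = - Rf a b c d z" "Rf a b d c z = - Rf a b c d z" for a b c d
    unfolding u2_riemann[OF z] w2_swaps[of b a] w2_swaps[of d c] by (simp_all add: algebra_simps)
  show "Wf b a c d z = - Wf a b c d z" for a b c d
    unfolding frame_weyl_def R(1)[of a b c d] by (simp add: field_simps)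
  show "Wf a b d c z = - Wf a b c d z" for a b c d
    unfolding frame_weyl_def R(2)[of a b c d] by (simp add: field_simps)
  show "?K b a c d = - ?K a b c d" "?K a b d c = - ?K a b c d" for a b c d
    unfolding weyl_diag_def weyl_mixed_def w2_swaps[of b a] w2_swaps[of d c]
    by (simp_all add: algebra_simps)
  \<comment> \<open>Rewriting \<open>F'\<close> and \<open>F''\<close> in terms of the two functions makes all terms with derivatives of \<open>C\<close> cancel.\<close>
  define S where "S = 8 - 2 * F z - 6 * F z * dlog C z ^ 2 - 12 * F z * deriv (dlog C) z
    - 12 * deriv F z * dlog C z - 4 * deriv (deriv F) z"
  have s: "Sf z * (C z * X) = S * X" for X using u2_scalar[OF z] C_nz[OF z] by (simp add: S_def)
  have d: "deriv (deriv F) z = w_plus F z + w_minus F z - 2 * F z + 2" "deriv F z = (w_minus F z - w_plus F z) / 3"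
    by (simp_all add: w_plus_def w_minus_def)
  show "Wf a b c d z = ?K a b c d"
    if "(a, b) \<in> {(1, 2), (1, 3), (1, 4), (2, 3), (2, 4), (3, 4)}" "(c, d) \<in> {(1, 2), (1, 3), (1, 4), (2, 3), (2, 4), (3, 4)}"
    for a b c d
    using that unfolding frame_weyl_def u2_riemann[OF z] u2_ricci[OF z]
    by (elim insertE emptyE; simp add: gf_table w2_def weyl_diag_def weyl_mixed_def s mult.assoc; simp add: S_def d field_simps power2_eq_square)
qed

lemma w_plus_smooth: "smooth_on I (w_plus F)"
  unfolding w_plus_def[abs_def] by (intro smooth_intros I F_smooth smooth_on_deriv) auto

lemma w_minus_smooth: "smooth_on I (w_minus F)"
  unfolding w_minus_def[abs_def] by (intro smooth_intros I F_smooth smooth_on_deriv) auto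

end

section \<open>The divergence of the Weyl tensor and the Bach tensor\<close>

text \<open>The primed functions are the derivatives with respect to \<open>f\<close>; \<open>weyl_mixed\<close> and \<open>div_mixed\<close> are linear in \<open>f\<close>.\<close>

definition weyl_diag' :: "real \<Rightarrow> 4 \<Rightarrow> 4 \<Rightarrow> 4 \<Rightarrow> 4 \<Rightarrow> real" where
  "weyl_diag' f a b c d = 4 / 3 * f * (w2 1 2 a b * w2 1 2 c d)
     - 1 / 3 * (w2 1 3 a b * w2 1 3 c d + w2 1 4 a b * w2 1 4 c d + w2 2 3 a b * w2 2 3 c d + w2 2 4 a b * w2 2 4 c d)"

definition div_diag :: "real \<Rightarrow> 4 \<Rightarrow> 4 \<Rightarrow> 4 \<Rightarrow> real" where
  "div_diag f i j t = (if i = 2 then 2 / 3 * f ^ 2 * w2 1 2 j t else if i = 3 then - (f / 3) * w2 1 3 j t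
     else if i = 4 then - (f / 3) * w2 1 4 j t else 0)"

definition div_diag' :: "real \<Rightarrow> 4 \<Rightarrow> 4 \<Rightarrow> 4 \<Rightarrow> real" where
  "div_diag' f i j t = (if i = 2 then 4 / 3 * f * w2 1 2 j t else if i = 3 then - (1 / 3) * w2 1 3 j t
     else if i = 4 then - (1 / 3) * w2 1 4 j t else 0)"

definition div_mixed :: "real \<Rightarrow> 4 \<Rightarrow> 4 \<Rightarrow> 4 \<Rightarrow> real" where
  "div_mixed f i j t = (if i = 2 then 2 / 3 * f * w2 3 4 j t else if i = 3 then f / 3 * w2 2 4 j t else
     if i = 4 then - (f / 3) * w2 2 3 j t else 0)"

text \<open>The analogue of \<open>bivector_ext\<close> for tensors which are antisymmetric in their last two indices, such as the divergence.\<close>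

lemma trivector_ext:
  fixes X Y :: "4 \<Rightarrow> 4 \<Rightarrow> 4 \<Rightarrow> real"
  assumes X: "\<And>a c d. X a d c = - X a c d" and Y: "\<And>a c d. Y a d c = - Y a c d"
    and eq: "\<And>a c d. (c, d) \<in> {(1, 2), (1, 3), (1, 4), (2, 3), (2, 4), (3, 4)} \<Longrightarrow> X a c d = Y a c d"
  shows "X a c d = Y a c d"
proof -
  let ?P = "{(1, 2), (1, 3), (1, 4), (2, 3), (2, 4), (3, 4)} :: (4 \<times> 4) set"
  have trichotomy: "c = d \<or> (c, d) \<in> ?P \<or> (d, c) \<in> ?P"
    using exhaust_4[of c] exhaust_4[of d] by auto
  have 0: "X a c c = 0" "Y a c c = 0" using X[of a c c] Y[of a c c] by auto
  show ?thesis
    using trichotomy eq[of c d a] eq[of d c a] X[of a c d] Y[of a c d] 0 by (metis minus_minus)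
qed

context u2
begin

text \<open>
  The divergences of the self-dual and of the anti-self-dual part. The exponents \<open>\<plusminus>3\<close> and the factor \<open>2\<close>
  say that the part is divergence-free iff \<open>w\<^sub>\<plusminus>\<^sup>2 C\<close> is a constant multiple of \<open>exp (\<minusplus>3 z)\<close>.
\<close>

definition div_plus :: "real \<Rightarrow> real" where
  "div_plus z = dlog C z * w_plus F z + 3 * w_plus F z + 2 * deriv (w_plus F) z"

definition div_minus :: "real \<Rightarrow> real" where
  "div_minus z = dlog C z * w_minus F z - 3 * w_minus F z + 2 * deriv (w_minus F) z"

lemma w_derivs:
  assumes z: "z \<in> I"
  shows "(w_plus F has_real_derivative deriv (w_plus F) z) (at z)"
    "(w_minus F has_real_derivative deriv (w_minus F) z) (at z)"
    "(deriv (w_plus F) has_real_derivative deriv (deriv (w_plus F)) z) (at z)"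
    "(deriv (w_minus F) has_real_derivative deriv (deriv (w_minus F)) z) (at z)"
    "(dlog C has_real_derivative deriv (dlog C) z) (at z)"
  using smooth_on_has_real_derivative[OF _ z] w_plus_smooth w_minus_smooth smooth_on_deriv[OF I] dlog_smooth
  by blast+

lemma C_deriv': "z \<in> I \<Longrightarrow> (C has_real_derivative dlog C z * C z) (at z)"
  using C_deriv C_nz by (simp add: dlog_def)

lemma deriv_eq_on:
  assumes z: "z \<in> I" and eq: "\<And>y. y \<in> I \<Longrightarrow> f y = h y" and h: "(h has_real_derivative d) (at z)"
  shows "deriv f z = d"
proof -
  have "(f has_real_derivative d) (at z)"
    by (rule has_field_derivative_transform_within_open[OF h I z]) (simp add: eq)
  then show ?thesis by (rule DERIV_imp_deriv)
qed

lemma weyl_comp_eq: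
  assumes z: "z \<in> I"
  shows "weyl_comp [a, b, c, d] z = C z * ((w_plus F z + w_minus F z) * weyl_diag (F z) a b c d
    + (w_plus F z - w_minus F z) * weyl_mixed (F z) a b c d)"
  using u2_weyl[OF z] by (simp add: weyl_comp_def numeral_eq_Suc)

lemma weyl_coeff_derivs:
  assumes z: "z \<in> I"
  shows "((\<lambda>z. weyl_diag (F z) a b c d) has_real_derivative deriv F z * weyl_diag' (F z) a b c d) (at z)"
    "((\<lambda>z. weyl_mixed (F z) a b c d) has_real_derivative deriv F z * weyl_mixed 1 a b c d) (at z)"
  unfolding weyl_diag_def weyl_diag'_def weyl_mixed_def
  by (auto intro!: derivative_eq_intros F_deriv[OF z] simp: algebra_simps)

lemma deriv_weyl_comp:
  assumes z: "z \<in> I"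
  shows "deriv (weyl_comp [a, b, c, d]) z = C z * (
      (dlog C z * (w_plus F z + w_minus F z) + deriv (w_plus F) z + deriv (w_minus F) z) * weyl_diag (F z) a b c d
    + (dlog C z * (w_plus F z - w_minus F z) + deriv (w_plus F) z - deriv (w_minus F) z) * weyl_mixed (F z) a b c d
    + deriv F z * ((w_plus F z + w_minus F z) * weyl_diag' (F z) a b c d
                 + (w_plus F z - w_minus F z) * weyl_mixed 1 a b c d))"
proof (rule deriv_eq_on[OF z weyl_comp_eq])
  show "((\<lambda>z. C z * ((w_plus F z + w_minus F z) * weyl_diag (F z) a b c d
    + (w_plus F z - w_minus F z) * weyl_mixed (F z) a b c d)) has_real_derivative C z * (
      (dlog C z * (w_plus F z + w_minus F z) + deriv (w_plus F) z + deriv (w_minus F) z) * weyl_diag (F z) a b c d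
    + (dlog C z * (w_plus F z - w_minus F z) + deriv (w_plus F) z - deriv (w_minus F) z) * weyl_mixed (F z) a b c d
    + deriv F z * ((w_plus F z + w_minus F z) * weyl_diag' (F z) a b c d
                 + (w_plus F z - w_minus F z) * weyl_mixed 1 a b c d))) (at z)"
    by (auto intro!: derivative_eq_intros C_deriv'[OF z] w_derivs[OF z] weyl_coeff_derivs[OF z] simp: algebra_simps)
qed

lemma frame_cov4: "frame_cov (u2_D F) (u2_gamma F C) e T [a, b, c, d] z = u2_D F e (T [a, b, c, d]) z
    - ((\<Sum>m\<in>UNIV. u2_gamma F C m e a z * T [m, b, c, d] z) + (\<Sum>m\<in>UNIV. u2_gamma F C m e b z * T [a, m, c, d] z)
     + (\<Sum>m\<in>UNIV. u2_gamma F C m e c z * T [a, b, m, d] z) + (\<Sum>m\<in>UNIV. u2_gamma F C m e d z * T [a, b, c, m] z))"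
  by (simp add: frame_cov_def)

lemma frame_cov3: "frame_cov (u2_D F) (u2_gamma F C) e T [a, b, c] z = u2_D F e (T [a, b, c]) z
    - ((\<Sum>m\<in>UNIV. u2_gamma F C m e a z * T [m, b, c] z) + (\<Sum>m\<in>UNIV. u2_gamma F C m e b z * T [a, m, c] z)
     + (\<Sum>m\<in>UNIV. u2_gamma F C m e c z * T [a, b, m] z))"
  by (simp add: frame_cov_def)

lemma u2_div:
  assumes z: "z \<in> I"
  shows "div_comp [i, j, t] z = (div_plus z + div_minus z) * div_diag (F z) i j t
    + (div_plus z - div_minus z) * div_mixed (F z) i j t"
proof -
  note nz = C_nz[OF z] F_nz[OF z]
  let ?K = "\<lambda>i j t. (div_plus z + div_minus z) * div_diag (F z) i j t
    + (div_plus z - div_minus z) * div_mixed (F z) i j t"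
  have W: "weyl_comp [a, b, c, d] y = - weyl_comp [a, b, d, c] y" if "y \<in> I" for a b c d y
    unfolding weyl_comp_eq[OF that] weyl_diag_def weyl_mixed_def w2_swaps[of c d]
    by (simp add: algebra_simps)
  have dW: "u2_D F e (weyl_comp [a, b, c, d]) z = - u2_D F e (weyl_comp [a, b, d, c]) z" for a b c d e
  proof -
    have "((\<lambda>y. - weyl_comp [a, b, d, c] y) has_real_derivative - deriv (weyl_comp [a, b, d, c]) z) (at z)"
      using smooth_on_has_real_derivative[OF weyl_comp_smooth z] by (auto intro!: derivative_eq_intros)
    from deriv_eq_on[OF z W this] show ?thesis by (simp add: u2_D_def)
  qed
  show ?thesis
  proof (rule trivector_ext[of "\<lambda>i j t. div_comp [i, j, t] z" ?K])
    show "div_comp [i, t, j] z = - div_comp [i, j, t] z" for i j t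
      unfolding div_comp_def frame_div_def gi_sum sum_negf[symmetric] frame_cov4
        dW[of _ _ i t j] W[OF z, of _ _ t j] W[OF z, of _ i _ j] W[OF z, of _ i t]
      by (simp add: sum_negf algebra_simps)
    show "?K i t j = - ?K i j t" for i j t
      unfolding div_diag_def div_mixed_def w2_swaps[of t j] by (auto simp: algebra_simps)
    have cases: "i = 1 \<or> i = 2 \<or> i = 3 \<or> i = 4" for i :: 4 by (rule exhaust_4)
    show "div_comp [i, j, t] z = ?K i j t" if "(j, t) \<in> {(1, 2), (1, 3), (1, 4), (2, 3), (2, 4), (3, 4)}" for i j t
      using that cases[of i] unfolding div_comp_def frame_div_def gi_sum
      by (elim insertE emptyE disjE;
        simp add: frame_cov4 sum_4 gamma_table gi_table u2_D_def;
        simp add: weyl_comp_eq[OF z] deriv_weyl_comp[OF z] weyl_diag_def weyl_mixed_def weyl_diag'_def w2_def;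
        simp add: div_diag_def div_mixed_def w2_def div_plus_def div_minus_def;
        simp add: nz field_simps power2_eq_square)
  qed
qed

lemma div_smooth: "smooth_on I div_plus" "smooth_on I div_minus"
  unfolding div_plus_def[abs_def] div_minus_def[abs_def]
  by (intro smooth_intros I dlog_smooth w_plus_smooth w_minus_smooth smooth_on_deriv)+

lemma deriv_div_comp:
  assumes z: "z \<in> I"
  shows "deriv (div_comp [i, j, t]) z = (deriv div_plus z + deriv div_minus z) * div_diag (F z) i j t
    + (deriv div_plus z - deriv div_minus z) * div_mixed (F z) i j t
    + deriv F z * ((div_plus z + div_minus z) * div_diag' (F z) i j t + (div_plus z - div_minus z) * div_mixed 1 i j t)"
proof (rule deriv_eq_on[OF z u2_div])
  have d: "((\<lambda>z. div_diag (F z) i j t) has_real_derivative deriv F z * div_diag' (F z) i j t) (at z)"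
    "((\<lambda>z. div_mixed (F z) i j t) has_real_derivative deriv F z * div_mixed 1 i j t) (at z)"
    unfolding div_diag_def div_diag'_def div_mixed_def
    by (auto intro!: derivative_eq_intros F_deriv[OF z] simp: algebra_simps)
  show "((\<lambda>z. (div_plus z + div_minus z) * div_diag (F z) i j t + (div_plus z - div_minus z) * div_mixed (F z) i j t)
    has_real_derivative (deriv div_plus z + deriv div_minus z) * div_diag (F z) i j t
    + (deriv div_plus z - deriv div_minus z) * div_mixed (F z) i j t
    + deriv F z * ((div_plus z + div_minus z) * div_diag' (F z) i j t + (div_plus z - div_minus z) * div_mixed 1 i j t)) (at z)"
    using smooth_on_has_real_derivative[OF div_smooth(1) z] smooth_on_has_real_derivative[OF div_smooth(2) z]
    by (auto intro!: derivative_eq_intros d simp: algebra_simps)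
qed

lemma deriv_div:
  assumes z: "z \<in> I"
  shows "deriv div_plus z = deriv (dlog C) z * w_plus F z + dlog C z * deriv (w_plus F) z
      + 3 * deriv (w_plus F) z + 2 * deriv (deriv (w_plus F)) z"
    "deriv div_minus z = deriv (dlog C) z * w_minus F z + dlog C z * deriv (w_minus F) z
      - 3 * deriv (w_minus F) z + 2 * deriv (deriv (w_minus F)) z"
  unfolding div_plus_def[abs_def] div_minus_def[abs_def]
  by (rule DERIV_imp_deriv, auto intro!: derivative_eq_intros w_derivs[OF z])+

lemma deriv_w:
  assumes z: "z \<in> I"
  shows "deriv (w_plus F) z = deriv (deriv (deriv F)) z / 2 - 3 / 2 * deriv (deriv F) z + deriv F z"
    "deriv (w_minus F) z = deriv (deriv (deriv F)) z / 2 + 3 / 2 * deriv (deriv F) z + deriv F z"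
    "deriv (deriv (w_plus F)) z = deriv (deriv (deriv (deriv F))) z / 2 - 3 / 2 * deriv (deriv (deriv F)) z + deriv (deriv F) z"
    "deriv (deriv (w_minus F)) z = deriv (deriv (deriv (deriv F))) z / 2 + 3 / 2 * deriv (deriv (deriv F)) z + deriv (deriv F) z"
proof -
  note F2 = smooth_on_deriv[OF I F1_smooth] and F3 = smooth_on_deriv[OF I smooth_on_deriv[OF I F1_smooth]]
  note d = F_deriv smooth_on_has_real_derivative[OF F1_smooth] smooth_on_has_real_derivative[OF F2]
    smooth_on_has_real_derivative[OF F3]
  have 1: "deriv (w_plus F) y = deriv (deriv (deriv F)) y / 2 - 3 / 2 * deriv (deriv F) y + deriv F y"
    and 2: "deriv (w_minus F) y = deriv (deriv (deriv F)) y / 2 + 3 / 2 * deriv (deriv F) y + deriv F y"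
    if "y \<in> I" for y
    unfolding w_plus_def[abs_def] w_minus_def[abs_def]
    by (rule DERIV_imp_deriv, auto intro!: derivative_eq_intros d[OF that])+
  show "deriv (w_plus F) z = deriv (deriv (deriv F)) z / 2 - 3 / 2 * deriv (deriv F) z + deriv F z"
    "deriv (w_minus F) z = deriv (deriv (deriv F)) z / 2 + 3 / 2 * deriv (deriv F) z + deriv F z"
    using 1 2 z by auto
  show "deriv (deriv (w_plus F)) z = deriv (deriv (deriv (deriv F))) z / 2 - 3 / 2 * deriv (deriv (deriv F)) z + deriv (deriv F) z"
    by (rule deriv_eq_on[OF z 1]) (auto intro!: derivative_eq_intros d[OF z])
  show "deriv (deriv (w_minus F)) z = deriv (deriv (deriv (deriv F))) z / 2 + 3 / 2 * deriv (deriv (deriv F)) z + deriv (deriv F) z"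
    by (rule deriv_eq_on[OF z 2]) (auto intro!: derivative_eq_intros d[OF z])
qed

text \<open>
  The Bach tensor is diagonal and has two independent components, a linear fourth-order operator and
  a quadratic third-order operator in \<open>F\<close>. The derivative of the second is \<open>- 2 F'\<close> times the first, so
  the second is a first integral of the linear equation.
\<close>

definition bach_quadratic :: "real \<Rightarrow> real" where
  "bach_quadratic z = deriv (deriv F) z ^ 2 - 2 * deriv F z * deriv (deriv (deriv F)) z
     + 5 * deriv F z ^ 2 - 4 * (F z - 1) ^ 2"

definition bach_linear :: "real \<Rightarrow> real" where
  "bach_linear z = deriv (deriv (deriv (deriv F))) z - 5 * deriv (deriv F) z + 4 * F z - 4"

lemma u2_bach:
  assumes z: "z \<in> I"
  shows "bach_comp [a, b] z = (if a \<noteq> b then 0 else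
     if a = 1 then 2 / 3 * F z * bach_quadratic z / C z else
     if a = 2 then (2 / 3 * F z * bach_quadratic z - 8 / 3 * F z ^ 2 * bach_linear z) / C z else
     (4 / 3 * F z * bach_linear z - 2 / 3 * bach_quadratic z) / C z)" (is "_ = ?K a b")
proof -
  note nz = C_nz[OF z] F_nz[OF z]
  have RW: "(\<Sum>s\<in>UNIV. \<Sum>t\<in>UNIV. \<Sum>p\<in>UNIV. \<Sum>q\<in>UNIV. u2_gi F C s p z * u2_gi F C t q z * (weyl_comp (s # [a, b] @ [t]) z * Ricf p q z))
    = (\<Sum>s\<in>UNIV. u2_gi F C s s z * u2_gi F C s s z * (weyl_comp [s, a, b, s] z * Ricf s s z))" for a b
  proof -
    have "(\<Sum>p\<in>UNIV. \<Sum>q\<in>UNIV. u2_gi F C s p z * u2_gi F C t q z * (weyl_comp [s, a, b, t] z * Ricf p q z))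
      = (if t = s then u2_gi F C s s z * u2_gi F C s s z * (weyl_comp [s, a, b, s] z * Ricf s s z) else 0)" for s t
      by (simp add: mult.assoc sum_distrib_left[symmetric] gi_sum) (simp add: u2_ricci[OF z])
    then show ?thesis by simp
  qed
  have "\<forall>a b. bach_comp [a, b] z = ?K a b"
    unfolding forall_4 bach_comp_def gi_sum RW append_Cons append_Nil
    by (intro conjI;
      simp add: frame_cov3 sum_4 gamma_table gi_table u2_D_def;
      simp add: u2_div[OF z] deriv_div_comp[OF z] weyl_comp_eq[OF z] u2_ricci[OF z] weyl_diag_def weyl_mixed_def
        div_diag_def div_diag'_def div_mixed_def w2_def;
      simp add: deriv_div[OF z] div_plus_def div_minus_def deriv_w[OF z];
      simp add: w_plus_def w_minus_def bach_quadratic_def bach_linear_def;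
      simp add: nz field_simps power2_eq_square)
  then show ?thesis by blast
qed

text \<open>This lemma, \<open>u2_gradient_norm\<close> and \<open>u2_trace_weyl\<close> give the scalar invariants by which metrics are told apart later.\<close>

lemma u2_div_norm:
  assumes z: "z \<in> I"
  shows "tensor_inner (u2_gi F C) 3 div_comp div_comp z = 8 / 3 * F z * (div_plus z ^ 2 + div_minus z ^ 2) / C z ^ 3"
proof -
  have "tensor_inner (u2_gi F C) 3 div_comp div_comp z
    = (\<Sum>a\<in>UNIV. u2_gi F C a a z * (\<Sum>b\<in>UNIV. u2_gi F C b b z * (\<Sum>c\<in>UNIV. u2_gi F C c c z * (div_comp [a, b, c] z * div_comp [a, b, c] z))))"
    by (simp add: numeral_3_eq_3 gi_sum)
  also have "\<dots> = 8 / 3 * F z * (div_plus z ^ 2 + div_minus z ^ 2) / C z ^ 3"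
  proof -
    define P Q f c where "P = div_plus z + div_minus z" and "Q = div_plus z - div_minus z" and "f = F z" and "c = C z"
    have nz: "f \<noteq> 0" "c \<noteq> 0" using C_nz[OF z] F_nz[OF z] by (auto simp: f_def c_def)
    define S where "S a = u2_gi F C a a z * (\<Sum>b\<in>UNIV. u2_gi F C b b z * (\<Sum>d\<in>UNIV. u2_gi F C d d z * (div_comp [a, b, d] z * div_comp [a, b, d] z)))" for a
    note tab = S_def u2_div[OF z] P_def[symmetric] Q_def[symmetric] sum_4 gi_table f_def[symmetric] c_def[symmetric]
      div_diag_def div_mixed_def w2_def
    have "S 1 = 0" by (simp add: tab)
    moreover have "S 2 = 8 / 9 * (f * (P ^ 2 + Q ^ 2) / c ^ 3)"
      using nz by (simp add: tab; simp add: field_simps power2_eq_square power3_eq_cube power4_eq_xxxx)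
    moreover have "S 3 = 2 / 9 * (f * (P ^ 2 + Q ^ 2) / c ^ 3)"
      using nz by (simp add: tab; simp add: field_simps power2_eq_square power3_eq_cube power4_eq_xxxx)
    moreover have "S 4 = 2 / 9 * (f * (P ^ 2 + Q ^ 2) / c ^ 3)"
      using nz by (simp add: tab; simp add: field_simps power2_eq_square power3_eq_cube power4_eq_xxxx)
    moreover have PQ: "P ^ 2 + Q ^ 2 = 2 * (div_plus z ^ 2 + div_minus z ^ 2)"
      by (simp add: P_def Q_def algebra_simps power2_eq_square)
    ultimately have "(\<Sum>a\<in>UNIV. S a) = 4 / 3 * (f * (P ^ 2 + Q ^ 2) / c ^ 3)"
      unfolding sum_4[of S] by linarith
    also have "\<dots> = 8 / 3 * F z * (div_plus z ^ 2 + div_minus z ^ 2) / C z ^ 3"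
      unfolding PQ by (simp add: f_def c_def)
    finally show ?thesis by (simp only: S_def)
  qed
  finally show ?thesis .
qed

lemma u2_gradient_norm:
  assumes z: "z \<in> I"
  shows "tensor_inner (u2_gi F C) 1 (\<lambda>as. u2_D F (hd as) f) (\<lambda>as. u2_D F (hd as) f) z = 4 * F z * deriv f z ^ 2 / C z"
  using C_nz[OF z] F_nz[OF z]
  by (simp add: gi_sum sum_4 gi_table u2_D_def) (simp add: field_simps power2_eq_square)

lemma gi_sym: "u2_gi F C a b = u2_gi F C b a"
  by (simp add: u2_gi_def)

lemma u2_trace_weyl:
  assumes z: "z \<in> I"
  shows "trace (raise2 (u2_gi F C) Wf z ** raise2 (u2_gi F C) Wf z) = 32 / 3 * (w_plus F z ^ 2 + w_minus F z ^ 2) / C z ^ 2"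
    "trace (raise2 (u2_gi F C) Wf z ** raise2 (u2_gi F C) Wf z ** raise2 (u2_gi F C) Wf z)
      = 128 / 9 * (w_plus F z ^ 3 + w_minus F z ^ 3) / C z ^ 3"
proof -
  note nz = C_nz[OF z] F_nz[OF z]
  let ?M = "raise2 (u2_gi F C) Wf z"
  define u v f where "u = w_plus F z" and "v = w_minus F z" and "f = F z"
  have f: "f \<noteq> 0" using nz by (simp add: f_def)
  have pr: "(\<Sum>p\<in>(UNIV :: (4 \<times> 4) set). X p) = (\<Sum>a\<in>UNIV. \<Sum>b\<in>UNIV. X (a, b))" for X :: "4 \<times> 4 \<Rightarrow> real"
    by (simp add: sum.cartesian_product)
  define N where "N a b c d = ((u + v) * (2 / 3 * (w2 1 2 a b * w2 1 2 c d + w2 3 4 a b * w2 3 4 c d)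
      - 1 / 3 * (w2 1 3 a b * w2 1 3 c d + w2 1 4 a b * w2 1 4 c d + w2 2 3 a b * w2 2 3 c d + w2 2 4 a b * w2 2 4 c d))
    + (u - v) * (2 / 3 * (f * (w2 1 2 a b * w2 3 4 c d) + w2 3 4 a b * w2 1 2 c d / f)
      + 1 / 3 * (w2 1 3 a b * w2 2 4 c d + w2 2 4 a b * w2 1 3 c d - w2 1 4 a b * w2 2 3 c d - w2 2 3 a b * w2 1 4 c d)))" for a b c d
  have M: "?M $ (a, b) $ (c, d) = N a b c d / C z" for a b c d
  proof -
    have 1: "?M $ (a, b) $ (c, d) = Wf a b c d z * (u2_gi F C c c z * u2_gi F C d d z)"
    proof -
      have "?M $ (a, b) $ (c, d) = (\<Sum>p\<in>UNIV. \<Sum>q\<in>UNIV. u2_gi F C c p z * (u2_gi F C d q z * Wf a b p q z))"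
        by (simp add: raise2_def gi_sym[of c] gi_sym[of d] mult_ac)
      then show ?thesis by (simp add: sum_distrib_left[symmetric] gi_sum mult_ac)
    qed
    have "\<forall>c d. Wf a b c d z * (u2_gi F C c c z * u2_gi F C d d z) = N a b c d / C z"
      unfolding forall_4 u2_weyl[OF z] N_def u_def[symmetric] v_def[symmetric] f_def[symmetric]
      by (intro conjI; simp add: gi_table weyl_diag_def weyl_mixed_def w2_def f_def[symmetric]; simp add: nz f field_simps power2_eq_square)
    with 1 show ?thesis by simp
  qed
  define N2 where "N2 a b c d = ((u ^ 2 + v ^ 2) * (16 / 9 * (w2 1 2 a b * w2 1 2 c d + w2 3 4 a b * w2 3 4 c d)
      + 4 / 9 * (w2 1 3 a b * w2 1 3 c d + w2 1 4 a b * w2 1 4 c d + w2 2 3 a b * w2 2 3 c d + w2 2 4 a b * w2 2 4 c d))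
    + (u ^ 2 - v ^ 2) * (16 / 9 * (f * (w2 1 2 a b * w2 3 4 c d) + w2 3 4 a b * w2 1 2 c d / f)
      - 4 / 9 * (w2 1 3 a b * w2 2 4 c d + w2 2 4 a b * w2 1 3 c d - w2 1 4 a b * w2 2 3 c d - w2 2 3 a b * w2 1 4 c d)))" for a b c d
  have NN: "(\<Sum>p\<in>UNIV. \<Sum>q\<in>UNIV. N a b p q * N p q c d) = N2 a b c d" for a b c d
    unfolding N_def sum_4 using f
    by (simp add: w2_def[of _ _ 1] w2_def[of _ _ 2] w2_def[of _ _ 3] w2_def[of _ _ 4])
      (simp add: N2_def field_simps power2_eq_square)
  have M2: "(?M ** ?M) $ (a, b) $ (c, d) = N2 a b c d / C z ^ 2" for a b c d
    by (simp add: matrix_mult_nth pr M NN[symmetric] sum_divide_distrib power2_eq_square)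
  show "trace (?M ** ?M) = 32 / 3 * (w_plus F z ^ 2 + w_minus F z ^ 2) / C z ^ 2"
    unfolding trace_def pr M2 N2_def sum_4 using nz f
    by (simp add: w2_def u_def v_def) (simp add: field_simps power2_eq_square)
  have M3: "trace (?M ** ?M ** ?M) = (\<Sum>a\<in>UNIV. \<Sum>b\<in>UNIV. \<Sum>c\<in>UNIV. \<Sum>d\<in>UNIV. N2 a b c d * N c d a b) / C z ^ 3"
    unfolding trace_def pr
    by (simp add: matrix_mult_nth[of "?M ** ?M"] pr M M2 sum_divide_distrib power2_eq_square power3_eq_cube)
  have NNN: "\<forall>a b. (\<Sum>c\<in>UNIV. \<Sum>d\<in>UNIV. N2 a b c d * N c d a b) = (u ^ 3 + v ^ 3) *
    (128 / 27 * (w2 1 2 a b ^ 2 + w2 3 4 a b ^ 2) - 16 / 27 * (w2 1 3 a b ^ 2 + w2 1 4 a b ^ 2 + w2 2 3 a b ^ 2 + w2 2 4 a b ^ 2))"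
    unfolding forall_4 N_def N2_def sum_4 using f
    by (intro conjI; simp add: w2_def; simp add: field_simps power2_eq_square power3_eq_cube)
  show "trace (?M ** ?M ** ?M) = 128 / 9 * (w_plus F z ^ 3 + w_minus F z ^ 3) / C z ^ 3"
  proof -
    have tot: "(\<Sum>a\<in>UNIV. \<Sum>b\<in>UNIV. (u ^ 3 + v ^ 3) * (128 / 27 * (w2 1 2 a b ^ 2 + w2 3 4 a b ^ 2)
        - 16 / 27 * (w2 1 3 a b ^ 2 + w2 1 4 a b ^ 2 + w2 2 3 a b ^ 2 + w2 2 4 a b ^ 2))) = 128 / 9 * (u ^ 3 + v ^ 3)"
      unfolding sum_4 by (simp add: w2_def field_simps)
    show ?thesis unfolding M3 NNN[rule_format] tot by (simp add: u_def v_def)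
  qed
qed

end

section \<open>The self-dual and the anti-self-dual Weyl tensor\<close>

lemma det_4:
  fixes A :: "real^4^4"
  shows "det A =
      A$1$1 * (A$2$2 * (A$3$3 * A$4$4 - A$3$4 * A$4$3) - A$2$3 * (A$3$2 * A$4$4 - A$3$4 * A$4$2) + A$2$4 * (A$3$2 * A$4$3 - A$3$3 * A$4$2))
    - A$1$2 * (A$2$1 * (A$3$3 * A$4$4 - A$3$4 * A$4$3) - A$2$3 * (A$3$1 * A$4$4 - A$3$4 * A$4$1) + A$2$4 * (A$3$1 * A$4$3 - A$3$3 * A$4$1))
    + A$1$3 * (A$2$1 * (A$3$2 * A$4$4 - A$3$4 * A$4$2) - A$2$2 * (A$3$1 * A$4$4 - A$3$4 * A$4$1) + A$2$4 * (A$3$1 * A$4$2 - A$3$2 * A$4$1))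
    - A$1$4 * (A$2$1 * (A$3$2 * A$4$3 - A$3$3 * A$4$2) - A$2$2 * (A$3$1 * A$4$3 - A$3$3 * A$4$1) + A$2$3 * (A$3$1 * A$4$2 - A$3$2 * A$4$1))"
proof -
  have f1: "finite {2::4, 3, 4}" "1 \<notin> {2::4, 3, 4}" by auto
  have f2: "finite {3::4, 4}" "2 \<notin> {3::4, 4}" by auto
  have f3: "finite {4::4}" "3 \<notin> {4::4}" by auto
  show ?thesis
    unfolding det_def UNIV_4
    unfolding sum_over_permutations_insert[OF f1]
    unfolding sum_over_permutations_insert[OF f2]
    unfolding sum_over_permutations_insert[OF f3]
    unfolding permutes_sing
    by (simp add: sign_swap_id permutation_swap_id permutation_compose sign_compose sign_id swap_id_eq algebra_simps)
qed

definition eps :: "4 \<Rightarrow> 4 \<Rightarrow> 4 \<Rightarrow> 4 \<Rightarrow> real" where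
  "eps a b c d = det (vector [axis a 1, axis b 1, axis c 1, axis d 1] :: real^4^4)"

lemma vector4_nth:
  "(vector [a, b, c, d] :: real^4^4) $ 1 = a" "(vector [a, b, c, d] :: real^4^4) $ 2 = b"
  "(vector [a, b, c, d] :: real^4^4) $ 3 = c" "(vector [a, b, c, d] :: real^4^4) $ 4 = d"
  by (simp_all add: vector_def)

lemma det_row_expand:
  fixes p q r s :: "real^4"
  shows "(\<Sum>a\<in>UNIV. p $ a * det (vector [axis a 1, q, r, s] :: real^4^4)) = det (vector [p, q, r, s] :: real^4^4)"
    "(\<Sum>a\<in>UNIV. q $ a * det (vector [p, axis a 1, r, s] :: real^4^4)) = det (vector [p, q, r, s] :: real^4^4)"
    "(\<Sum>a\<in>UNIV. r $ a * det (vector [p, q, axis a 1, s] :: real^4^4)) = det (vector [p, q, r, s] :: real^4^4)"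
    "(\<Sum>a\<in>UNIV. s $ a * det (vector [p, q, r, axis a 1] :: real^4^4)) = det (vector [p, q, r, s] :: real^4^4)"
  by (simp_all add: sum_4 det_4 vector4_nth axis_def algebra_simps)

lemma eps_expand:
  "(\<Sum>a\<in>UNIV. \<Sum>b\<in>UNIV. \<Sum>c\<in>UNIV. \<Sum>d\<in>UNIV. p $ a * (q $ b * (r $ c * (s $ d * eps a b c d))))
    = det (vector [p, q, r, s] :: real^4^4)"
  by (simp only: eps_def sum_distrib_left[symmetric] det_row_expand)

lemma sqrt_det_positive:
  assumes "0 < a" "0 < (d::real)" shows "sqrt (d * (a * a) * d) = a * d"
  using assms by (simp add: real_sqrt_mult)

context u2
begin

text \<open>The invariant frame is positively oriented, so the volume form is the positive multiple of \<open>eps\<close> in the frame.\<close>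

lemma det_coframe:
  assumes x: "x \<in> cyl I" shows "0 < det (\<Theta> x)"
proof -
  have x0: "x \<bullet> x > 0" and F: "F (zcoord x) > 0" using x F_pos by (auto simp: cyl_def)
  define M :: "real^4^4" where "M = vector [x, e1 x, e2 x, e3 x]"
  have "det M = (x \<bullet> x) ^ 2"
    by (simp add: M_def det_4 vector4_nth e1_def e2_def e3_def vec4_nth inner4 power2_eq_square algebra_simps)
  define k where "k a = (if a = (1::4) then 1 / (2 * F (zcoord x)) else 1) / (x \<bullet> x)" for a
  have "\<Theta> x = (\<chi> a. k a *\<^sub>R M $ a)"
    unfolding vec_eq_iff forall_4[of "\<lambda>a. \<forall>i. _ a i"]
    by (simp add: \<Theta>_def u2_coframe_def M_def vector4_nth k_def dz_def eta1_def eta2_def eta3_def e0_def divide_simps)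
  then have "det (\<Theta> x) = k 1 * k 2 * k 3 * k 4 * det M"
    by (simp add: det_4 algebra_simps)
  also have "\<dots> > 0" unfolding \<open>det M = _\<close> using x0 F by (simp add: k_def)
  finally show ?thesis .
qed

lemma vol_form_frame:
  assumes x: "x \<in> cyl I"
  shows "vol_form (u2_metric F C) i j k l x = C (zcoord x) ^ 2 * F (zcoord x) *
    (\<Sum>a\<in>UNIV. \<Sum>b\<in>UNIV. \<Sum>c\<in>UNIV. \<Sum>d\<in>UNIV.
       u2_coframe F a i x * (u2_coframe F b j x * (u2_coframe F c k x * (u2_coframe F d l x * eps a b c d))))"
proof -
  let ?c = "C (zcoord x)" and ?f = "F (zcoord x)"
  have z: "zcoord x \<in> I" using x by (simp add: cyl_def)
  have "det (u2_metric F C x) = det (\<Theta> x) * det (\<chi> a b. u2_gf F C a b (zcoord x) :: real^4^4) * det (\<Theta> x)"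
    unfolding g_matrix[OF x] by (simp add: det_mul)
  also have "det (\<chi> a b. u2_gf F C a b (zcoord x) :: real^4^4) = (?c ^ 2 * ?f) * (?c ^ 2 * ?f)"
    by (simp add: det_4 u2_gf_def power2_eq_square)
  finally have d: "sqrt (det (u2_metric F C x)) = ?c ^ 2 * ?f * det (\<Theta> x)"
    using sqrt_det_positive[of "?c ^ 2 * ?f" "det (\<Theta> x)"] det_coframe[OF x] F_pos[OF z] C_pos[OF z] by simp
  define t where "t i = (\<chi> a. u2_coframe F a i x)" for i
  have "(vector [t i, t j, t k, t l] :: real^4^4) = vector [axis i 1, axis j 1, axis k 1, axis l 1] ** transpose (\<Theta> x)"
    unfolding vec_eq_iff forall_4[of "\<lambda>a. \<forall>i. _ a i"]
    by (simp add: matrix_mult_nth vector4_nth transpose_def t_def \<Theta>_def axis_def if_distrib[of "\<lambda>r. r * _"] cong: if_cong)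
  then have "det (vector [t i, t j, t k, t l] :: real^4^4) = eps i j k l * det (\<Theta> x)"
    by (simp add: det_mul eps_def)
  then show ?thesis
    unfolding vol_form_def d eps_def[symmetric] eps_expand[of "t i" "t j" "t k" "t l", symmetric]
    by (simp add: t_def eps_expand[of "t i" "t j" "t k" "t l", symmetric])
qed

definition star_frame :: "4 \<Rightarrow> 4 \<Rightarrow> 4 \<Rightarrow> 4 \<Rightarrow> real \<Rightarrow> real" where
  "star_frame a b c d z = (\<Sum>m\<in>UNIV. \<Sum>n\<in>UNIV. u2_gi F C m m z * u2_gi F C n n z *
     (C z ^ 2 * F z * eps a b m n * Wf m n c d z)) / 2"

lemma star_weyl_tens:
  assumes x: "x \<in> cyl I"
  shows "star_weyl (u2_metric F C) i j k l x
    = tens (u2_coframe F) zcoord (\<lambda>as. star_frame (as ! 0) (as ! 1) (as ! 2) (as ! 3)) [i, j, k, l] x"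
proof -
  let ?g = "u2_metric F C" and ?z = "zcoord x" and ?\<theta> = "\<lambda>a i. u2_coframe F a i x"
  let ?v = "C (zcoord x) ^ 2 * F (zcoord x)"
  define T where "T is = vol_form ?g i j (is ! 0) (is ! 1) x" for "is"
  define T' where "T' is = weyl ?g (is ! 0) (is ! 1) k l x" for "is"
  define Vf where "Vf as = ?v * (\<Sum>a\<in>UNIV. \<Sum>b\<in>UNIV. ?\<theta> a i * (?\<theta> b j * eps a b (as ! 0) (as ! 1)))" for as
  define Yf where "Yf as = (\<Sum>c\<in>UNIV. \<Sum>d\<in>UNIV. ?\<theta> c k * (?\<theta> d l * Wf (as ! 0) (as ! 1) c d ?z))" for as
  have "star_weyl ?g i j k l x = (\<Sum>a\<in>UNIV. \<Sum>b\<in>UNIV. \<Sum>c\<in>UNIV. \<Sum>d\<in>UNIV.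
      ginv ?g x $ c $ a * (ginv ?g x $ d $ b * (T [c, d] * T' [a, b]))) / 2"
    by (simp add: star_weyl_def T_def T'_def mult_ac)
  also have "(\<Sum>a\<in>UNIV. \<Sum>b\<in>UNIV. \<Sum>c\<in>UNIV. \<Sum>d\<in>UNIV. ginv ?g x $ c $ a * (ginv ?g x $ d $ b * (T [c, d] * T' [a, b])))
    = (\<Sum>c\<in>UNIV. \<Sum>d\<in>UNIV. \<Sum>a\<in>UNIV. \<Sum>b\<in>UNIV. ginv ?g x $ c $ a * (ginv ?g x $ d $ b * (T [c, d] * T' [a, b])))"
    by (rule sum_rotate4)
  also have "\<dots> = (\<Sum>c\<in>UNIV. \<Sum>a\<in>UNIV. \<Sum>d\<in>UNIV. \<Sum>b\<in>UNIV. ginv ?g x $ c $ a * (ginv ?g x $ d $ b * (T [c, d] * T' [a, b])))"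
    by (intro sum.cong refl sum.swap)
  also have "\<dots> = inner_of ?g 2 (\<lambda>is y. T is) (\<lambda>is y. T' is) x"
    by (simp add: numeral_2_eq_2 sum_distrib_left)
  also have "\<dots> = inner_of ?g 2 (tens (u2_coframe F) zcoord (\<lambda>as y. Vf as)) (tens (u2_coframe F) zcoord (\<lambda>as y. Yf as)) x"
  proof (rule tensor_inner_cong)
    fix as :: "4 list" assume "length as = 2"
    then obtain p q where as: "as = [p, q]" unfolding length2 by blast
    have "T as = ?v * (\<Sum>a\<in>UNIV. \<Sum>b\<in>UNIV. \<Sum>c\<in>UNIV. \<Sum>d\<in>UNIV. ?\<theta> a i * (?\<theta> b j * (?\<theta> c p * (?\<theta> d q * eps a b c d))))"
      by (simp add: T_def as vol_form_frame[OF x])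
    also have "\<dots> = ?v * (\<Sum>c\<in>UNIV. \<Sum>d\<in>UNIV. \<Sum>a\<in>UNIV. \<Sum>b\<in>UNIV. ?\<theta> a i * (?\<theta> b j * (?\<theta> c p * (?\<theta> d q * eps a b c d))))"
      by (subst sum_rotate4) simp
    also have "\<dots> = tens (u2_coframe F) zcoord (\<lambda>as y. Vf as) as x"
      unfolding as tens2 by (simp add: Vf_def sum_distrib_left mult_ac)
    finally show "T as = tens (u2_coframe F) zcoord (\<lambda>as y. Vf as) as x" .
    have "T' as = (\<Sum>a\<in>UNIV. \<Sum>b\<in>UNIV. \<Sum>c\<in>UNIV. \<Sum>d\<in>UNIV. ?\<theta> a p * (?\<theta> b q * (?\<theta> c k * (?\<theta> d l * Wf a b c d ?z))))"
      by (simp add: T'_def as weyl_tens4[OF x] tens4 numeral_eq_Suc del: tens.simps)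
    also have "\<dots> = tens (u2_coframe F) zcoord (\<lambda>as y. Yf as) as x"
      unfolding as tens2 by (simp add: Yf_def sum_distrib_left mult_ac)
    finally show "T' as = tens (u2_coframe F) zcoord (\<lambda>as y. Yf as) as x" .
  qed
  also have "\<dots> = (\<Sum>m\<in>UNIV. u2_gi F C m m ?z * (\<Sum>n\<in>UNIV. u2_gi F C n n ?z * (Vf [m, n] * Yf [m, n])))"
    unfolding tensor_inner_tens[OF x] by (simp add: numeral_2_eq_2 gi_sum)
  also have "\<dots> = (\<Sum>m\<in>UNIV. \<Sum>n\<in>UNIV. \<Sum>a\<in>UNIV. \<Sum>b\<in>UNIV. \<Sum>c\<in>UNIV. \<Sum>d\<in>UNIV.
      ?\<theta> a i * (?\<theta> b j * (?\<theta> c k * (?\<theta> d l * (u2_gi F C m m ?z * u2_gi F C n n ?z * (?v * eps a b m n * Wf m n c d ?z))))))"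
  proof (intro sum.cong refl, unfold sum_distrib_left, intro sum.cong refl)
    fix m n
    have "Vf [m, n] * Yf [m, n] = ?v * (\<Sum>a\<in>UNIV. \<Sum>b\<in>UNIV. \<Sum>c\<in>UNIV. \<Sum>d\<in>UNIV.
        (?\<theta> a i * (?\<theta> b j * eps a b m n)) * (?\<theta> c k * (?\<theta> d l * Wf m n c d ?z)))"
      unfolding sum_product4[symmetric] by (simp add: Vf_def Yf_def)
    then show "u2_gi F C m m ?z * (u2_gi F C n n ?z * (Vf [m, n] * Yf [m, n]))
      = (\<Sum>a\<in>UNIV. \<Sum>b\<in>UNIV. \<Sum>c\<in>UNIV. \<Sum>d\<in>UNIV. ?\<theta> a i * (?\<theta> b j * (?\<theta> c k * (?\<theta> d l *
          (u2_gi F C m m ?z * u2_gi F C n n ?z * (?v * eps a b m n * Wf m n c d ?z))))))"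
      by (simp only: sum_distrib_left mult_ac)
  qed
  also have "\<dots> = (\<Sum>a\<in>UNIV. \<Sum>b\<in>UNIV. \<Sum>c\<in>UNIV. \<Sum>d\<in>UNIV. \<Sum>m\<in>UNIV. \<Sum>n\<in>UNIV.
      ?\<theta> a i * (?\<theta> b j * (?\<theta> c k * (?\<theta> d l * (u2_gi F C m m ?z * u2_gi F C n n ?z * (?v * eps a b m n * Wf m n c d ?z))))))"
    by (subst sum_rotate4) (intro sum.cong refl sum_rotate4)
  finally show ?thesis
    unfolding tens4 by (simp add: star_frame_def sum_distrib_left sum_divide_distrib numeral_eq_Suc)
qed

text \<open>The star exchanges \<open>weyl_diag\<close> and \<open>weyl_mixed\<close>, so their sum and difference span the two eigenspaces.\<close>

lemma star_frame_eq:
  assumes z: "z \<in> I"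
  shows "star_frame a b c d z = C z * ((w_plus F z - w_minus F z) * weyl_diag (F z) a b c d
    + (w_plus F z + w_minus F z) * weyl_mixed (F z) a b c d)" (is "_ = ?K a b c d")
proof (rule bivector_ext[of "\<lambda>a b c d. star_frame a b c d z" ?K])
  have e: "eps b a c d = - eps a b c d" for a b c d
    by (simp add: eps_def det_4 vector4_nth algebra_simps)
  show "star_frame b a c d z = - star_frame a b c d z" for a b c d
    unfolding star_frame_def e[of b a] by (simp add: sum_negf)
  show "star_frame a b d c z = - star_frame a b c d z" for a b c d
  proof -
    have "Wf m n d c z = - Wf m n c d z" for m n
      unfolding u2_weyl[OF z] weyl_diag_def weyl_mixed_def w2_swaps[of d c] by (simp add: algebra_simps)
    then show ?thesis unfolding star_frame_def by (simp add: sum_negf)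
  qed
  show "?K b a c d = - ?K a b c d" "?K a b d c = - ?K a b c d" for a b c d
    unfolding weyl_diag_def weyl_mixed_def w2_swaps[of b a] w2_swaps[of d c]
    by (simp_all add: algebra_simps)
  show "star_frame a b c d z = ?K a b c d"
    if "(a, b) \<in> {(1, 2), (1, 3), (1, 4), (2, 3), (2, 4), (3, 4)}" "(c, d) \<in> {(1, 2), (1, 3), (1, 4), (2, 3), (2, 4), (3, 4)}"
    for a b c d
    using that C_nz[OF z] F_nz[OF z] unfolding star_frame_def sum_4
    by (elim insertE emptyE; simp add: eps_def det_4 vector4_nth axis_def;
      simp add: u2_weyl[OF z] gi_table weyl_diag_def weyl_mixed_def w2_def; simp add: field_simps power2_eq_square)
qed

lemma exists_zcoord: "z \<in> I \<Longrightarrow> \<exists>x\<in>cyl I. zcoord x = z"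
  by (intro bexI[of _ "exp z *\<^sub>R axis 1 1"]) (auto simp: cyl_def zcoord_def norm_eq_sqrt_inner inner_axis_axis)

lemma weyl_half_zero_iff:
  assumes W: "\<And>i j k l x. x \<in> cyl I \<Longrightarrow> W i j k l x = tens (u2_coframe F) zcoord
      (\<lambda>as z. C z * w z * (weyl_diag (F z) (as ! 0) (as ! 1) (as ! 2) (as ! 3) + s * weyl_mixed (F z) (as ! 0) (as ! 1) (as ! 2) (as ! 3)))
      [i, j, k, l] x"
  shows "(\<forall>x\<in>cyl I. \<forall>i j k l. W i j k l x = 0) \<longleftrightarrow> (\<forall>z\<in>I. w z = 0)"
proof
  assume "\<forall>z\<in>I. w z = 0"
  then show "\<forall>x\<in>cyl I. \<forall>i j k l. W i j k l x = 0"
    using W base by (simp add: tens4 del: tens.simps)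
next
  let ?T = "\<lambda>as z. C z * w z * (weyl_diag (F z) (as ! 0) (as ! 1) (as ! 2) (as ! 3) + s * weyl_mixed (F z) (as ! 0) (as ! 1) (as ! 2) (as ! 3))"
  assume L: "\<forall>x\<in>cyl I. \<forall>i j k l. W i j k l x = 0"
  show "\<forall>z\<in>I. w z = 0"
  proof
    fix z assume z: "z \<in> I"
    obtain x where x: "x \<in> cyl I" "zcoord x = z" using exists_zcoord[OF z] by blast
    have "\<forall>is. length is = 4 \<longrightarrow> tens (u2_coframe F) zcoord ?T is x = 0"
      using L W[OF x(1)] x(1) unfolding length4 by auto
    then have "\<forall>as. length as = 4 \<longrightarrow> ?T as z = 0"
      unfolding tens_zero_iff[OF x(1)] x(2) .
    \<comment> \<open>Here \<open>weyl_diag\<close> is 2/3 and \<open>weyl_mixed\<close> vanishes.\<close>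
    from this[rule_format, of "[3, 4, 3, 4]"] show "w z = 0"
      using C_nz[OF z] by (simp add: weyl_diag_def weyl_mixed_def w2_def numeral_eq_Suc)
  qed
qed

lemma weyl_plus_zero_iff: "weyl_plus_zero (cyl I) (u2_metric F C) \<longleftrightarrow> (\<forall>z\<in>I. w_plus F z = 0)"
  unfolding weyl_plus_zero_def
proof (rule weyl_half_zero_iff[where s=1])
  fix i j k l x assume x: "x \<in> cyl I"
  then have z: "zcoord x \<in> I" by (simp add: cyl_def)
  have "weyl_plus (u2_metric F C) i j k l x = (1 / 2) * tens (u2_coframe F) zcoord
      (\<lambda>as z. Wf (as ! 0) (as ! 1) (as ! 2) (as ! 3) z + star_frame (as ! 0) (as ! 1) (as ! 2) (as ! 3) z) [i, j, k, l] x"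
    unfolding weyl_plus_def weyl_tens4[OF x] star_weyl_tens[OF x] tens_add by simp
  also have "\<dots> = tens (u2_coframe F) zcoord (\<lambda>as z. (1 / 2) *
      (Wf (as ! 0) (as ! 1) (as ! 2) (as ! 3) z + star_frame (as ! 0) (as ! 1) (as ! 2) (as ! 3) z)) [i, j, k, l] x"
    unfolding tens_scale ..
  also have "\<dots> = tens (u2_coframe F) zcoord (\<lambda>as z. C z * w_plus F z *
      (weyl_diag (F z) (as ! 0) (as ! 1) (as ! 2) (as ! 3) + 1 * weyl_mixed (F z) (as ! 0) (as ! 1) (as ! 2) (as ! 3))) [i, j, k, l] x"
    by (rule tens_cong) (simp add: u2_weyl[OF z] star_frame_eq[OF z] algebra_simps)
  finally show "weyl_plus (u2_metric F C) i j k l x = \<dots>" .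
qed

lemma weyl_minus_zero_iff: "weyl_minus_zero (cyl I) (u2_metric F C) \<longleftrightarrow> (\<forall>z\<in>I. w_minus F z = 0)"
  unfolding weyl_minus_zero_def
proof (rule weyl_half_zero_iff[where s="-1"])
  fix i j k l x assume x: "x \<in> cyl I"
  then have z: "zcoord x \<in> I" by (simp add: cyl_def)
  have "weyl_minus (u2_metric F C) i j k l x = (1 / 2) * tens (u2_coframe F) zcoord
      (\<lambda>as z. Wf (as ! 0) (as ! 1) (as ! 2) (as ! 3) z - star_frame (as ! 0) (as ! 1) (as ! 2) (as ! 3) z) [i, j, k, l] x"
    unfolding weyl_minus_def weyl_tens4[OF x] star_weyl_tens[OF x] tens_diff by simp
  also have "\<dots> = tens (u2_coframe F) zcoord (\<lambda>as z. (1 / 2) *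
      (Wf (as ! 0) (as ! 1) (as ! 2) (as ! 3) z - star_frame (as ! 0) (as ! 1) (as ! 2) (as ! 3) z)) [i, j, k, l] x"
    unfolding tens_scale ..
  also have "\<dots> = tens (u2_coframe F) zcoord (\<lambda>as z. C z * w_minus F z *
      (weyl_diag (F z) (as ! 0) (as ! 1) (as ! 2) (as ! 3) + - 1 * weyl_mixed (F z) (as ! 0) (as ! 1) (as ! 2) (as ! 3))) [i, j, k, l] x"
    by (rule tens_cong) (simp add: u2_weyl[OF z] star_frame_eq[OF z] algebra_simps)
  finally show "weyl_minus (u2_metric F C) i j k l x = \<dots>" .
qed

lemma bach_flat_iff:
  "bach_flat (cyl I) (u2_metric F C) \<longleftrightarrow> (\<forall>z\<in>I. bach_linear z = 0 \<and> bach_quadratic z = 0)"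
proof -
  have pt: "(\<forall>a b. bach_comp [a, b] z = 0) \<longleftrightarrow> bach_linear z = 0 \<and> bach_quadratic z = 0" if z: "z \<in> I" for z
    unfolding forall_4 u2_bach[OF z] using C_nz[OF z] F_nz[OF z] by (auto simp: power2_eq_square)
  have "bach_flat (cyl I) (u2_metric F C) \<longleftrightarrow> (\<forall>x\<in>cyl I. \<forall>a b. bach_comp [a, b] (zcoord x) = 0)"
    unfolding bach_flat_def using bach_zero_iff by blast
  also have "\<dots> \<longleftrightarrow> (\<forall>z\<in>I. \<forall>a b. bach_comp [a, b] z = 0)"
    using exists_zcoord base by (metis (no_types, lifting))
  finally show ?thesis using pt by simp
qed

end

section \<open>Naturality under diffeomorphisms\<close>

lemma vec_axis_sum: "(v :: real^4) = (\<Sum>a\<in>UNIV. v $ a *\<^sub>R axis a 1)"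
  unfolding vec_eq_iff by (simp add: axis_def if_distrib[of "\<lambda>r. _ * r"] cong: if_cong)

lemma chain_rule:
  fixes \<phi> :: "real^4 \<Rightarrow> real^4"
  assumes \<phi>: "\<phi> differentiable (at x)" and f: "f differentiable (at (\<phi> x))"
  shows "(\<lambda>y. f (\<phi> y)) differentiable (at x)"
    and "pd i (\<lambda>y. f (\<phi> y)) x = (\<Sum>a\<in>UNIV. pd i (\<lambda>y. \<phi> y $ a) x * pd a f (\<phi> x))"
proof -
  have d\<phi>: "(\<phi> has_derivative frechet_derivative \<phi> (at x)) (at x)"
    and df: "(f has_derivative frechet_derivative f (at (\<phi> x))) (at (\<phi> x))"
    using assms frechet_derivative_works by blast+
  have c: "((\<lambda>y. f (\<phi> y)) has_derivative (\<lambda>v. frechet_derivative f (at (\<phi> x)) (frechet_derivative \<phi> (at x) v))) (at x)"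
    using has_derivative_compose[OF d\<phi> df] .
  then show "(\<lambda>y. f (\<phi> y)) differentiable (at x)" by (rule differentiableI)
  have comp: "pd i (\<lambda>y. \<phi> y $ a) x = frechet_derivative \<phi> (at x) (axis i 1) $ a" for a
    by (rule pd_has_derivative[OF bounded_linear.has_derivative[OF bounded_linear_vec_nth d\<phi>]])
  interpret L: linear "frechet_derivative f (at (\<phi> x))" by (rule has_derivative_linear[OF df])
  let ?v = "frechet_derivative \<phi> (at x) (axis i 1)"
  have "pd i (\<lambda>y. f (\<phi> y)) x = frechet_derivative f (at (\<phi> x)) ?v"
    by (rule pd_has_derivative[OF c])
  also have "\<dots> = frechet_derivative f (at (\<phi> x)) (\<Sum>a\<in>UNIV. ?v $ a *\<^sub>R axis a 1)"
    by (subst vec_axis_sum[of ?v]) (rule refl)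
  also have "\<dots> = (\<Sum>a\<in>UNIV. ?v $ a * pd a f (\<phi> x))"
    by (simp add: L.sum L.scale pd_def)
  finally show "pd i (\<lambda>y. f (\<phi> y)) x = (\<Sum>a\<in>UNIV. pd i (\<lambda>y. \<phi> y $ a) x * pd a f (\<phi> x))"
    by (simp add: comp)
qed

lemma pd_nth: "pd i (\<lambda>y. y $ a) x = (if a = i then 1 else 0)"
  using pd_has_derivative[OF bounded_linear_imp_has_derivative[OF bounded_linear_vec_nth]] by (simp add: axis_def)

text \<open>
  An isometry is the special case of a moving frame in which the base of the frame is the target
  and the coframe is given by the differential: the expressions in the frame become the coordinate
  expressions in the target. So all curvature quantities are natural.
\<close>

locale isometry = M: smooth_metric U g + N: smooth_metric V g'
  for U V :: "(real^4) set" and g g' :: metric +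
  fixes \<phi> :: "real^4 \<Rightarrow> real^4"
  assumes diffeo: "diffeomorphism_on \<phi> U V"
    and pullback: "x \<in> U \<Longrightarrow> pullback \<phi> g' x = g x"
begin

abbreviation gN :: "4 \<Rightarrow> 4 \<Rightarrow> real^4 \<Rightarrow> real" where "gN \<equiv> \<lambda>a b y. g' y $ a $ b"
abbreviation giN :: "4 \<Rightarrow> 4 \<Rightarrow> real^4 \<Rightarrow> real" where "giN \<equiv> \<lambda>a b y. ginv g' y $ a $ b"
definition inverse_map :: "real^4 \<Rightarrow> real^4" where
  "inverse_map = (SOME \<psi>. \<psi> ` V = U \<and> smooth_on V \<psi> \<and> (\<forall>x\<in>U. \<psi> (\<phi> x) = x) \<and> (\<forall>y\<in>V. \<phi> (\<psi> y) = y))"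

lemma inverse_map:
  "inverse_map ` V = U" "smooth_on V inverse_map" "x \<in> U \<Longrightarrow> inverse_map (\<phi> x) = x" "y \<in> V \<Longrightarrow> \<phi> (inverse_map y) = y"
  using someI_ex[of "\<lambda>\<psi>. \<psi> ` V = U \<and> smooth_on V \<psi> \<and> (\<forall>x\<in>U. \<psi> (\<phi> x) = x) \<and> (\<forall>y\<in>V. \<phi> (\<psi> y) = y)"]
    diffeo
  unfolding diffeomorphism_on_def inverse_map_def[symmetric] by blast+

lemma map_in: "x \<in> U \<Longrightarrow> \<phi> x \<in> V" and map_smooth: "smooth_on U \<phi>"
  using diffeo unfolding diffeomorphism_on_def by blast+

sublocale moving_frame U g V "\<lambda>a i. pd i (\<lambda>y. \<phi> y $ a)" "\<lambda>b i x. pd b (\<lambda>y. inverse_map y $ i) (\<phi> x)" \<phi> pd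
  gN giN "christoffel g'"
proof unfold_locales
  show "\<phi> x \<in> V" if "x \<in> U" for x by (rule map_in[OF that])
  show "(\<lambda>x. f (\<phi> x)) differentiable (at x)"
    "pd i (\<lambda>x. f (\<phi> x)) x = (\<Sum>a\<in>UNIV. pd i (\<lambda>y. \<phi> y $ a) x * pd a f (\<phi> x))"
    if "smooth_on V f" "x \<in> U" for f x i
    by (rule chain_rule[OF smooth_on_differentiable[OF map_smooth that(2)]
          smooth_on_differentiable[OF that(1) map_in[OF that(2)]]])+
  show "open V" by (rule N.U)
  show "smooth_on V (pd a f)" if "smooth_on V f" for a f by (rule smooth_on_pd[OF that])
  show "smooth_on U (pd i (\<lambda>y. \<phi> y $ a))" for a i
    by (rule smooth_on_pd[OF smooth_on_nth[OF M.U map_smooth]])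
  show "(\<Sum>i\<in>UNIV. pd i (\<lambda>y. \<phi> y $ a) x * pd b (\<lambda>y. inverse_map y $ i) (\<phi> x)) = (if a = b then 1 else 0)"
    if x: "x \<in> U" for x a b
  proof -
    have "(\<lambda>y. \<phi> y $ a) differentiable (at (inverse_map (\<phi> x)))"
      unfolding inverse_map(3)[OF x] by (rule smooth_on_differentiable[OF smooth_on_nth[OF M.U map_smooth] x])
    from chain_rule(2)[OF smooth_on_differentiable[OF inverse_map(2) map_in[OF x]] this, of b]
    have "pd b (\<lambda>y. \<phi> (inverse_map y) $ a) (\<phi> x)
      = (\<Sum>i\<in>UNIV. pd b (\<lambda>y. inverse_map y $ i) (\<phi> x) * pd i (\<lambda>y. \<phi> y $ a) x)"
      unfolding inverse_map(3)[OF x] .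
    moreover have "pd b (\<lambda>y. \<phi> (inverse_map y) $ a) (\<phi> x) = pd b (\<lambda>y. y $ a) (\<phi> x)"
      by (rule pd_cong[OF N.U map_in[OF x]]) (simp add: inverse_map(4))
    ultimately show ?thesis by (simp add: pd_nth mult.commute)
  qed
  show "smooth_on V (gN a b)" "smooth_on V (giN a b)" for a b by (rule N.g_smooth N.ginv_smooth)+
  show "smooth_on V (christoffel g' c a b)" for c a b by (rule N.christoffel_smooth)
  show "gN a b y = gN b a y" if "y \<in> V" for a b y by (rule N.g_sym[OF that])
  show "(\<Sum>b\<in>UNIV. gN a b y * giN b c y) = (if a = c then 1 else 0)" if "y \<in> V" for a c y
    by (rule N.g_ginv_nth[OF that])
  show "g x $ i $ j = (\<Sum>a\<in>UNIV. \<Sum>b\<in>UNIV. gN a b (\<phi> x) * (pd i (\<lambda>y. \<phi> y $ a) x * pd j (\<lambda>y. \<phi> y $ b) x))"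
    if x: "x \<in> U" for x i j
  proof -
    have d: "(\<phi> has_derivative frechet_derivative \<phi> (at x)) (at x)"
      by (rule smooth_on_has_derivative[OF map_smooth x])
    have comp: "matrix (frechet_derivative \<phi> (at x)) $ a $ i = pd i (\<lambda>y. \<phi> y $ a) x" for a i
      unfolding pd_has_derivative[OF bounded_linear.has_derivative[OF bounded_linear_vec_nth d]]
      by (simp add: matrix_def)
    have "g x $ i $ j = pullback \<phi> g' x $ i $ j" by (simp add: pullback[OF x])
    also have "\<dots> = (\<Sum>b\<in>UNIV. \<Sum>a\<in>UNIV. gN a b (\<phi> x) * (pd i (\<lambda>y. \<phi> y $ a) x * pd j (\<lambda>y. \<phi> y $ b) x))"
      by (simp add: pullback_def Let_def matrix_mult_nth transpose_def comp sum_distrib_right sum_distrib_left mult_ac)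
    finally show ?thesis by (subst sum.swap)
  qed
  show "pd a (gN b c) y = (\<Sum>m\<in>UNIV. christoffel g' m a b y * gN m c y + christoffel g' m a c y * gN b m y)"
    if "y \<in> V" for a b c y
    using N.metric_parallel[OF that, of a b c] by (simp add: sum.distrib)
  show "pd i (pd j (\<lambda>y. \<phi> y $ c)) x - pd j (pd i (\<lambda>y. \<phi> y $ c)) x = - (\<Sum>a\<in>UNIV. \<Sum>b\<in>UNIV.
      (christoffel g' c a b (\<phi> x) - christoffel g' c b a (\<phi> x)) * (pd i (\<lambda>y. \<phi> y $ a) x * pd j (\<lambda>y. \<phi> y $ b) x))"
    if x: "x \<in> U" for x i j c
    using pd_commute[OF M.U smooth_on_nth[OF M.U map_smooth] x, of i j c] N.christoffel_sym[OF map_in[OF x], of c]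
    by simp
qed

lemma coordinate_curvature:
  assumes y: "y \<in> V"
  shows "Rf s i j t y = riemann g' s i j t y" "Ricf i j y = ricci g' i j y" "Sf y = scalar_curv g' y"
    "Wf s i j t y = weyl g' s i j t y"
proof -
  show R: "Rf s i j t y = riemann g' s i j t y" for s i j t
    using N.christoffel_sym[OF y] by (simp add: frame_riemann_def frame_riemann_up_def riemann_def riemann_up_def)
  show Ric: "Ricf i j y = ricci g' i j y" for i j by (simp add: frame_ricci_def ricci_def R)
  show S: "Sf y = scalar_curv g' y" by (simp add: frame_scalar_def scalar_curv_def Ric)
  show "Wf s i j t y = weyl g' s i j t y" by (simp add: frame_weyl_def weyl_def R Ric S)
qed

lemma scalar_natural: "x \<in> U \<Longrightarrow> scalar_curv g x = scalar_curv g' (\<phi> x)"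
  using scalar_frame coordinate_curvature(3)[OF map_in] by simp

lemma weyl_op_natural:
  assumes x: "x \<in> U"
  shows "trace (weyl_op g x ** weyl_op g x) = trace (weyl_op g' (\<phi> x) ** weyl_op g' (\<phi> x))"
    "trace (weyl_op g x ** weyl_op g x ** weyl_op g x) = trace (weyl_op g' (\<phi> x) ** weyl_op g' (\<phi> x) ** weyl_op g' (\<phi> x))"
proof -
  have "raise2 giN Wf (\<phi> x) = weyl_op g' (\<phi> x)"
    by (simp add: raise2_def coordinate_curvature(4)[OF map_in[OF x]])
  then show "trace (weyl_op g x ** weyl_op g x) = trace (weyl_op g' (\<phi> x) ** weyl_op g' (\<phi> x))"
    "trace (weyl_op g x ** weyl_op g x ** weyl_op g x) = trace (weyl_op g' (\<phi> x) ** weyl_op g' (\<phi> x) ** weyl_op g' (\<phi> x))"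
    using trace_weyl_op_frame[OF x] by simp_all
qed

lemma weyl_div_natural:
  assumes x: "x \<in> U"
  shows "inner_of g 3 (weyl_div g) (weyl_div g) x = inner_of g' 3 (weyl_div g') (weyl_div g') (\<phi> x)"
proof -
  have W: "weyl_comp as y = weyl_tensor g' as y" if "y \<in> V" for as y
    by (simp add: weyl_comp_def weyl_tensor_def coordinate_curvature(4)[OF that])
  have y: "\<phi> x \<in> V" by (rule map_in[OF x])
  have "div_comp as (\<phi> x) = weyl_div g' as (\<phi> x)" for as
  proof -
    have "frame_cov pd (christoffel g') a weyl_comp (s # as) (\<phi> x) = cov_deriv g' (weyl_tensor g') ((s # as) @ [a]) (\<phi> x)" for s a
      unfolding cov_deriv_snoc frame_cov_def using pd_cong[OF N.U y, of "weyl_comp (s # as)"] W y by simp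
    then show ?thesis by (simp add: div_comp_def frame_div_def weyl_div_def)
  qed
  then show ?thesis unfolding weyl_div_inner_frame[OF x] by (intro tensor_inner_cong)
qed

lemma gradient_natural:
  assumes "x \<in> U" "smooth_on V f"
  shows "inner_of g 1 (\<lambda>is. pd (hd is) (\<lambda>x. f (\<phi> x))) (\<lambda>is. pd (hd is) (\<lambda>x. f (\<phi> x))) x
    = inner_of g' 1 (\<lambda>is. pd (hd is) f) (\<lambda>is. pd (hd is) f) (\<phi> x)"
  using gradient_inner_frame[OF assms] .

end


section \<open>Conformal invariance of the Weyl tensor\<close>

locale conformal_change = smooth_metric U g for U g +
  fixes u :: "real^4 \<Rightarrow> real"
  assumes u_smooth: "smooth_on U u" and u_pos: "x \<in> U \<Longrightarrow> 0 < u x"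
begin

definition gc :: metric where "gc x = u x *\<^sub>R g x"

lemma gc_inverse: "x \<in> U \<Longrightarrow> ginv gc x = (1 / u x) *\<^sub>R ginv g x"
proof -
  assume x: "x \<in> U"
  have "gc x ** ((1 / u x) *\<^sub>R ginv g x) = mat 1"
    using g_ginv[OF x] u_pos[OF x] by (simp add: gc_def scalar_matrix_assoc[symmetric] matrix_scalar_ac)
  then show ?thesis unfolding ginv_def[of gc] by (rule matrix_inv_eqI)
qed

lemma smooth_metric_gc: "smooth_metric U gc"
proof
  show "open U" by (rule U)
  show "smooth_on U (\<lambda>x. gc x $ i $ j)" for i j
    unfolding gc_def by (simp, intro smooth_intros U u_smooth g_smooth)
  show "smooth_on U (\<lambda>x. ginv gc x $ i $ j)" for i j
  proof (rule smooth_on_cong[OF U])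
    show "smooth_on U (\<lambda>x. 1 / u x * ginv g x $ i $ j)"
      using u_pos by (intro smooth_intros U u_smooth ginv_smooth) fastforce
  qed (simp add: gc_inverse)
  show "gc x $ i $ j = gc x $ j $ i" if "x \<in> U" for x i j using g_sym[OF that] by (simp add: gc_def)
  show "gc x ** ginv gc x = mat 1" if "x \<in> U" for x
    unfolding gc_inverse[OF that] using g_ginv[OF that] u_pos[OF that]
    by (simp add: gc_def scalar_matrix_assoc[symmetric] matrix_scalar_ac)
qed

text \<open>
  With \<open>u = exp (2 f)\<close>, these are the 1-form \<open>df\<close>, its dual vector field, and the Christoffel symbols
  of \<open>g\<close> with lowered index.
\<close>

definition v :: "4 \<Rightarrow> real^4 \<Rightarrow> real" where "v i x = pd i u x / (2 * u x)"
definition vup :: "4 \<Rightarrow> real^4 \<Rightarrow> real" where "vup l x = (\<Sum>m\<in>UNIV. ginv g x $ l $ m * v m x)"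
definition G :: "4 \<Rightarrow> 4 \<Rightarrow> 4 \<Rightarrow> real^4 \<Rightarrow> real" where
  "G t i j x = (\<Sum>m\<in>UNIV. g x $ t $ m * christoffel g m i j x)"

lemma lower_vup: "x \<in> U \<Longrightarrow> (\<Sum>m\<in>UNIV. g x $ t $ m * vup m x) = v t x"
proof -
  assume x: "x \<in> U"
  have "(\<Sum>m\<in>UNIV. g x $ t $ m * vup m x) = (\<Sum>k\<in>UNIV. (\<Sum>m\<in>UNIV. g x $ t $ m * ginv g x $ m $ k) * v k x)"
    by (simp add: vup_def sum_distrib_left sum_distrib_right mult.assoc) (rule sum.swap)
  then show ?thesis by (simp add: g_ginv_nth[OF x] if_distrib[of "\<lambda>r. r * _"] cong: if_cong)
qed

lemma v_smooth: "smooth_on U (v i)"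
  unfolding v_def[abs_def] using u_pos by (intro smooth_intros U smooth_on_pd u_smooth) fastforce

lemma christoffel_gc:
  assumes x: "x \<in> U"
  shows "christoffel gc l i j x = christoffel g l i j x + (if l = i then v j x else 0)
    + (if l = j then v i x else 0) - g x $ i $ j * vup l x"
proof -
  interpret gc: smooth_metric U gc by (rule smooth_metric_gc)
  let ?S = "\<lambda>l i j. christoffel g l i j x + (if l = i then v j x else 0)
    + (if l = j then v i x else 0) - g x $ i $ j * vup l x"
  show ?thesis
  proof (rule gc.christoffel_unique[OF x])
    show "?S m i j = ?S m j i" for m i j
      using christoffel_sym[OF x, of m i j] g_sym[OF x, of i j] by simp
    show "pd k (\<lambda>y. gc y $ i $ j) x = (\<Sum>m\<in>UNIV. ?S m k i * gc x $ m $ j + ?S m k j * gc x $ i $ m)" for k i j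
    proof -
      have S: "(\<Sum>m\<in>UNIV. ?S m k i * gc x $ m $ j) = u x * ((\<Sum>m\<in>UNIV. christoffel g m k i x * g x $ m $ j)
          + v i x * g x $ k $ j + v k x * g x $ i $ j - g x $ k $ i * v j x)" for i j
      proof -
        have "(\<Sum>m\<in>UNIV. ?S m k i * gc x $ m $ j) = u x * (\<Sum>m\<in>UNIV. christoffel g m k i x * g x $ m $ j
            + (if m = k then v i x * g x $ k $ j else 0) + (if m = i then v k x * g x $ i $ j else 0)
            - g x $ k $ i * (g x $ j $ m * vup m x))"
          unfolding sum_distrib_left
          by (intro sum.cong refl) (auto simp: gc_def g_sym[OF x, of j] algebra_simps)
        then show ?thesis by (simp add: sum.distrib sum_subtractf sum_distrib_left[symmetric] lower_vup[OF x])
      qed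
      have S': "(\<Sum>m\<in>UNIV. ?S m k j * gc x $ i $ m) = (\<Sum>m\<in>UNIV. ?S m k j * gc x $ m $ i)"
        by (simp add: gc_def g_sym[OF x, of i])
      have S'': "(\<Sum>m\<in>UNIV. christoffel g m k j x * g x $ m $ i) = (\<Sum>m\<in>UNIV. christoffel g m k j x * g x $ i $ m)"
        by (simp add: g_sym[OF x, of i])
      have "pd k (\<lambda>y. gc y $ i $ j) x = pd k u x * g x $ i $ j + u x * pd k (\<lambda>y. g y $ i $ j) x"
        using pd_mult[OF smooth_on_differentiable[OF u_smooth x] smooth_on_differentiable[OF g_smooth x]]
        by (simp add: gc_def)
      also have "pd k u x = 2 * u x * v k x" using u_pos[OF x] by (simp add: v_def)
      finally show ?thesis
        unfolding sum.distrib S' S S'' metric_parallel[OF x]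
        by (simp add: sum.distrib g_sym[OF x, of j i] algebra_simps)
    qed
  qed
qed

text \<open>
  For any connection \<open>S\<close>, lowering the upper index of its curvature by \<open>g\<close>: the derivative of \<open>g\<close> which
  arises when \<open>pd\<close> is moved outside is expressed by the Christoffel symbols of \<open>g\<close>.
\<close>

lemma lowered_curvature:
  assumes x: "x \<in> U"
    and S: "\<And>l i j. smooth_on U (S l i j)"
    and A: "\<And>t i j y. y \<in> U \<Longrightarrow> A t i j y = (\<Sum>l\<in>UNIV. g y $ t $ l * S l i j y)"
  shows "(\<Sum>l\<in>UNIV. g x $ t $ l * (pd s (S l i j) x + (\<Sum>m\<in>UNIV. S l s m x * S m i j x)))
    = pd s (A t i j) x - (\<Sum>m\<in>UNIV. christoffel g m s t x * A m i j x)
      + (\<Sum>m\<in>UNIV. (A t s m x - G t s m x) * S m i j x)"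
proof -
  have "pd s (A t i j) x = pd s (\<lambda>y. \<Sum>l\<in>UNIV. g y $ t $ l * S l i j y) x"
    by (rule pd_cong[OF U x A])
  also have "\<dots> = (\<Sum>l\<in>UNIV. pd s (\<lambda>y. g y $ t $ l) x * S l i j x) + (\<Sum>l\<in>UNIV. g x $ t $ l * pd s (S l i j) x)"
    using smooth_on_differentiable[OF S x] smooth_on_differentiable[OF g_smooth x]
    by (simp add: pd_sum pd_mult differentiable_mult sum.distrib)
  also have "(\<Sum>l\<in>UNIV. pd s (\<lambda>y. g y $ t $ l) x * S l i j x)
    = (\<Sum>m\<in>UNIV. christoffel g m s t x * A m i j x) + (\<Sum>l\<in>UNIV. G t s l x * S l i j x)"
  proof -
    have "(\<Sum>l\<in>UNIV. \<Sum>m\<in>UNIV. christoffel g m s t x * (g x $ m $ l * S l i j x))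
      = (\<Sum>m\<in>UNIV. christoffel g m s t x * A m i j x)"
      unfolding A[OF x] sum_distrib_left by (rule sum.swap)
    then show ?thesis
      unfolding metric_parallel[OF x] G_def
      by (simp add: sum.distrib distrib_right distrib_left sum_distrib_right sum_distrib_left mult_ac)
  qed
  finally have 1: "pd s (A t i j) x = (\<Sum>m\<in>UNIV. christoffel g m s t x * A m i j x)
     + (\<Sum>l\<in>UNIV. G t s l x * S l i j x) + (\<Sum>l\<in>UNIV. g x $ t $ l * pd s (S l i j) x)" .
  have 2: "(\<Sum>l\<in>UNIV. g x $ t $ l * (\<Sum>m\<in>UNIV. S l s m x * S m i j x)) = (\<Sum>m\<in>UNIV. A t s m x * S m i j x)"
    unfolding A[OF x] by (simp add: sum_distrib_left sum_distrib_right) (subst sum.swap, simp add: mult_ac)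
  show ?thesis unfolding 1
    by (simp add: distrib_left sum.distrib 2 left_diff_distrib sum_subtractf)
qed

text \<open>\<open>h = \<nabla>df - df \<otimes> df + |df|\<^sup>2 g / 2\<close>, minus the change of the Schouten tensor.\<close>

definition vnorm :: "real^4 \<Rightarrow> real" where "vnorm x = (\<Sum>m\<in>UNIV. v m x * vup m x)"
definition h :: "4 \<Rightarrow> 4 \<Rightarrow> real^4 \<Rightarrow> real" where
  "h i j x = pd i (v j) x - (\<Sum>m\<in>UNIV. v m x * christoffel g m i j x) - v i x * v j x + vnorm x * g x $ i $ j / 2"

text \<open>The 1-form is exact: \<open>v\<close> is the differential of \<open>ln u / 2\<close>.\<close>

lemma pd_v_sym:
  assumes x: "x \<in> U" shows "pd i (v j) x = pd j (v i) x"
proof -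
  define f where "f y = (1 / 2) * ln (u y)" for y
  have f: "smooth_on U f" unfolding f_def[abs_def] by (intro smooth_intros smooth_on_ln U u_smooth u_pos)
  have fv: "pd k f y = v k y" if "y \<in> U" for k y
  proof -
    have "((\<lambda>t. (1 / 2) * ln t) has_real_derivative (1 / 2) * inverse (u y)) (at (u y))"
      by (rule DERIV_cmult[OF DERIV_ln[OF u_pos[OF that]]])
    then have "pd k (\<lambda>y. (1 / 2) * ln (u y)) y = (1 / 2) * inverse (u y) * pd k u y"
      by (rule pd_compose[where f=u and x=y and i=k and h="\<lambda>t. (1 / 2) * ln t"])
        (rule smooth_on_differentiable[OF u_smooth that])
    moreover have "f = (\<lambda>y. (1 / 2) * ln (u y))" by (rule ext) (rule f_def)
    ultimately have "pd k f y = (1 / 2) * inverse (u y) * pd k u y" by (simp only:)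
    then show ?thesis by (simp add: v_def field_simps)
  qed
  have "pd i (v j) x = pd i (pd j f) x" "pd j (v i) x = pd j (pd i f) x"
    by (rule pd_cong[OF U x]; simp add: fv)+
  then show ?thesis using pd_commute[OF U f x] by simp
qed

text \<open>
  Up to the factor \<open>u\<close>, the curvature changes by a Kulkarni-Nomizu product with \<open>g\<close>, which has no
  trace-free part; therefore the Weyl tensor is only multiplied by \<open>u\<close>.
\<close>

lemma riemann_gc:
  assumes x: "x \<in> U"
  shows "riemann gc s i j t x = u x * (riemann g s i j t x
    - (g x $ s $ t * h i j x + g x $ i $ j * h s t x - g x $ s $ j * h i t x - g x $ i $ t * h s j x))"
proof -
  interpret gc: smooth_metric U gc by (rule smooth_metric_gc)
  let ?g = "\<lambda>i j. g x $ i $ j"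
  define A where "A t i j y = G t i j y + g y $ t $ i * v j y + g y $ t $ j * v i y - g y $ i $ j * v t y" for t i j y
  have A: "A t i j y = (\<Sum>l\<in>UNIV. g y $ t $ l * christoffel gc l i j y)" if y: "y \<in> U" for t i j y
  proof -
    have "(\<Sum>l\<in>UNIV. g y $ t $ l * christoffel gc l i j y) = (\<Sum>l\<in>UNIV. g y $ t $ l * christoffel g l i j y
       + (if l = i then g y $ t $ i * v j y else 0) + (if l = j then g y $ t $ j * v i y else 0)
       - g y $ i $ j * (g y $ t $ l * vup l y))"
      by (intro sum.cong refl) (auto simp: christoffel_gc[OF y] algebra_simps)
    then show ?thesis
      by (simp add: sum.distrib sum_subtractf sum_distrib_left[symmetric] lower_vup[OF y] A_def G_def)
  qed
  have Gs: "smooth_on U (G t i j)" for t i j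
    unfolding G_def[abs_def] by (intro smooth_intros U g_smooth christoffel_smooth)
  note d = smooth_on_differentiable[OF Gs x] smooth_on_differentiable[OF g_smooth x] smooth_on_differentiable[OF v_smooth x]
  have Gsym: "G t i j x = G t j i x" for t i j
    unfolding G_def using christoffel_sym[OF x, of _ i j] by simp
  have dg: "pd s (\<lambda>y. g y $ t $ i) x = G i s t x + G t s i x" for s t i
    unfolding metric_parallel[OF x] G_def by (simp add: sum.distrib g_sym[OF x, of i] mult.commute)
  have dA: "pd s (A t i j) x = pd s (G t i j) x + (G i s t x + G t s i x) * v j x + ?g t i * pd s (v j) x
     + (G j s t x + G t s j x) * v i x + ?g t j * pd s (v i) x - (G j s i x + G i s j x) * v t x - ?g i j * pd s (v t) x" for s t i j
    unfolding A_def[abs_def] using d by (simp add: pd_add pd_diff pd_mult differentiable_mult differentiable_add dg)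
  define Gv where "Gv i j = (\<Sum>m\<in>UNIV. v m x * christoffel g m i j x)" for i j
  have Gvsym: "Gv i j = Gv j i" for i j unfolding Gv_def using christoffel_sym[OF x, of _ i j] by simp
  have \<Gamma>A: "(\<Sum>m\<in>UNIV. christoffel g m s t x * A m i j x) = (\<Sum>m\<in>UNIV. christoffel g m s t x * G m i j x)
     + G i s t x * v j x + G j s t x * v i x - ?g i j * Gv s t" for s t i j
  proof -
    have G': "G k s t x = (\<Sum>m\<in>UNIV. christoffel g m s t x * ?g m k)" for k
      unfolding G_def by (simp add: g_sym[OF x, of k] mult.commute)
    show ?thesis
      unfolding A_def G'[of i] G'[of j] Gv_def
      by (simp add: sum.distrib sum_subtractf distrib_left right_diff_distrib sum_distrib_left sum_distrib_right mult_ac)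
  qed
  have vS: "(\<Sum>m\<in>UNIV. v m x * christoffel gc m i j x) = Gv i j + 2 * v i x * v j x - ?g i j * vnorm x" for i j
  proof -
    have "(\<Sum>m\<in>UNIV. v m x * christoffel gc m i j x) = (\<Sum>m\<in>UNIV. v m x * christoffel g m i j x
       + (if m = i then v i x * v j x else 0) + (if m = j then v j x * v i x else 0) - ?g i j * (v m x * vup m x))"
      by (intro sum.cong refl) (auto simp: christoffel_gc[OF x] algebra_simps)
    then show ?thesis by (simp add: sum.distrib sum_subtractf sum_distrib_left[symmetric] Gv_def vnorm_def)
  qed
  have AS: "(\<Sum>m\<in>UNIV. (A t s m x - G t s m x) * christoffel gc m i j x)
     = ?g t s * (Gv i j + 2 * v i x * v j x - ?g i j * vnorm x) + v s x * A t i j x - v t x * A s i j x" for t s i j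
    unfolding vS[symmetric] A[OF x, of t i j] A[OF x, of s i j] A_def[of t s]
    by (simp add: algebra_simps sum.distrib sum_subtractf sum_distrib_left)
  have low: "(\<Sum>l\<in>UNIV. g x $ t $ l * (pd s (christoffel gc l i j) x + (\<Sum>m\<in>UNIV. christoffel gc l s m x * christoffel gc m i j x)))
     = pd s (A t i j) x - (\<Sum>m\<in>UNIV. christoffel g m s t x * A m i j x)
      + (\<Sum>m\<in>UNIV. (A t s m x - G t s m x) * christoffel gc m i j x)" for s i
    by (rule lowered_curvature[OF x gc.christoffel_smooth A])
  have low0: "(\<Sum>l\<in>UNIV. g x $ t $ l * (pd s (christoffel g l i j) x + (\<Sum>m\<in>UNIV. christoffel g l s m x * christoffel g m i j x)))
     = pd s (G t i j) x - (\<Sum>m\<in>UNIV. christoffel g m s t x * G m i j x)" for s i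
    by (subst lowered_curvature[OF x christoffel_smooth, of G]) (simp_all add: G_def)
  have up: "riemann_up k l j s i x = (pd s (christoffel k l i j) x + (\<Sum>m\<in>UNIV. christoffel k l s m x * christoffel k m i j x))
     - (pd i (christoffel k l s j) x + (\<Sum>m\<in>UNIV. christoffel k l i m x * christoffel k m s j x))" for k l
    by (simp add: riemann_up_def sum_subtractf)
  have R0: "riemann g s i j t x = (pd s (G t i j) x - (\<Sum>m\<in>UNIV. christoffel g m s t x * G m i j x))
     - (pd i (G t s j) x - (\<Sum>m\<in>UNIV. christoffel g m i t x * G m s j x))"
    unfolding riemann_def up right_diff_distrib sum_subtractf low0 ..
  have "riemann gc s i j t x = u x * (\<Sum>l\<in>UNIV. g x $ t $ l * riemann_up gc l j s i x)"
    by (simp add: riemann_def gc_def sum_distrib_left mult_ac)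
  also have "(\<Sum>l\<in>UNIV. g x $ t $ l * riemann_up gc l j s i x)
     = riemann g s i j t x - (g x $ s $ t * h i j x + g x $ i $ j * h s t x - g x $ s $ j * h i t x - g x $ i $ t * h s j x)"
    unfolding up right_diff_distrib sum_subtractf low
    unfolding dA \<Gamma>A AS
    unfolding R0 h_def Gv_def[symmetric] A_def
    using Gsym[of t s i] Gsym[of j s i] Gsym[of i s j] Gsym[of s i j] Gsym[of t i j] Gsym[of t s j] Gsym[of i j s] Gsym[of s j i]
      g_sym[OF x, of t s] g_sym[OF x, of t i] g_sym[OF x, of t j] g_sym[OF x, of s i] g_sym[OF x, of s j] g_sym[OF x, of i j]
      pd_v_sym[OF x, of s i] Gvsym[of s i]
    by (simp add: field_simps)
  finally show ?thesis .
qed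

lemma weyl_conformal:
  assumes x: "x \<in> U" shows "weyl gc s i j t x = u x * weyl g s i j t x"
proof -
  let ?g = "\<lambda>i j. g x $ i $ j" and ?k = "\<lambda>i j. ginv g x $ i $ j"
  have u: "u x \<noteq> 0" using u_pos[OF x] by simp
  define H where "H = (\<Sum>s\<in>UNIV. \<Sum>t\<in>UNIV. ?k s t * h s t x)"
  have tr: "(\<Sum>s\<in>UNIV. \<Sum>t\<in>UNIV. ?k s t * ?g s t) = 4"
  proof -
    have "(\<Sum>t\<in>UNIV. ?k s t * ?g s t) = 1" for s
      using ginv_g_nth[OF x, of s s] by (simp add: g_sym[OF x, of s])
    then show ?thesis by simp
  qed
  have c1: "(\<Sum>s\<in>UNIV. \<Sum>t\<in>UNIV. ?k s t * (?g s j * X t)) = X j" for X j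
  proof -
    have "?k s t * (?g s j * X t) = ?k t s * ?g s j * X t" for s t by (simp add: ginv_sym[OF x, of s t])
    then have "(\<Sum>s\<in>UNIV. \<Sum>t\<in>UNIV. ?k s t * (?g s j * X t)) = (\<Sum>s\<in>UNIV. \<Sum>t\<in>UNIV. ?k t s * ?g s j * X t)"
      by (simp only:)
    also have "\<dots> = (\<Sum>t\<in>UNIV. (\<Sum>s\<in>UNIV. ?k t s * ?g s j) * X t)"
      by (subst sum.swap) (simp add: sum_distrib_right)
    finally have "(\<Sum>s\<in>UNIV. \<Sum>t\<in>UNIV. ?k s t * (?g s j * X t)) = (\<Sum>t\<in>UNIV. (\<Sum>s\<in>UNIV. ?k t s * ?g s j) * X t)" .
    then show ?thesis by (simp add: ginv_g_nth[OF x] if_distrib[of "\<lambda>r. r * _"] cong: if_cong)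
  qed
  have c2: "(\<Sum>s\<in>UNIV. \<Sum>t\<in>UNIV. ?k s t * (?g i t * X s)) = X i" for X i
  proof -
    have "?k s t * (?g i t * X s) = ?k t s * (?g t i * X s)" for s t
      by (simp add: ginv_sym[OF x, of s t] g_sym[OF x, of i t])
    then have "(\<Sum>s\<in>UNIV. \<Sum>t\<in>UNIV. ?k s t * (?g i t * X s)) = (\<Sum>s\<in>UNIV. \<Sum>t\<in>UNIV. ?k t s * (?g t i * X s))"
      by (simp only:)
    then show ?thesis using c1[of i X] by (subst (asm) (2) sum.swap) simp
  qed
  have ric: "ricci gc i j x = ricci g i j x - 2 * h i j x - ?g i j * H" for i j
  proof -
    have "ricci gc i j x = (\<Sum>s\<in>UNIV. \<Sum>t\<in>UNIV. ?k s t * (riemann g s i j t x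
      - (?g s t * h i j x + ?g i j * h s t x - ?g s j * h i t x - ?g i t * h s j x)))"
      using u by (simp add: ricci_def gc_inverse[OF x] riemann_gc[OF x])
    also have "\<dots> = ricci g i j x - ((\<Sum>s\<in>UNIV. \<Sum>t\<in>UNIV. ?k s t * ?g s t) * h i j x + ?g i j * H
      - (\<Sum>s\<in>UNIV. \<Sum>t\<in>UNIV. ?k s t * (?g s j * h i t x)) - (\<Sum>s\<in>UNIV. \<Sum>t\<in>UNIV. ?k s t * (?g i t * h s j x)))"
      by (simp add: ricci_def H_def right_diff_distrib distrib_left sum_subtractf sum.distrib sum_distrib_left
          sum_distrib_right mult_ac)
    finally show ?thesis unfolding tr c1 c2 by simp
  qed
  have sc: "scalar_curv gc x = (scalar_curv g x - 6 * H) / u x"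
  proof -
    have "scalar_curv gc x = (\<Sum>i\<in>UNIV. \<Sum>j\<in>UNIV. ?k i j * (ricci g i j x - 2 * h i j x - ?g i j * H)) / u x"
      by (simp add: scalar_curv_def gc_inverse[OF x] ric sum_divide_distrib)
    also have "(\<Sum>i\<in>UNIV. \<Sum>j\<in>UNIV. ?k i j * (ricci g i j x - 2 * h i j x - ?g i j * H))
      = scalar_curv g x - 2 * H - (\<Sum>i\<in>UNIV. \<Sum>j\<in>UNIV. ?k i j * ?g i j) * H"
    proof -
      have "(\<Sum>i\<in>UNIV. \<Sum>j\<in>UNIV. ?k i j * (ricci g i j x - 2 * h i j x - ?g i j * H))
        = (\<Sum>i\<in>UNIV. \<Sum>j\<in>UNIV. ?k i j * ricci g i j x) - 2 * (\<Sum>i\<in>UNIV. \<Sum>j\<in>UNIV. ?k i j * h i j x)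
          - (\<Sum>i\<in>UNIV. \<Sum>j\<in>UNIV. ?k i j * ?g i j) * H"
        by (simp add: right_diff_distrib sum_subtractf sum_distrib_left sum_distrib_right mult_ac)
      then show ?thesis by (simp only: scalar_curv_def H_def)
    qed
    finally show ?thesis unfolding tr by simp
  qed
  show ?thesis
    unfolding weyl_def riemann_gc[OF x] ric sc using u by (simp add: gc_def field_simps)
qed

lemma weyl_op_conformal:
  assumes x: "x \<in> U" shows "weyl_op gc x = (1 / u x) *\<^sub>R weyl_op g x"
  using u_pos[OF x] unfolding vec_eq_iff
  by (simp add: raise2_def weyl_conformal[OF x] gc_inverse[OF x] sum_divide_distrib)

end

section \<open>Linear differential equations\<close>

lemma constant_on_interval:
  fixes h :: "real \<Rightarrow> real"
  assumes "is_interval I" "\<And>z. z \<in> I \<Longrightarrow> (h has_real_derivative 0) (at z)"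
  shows "\<exists>c. \<forall>z\<in>I. h z = c"
proof -
  have "convex I" using assms(1) by (simp add: is_interval_convex)
  moreover have "(h has_field_derivative 0) (at z within I)" if "z \<in> I" for z
    using assms(2)[OF that] by (rule has_field_derivative_at_within)
  ultimately have "\<exists>c. \<forall>z\<in>I. h z = c" by (rule has_field_derivative_zero_constant)
  then show ?thesis .
qed

lemma exponential_ode:
  fixes h :: "real \<Rightarrow> real"
  assumes "is_interval I" and h: "\<And>z. z \<in> I \<Longrightarrow> (h has_real_derivative k * h z) (at z)"
  shows "\<exists>c. \<forall>z\<in>I. h z = c * exp (k * z)"
proof -
  have "((\<lambda>z. h z * exp (- k * z)) has_real_derivative 0) (at z)" if "z \<in> I" for z
    using h[OF that] by (auto intro!: derivative_eq_intros simp: algebra_simps)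
  from constant_on_interval[OF assms(1) this] obtain c where c: "\<forall>z\<in>I. h z * exp (- k * z) = c" by blast
  have "h z = c * exp (k * z)" if "z \<in> I" for z
  proof -
    have "exp (- k * z) * exp (k * z) = 1" by (simp add: exp_minus)
    then have "h z = (h z * exp (- k * z)) * exp (k * z)" by (simp only: mult.assoc mult_1_right)
    then show ?thesis using c that by (simp only:)
  qed
  then show ?thesis by blast
qed

text \<open>
  When one of the two first-order factors of the operator is applied to \<open>h\<close>, the other annihilates the
  result. So \<open>h' - l h\<close> and \<open>h' - k h\<close> are multiples of exponentials, and their difference is \<open>(k - l) h\<close>.
\<close>

lemma second_order_ode:
  fixes h :: "real \<Rightarrow> real"
  assumes I: "open I" "is_interval I" and h: "smooth_on I h" and kl: "k \<noteq> l"
    and ode: "\<And>z. z \<in> I \<Longrightarrow> deriv (deriv h) z = (k + l) * deriv h z - k * l * h z"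
  shows "\<exists>a b. \<forall>z\<in>I. h z = a * exp (k * z) + b * exp (l * z)"
proof -
  note d = smooth_on_has_real_derivative[OF h] smooth_on_has_real_derivative[OF smooth_on_deriv[OF I(1) h]]
  have "((\<lambda>z. deriv h z - l * h z) has_real_derivative k * (deriv h z - l * h z)) (at z)" if "z \<in> I" for z
    by (auto intro!: derivative_eq_intros d[OF that] simp: ode[OF that] algebra_simps)
  from exponential_ode[OF I(2) this] obtain a where a: "\<forall>z\<in>I. deriv h z - l * h z = a * exp (k * z)" by blast
  have "((\<lambda>z. deriv h z - k * h z) has_real_derivative l * (deriv h z - k * h z)) (at z)" if "z \<in> I" for z
    by (auto intro!: derivative_eq_intros d[OF that] simp: ode[OF that] algebra_simps)
  from exponential_ode[OF I(2) this] obtain b where b: "\<forall>z\<in>I. deriv h z - k * h z = b * exp (l * z)" by blast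
  have "h z = a / (k - l) * exp (k * z) + (- b / (k - l)) * exp (l * z)" if "z \<in> I" for z
  proof -
    have "(k - l) * h z = (deriv h z - l * h z) - (deriv h z - k * h z)" by (simp add: algebra_simps)
    also have "\<dots> = a * exp (k * z) - b * exp (l * z)" using a b that by (simp only:)
    finally have "h z = (a * exp (k * z) - b * exp (l * z)) / (k - l)" using kl by (simp add: eq_divide_eq mult.commute)
    then show ?thesis by (simp add: diff_divide_distrib)
  qed
  then show ?thesis by blast
qed

lemma L_plus_eq:
  assumes I: "open I" and f: "smooth_on I f" and z: "z \<in> I"
  shows "L_plus f z = deriv (deriv f) z / 2 - 3 / 2 * deriv f z + f z"
proof -
  note d = smooth_on_has_real_derivative[OF f z] smooth_on_has_real_derivative[OF smooth_on_deriv[OF I f] z]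
  have "deriv (\<lambda>z. - deriv f z + f z) z = - deriv (deriv f) z + deriv f z"
    by (rule DERIV_imp_deriv) (auto intro!: derivative_eq_intros d)
  then show ?thesis by (simp add: L_plus_def Let_def field_simps)
qed

lemma L_minus_eq:
  assumes I: "open I" and f: "smooth_on I f" and z: "z \<in> I"
  shows "L_minus f z = deriv (deriv f) z / 2 + 3 / 2 * deriv f z + f z"
proof -
  note d = smooth_on_has_real_derivative[OF f z] smooth_on_has_real_derivative[OF smooth_on_deriv[OF I f] z]
  have "deriv (\<lambda>z. deriv f z + f z) z = deriv (deriv f) z + deriv f z"
    by (rule DERIV_imp_deriv) (auto intro!: derivative_eq_intros d)
  then show ?thesis by (simp add: L_minus_def Let_def field_simps)
qed

lemma exp_powers: "exp (2 * z) = exp z ^ 2" "exp (- 2 * z) = 1 / exp z ^ 2" "exp (- z) = 1 / exp (z::real)"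
  by (simp_all add: power2_eq_square exp_add[symmetric] divide_inverse exp_minus[symmetric])

locale u2_interval = u2 +
  assumes interval: "is_interval I" and nonempty: "I \<noteq> {}"
begin

lemma L_plus_w: "z \<in> I \<Longrightarrow> L_plus F z - 1 = w_plus F z"
  using L_plus_eq[OF I F_smooth] by (simp add: w_plus_def)

lemma L_minus_w: "z \<in> I \<Longrightarrow> L_minus F z - 1 = w_minus F z"
  using L_minus_eq[OF I F_smooth] by (simp add: w_minus_def)

lemma L_plus_L_minus:
  assumes z: "z \<in> I" shows "L_plus (L_minus F) z - 1 = bach_linear z / 4"
proof -
  have eq: "L_minus F y = w_minus F y + 1" if "y \<in> I" for y using L_minus_w[OF that] by simp
  have s: "smooth_on I (\<lambda>y. w_minus F y + 1)" by (intro smooth_intros I w_minus_smooth)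
  have sm: "smooth_on I (L_minus F)" by (rule smooth_on_cong[OF I eq s])
  have d1: "deriv (L_minus F) y = deriv (w_minus F) y" if "y \<in> I" for y
    by (rule deriv_eq_on[OF that eq]) (auto intro!: derivative_eq_intros w_derivs[OF that])
  have d2: "deriv (deriv (L_minus F)) z = deriv (deriv (w_minus F)) z"
    by (rule deriv_eq_on[OF z d1]) (auto intro!: derivative_eq_intros w_derivs[OF z])
  show ?thesis
    unfolding L_plus_eq[OF I sm z] d1[OF z] d2 eq[OF z] deriv_w[OF z] bach_linear_def
    by (simp add: w_minus_def field_simps)
qed

lemma sol_derivs:
  assumes F: "\<forall>z\<in>I. F z = F_sol C1 C2 C3 C4 z" and z: "z \<in> I"
  shows "deriv F z = - C1 * exp (- 2 * z) - C2 * exp (- z) + C3 * exp z + C4 * exp (2 * z)"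
    "deriv (deriv F) z = 2 * C1 * exp (- 2 * z) + C2 * exp (- z) + C3 * exp z + 2 * C4 * exp (2 * z)"
    "deriv (deriv (deriv F)) z = - 4 * C1 * exp (- 2 * z) - C2 * exp (- z) + C3 * exp z + 4 * C4 * exp (2 * z)"
    "deriv (deriv (deriv (deriv F))) z = 8 * C1 * exp (- 2 * z) + C2 * exp (- z) + C3 * exp z + 8 * C4 * exp (2 * z)"
proof -
  have 1: "deriv F y = - C1 * exp (- 2 * y) - C2 * exp (- y) + C3 * exp y + C4 * exp (2 * y)" if "y \<in> I" for y
    by (rule deriv_eq_on[OF that, of F "F_sol C1 C2 C3 C4"])
      (use F in \<open>auto simp: F_sol_def[abs_def] intro!: derivative_eq_intros\<close>)
  have 2: "deriv (deriv F) y = 2 * C1 * exp (- 2 * y) + C2 * exp (- y) + C3 * exp y + 2 * C4 * exp (2 * y)" if "y \<in> I" for y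
    by (rule deriv_eq_on[OF that 1]) (auto intro!: derivative_eq_intros)
  have 3: "deriv (deriv (deriv F)) y = - 4 * C1 * exp (- 2 * y) - C2 * exp (- y) + C3 * exp y + 4 * C4 * exp (2 * y)" if "y \<in> I" for y
    by (rule deriv_eq_on[OF that 2]) (auto intro!: derivative_eq_intros)
  have 4: "deriv (deriv (deriv (deriv F))) y = 8 * C1 * exp (- 2 * y) + C2 * exp (- y) + C3 * exp y + 8 * C4 * exp (2 * y)" if "y \<in> I" for y
    by (rule deriv_eq_on[OF that 3]) (auto intro!: derivative_eq_intros)
  show "deriv F z = - C1 * exp (- 2 * z) - C2 * exp (- z) + C3 * exp z + C4 * exp (2 * z)"
    "deriv (deriv F) z = 2 * C1 * exp (- 2 * z) + C2 * exp (- z) + C3 * exp z + 2 * C4 * exp (2 * z)"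
    "deriv (deriv (deriv F)) z = - 4 * C1 * exp (- 2 * z) - C2 * exp (- z) + C3 * exp z + 4 * C4 * exp (2 * z)"
    "deriv (deriv (deriv (deriv F))) z = 8 * C1 * exp (- 2 * z) + C2 * exp (- z) + C3 * exp z + 8 * C4 * exp (2 * z)"
    using 1 2 3 4 z by auto
qed

lemma sol_weyl:
  assumes F: "\<forall>z\<in>I. F z = F_sol C1 C2 C3 C4 z" and z: "z \<in> I"
  shows "w_plus F z = 3 * (C1 * exp (- 2 * z) + C2 * exp (- z))"
    "w_minus F z = 3 * (C3 * exp z + C4 * exp (2 * z))"
    "bach_linear z = 0" "bach_quadratic z = 12 * (C1 * C4 - C2 * C3)"
proof -
  have Fz: "F z = F_sol C1 C2 C3 C4 z" using F z by blast
  note d = sol_derivs[OF F z]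
  show "w_plus F z = 3 * (C1 * exp (- 2 * z) + C2 * exp (- z))"
    "w_minus F z = 3 * (C3 * exp z + C4 * exp (2 * z))" "bach_linear z = 0"
    by (simp_all add: w_plus_def w_minus_def bach_linear_def d Fz F_sol_def field_simps)
  define X where "X = exp z"
  have X: "X \<noteq> 0" by (simp add: X_def)
  show "bach_quadratic z = 12 * (C1 * C4 - C2 * C3)"
    unfolding bach_quadratic_def d Fz F_sol_def exp_powers X_def[symmetric] using X
    by (simp add: field_simps power2_eq_square)
qed

text \<open>
  The linear equation splits into a second-order equation for \<open>w_plus F\<close> and one for \<open>w_minus F\<close>; in
  turn, \<open>F\<close> is a combination of these two functions and their first derivatives.
\<close>

lemma bach_linear_zero_iff:
  "(\<forall>z\<in>I. bach_linear z = 0) \<longleftrightarrow> (\<exists>C1 C2 C3 C4. \<forall>z\<in>I. F z = F_sol C1 C2 C3 C4 z)"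
proof
  assume L: "\<forall>z\<in>I. bach_linear z = 0"
  have "deriv (deriv (w_plus F)) z = (-1 + -2) * deriv (w_plus F) z - (-1) * (-2) * w_plus F z" if "z \<in> I" for z
    using L[rule_format, OF that] unfolding deriv_w[OF that] w_plus_def bach_linear_def by (simp add: field_simps)
  from second_order_ode[OF I interval w_plus_smooth _ this]
  obtain a b where u: "\<forall>z\<in>I. w_plus F z = a * exp (- 1 * z) + b * exp (- 2 * z)" by auto
  have "deriv (deriv (w_minus F)) z = (1 + 2) * deriv (w_minus F) z - 1 * 2 * w_minus F z" if "z \<in> I" for z
    using L[rule_format, OF that] unfolding deriv_w[OF that] w_minus_def bach_linear_def by (simp add: field_simps)
  from second_order_ode[OF I interval w_minus_smooth _ this]
  obtain c d where v: "\<forall>z\<in>I. w_minus F z = c * exp (1 * z) + d * exp (2 * z)" by auto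
  have "F z = F_sol (b / 3) (a / 3) (c / 3) (d / 3) z" if z: "z \<in> I" for z
  proof -
    have du: "deriv (w_plus F) z = - a * exp (- 1 * z) - 2 * b * exp (- 2 * z)"
      by (rule deriv_eq_on[OF z, of _ "\<lambda>z. a * exp (- 1 * z) + b * exp (- 2 * z)"])
        (use u in \<open>auto intro!: derivative_eq_intros\<close>)
    have dv: "deriv (w_minus F) z = c * exp (1 * z) + 2 * d * exp (2 * z)"
      by (rule deriv_eq_on[OF z, of _ "\<lambda>z. c * exp (1 * z) + d * exp (2 * z)"])
        (use v in \<open>auto intro!: derivative_eq_intros\<close>)
    have "F z = 1 + (w_plus F z + w_minus F z) / 2 - (deriv (w_minus F) z - deriv (w_plus F) z) / 6"
      unfolding deriv_w[OF z] by (simp add: w_plus_def w_minus_def field_simps)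
    then show ?thesis
      unfolding du dv u[rule_format, OF z] v[rule_format, OF z] F_sol_def by (simp add: field_simps)
  qed
  then show "\<exists>C1 C2 C3 C4. \<forall>z\<in>I. F z = F_sol C1 C2 C3 C4 z" by blast
next
  assume "\<exists>C1 C2 C3 C4. \<forall>z\<in>I. F z = F_sol C1 C2 C3 C4 z"
  then show "\<forall>z\<in>I. bach_linear z = 0" using sol_weyl(3) by blast
qed

lemma extremal_ode_iff:
  "(\<forall>z\<in>I. L_plus (L_minus F) z - 1 = 0) \<longleftrightarrow> (\<exists>C1 C2 C3 C4. \<forall>z\<in>I. F z = F_sol C1 C2 C3 C4 z)"
  using bach_linear_zero_iff L_plus_L_minus by auto

text \<open>On the solutions of the linear equation the quadratic one is the constant \<open>12 (C1 C4 - C2 C3)\<close>.\<close>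

lemma bach_flat_sol_iff:
  "bach_flat (cyl I) (u2_metric F C) \<longleftrightarrow>
     (\<exists>C1 C2 C3 C4. (\<forall>z\<in>I. F z = F_sol C1 C2 C3 C4 z) \<and> C1 * C4 - C2 * C3 = 0)"
proof
  assume "bach_flat (cyl I) (u2_metric F C)"
  then have L: "\<forall>z\<in>I. bach_linear z = 0" and Q: "\<forall>z\<in>I. bach_quadratic z = 0"
    unfolding bach_flat_iff by auto
  obtain C1 C2 C3 C4 where F: "\<forall>z\<in>I. F z = F_sol C1 C2 C3 C4 z" using L bach_linear_zero_iff by blast
  obtain z where z: "z \<in> I" using nonempty by blast
  have "C1 * C4 - C2 * C3 = 0" using sol_weyl(4)[OF F z] Q z by simp
  with F show "\<exists>C1 C2 C3 C4. (\<forall>z\<in>I. F z = F_sol C1 C2 C3 C4 z) \<and> C1 * C4 - C2 * C3 = 0" by blast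
next
  assume "\<exists>C1 C2 C3 C4. (\<forall>z\<in>I. F z = F_sol C1 C2 C3 C4 z) \<and> C1 * C4 - C2 * C3 = 0"
  then obtain C1 C2 C3 C4 where F: "\<forall>z\<in>I. F z = F_sol C1 C2 C3 C4 z" and q: "C1 * C4 - C2 * C3 = 0" by blast
  then show "bach_flat (cyl I) (u2_metric F C)"
    unfolding bach_flat_iff using sol_weyl(3,4)[OF F] by simp
qed

lemma w_plus_zero_iff:
  "(\<forall>z\<in>I. w_plus F z = 0) \<longleftrightarrow> (\<exists>C3 C4. \<forall>z\<in>I. F z = 1 + C3 * exp z + 1 / 2 * C4 * exp (2 * z))"
proof
  assume L: "\<forall>z\<in>I. w_plus F z = 0"
  have d: "deriv (\<lambda>z. F z - 1) y = deriv F y" if "y \<in> I" for y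
    by (rule DERIV_imp_deriv) (auto intro!: derivative_eq_intros F_deriv[OF that])
  have "deriv (deriv (\<lambda>z. F z - 1)) z = (1 + 2) * deriv (\<lambda>z. F z - 1) z - 1 * 2 * (F z - 1)" if z: "z \<in> I" for z
  proof -
    have "deriv (deriv (\<lambda>z. F z - 1)) z = deriv (deriv F) z"
      by (rule deriv_eq_on[OF z d]) (auto intro!: smooth_on_has_real_derivative[OF F1_smooth z])
    then show ?thesis using L z by (simp add: d w_plus_def field_simps)
  qed
  from second_order_ode[OF I interval _ _ this] obtain a b
    where "\<forall>z\<in>I. F z - 1 = a * exp (1 * z) + b * exp (2 * z)"
    using smooth_on_diff[OF I F_smooth smooth_on_const[OF I, of 1]] by auto
  then have "\<forall>z\<in>I. F z = 1 + a * exp z + 1 / 2 * (2 * b) * exp (2 * z)" by (auto simp: algebra_simps)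
  then show "\<exists>C3 C4. \<forall>z\<in>I. F z = 1 + C3 * exp z + 1 / 2 * C4 * exp (2 * z)" by blast
next
  assume "\<exists>C3 C4. \<forall>z\<in>I. F z = 1 + C3 * exp z + 1 / 2 * C4 * exp (2 * z)"
  then obtain C3 C4 where "\<forall>z\<in>I. F z = F_sol 0 0 C3 C4 z" by (auto simp: F_sol_def)
  from sol_weyl(1)[OF this] show "\<forall>z\<in>I. w_plus F z = 0" by simp
qed

lemma w_minus_zero_iff:
  "(\<forall>z\<in>I. w_minus F z = 0) \<longleftrightarrow> (\<exists>C1 C2. \<forall>z\<in>I. F z = 1 + 1 / 2 * C1 * exp (- 2 * z) + C2 * exp (- z))"
proof
  assume L: "\<forall>z\<in>I. w_minus F z = 0"
  have d: "deriv (\<lambda>z. F z - 1) y = deriv F y" if "y \<in> I" for y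
    by (rule DERIV_imp_deriv) (auto intro!: derivative_eq_intros F_deriv[OF that])
  have "deriv (deriv (\<lambda>z. F z - 1)) z = (-1 + -2) * deriv (\<lambda>z. F z - 1) z - (-1) * (-2) * (F z - 1)" if z: "z \<in> I" for z
  proof -
    have "deriv (deriv (\<lambda>z. F z - 1)) z = deriv (deriv F) z"
      by (rule deriv_eq_on[OF z d]) (auto intro!: smooth_on_has_real_derivative[OF F1_smooth z])
    then show ?thesis using L z by (simp add: d w_minus_def field_simps)
  qed
  from second_order_ode[OF I interval _ _ this] obtain a b
    where "\<forall>z\<in>I. F z - 1 = a * exp (-1 * z) + b * exp (-2 * z)"
    using smooth_on_diff[OF I F_smooth smooth_on_const[OF I, of 1]] by auto
  then have "\<forall>z\<in>I. F z = 1 + 1 / 2 * (2 * b) * exp (- 2 * z) + a * exp (- z)" by (auto simp: algebra_simps)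
  then show "\<exists>C1 C2. \<forall>z\<in>I. F z = 1 + 1 / 2 * C1 * exp (- 2 * z) + C2 * exp (- z)" by blast
next
  assume "\<exists>C1 C2. \<forall>z\<in>I. F z = 1 + 1 / 2 * C1 * exp (- 2 * z) + C2 * exp (- z)"
  then obtain C1 C2 where "\<forall>z\<in>I. F z = F_sol C1 C2 0 0 z" by (auto simp: F_sol_def)
  from sol_weyl(2)[OF this] show "\<forall>z\<in>I. w_minus F z = 0" by simp
qed

end


section \<open>Kaehler metrics\<close>

lemma matrix_minus_left: "(- A) ** (B::real^'n^'m) = - (A ** B)"
  by (vector matrix_matrix_mult_def sum_negf)

text \<open>In the invariant frame \<open>J\<^sup>+\<close> is constant: \<open>E\<^sub>1 \<mapsto> E\<^sub>2\<close> and \<open>E\<^sub>3 \<mapsto> E\<^sub>4\<close>.\<close>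

definition J_matrix :: "real^4^4" where
  "J_matrix = (\<chi> a b. if (a, b) \<in> {(2, 1), (4, 3)} then 1 else if (a, b) \<in> {(1, 2), (3, 4)} then -1 else 0)"

context u2
begin

text \<open>As \<open>J\<^sup>+\<close> has constant frame components, its covariant derivative along \<open>E\<^sub>c\<close> is a commutator with the connection matrix.\<close>

definition gammam :: "4 \<Rightarrow> real \<Rightarrow> real^4^4" where "gammam c z = (\<chi> a b. u2_gamma F C a c b z)"

definition J_cov :: "4 \<Rightarrow> real \<Rightarrow> real^4^4" where "J_cov c z = gammam c z ** J_matrix - J_matrix ** gammam c z"

lemma J_frame: "x \<in> cyl I \<Longrightarrow> Jplus F x = E x ** J_matrix ** \<Theta> x"
  unfolding vec_eq_iff
  by (simp add: matrix_mult_nth sum_4 J_matrix_def Jplus_def Let_def E_def \<Theta>_def u2_frame_def u2_coframe_def)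

lemma J_square: "J_matrix ** J_matrix = - mat 1"
  unfolding vec_eq_iff forall_4 by (simp add: matrix_mult_nth sum_4 J_matrix_def mat_def)

lemma Jplus_square: "x \<in> cyl I \<Longrightarrow> Jplus F x ** Jplus F x = - mat 1"
proof -
  assume x: "x \<in> cyl I"
  have "Jplus F x ** Jplus F x = E x ** J_matrix ** (\<Theta> x ** E x) ** J_matrix ** \<Theta> x"
    unfolding J_frame[OF x] by (simp only: matrix_mul_assoc)
  also have "\<dots> = E x ** (J_matrix ** J_matrix) ** \<Theta> x" by (simp add: \<Theta>_E[OF x] matrix_mul_assoc)
  also have "\<dots> = - mat 1"
    unfolding J_square
    by (simp add: matrix_minus_right matrix_minus_left E_\<Theta>[OF x])
  finally show ?thesis .
qed

lemma Jplus_compatible: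
  assumes x: "x \<in> cyl I"
  shows "transpose (Jplus F x) ** u2_metric F C x ** Jplus F x = u2_metric F C x"
proof -
  let ?G = "(\<chi> a b. u2_gf F C a b (zcoord x)) :: real^4^4"
  have JGJ: "transpose J_matrix ** ?G ** J_matrix = ?G"
    unfolding vec_eq_iff forall_4
    by (simp add: matrix_mult_nth sum_4 J_matrix_def transpose_def u2_gf_def)
  have "transpose (Jplus F x) ** u2_metric F C x ** Jplus F x
    = transpose (\<Theta> x) ** transpose J_matrix ** transpose (\<Theta> x ** E x) ** ?G ** (\<Theta> x ** E x) ** J_matrix ** \<Theta> x"
    unfolding J_frame[OF x] g_matrix[OF x] matrix_transpose_mul by (simp only: matrix_mul_assoc)
  also have "\<dots> = transpose (\<Theta> x) ** (transpose J_matrix ** ?G ** J_matrix) ** \<Theta> x"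
    by (simp add: \<Theta>_E[OF x] matrix_mul_assoc)
  finally show ?thesis unfolding JGJ g_matrix[OF x] .
qed

lemma E_differentiable: "x \<in> cyl I \<Longrightarrow> (\<lambda>y. E y $ i $ a) differentiable (at x)"
  using smooth_on_differentiable[OF frame_smooth] by (simp add: E_def)

lemma \<Theta>_differentiable: "x \<in> cyl I \<Longrightarrow> (\<lambda>y. \<Theta> y $ a $ i) differentiable (at x)"
  using smooth_on_differentiable[OF coframe_smooth] by (simp add: \<Theta>_def)

abbreviation Gam :: "4 \<Rightarrow> real^4 \<Rightarrow> real^4^4" where
  "Gam i x \<equiv> (\<chi> l k. christoffel (u2_metric F C) l i k x)"

text \<open>Dual to \<open>christoffel_frame\<close>, by differentiating \<open>E ** \<Theta> = 1\<close>.\<close>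

lemma pdm_frame:
  assumes x: "x \<in> cyl I" shows "pdm i E x = E x ** A i x - Gam i x ** E x"
proof -
  have "pdm i (\<lambda>y. E y ** \<Theta> y) x = 0"
  proof -
    have "pd i (\<lambda>y. (E y ** \<Theta> y) $ a $ b) x = pd i (\<lambda>y. (mat 1 :: real^4^4) $ a $ b) x" for a b
      by (rule pd_cong[OF open_cyl[OF I] x]) (simp add: E_\<Theta>)
    then show ?thesis by (simp add: pdm_def vec_eq_iff pd_const)
  qed
  then have "pdm i E x ** \<Theta> x + E x ** pdm i \<Theta> x = 0"
    using pdm_mult[of E x \<Theta> i] E_differentiable[OF x] \<Theta>_differentiable[OF x] by simp
  moreover have "pdm i \<Theta> x = \<Theta> x ** Gam i x - A i x ** \<Theta> x"
    using christoffel_frame[OF x, of i] by simp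
  ultimately have "pdm i E x ** \<Theta> x = E x ** A i x ** \<Theta> x - (E x ** \<Theta> x) ** Gam i x"
    by (simp add: matrix_ring eq_neg_iff_add_eq_0[symmetric])
  then have "pdm i E x ** (\<Theta> x ** E x) = E x ** A i x ** (\<Theta> x ** E x) - Gam i x ** E x"
    by (simp add: matrix_mul_assoc E_\<Theta>[OF x] matrix_diff_rdistrib)
  then show ?thesis by (simp add: \<Theta>_E[OF x])
qed

lemma A_eq: "A i x = (\<Sum>c\<in>UNIV. \<theta> c i x *\<^sub>R gammam c (zcoord x))" if "\<theta> = u2_coframe F" for \<theta>
  using that by (simp add: A_def gammam_def vec_eq_iff)

lemma pdm_J:
  assumes x: "x \<in> cyl I"
  shows "pdm i (Jplus F) x = E x ** (A i x ** J_matrix - J_matrix ** A i x) ** \<Theta> x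
    - Gam i x ** Jplus F x + Jplus F x ** Gam i x"
proof -
  have d: "(\<lambda>y. (E y ** J_matrix) $ a $ b) differentiable (at x)" for a b
    unfolding matrix_mult_nth using E_differentiable[OF x] by (auto intro!: differentiable_sum differentiable_mult)
  have EJ: "pdm i (\<lambda>y. E y ** J_matrix) x = pdm i E x ** J_matrix"
    using pdm_mult[of E x "\<lambda>y. J_matrix" i] E_differentiable[OF x]
    by (simp add: pdm_def[of _ "\<lambda>y. J_matrix"] pd_const zero_vec_def[symmetric] flip: zero_vec_def)
  have "pdm i (Jplus F) x = pdm i (\<lambda>y. E y ** J_matrix ** \<Theta> y) x"
    using pd_cong[OF open_cyl[OF I] x, of "\<lambda>y. Jplus F y $ _ $ _"] J_frame by (simp add: pdm_def vec_eq_iff)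
  also have "\<dots> = pdm i E x ** J_matrix ** \<Theta> x + E x ** J_matrix ** pdm i \<Theta> x"
    using pdm_mult[of "\<lambda>y. E y ** J_matrix" x \<Theta> i] d \<Theta>_differentiable[OF x] by (simp add: EJ)
  also have "pdm i \<Theta> x = \<Theta> x ** Gam i x - A i x ** \<Theta> x"
    using christoffel_frame[OF x, of i] by simp
  finally show ?thesis
    unfolding pdm_frame[OF x] J_frame[OF x] by (simp add: matrix_ring)
qed

end

lemma tens3_rotate:
  "tens \<theta> \<pi> T [j, k, i] x = tens \<theta> \<pi> (\<lambda>as. T [as ! 1, as ! 2, as ! 0]) [i, j, k] x"
proof -
  have "tens \<theta> \<pi> T [j, k, i] x = (\<Sum>b\<in>UNIV. \<Sum>c\<in>UNIV. \<Sum>a\<in>UNIV. \<theta> b j x * (\<theta> c k x * (\<theta> a i x * T [b, c, a] (\<pi> x))))"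
    by (simp add: sum_distrib_left)
  also have "\<dots> = (\<Sum>a\<in>UNIV. \<Sum>b\<in>UNIV. \<Sum>c\<in>UNIV. \<theta> b j x * (\<theta> c k x * (\<theta> a i x * T [b, c, a] (\<pi> x))))"
    by (rule sum_rotate3[symmetric])
  finally show ?thesis by (simp add: sum_distrib_left mult_ac numeral_2_eq_2)
qed

context u2
begin

text \<open>The frame form of the vanishing of the Nijenhuis tensor, written with covariant derivatives.\<close>

lemma J_cov_symmetric:
  assumes z: "z \<in> I"
  shows "(\<Sum>c\<in>UNIV. J_matrix $ c $ d * J_cov c z $ a $ b) - (J_matrix ** J_cov d z) $ a $ b
    = (\<Sum>c\<in>UNIV. J_matrix $ c $ b * J_cov c z $ a $ d) - (J_matrix ** J_cov b z) $ a $ d"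
proof -
  have "\<forall>a b d. (\<Sum>c\<in>UNIV. J_matrix $ c $ d * J_cov c z $ a $ b) - (J_matrix ** J_cov d z) $ a $ b
    = (\<Sum>c\<in>UNIV. J_matrix $ c $ b * J_cov c z $ a $ d) - (J_matrix ** J_cov b z) $ a $ d"
    unfolding forall_4
    by (intro conjI; simp add: J_cov_def gammam_def matrix_mult_nth sum_4 J_matrix_def; simp add: gamma_table)
  then show ?thesis by blast
qed

text \<open>
  In the Nijenhuis tensor partial derivatives may be replaced by covariant ones, as the connection
  is symmetric; the covariant derivative of \<open>J\<close> is computed in the frame.
\<close>

lemma nijenhuis_zero:
  assumes x: "x \<in> cyl I" shows "nijenhuis (Jplus F) k i j x = 0"
proof -
  let ?J = "Jplus F x" and ?z = "zcoord x"
  have z: "?z \<in> I" using x by (simp add: cyl_def)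
  \<comment> \<open>The covariant part of the derivative of \<open>J\<close>, and the part which involves the Christoffel symbols.\<close>
  define P where "P m = E x ** (A m x ** J_matrix - J_matrix ** A m x) ** \<Theta> x" for m
  define B where "B m = ?J ** Gam m x - Gam m x ** ?J" for m
  have pdJ: "pd m (\<lambda>y. Jplus F y $ a $ b) x = P m $ a $ b + B m $ a $ b" for m a b
  proof -
    have "pd m (\<lambda>y. Jplus F y $ a $ b) x = pdm m (Jplus F) x $ a $ b" by (simp add: pdm_def)
    then show ?thesis unfolding pdm_J[OF x] by (simp add: P_def B_def)
  qed
  have NB: "(\<Sum>m\<in>UNIV. ?J $ m $ i * B m $ k $ j - ?J $ m $ j * B m $ k $ i - ?J $ k $ m * (B i $ m $ j - B j $ m $ i)) = 0"
  proof -
    let ?\<Gamma> = "\<lambda>l m j. christoffel (u2_metric F C) l m j x"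
    have \<Gamma>: "?\<Gamma> l m j = ?\<Gamma> l j m" for l m j by (rule christoffel_sym[OF x])
    define S1 where "S1 i j = (\<Sum>m\<in>UNIV. \<Sum>l\<in>UNIV. ?J $ m $ i * (?\<Gamma> k m l * ?J $ l $ j))" for i j
    define S2 where "S2 i j = (\<Sum>m\<in>UNIV. \<Sum>l\<in>UNIV. ?J $ m $ i * (?J $ k $ l * ?\<Gamma> l m j))" for i j
    define S3 where "S3 i j = (\<Sum>m\<in>UNIV. \<Sum>l\<in>UNIV. ?J $ k $ m * (?\<Gamma> m i l * ?J $ l $ j))" for i j
    define S4 where "S4 i j = (\<Sum>m\<in>UNIV. \<Sum>l\<in>UNIV. ?J $ k $ m * (?J $ m $ l * ?\<Gamma> l i j))" for i j
    have B: "B m $ a $ b = (\<Sum>l\<in>UNIV. ?J $ a $ l * ?\<Gamma> l m b) - (\<Sum>l\<in>UNIV. ?\<Gamma> a m l * ?J $ l $ b)" for m a b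
      by (simp add: B_def matrix_mult_nth)
    have "(\<Sum>m\<in>UNIV. ?J $ m $ i * B m $ k $ j - ?J $ m $ j * B m $ k $ i - ?J $ k $ m * (B i $ m $ j - B j $ m $ i))
      = (S2 i j - S1 i j) - (S2 j i - S1 j i) - ((S4 i j - S3 i j) - (S4 j i - S3 j i))"
      by (simp only: B S1_def S2_def S3_def S4_def right_diff_distrib sum_subtractf sum_distrib_left)
    moreover have "S1 i j = S1 j i" unfolding S1_def by (subst sum.swap) (simp add: \<Gamma>[of k] mult_ac)
    moreover have "S3 i j = S2 j i" for i j unfolding S3_def S2_def by (subst sum.swap) (simp add: \<Gamma>[of _ i] mult_ac)
    moreover have "S4 i j = S4 j i" unfolding S4_def by (simp add: \<Gamma>[of _ i j])
    ultimately show ?thesis by simp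
  qed
  have NP: "(\<Sum>m\<in>UNIV. ?J $ m $ i * P m $ k $ j - ?J $ m $ j * P m $ k $ i - ?J $ k $ m * (P i $ m $ j - P j $ m $ i)) = 0"
  proof -
    let ?\<theta> = "\<lambda>a i. u2_coframe F a i x"
    have P: "P m = (\<Sum>c\<in>UNIV. ?\<theta> c m *\<^sub>R (E x ** J_cov c ?z ** \<Theta> x))" for m
    proof -
      have "A m x ** J_matrix - J_matrix ** A m x = (\<Sum>c\<in>UNIV. ?\<theta> c m *\<^sub>R J_cov c ?z)"
        unfolding A_eq[OF refl] J_cov_def sum_4
        by (simp add: matrix_ring matrix_scalar_ac scalar_matrix_assoc[symmetric] scaleR_diff_right)
      then show ?thesis
        unfolding P_def sum_4 by (simp add: matrix_ring matrix_scalar_ac scalar_matrix_assoc[symmetric])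
    qed
    define Q where "Q d j = (\<Sum>b\<in>UNIV. (\<Sum>a\<in>UNIV. E x $ k $ a * ((\<Sum>c\<in>UNIV. J_matrix $ c $ d * J_cov c ?z $ a $ b)
        - (J_matrix ** J_cov d ?z) $ a $ b)) * ?\<theta> b j)" for d j
    have first: "(\<Sum>m\<in>UNIV. ?J $ m $ i * P m $ k $ j) - (\<Sum>m\<in>UNIV. ?J $ k $ m * P i $ m $ j) = (\<Sum>d\<in>UNIV. ?\<theta> d i * Q d j)" for i j
    proof -
      have \<theta>J: "(\<Sum>m\<in>UNIV. ?\<theta> c m * ?J $ m $ i) = (\<Sum>d\<in>UNIV. J_matrix $ c $ d * ?\<theta> d i)" for c
      proof -
        have "\<Theta> x ** ?J = J_matrix ** \<Theta> x"
          unfolding J_frame[OF x] by (simp add: matrix_mul_assoc \<Theta>_E[OF x])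
        then have "(\<Theta> x ** ?J) $ c $ i = (J_matrix ** \<Theta> x) $ c $ i" by simp
        then show ?thesis by (simp add: matrix_mult_nth \<Theta>_def)
      qed
      have "(\<Sum>m\<in>UNIV. ?J $ m $ i * P m $ k $ j) = (\<Sum>m\<in>UNIV. \<Sum>c\<in>UNIV. (?\<theta> c m * ?J $ m $ i) * (E x ** J_cov c ?z ** \<Theta> x) $ k $ j)"
        unfolding P by (simp add: sum_distrib_left mult_ac)
      also have "\<dots> = (\<Sum>c\<in>UNIV. (\<Sum>d\<in>UNIV. J_matrix $ c $ d * ?\<theta> d i) * (E x ** J_cov c ?z ** \<Theta> x) $ k $ j)"
        by (subst sum.swap) (simp only: sum_distrib_right[symmetric] \<theta>J)
      also have "\<dots> = (\<Sum>d\<in>UNIV. ?\<theta> d i * (\<Sum>c\<in>UNIV. J_matrix $ c $ d * (E x ** J_cov c ?z ** \<Theta> x) $ k $ j))"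
        by (simp add: sum_distrib_right sum_distrib_left) (subst sum.swap, simp add: mult_ac)
      finally have 1: "(\<Sum>m\<in>UNIV. ?J $ m $ i * P m $ k $ j) = (\<Sum>d\<in>UNIV. ?\<theta> d i * (\<Sum>c\<in>UNIV. J_matrix $ c $ d * (E x ** J_cov c ?z ** \<Theta> x) $ k $ j))" .
      have "?J ** P i = (\<Sum>d\<in>UNIV. ?\<theta> d i *\<^sub>R (E x ** (J_matrix ** J_cov d ?z) ** \<Theta> x))"
      proof -
        have "?J ** (E x ** M ** \<Theta> x) = E x ** (J_matrix ** M) ** \<Theta> x" for M
        proof -
          have "?J ** (E x ** M ** \<Theta> x) = E x ** J_matrix ** (\<Theta> x ** E x) ** M ** \<Theta> x"
            unfolding J_frame[OF x] by (simp only: matrix_mul_assoc)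
          then show ?thesis by (simp add: \<Theta>_E[OF x] matrix_mul_assoc)
        qed
        then show ?thesis unfolding P sum_4 by (simp add: matrix_ring matrix_scalar_ac scalar_matrix_assoc[symmetric])
      qed
      then have "(?J ** P i) $ k $ j = (\<Sum>d\<in>UNIV. ?\<theta> d i * (E x ** (J_matrix ** J_cov d ?z) ** \<Theta> x) $ k $ j)" by simp
      then have 2: "(\<Sum>m\<in>UNIV. ?J $ k $ m * P i $ m $ j) = (\<Sum>d\<in>UNIV. ?\<theta> d i * (E x ** (J_matrix ** J_cov d ?z) ** \<Theta> x) $ k $ j)"
        by (simp add: matrix_mult_nth[of ?J])
      have ent: "(E x ** M ** \<Theta> x) $ k $ j = (\<Sum>b\<in>UNIV. (\<Sum>a\<in>UNIV. E x $ k $ a * M $ a $ b) * ?\<theta> b j)" for M :: "real^4^4"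
        by (simp add: matrix_mult_nth \<Theta>_def)
      have 3: "(\<Sum>c\<in>UNIV. J_matrix $ c $ d * (E x ** J_cov c ?z ** \<Theta> x) $ k $ j) - (E x ** (J_matrix ** J_cov d ?z) ** \<Theta> x) $ k $ j = Q d j" for d
        unfolding ent Q_def by (simp add: sum_4 algebra_simps)
      show ?thesis unfolding 1 2 sum_subtractf[symmetric] right_diff_distrib[symmetric] 3 ..
    qed
    have "(\<Sum>d\<in>UNIV. ?\<theta> d i * Q d j) = (\<Sum>d\<in>UNIV. ?\<theta> d j * Q d i)"
    proof -
      define L where "L d b = (\<Sum>a\<in>UNIV. E x $ k $ a * ((\<Sum>c\<in>UNIV. J_matrix $ c $ d * J_cov c ?z $ a $ b)
        - (J_matrix ** J_cov d ?z) $ a $ b))" for d b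
      have L: "L d b = L b d" for d b unfolding L_def using J_cov_symmetric[OF z, of d _ b] by simp
      have "(\<Sum>d\<in>UNIV. ?\<theta> d i * Q d j) = (\<Sum>d\<in>UNIV. \<Sum>b\<in>UNIV. ?\<theta> d i * (L d b * ?\<theta> b j))"
        by (simp add: Q_def L_def sum_distrib_left)
      also have "\<dots> = (\<Sum>b\<in>UNIV. \<Sum>d\<in>UNIV. ?\<theta> b j * (L b d * ?\<theta> d i))"
        by (subst sum.swap) (simp add: L mult_ac)
      also have "\<dots> = (\<Sum>d\<in>UNIV. ?\<theta> d j * Q d i)" by (simp add: Q_def L_def sum_distrib_left)
      finally show ?thesis .
    qed
    then show ?thesis using first[of i j] first[of j i] by (simp add: sum_subtractf right_diff_distrib)
  qed
  have "nijenhuis (Jplus F) k i j x =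
      (\<Sum>m\<in>UNIV. ?J $ m $ i * P m $ k $ j - ?J $ m $ j * P m $ k $ i - ?J $ k $ m * (P i $ m $ j - P j $ m $ i))
    + (\<Sum>m\<in>UNIV. ?J $ m $ i * B m $ k $ j - ?J $ m $ j * B m $ k $ i - ?J $ k $ m * (B i $ m $ j - B j $ m $ i))"
    unfolding nijenhuis_def pdJ sum.distrib[symmetric] by (intro sum.cong refl) (simp add: algebra_simps)
  then show ?thesis using NB NP by simp
qed

lemma Jplus_smooth: "smooth_on (cyl I) (Jplus F)"
proof (rule smooth_on_cong[OF open_cyl[OF I] J_frame])
  show "smooth_on (cyl I) (\<lambda>x. E x ** J_matrix ** \<Theta> x)"
  proof (intro smooth_on_vec open_cyl I)
    fix i j
    show "smooth_on (cyl I) (\<lambda>x. (E x ** J_matrix ** \<Theta> x) $ i $ j)"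
      unfolding matrix_mult_nth E_def \<Theta>_def
      by (simp, intro smooth_intros open_cyl I frame_smooth coframe_smooth)
  qed
qed

definition omega_frame :: "4 list \<Rightarrow> real \<Rightarrow> real" where
  "omega_frame as = (if as ! 0 = 1 \<and> as ! 1 = 2 then (\<lambda>z. C z * F z) else
     if as ! 0 = 2 \<and> as ! 1 = 1 then (\<lambda>z. - (C z * F z)) else
     if as ! 0 = 3 \<and> as ! 1 = 4 then C else if as ! 0 = 4 \<and> as ! 1 = 3 then (\<lambda>z. - C z) else (\<lambda>z. 0))"

lemma omega_smooth: "smooth_on I (omega_frame as)"
  unfolding omega_frame_def by (simp only: split: if_split) (intro conjI impI smooth_intros I F_smooth C_smooth)

lemma kaehler_form_tens:
  assumes x: "x \<in> cyl I"
  shows "kaehler_form (u2_metric F C) (Jplus F) i j x = tens (u2_coframe F) zcoord omega_frame [i, j] x"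
proof -
  let ?G = "(\<chi> a b. u2_gf F C a b (zcoord x)) :: real^4^4"
  have "kaehler_form (u2_metric F C) (Jplus F) i j x = (transpose (Jplus F x) ** u2_metric F C x) $ i $ j"
    by (simp add: kaehler_form_def matrix_mult_nth transpose_def)
  also have "transpose (Jplus F x) ** u2_metric F C x
    = transpose (\<Theta> x) ** transpose J_matrix ** transpose (\<Theta> x ** E x) ** ?G ** \<Theta> x"
    unfolding J_frame[OF x] g_matrix[OF x] matrix_transpose_mul by (simp only: matrix_mul_assoc)
  also have "\<dots> = transpose (\<Theta> x) ** (transpose J_matrix ** ?G) ** \<Theta> x"
    by (simp add: \<Theta>_E[OF x] matrix_mul_assoc)
  also have "transpose J_matrix ** ?G = (\<chi> a b. omega_frame [a, b] (zcoord x))"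
    unfolding vec_eq_iff forall_4
    by (simp add: matrix_mult_nth sum_4 J_matrix_def transpose_def u2_gf_def omega_frame_def)
  also have "(transpose (\<Theta> x) ** (\<chi> a b. omega_frame [a, b] (zcoord x)) ** \<Theta> x) $ i $ j
    = tens (u2_coframe F) zcoord omega_frame [i, j] x"
    unfolding tens2 by (subst sum.swap) (simp add: matrix_mult_nth transpose_def \<Theta>_def sum_distrib_left sum_distrib_right mult_ac)
  finally show ?thesis .
qed

lemma frame_cov2: "frame_cov (u2_D F) (u2_gamma F C) e T [a, b] z = u2_D F e (T [a, b]) z
    - ((\<Sum>m\<in>UNIV. u2_gamma F C m e a z * T [m, b] z) + (\<Sum>m\<in>UNIV. u2_gamma F C m e b z * T [a, m] z))"
  by (simp add: frame_cov_def)

definition domega :: "4 list \<Rightarrow> real \<Rightarrow> real" where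
  "domega as z = frame_cov (u2_D F) (u2_gamma F C) (as ! 0) omega_frame [as ! 1, as ! 2] z
    + frame_cov (u2_D F) (u2_gamma F C) (as ! 1) omega_frame [as ! 2, as ! 0] z
    + frame_cov (u2_D F) (u2_gamma F C) (as ! 2) omega_frame [as ! 0, as ! 1] z"

text \<open>
  As in the Nijenhuis tensor, the Christoffel symbols cancel, here from the cyclic sum over an
  antisymmetric tensor; so \<open>d\<omega>\<close> is computed from covariant derivatives in the frame.
\<close>

lemma exterior_derivative_omega:
  assumes x: "x \<in> cyl I"
  shows "pd i (kaehler_form (u2_metric F C) (Jplus F) j k) x + pd j (kaehler_form (u2_metric F C) (Jplus F) k i) x
     + pd k (kaehler_form (u2_metric F C) (Jplus F) i j) x = tens (u2_coframe F) zcoord domega [i, j, k] x"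
proof -
  let ?w = "tens (u2_coframe F) zcoord omega_frame" and ?\<Gamma> = "\<lambda>m i j. christoffel (u2_metric F C) m i j x"
  have pw: "pd i (kaehler_form (u2_metric F C) (Jplus F) j k) x = pd i (?w [j, k]) x" for i j k
    by (rule pd_cong[OF open_cyl[OF I] x kaehler_form_tens])
  have cov: "frame_cov pd (christoffel (u2_metric F C)) i ?w [j, k] x
    = pd i (?w [j, k]) x - (\<Sum>m\<in>UNIV. ?\<Gamma> m i j * ?w [m, k] x) - (\<Sum>m\<in>UNIV. ?\<Gamma> m i k * ?w [j, m] x)" for i j k
    by (simp add: frame_cov_def del: tens.simps)
  have wanti: "?w [j, m] x = - ?w [m, j] x" for j m
  proof -
    have o: "omega_frame [a, b] z = - omega_frame [b, a] z" for a b z by (auto simp: omega_frame_def)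
    have "?w [j, m] x = (\<Sum>b\<in>UNIV. \<Sum>a\<in>UNIV. u2_coframe F a j x * (u2_coframe F b m x * omega_frame [a, b] (zcoord x)))"
      unfolding tens2 by (rule sum.swap)
    also have "\<dots> = - ?w [m, j] x"
      unfolding tens2 sum_negf[symmetric] by (intro sum.cong refl) (subst o, simp)
    finally show ?thesis .
  qed
  have \<Gamma>: "?\<Gamma> m i j = ?\<Gamma> m j i" for m i j by (rule christoffel_sym[OF x])
  have T: "frame_cov pd (christoffel (u2_metric F C)) i ?w [j, k] x
    = tens (u2_coframe F) zcoord (\<lambda>as. frame_cov (u2_D F) (u2_gamma F C) (hd as) omega_frame (tl as)) [i, j, k] x" for i j k
    by (subst frame_cov_tens[OF x omega_smooth]) simp
  have "pd i (?w [j, k]) x + pd j (?w [k, i]) x + pd k (?w [i, j]) x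
    = frame_cov pd (christoffel (u2_metric F C)) i ?w [j, k] x + frame_cov pd (christoffel (u2_metric F C)) j ?w [k, i] x
      + frame_cov pd (christoffel (u2_metric F C)) k ?w [i, j] x"
    unfolding cov wanti[of j] wanti[of k] wanti[of i]
    by (simp add: \<Gamma>[of _ j i] \<Gamma>[of _ k i] \<Gamma>[of _ k j] sum_negf del: tens.simps)
  also have "\<dots> = tens (u2_coframe F) zcoord domega [i, j, k] x"
    unfolding T tens3_rotate[of _ _ _ j k i] tens3_rotate[of _ _ _ k i j]
      tens3_rotate[of _ _ _ j k i] tens_add[symmetric]
    by (rule tens_cong) (auto simp: domega_def length_Suc_conv numeral_2_eq_2)
  finally show ?thesis unfolding pw .
qed

lemma length3_all: "(\<forall>as. length as = 3 \<longrightarrow> P as) \<longleftrightarrow> (\<forall>a b c. P [a, b, c])" for P :: "4 list \<Rightarrow> bool"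
  unfolding length3 by blast

text \<open>As \<open>\<omega> = C (dz \<and> \<eta>\<^sup>1 / 2 + \<eta>\<^sup>2 \<and> \<eta>\<^sup>3)\<close> and \<open>d\<eta>\<^sup>1 = - 2 \<eta>\<^sup>2 \<and> \<eta>\<^sup>3\<close>, the form \<open>d\<omega>\<close> is \<open>(C' + C) dz \<and> \<eta>\<^sup>2 \<and> \<eta>\<^sup>3\<close>.\<close>

lemma domega_zero_iff:
  assumes z: "z \<in> I"
  shows "(\<forall>a b c. domega [a, b, c] z = 0) \<longleftrightarrow> deriv C z = - C z"
proof -
  have d: "deriv (\<lambda>z. C z * F z) z = dlog C z * C z * F z + C z * deriv F z"
    "deriv (\<lambda>z. - (C z * F z)) z = - (dlog C z * C z * F z + C z * deriv F z)"
    "deriv C z = dlog C z * C z" "deriv (\<lambda>z. - C z) z = - (dlog C z * C z)"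
    by (rule DERIV_imp_deriv, auto intro!: derivative_eq_intros C_deriv'[OF z] F_deriv[OF z])+
  have cancel: "x = - 1" if "- (C z * (F z * x)) = C z * F z" for x
  proof -
    have "C z * F z * (x + 1) = 0" using that by (simp add: algebra_simps)
    then show ?thesis using C_nz[OF z] F_nz[OF z] by simp
  qed
  have "(\<forall>a b c. domega [a, b, c] z = 0) \<longleftrightarrow> dlog C z = - 1"
    unfolding forall_4 domega_def using C_nz[OF z] F_nz[OF z]
    by (simp add: frame_cov2 sum_4 gamma_table u2_D_def omega_frame_def d) (auto simp: algebra_simps intro: cancel)
  also have "\<dots> \<longleftrightarrow> (dlog C z + 1) * C z = 0" using C_nz[OF z] by auto
  finally show ?thesis unfolding d by (simp add: algebra_simps eq_neg_iff_add_eq_0)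
qed

lemma kaehler_iff: "kaehler (cyl I) (u2_metric F C) (Jplus F) \<longleftrightarrow> (\<forall>z\<in>I. deriv C z = - C z)"
proof -
  have "kaehler (cyl I) (u2_metric F C) (Jplus F) \<longleftrightarrow>
    (\<forall>x\<in>cyl I. \<forall>i j k. tens (u2_coframe F) zcoord domega [i, j, k] x = 0)"
    unfolding kaehler_def complex_structure_def
    using Jplus_smooth Jplus_square nijenhuis_zero Jplus_compatible exterior_derivative_omega by auto
  also have "\<dots> \<longleftrightarrow> (\<forall>x\<in>cyl I. \<forall>a b c. domega [a, b, c] (zcoord x) = 0)"
    using tens_zero_iff[of _ 3 domega] by (simp add: length3_all del: tens.simps)
  also have "\<dots> \<longleftrightarrow> (\<forall>z\<in>I. \<forall>a b c. domega [a, b, c] z = 0)"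
    using exists_zcoord base by (metis (no_types, lifting))
  finally show ?thesis using domega_zero_iff by simp
qed

end

section \<open>Extremal and Kaehler-Einstein metrics\<close>

context u2
begin

text \<open>The scalar curvature depends only on \<open>z\<close>, so \<open>J \<nabla>s\<close> is the multiple of \<open>e\<^sub>1\<close> by this function of \<open>z\<close>.\<close>

definition field_speed :: "real \<Rightarrow> real" where "field_speed z = 2 * deriv Sf z / C z"

lemma field_speed_smooth: "smooth_on I field_speed"
  unfolding field_speed_def[abs_def]
  by (intro smooth_intros I smooth_on_deriv Sf_smooth C_smooth C_nz)

lemma extremal_field:
  assumes x: "x \<in> cyl I"
  shows "(Jplus F x *v gradient (u2_metric F C) (scalar_curv (u2_metric F C)) x) $ k
    = field_speed (zcoord x) * u2_frame F 2 k x"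
proof -
  let ?z = "zcoord x"
  have z: "?z \<in> I" using x by (simp add: cyl_def)
  have p: "pd j (scalar_curv (u2_metric F C)) x = u2_coframe F 1 j x * (2 * F ?z * deriv Sf ?z)" for j
  proof -
    have "pd j (scalar_curv (u2_metric F C)) x = pd j (\<lambda>x. Sf (zcoord x)) x"
      by (rule pd_cong[OF open_cyl[OF I] x scalar_frame])
    then show ?thesis by (simp add: pd_base[OF Sf_smooth x] sum_4 u2_D_def)
  qed
  have "gradient (u2_metric F C) (scalar_curv (u2_metric F C)) x $ i = field_speed ?z * u2_frame F 1 i x" for i
  proof -
    have s: "ginv (u2_metric F C) x $ i $ j = ginv (u2_metric F C) x $ j $ i" for j
      using ginv_sym[OF x] by simp
    have "gradient (u2_metric F C) (scalar_curv (u2_metric F C)) x $ i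
      = 2 * F ?z * deriv Sf ?z * (\<Sum>j\<in>UNIV. ginv (u2_metric F C) x $ j $ i * u2_coframe F 1 j x)"
      by (simp add: gradient_def p s sum_distrib_left mult_ac)
    then show ?thesis
      unfolding raise_coframe[OF x] gi_sum using F_nz[OF z] by (simp add: gi_table field_speed_def)
  qed
  then have "gradient (u2_metric F C) (scalar_curv (u2_metric F C)) x = field_speed ?z *\<^sub>R (\<chi> i. u2_frame F 1 i x)"
    by (simp add: vec_eq_iff)
  moreover have "Jplus F x *v (\<chi> i. u2_frame F 1 i x) = (\<chi> i. u2_frame F 2 i x)"
  proof -
    have "(Jplus F x ** E x) $ i $ 1 = (E x ** J_matrix) $ i $ 1" for i
      unfolding J_frame[OF x] by (simp add: \<Theta>_E[OF x] matrix_mul_assoc[symmetric])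
    moreover have "(E x ** J_matrix) $ i $ 1 = u2_frame F 2 i x" for i
      by (simp add: matrix_mult_nth sum_4 E_def J_matrix_def)
    ultimately show ?thesis
      by (simp add: vec_eq_iff matrix_vector_mult_def matrix_mult_nth E_def)
  qed
  ultimately show ?thesis by (simp add: matrix_vector_mult_scaleR)
qed

text \<open>Killing's equation for \<open>E\<^sub>2 = e\<^sub>1\<close>; its flow consists of the right multiplications by unit complex numbers.\<close>

lemma frame_killing:
  assumes z: "z \<in> I" shows "u2_gf F C a a z * u2_gamma F C a c 2 z + u2_gf F C c c z * u2_gamma F C c a 2 z = 0"
proof -
  have "\<forall>a c. u2_gf F C a a z * u2_gamma F C a c 2 z + u2_gf F C c c z * u2_gamma F C c a 2 z = 0"
    unfolding forall_4 by (simp add: gf_table gamma_table algebra_simps)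
  then show ?thesis by blast
qed

text \<open>
  Since \<open>e\<^sub>1\<close> generates isometries, the Lie derivative of the metric along \<open>\<phi> e\<^sub>1\<close> is the symmetrized
  product of \<open>d\<phi>\<close> and the one-form dual to \<open>e\<^sub>1\<close>.
\<close>

lemma lie_derivative_metric:
  assumes x: "x \<in> cyl I" and f: "smooth_on I \<phi>"
    and X: "\<And>y k. y \<in> cyl I \<Longrightarrow> X y $ k = \<phi> (zcoord y) * u2_frame F 2 k y"
  shows "(\<Sum>k\<in>UNIV. X x $ k * pd k (\<lambda>y. u2_metric F C y $ i $ j) x + u2_metric F C x $ k $ j * pd i (\<lambda>y. X y $ k) x
      + u2_metric F C x $ i $ k * pd j (\<lambda>y. X y $ k) x)
    = tens (u2_coframe F) zcoord (\<lambda>as z. u2_gf F C 2 2 z *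
        ((if as ! 0 = 1 \<and> as ! 1 = 2 then 2 * F z * deriv \<phi> z else 0)
       + (if as ! 0 = 2 \<and> as ! 1 = 1 then 2 * F z * deriv \<phi> z else 0))) [i, j] x"
proof -
  let ?g = "u2_metric F C" and ?z = "zcoord x" and ?\<theta> = "u2_coframe F" and ?\<Gamma> = "christoffel (u2_metric F C)"
  have z: "?z \<in> I" using x by (simp add: cyl_def)
  have pf: "pd i (\<lambda>x. \<phi> (zcoord x)) x = ?\<theta> 1 i x * (2 * F ?z * deriv \<phi> ?z)" for i
    by (simp add: pd_base[OF f x] sum_4 u2_D_def)
  have pX: "pd i (\<lambda>y. X y $ k) x = ?\<theta> 1 i x * (2 * F ?z * deriv \<phi> ?z) * E x $ k $ 2
    + \<phi> ?z * ((E x ** A i x) $ k $ 2 - (\<Sum>l\<in>UNIV. ?\<Gamma> k i l x * E x $ l $ 2))" for i k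
  proof -
    have "pd i (\<lambda>y. X y $ k) x = pd i (\<lambda>y. \<phi> (zcoord y) * E y $ k $ 2) x"
      by (rule pd_cong[OF open_cyl[OF I] x]) (simp add: X E_def)
    also have "\<dots> = pd i (\<lambda>y. \<phi> (zcoord y)) x * E x $ k $ 2 + \<phi> ?z * pd i (\<lambda>y. E y $ k $ 2) x"
      by (rule pd_mult[OF differentiable_base[OF f x] E_differentiable[OF x]])
    also have "pd i (\<lambda>y. E y $ k $ 2) x = pdm i E x $ k $ 2" by (simp add: pdm_def)
    finally show ?thesis unfolding pf pdm_frame[OF x] by (simp add: matrix_mult_nth)
  qed
  have gE: "(\<Sum>k\<in>UNIV. ?g x $ k $ j * E x $ k $ a) = u2_gf F C a a ?z * ?\<theta> a j x" for a j
  proof -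
    have "?g x ** E x = transpose (\<Theta> x) ** (\<chi> a b. u2_gf F C a b ?z) ** (\<Theta> x ** E x)"
      unfolding g_matrix[OF x] by (simp only: matrix_mul_assoc)
    then have "(?g x ** E x) $ j $ a = (transpose (\<Theta> x) ** (\<chi> a b. u2_gf F C a b ?z)) $ j $ a"
      by (simp add: \<Theta>_E[OF x])
    then have "(\<Sum>k\<in>UNIV. ?g x $ j $ k * E x $ k $ a) = (\<Sum>b\<in>UNIV. ?\<theta> b j x * u2_gf F C b a ?z)"
      by (simp add: matrix_mult_nth transpose_def \<Theta>_def)
    also have "\<dots> = (\<Sum>b\<in>UNIV. if b = a then u2_gf F C a a ?z * ?\<theta> a j x else 0)"
      by (intro sum.cong refl) (auto simp: gf_table(5))
    finally show ?thesis by (simp add: g_sym[OF x, of j])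
  qed
  have gEA: "(\<Sum>k\<in>UNIV. ?g x $ k $ j * (E x ** A i x) $ k $ 2)
    = (\<Sum>a\<in>UNIV. \<Sum>c\<in>UNIV. ?\<theta> a j x * ?\<theta> c i x * (u2_gf F C a a ?z * u2_gamma F C a c 2 ?z))" for i j
  proof -
    have "(\<Sum>k\<in>UNIV. ?g x $ k $ j * (E x ** A i x) $ k $ 2) = (\<Sum>a\<in>UNIV. (\<Sum>k\<in>UNIV. ?g x $ k $ j * E x $ k $ a) * A i x $ a $ 2)"
      by (simp add: matrix_mult_nth sum_distrib_left sum_distrib_right) (subst sum.swap, simp add: mult_ac)
    then show ?thesis unfolding gE by (simp add: A_def sum_distrib_left mult_ac)
  qed
  define N where "N i j = (\<Sum>k\<in>UNIV. \<Sum>l\<in>UNIV. ?g x $ k $ j * (?\<Gamma> k i l x * E x $ l $ 2))" for i j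
  \<comment> \<open>The Christoffel symbols from the derivative of the metric cancel against those from the derivative of the frame.\<close>
  have metric: "(\<Sum>k\<in>UNIV. E x $ k $ 2 * pd k (\<lambda>y. ?g y $ i $ j) x) = N i j + N j i"
  proof -
    have "E x $ k $ 2 * pd k (\<lambda>y. ?g y $ i $ j) x = (\<Sum>m\<in>UNIV. ?g x $ m $ j * (?\<Gamma> m i k x * E x $ k $ 2))
      + (\<Sum>m\<in>UNIV. ?g x $ m $ i * (?\<Gamma> m j k x * E x $ k $ 2))" for k
      unfolding metric_parallel[OF x] sum_distrib_left sum.distrib[symmetric]
      by (intro sum.cong refl) (simp add: christoffel_sym[OF x, of _ k] g_sym[OF x, of i] algebra_simps)
    then show ?thesis unfolding N_def by (simp add: sum.distrib) (subst (1 2) sum.swap, rule refl)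
  qed
  have skew: "(\<Sum>k\<in>UNIV. ?g x $ k $ j * (E x ** A i x) $ k $ 2) + (\<Sum>k\<in>UNIV. ?g x $ k $ i * (E x ** A j x) $ k $ 2) = 0"
  proof -
    have "(\<Sum>k\<in>UNIV. ?g x $ k $ i * (E x ** A j x) $ k $ 2)
      = (\<Sum>a\<in>UNIV. \<Sum>c\<in>UNIV. ?\<theta> a j x * ?\<theta> c i x * (u2_gf F C c c ?z * u2_gamma F C c a 2 ?z))"
      unfolding gEA by (subst sum.swap) (simp add: mult_ac)
    then have "(\<Sum>k\<in>UNIV. ?g x $ k $ j * (E x ** A i x) $ k $ 2) + (\<Sum>k\<in>UNIV. ?g x $ k $ i * (E x ** A j x) $ k $ 2)
      = (\<Sum>a\<in>UNIV. \<Sum>c\<in>UNIV. ?\<theta> a j x * ?\<theta> c i x * (u2_gf F C a a ?z * u2_gamma F C a c 2 ?z + u2_gf F C c c ?z * u2_gamma F C c a 2 ?z))"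
      unfolding gEA[of j i] by (simp add: sum.distrib distrib_left)
    then show ?thesis by (simp add: frame_killing[OF z])
  qed
  have X': "X x $ k = \<phi> ?z * E x $ k $ 2" for k using X[OF x] by (simp add: E_def)
  have half: "(\<Sum>k\<in>UNIV. ?g x $ k $ j * pd i (\<lambda>y. X y $ k) x) = ?\<theta> 1 i x * (2 * F ?z * deriv \<phi> ?z) * (u2_gf F C 2 2 ?z * ?\<theta> 2 j x)
    + \<phi> ?z * ((\<Sum>k\<in>UNIV. ?g x $ k $ j * (E x ** A i x) $ k $ 2) - N i j)" for i j
    unfolding pX gE[symmetric] N_def
    by (simp add: distrib_left sum.distrib right_diff_distrib sum_subtractf sum_distrib_left mult_ac)
  have "(\<Sum>k\<in>UNIV. X x $ k * pd k (\<lambda>y. ?g y $ i $ j) x + ?g x $ k $ j * pd i (\<lambda>y. X y $ k) x + ?g x $ i $ k * pd j (\<lambda>y. X y $ k) x)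
    = \<phi> ?z * (\<Sum>k\<in>UNIV. E x $ k $ 2 * pd k (\<lambda>y. ?g y $ i $ j) x)
     + (\<Sum>k\<in>UNIV. ?g x $ k $ j * pd i (\<lambda>y. X y $ k) x) + (\<Sum>k\<in>UNIV. ?g x $ k $ i * pd j (\<lambda>y. X y $ k) x)"
    by (simp add: sum.distrib X' sum_distrib_left mult_ac g_sym[OF x, of i])
  also have "\<dots> = ?\<theta> 1 i x * (2 * F ?z * deriv \<phi> ?z) * (u2_gf F C 2 2 ?z * ?\<theta> 2 j x)
     + ?\<theta> 1 j x * (2 * F ?z * deriv \<phi> ?z) * (u2_gf F C 2 2 ?z * ?\<theta> 2 i x)
     + \<phi> ?z * ((\<Sum>k\<in>UNIV. ?g x $ k $ j * (E x ** A i x) $ k $ 2) + (\<Sum>k\<in>UNIV. ?g x $ k $ i * (E x ** A j x) $ k $ 2))"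
    unfolding half metric by (simp add: algebra_simps)
  finally show ?thesis
    unfolding skew tens2 by (simp add: sum_4 algebra_simps)
qed

lemma killing_iff:
  "killing (cyl I) (u2_metric F C) (\<lambda>x. Jplus F x *v gradient (u2_metric F C) (scalar_curv (u2_metric F C)) x)
    \<longleftrightarrow> (\<forall>z\<in>I. deriv field_speed z = 0)"
proof -
  define K where "K as z = u2_gf F C 2 2 z *
        ((if as ! 0 = 1 \<and> as ! 1 = 2 then 2 * F z * deriv field_speed z else 0)
       + (if as ! 0 = 2 \<and> as ! 1 = 1 then 2 * F z * deriv field_speed z else 0))" for as :: "4 list" and z
  have K: "(\<forall>as. length as = 2 \<longrightarrow> K as z = 0) \<longleftrightarrow> deriv field_speed z = 0" if "z \<in> I" for z
  proof
    assume "\<forall>as. length as = 2 \<longrightarrow> K as z = 0"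
    then have "K [1, 2] z = 0" by simp
    then show "deriv field_speed z = 0" using C_nz[OF that] F_nz[OF that] by (simp add: K_def gf_table)
  qed (simp add: K_def)
  have "killing (cyl I) (u2_metric F C) (\<lambda>x. Jplus F x *v gradient (u2_metric F C) (scalar_curv (u2_metric F C)) x)
    \<longleftrightarrow> (\<forall>x\<in>cyl I. \<forall>i j. tens (u2_coframe F) zcoord K [i, j] x = 0)"
    unfolding killing_def K_def[abs_def]
    by (intro ball_cong refl all_cong1, subst lie_derivative_metric[OF _ field_speed_smooth extremal_field]) auto
  also have "\<dots> \<longleftrightarrow> (\<forall>x\<in>cyl I. \<forall>is. length is = 2 \<longrightarrow> tens (u2_coframe F) zcoord K is x = 0)"
    unfolding length2 by blast
  also have "\<dots> \<longleftrightarrow> (\<forall>x\<in>cyl I. deriv field_speed (zcoord x) = 0)"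
    using tens_zero_iff[of _ 2 K] K base by (simp del: tens.simps)
  also have "\<dots> \<longleftrightarrow> (\<forall>z\<in>I. deriv field_speed z = 0)" using exists_zcoord base by metis
  finally show ?thesis .
qed

lemma dlog_const:
  assumes k: "\<forall>z\<in>I. deriv C z = - C z" and z: "z \<in> I"
  shows "dlog C z = - 1" "deriv (dlog C) z = 0"
proof -
  have *: "dlog C y = - 1" if "y \<in> I" for y using k that C_nz[OF that] by (simp add: dlog_def)
  show "dlog C z = - 1" by (rule *[OF z])
  show "deriv (dlog C) z = 0" by (rule deriv_eq_on[OF z *]) auto
qed

lemma kaehler_scalar:
  assumes k: "\<forall>z\<in>I. deriv C z = - C z" and z: "z \<in> I"
  shows "Sf z = - 8 * w_plus F z / C z"
  unfolding u2_scalar[OF z] dlog_const[OF k z] w_plus_def using C_nz[OF z] by (simp add: field_simps)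

text \<open>
  For a Kaehler metric \<open>s = - 8 w_plus F / C\<close> is a multiple of the simple eigenvalue of \<open>W\<^sup>+\<close>, so that the
  condition on \<open>J \<nabla>s\<close> is an equation for \<open>w_plus F\<close> of second order.
\<close>

lemma field_speed_deriv:
  assumes k: "\<forall>z\<in>I. deriv C z = - C z" and z: "z \<in> I"
  shows "deriv field_speed z = - 8 * bach_linear z / C z ^ 2"
proof -
  note d = dlog_const[OF k]
  have C: "(C has_real_derivative - C y) (at y)" if "y \<in> I" for y using C_deriv'[OF that] d(1)[OF that] by simp
  note S = kaehler_scalar[OF k]
  have dS: "deriv Sf y = - 8 * (deriv (w_plus F) y + w_plus F y) / C y" if y: "y \<in> I" for y
    by (rule deriv_eq_on[OF y S]) (use C_nz[OF y] in \<open>auto intro!: derivative_eq_intros C[OF y] w_derivs[OF y] simp: field_simps\<close>)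
  have f: "field_speed y = - 16 * (deriv (w_plus F) y + w_plus F y) / C y ^ 2" if y: "y \<in> I" for y
    using dS[OF y] by (simp add: field_speed_def power2_eq_square)
  have "deriv field_speed z = - 16 * (deriv (deriv (w_plus F)) z + 3 * deriv (w_plus F) z + 2 * w_plus F z) / C z ^ 2"
    by (rule deriv_eq_on[OF z f]) (use C_nz[OF z] in \<open>auto intro!: derivative_eq_intros C[OF z] w_derivs[OF z] simp: field_simps power2_eq_square\<close>)
  then show ?thesis
    unfolding deriv_w[OF z] bach_linear_def w_plus_def using C_nz[OF z] by (simp add: field_simps)
qed

lemma extremal_iff:
  "extremal_kaehler (cyl I) (u2_metric F C) (Jplus F) \<longleftrightarrow> (\<forall>z\<in>I. deriv C z = - C z) \<and> (\<forall>z\<in>I. bach_linear z = 0)"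
  unfolding extremal_kaehler_def kaehler_iff killing_iff using field_speed_deriv C_nz by auto

lemma einstein_frame_iff:
  "(\<forall>x\<in>cyl I. \<forall>i j. ricci (u2_metric F C) i j x = \<Lambda> * u2_metric F C x $ i $ j)
    \<longleftrightarrow> (\<forall>z\<in>I. \<forall>a b. Ricf a b z = \<Lambda> * u2_gf F C a b z)"
proof -
  define T where "T as z = Ricf (as ! 0) (as ! 1) z - \<Lambda> * u2_gf F C (as ! 0) (as ! 1) z" for as :: "4 list" and z
  have "ricci (u2_metric F C) i j x - \<Lambda> * u2_metric F C x $ i $ j = tens (u2_coframe F) zcoord T [i, j] x" if "x \<in> cyl I" for i j x
    unfolding ricci_tens[OF that] metric_tens[OF that] T_def tens2 by (simp add: sum_4 algebra_simps)
  then have "(\<forall>x\<in>cyl I. \<forall>i j. ricci (u2_metric F C) i j x = \<Lambda> * u2_metric F C x $ i $ j)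
    \<longleftrightarrow> (\<forall>x\<in>cyl I. \<forall>is. length is = 2 \<longrightarrow> tens (u2_coframe F) zcoord T is x = 0)"
    unfolding length2 by (simp add: eq_iff_diff_eq_0[of "ricci _ _ _ _"] del: tens.simps) blast
  also have "\<dots> \<longleftrightarrow> (\<forall>x\<in>cyl I. \<forall>as. length as = 2 \<longrightarrow> T as (zcoord x) = 0)"
    using tens_zero_iff[of _ 2 T] by (simp del: tens.simps)
  also have "\<dots> \<longleftrightarrow> (\<forall>z\<in>I. \<forall>as. length as = 2 \<longrightarrow> T as z = 0)" using exists_zcoord base by metis
  also have "\<dots> \<longleftrightarrow> (\<forall>z\<in>I. \<forall>a b. Ricf a b z = \<Lambda> * u2_gf F C a b z)"
    unfolding length2 T_def by force
  finally show ?thesis .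
qed

end

context u2_interval
begin

lemma exponential_factor: "(\<forall>z\<in>I. deriv C z = - C z) \<longleftrightarrow> (\<exists>C0>0. \<forall>z\<in>I. C z = C0 * exp (- z))"
proof
  assume "\<forall>z\<in>I. deriv C z = - C z"
  then have "(C has_real_derivative -1 * C z) (at z)" if "z \<in> I" for z using C_deriv[OF that] that by simp
  from exponential_ode[OF interval this] obtain C0 where C0: "\<forall>z\<in>I. C z = C0 * exp (- z)" by auto
  obtain z where "z \<in> I" using nonempty by blast
  then have "0 < C0" using C_pos[of z] C0 by (auto simp: zero_less_mult_iff)
  then show "\<exists>C0>0. \<forall>z\<in>I. C z = C0 * exp (- z)" using C0 by blast
next
  assume "\<exists>C0>0. \<forall>z\<in>I. C z = C0 * exp (- z)"
  then obtain C0 where C0: "\<And>z. z \<in> I \<Longrightarrow> C z = C0 * exp (- z)" by blast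
  show "\<forall>z\<in>I. deriv C z = - C z"
    by (intro ballI, rule deriv_eq_on[OF _ C0]) (auto intro!: derivative_eq_intros simp: C0)
qed

lemma extremal_sol_iff:
  "extremal_kaehler (cyl I) (u2_metric F C) (Jplus F) \<longleftrightarrow>
     (\<exists>C0>0. \<forall>z\<in>I. C z = C0 * exp (- z)) \<and> (\<forall>z\<in>I. L_plus (L_minus F) z - 1 = 0)"
  unfolding extremal_iff exponential_factor using L_plus_L_minus by auto

text \<open>
  With \<open>C' = - C\<close> the Ricci tensor has two eigenvalues; their equality is an equation for \<open>F - 1\<close> with
  the exponents \<open>-1\<close> and \<open>2\<close>, and on its solutions the common value is the constant \<open>- 6 C2 / C0\<close>.
\<close>

lemma kaehler_einstein_sol_iff:
  "kaehler_einstein (cyl I) (u2_metric F C) (Jplus F) \<longleftrightarrow>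
     (\<exists>C0>0. \<forall>z\<in>I. C z = C0 * exp (- z)) \<and>
     (\<exists>C1 C2 C3 C4. (\<forall>z\<in>I. F z = F_sol C1 C2 C3 C4 z) \<and> C1 = 0 \<and> C3 = 0)"
proof -
  have "einstein (cyl I) (u2_metric F C) \<longleftrightarrow>
     (\<exists>C1 C2 C3 C4. (\<forall>z\<in>I. F z = F_sol C1 C2 C3 C4 z) \<and> C1 = 0 \<and> C3 = 0)"
    if "\<exists>C0>0. \<forall>z\<in>I. C z = C0 * exp (- z)"
  proof -
    obtain C0 where C0: "0 < C0" "\<And>z. z \<in> I \<Longrightarrow> C z = C0 * exp (- z)" using \<open>\<exists>C0>0. _\<close> by blast
    have k: "\<forall>z\<in>I. deriv C z = - C z" using exponential_factor C0 by blast
    note d = dlog_const[OF k]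
    have R: "(\<forall>a b. Ricf a b z = \<Lambda> * u2_gf F C a b z) \<longleftrightarrow>
       4 * deriv F z - 2 * deriv (deriv F) z = \<Lambda> * C z \<and> 4 - 4 * F z + 2 * deriv F z = \<Lambda> * C z" if z: "z \<in> I" for z \<Lambda>
    proof -
      have "F z * (4 * deriv F z - 2 * deriv (deriv F) z) = F z * (\<Lambda> * C z)
        \<longleftrightarrow> 4 * deriv F z - 2 * deriv (deriv F) z = \<Lambda> * C z" using F_nz[OF z] by simp
      then show ?thesis
        unfolding forall_4 u2_ricci[OF z] d[OF z] by (auto simp: gf_table algebra_simps)
    qed
    have "einstein (cyl I) (u2_metric F C) \<longleftrightarrow> (\<exists>\<Lambda>. \<forall>z\<in>I.
       4 * deriv F z - 2 * deriv (deriv F) z = \<Lambda> * C z \<and> 4 - 4 * F z + 2 * deriv F z = \<Lambda> * C z)"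
      unfolding einstein_def einstein_frame_iff using R by simp
    also have "\<dots> \<longleftrightarrow> (\<exists>C1 C2 C3 C4. (\<forall>z\<in>I. F z = F_sol C1 C2 C3 C4 z) \<and> C1 = 0 \<and> C3 = 0)"
    proof
      assume "\<exists>\<Lambda>. \<forall>z\<in>I. 4 * deriv F z - 2 * deriv (deriv F) z = \<Lambda> * C z \<and> 4 - 4 * F z + 2 * deriv F z = \<Lambda> * C z"
      then have o: "4 * deriv F z - 2 * deriv (deriv F) z = 4 - 4 * F z + 2 * deriv F z" if "z \<in> I" for z using that by force
      have d1: "deriv (\<lambda>z. F z - 1) y = deriv F y" if "y \<in> I" for y
        by (rule DERIV_imp_deriv) (auto intro!: derivative_eq_intros F_deriv[OF that])
      have "deriv (deriv (\<lambda>z. F z - 1)) z = (-1 + 2) * deriv (\<lambda>z. F z - 1) z - (-1) * 2 * (F z - 1)" if z: "z \<in> I" for z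
      proof -
        have "deriv (deriv (\<lambda>z. F z - 1)) z = deriv (deriv F) z"
          by (rule deriv_eq_on[OF z d1]) (auto intro!: smooth_on_has_real_derivative[OF F1_smooth z])
        then show ?thesis using o[OF z] d1[OF z] by simp
      qed
      from second_order_ode[OF I interval _ _ this] obtain a b
        where "\<forall>z\<in>I. F z - 1 = a * exp (- 1 * z) + b * exp (2 * z)"
        using smooth_on_diff[OF I F_smooth smooth_on_const[OF I, of 1]] by auto
      then have "\<forall>z\<in>I. F z = F_sol 0 a 0 (2 * b) z" by (auto simp: F_sol_def algebra_simps)
      then show "\<exists>C1 C2 C3 C4. (\<forall>z\<in>I. F z = F_sol C1 C2 C3 C4 z) \<and> C1 = 0 \<and> C3 = 0" by blast
    next
      assume "\<exists>C1 C2 C3 C4. (\<forall>z\<in>I. F z = F_sol C1 C2 C3 C4 z) \<and> C1 = 0 \<and> C3 = 0"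
      then obtain C2 C4 where F: "\<forall>z\<in>I. F z = F_sol 0 C2 0 C4 z" by blast
      have "4 * deriv F z - 2 * deriv (deriv F) z = - 6 * C2 / C0 * C z \<and> 4 - 4 * F z + 2 * deriv F z = - 6 * C2 / C0 * C z" if z: "z \<in> I" for z
        unfolding sol_derivs[OF F z] C0(2)[OF z] F[rule_format, OF z] F_sol_def using C0(1) by (simp add: field_simps)
      then show "\<exists>\<Lambda>. \<forall>z\<in>I. 4 * deriv F z - 2 * deriv (deriv F) z = \<Lambda> * C z \<and> 4 - 4 * F z + 2 * deriv F z = \<Lambda> * C z"
        by blast
    qed
    finally show ?thesis .
  qed
  then show ?thesis unfolding kaehler_einstein_def kaehler_iff exponential_factor by auto
qed

end

section \<open>Invariants of isometries and of conformal maps\<close>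

lemma u2_metric_scale: "u2_metric F (\<lambda>z. a z * C z) x = a (zcoord x) *\<^sub>R u2_metric F C x"
  by (simp add: u2_metric_def Let_def vec_eq_iff algebra_simps)

lemma pullback_scale: "pullback \<phi> (\<lambda>y. r y *\<^sub>R h y) x = r (\<phi> x) *\<^sub>R pullback \<phi> h x"
  by (simp add: pullback_def Let_def matrix_scalar_ac scalar_matrix_assoc[symmetric])

text \<open>
  An isometry between two of the metrics need not respect the frames, but scalar invariants relate \<open>z\<close>
  to the coordinate \<open>y\<close> of the image point.
\<close>

locale u2_isometry = A: u2 I F C + B: u2 J G K
  for I J and F C G K :: "real \<Rightarrow> real" +
  fixes \<phi> :: "real^4 \<Rightarrow> real^4"
  assumes diffeo: "diffeomorphism_on \<phi> (cyl I) (cyl J)"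
    and pullback: "x \<in> cyl I \<Longrightarrow> pullback \<phi> (u2_metric G K) x = u2_metric F C x"
begin

lemma iso: "isometry (cyl I) (cyl J) (u2_metric F C) (u2_metric G K) \<phi>"
  by (intro isometry.intro isometry_axioms.intro A.smooth_metric_axioms B.smooth_metric_axioms diffeo pullback)

lemma image: "x \<in> cyl I \<Longrightarrow> \<phi> x \<in> cyl J"
  using diffeo by (auto simp: diffeomorphism_on_def)

lemma image_coordinate: "x \<in> cyl I \<Longrightarrow> zcoord (\<phi> x) \<in> J"
  using B.base image by blast

lemma scalar_invariant: "x \<in> cyl I \<Longrightarrow> A.Sf (zcoord x) = B.Sf (zcoord (\<phi> x))"
  using isometry.scalar_natural[OF iso] A.scalar_frame B.scalar_frame image by metis

lemma weyl_trace_invariant: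
  assumes x: "x \<in> cyl I" and z: "z = zcoord x" and y: "y = zcoord (\<phi> x)"
  shows "(w_plus F z ^ 2 + w_minus F z ^ 2) / C z ^ 2 = (w_plus G y ^ 2 + w_minus G y ^ 2) / K y ^ 2"
    "(w_plus F z ^ 3 + w_minus F z ^ 3) / C z ^ 3 = (w_plus G y ^ 3 + w_minus G y ^ 3) / K y ^ 3"
proof -
  have cancel: "k * a / b = k * c / d \<Longrightarrow> k \<noteq> 0 \<Longrightarrow> a / b = c / d" for k a b c d :: real
    by (simp add: times_divide_eq_right[symmetric] del: times_divide_eq_right)
  note unfold = A.trace_weyl_op_frame[OF x] B.trace_weyl_op_frame[OF image[OF x]]
    A.u2_trace_weyl[OF A.base[OF x]] B.u2_trace_weyl[OF B.base[OF image[OF x]]]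
  show "(w_plus F z ^ 2 + w_minus F z ^ 2) / C z ^ 2 = (w_plus G y ^ 2 + w_minus G y ^ 2) / K y ^ 2"
    using isometry.weyl_op_natural(1)[OF iso x] unfolding unfold z y by (rule cancel) simp
  show "(w_plus F z ^ 3 + w_minus F z ^ 3) / C z ^ 3 = (w_plus G y ^ 3 + w_minus G y ^ 3) / K y ^ 3"
    using isometry.weyl_op_natural(2)[OF iso x] unfolding unfold z y by (rule cancel) simp
qed

lemma weyl_div_invariant:
  assumes x: "x \<in> cyl I" and z: "z = zcoord x" and y: "y = zcoord (\<phi> x)"
  shows "F z * (A.div_plus z ^ 2 + A.div_minus z ^ 2) / C z ^ 3
    = G y * (B.div_plus y ^ 2 + B.div_minus y ^ 2) / K y ^ 3"
  using isometry.weyl_div_natural[OF iso x]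
  unfolding A.weyl_div_inner_frame[OF x] B.weyl_div_inner_frame[OF image[OF x]]
    A.u2_div_norm[OF A.base[OF x]] B.u2_div_norm[OF B.base[OF image[OF x]]] z y
  by simp

text \<open>A function of \<open>z\<close> which corresponds to a function of \<open>y\<close> has a gradient of the same length.\<close>

lemma gradient_invariant:
  assumes x: "x \<in> cyl I" and z: "z = zcoord x" and y: "y = zcoord (\<phi> x)"
    and h: "smooth_on I h" and f: "smooth_on J f"
    and hf: "\<And>x. x \<in> cyl I \<Longrightarrow> h (zcoord x) = f (zcoord (\<phi> x))"
  shows "F z * deriv h z ^ 2 / C z = G y * deriv f y ^ 2 / K y"
proof -
  have p: "pd i (\<lambda>x. f (zcoord (\<phi> x))) x = pd i (\<lambda>x. h (zcoord x)) x" for i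
    by (rule pd_cong[OF open_cyl[OF A.I] x]) (simp add: hf)
  have "tensor_inner (u2_gi F C) 1 (\<lambda>as. u2_D F (hd as) h) (\<lambda>as. u2_D F (hd as) h) (zcoord x)
    = inner_of (u2_metric F C) 1 (\<lambda>is. pd (hd is) (\<lambda>x. f (zcoord (\<phi> x)))) (\<lambda>is. pd (hd is) (\<lambda>x. f (zcoord (\<phi> x)))) x"
    unfolding A.gradient_inner_frame[OF x h, symmetric] by (rule tensor_inner_cong) (simp_all add: p)
  also have "\<dots> = inner_of (u2_metric G K) 1 (\<lambda>is. pd (hd is) (\<lambda>x. f (zcoord x))) (\<lambda>is. pd (hd is) (\<lambda>x. f (zcoord x))) (\<phi> x)"
    by (rule isometry.gradient_natural[OF iso x smooth_on_zcoord_compose[OF B.I f]])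
  also have "\<dots> = tensor_inner (u2_gi G K) 1 (\<lambda>as. u2_D G (hd as) f) (\<lambda>as. u2_D G (hd as) f) (zcoord (\<phi> x))"
    by (rule B.gradient_inner_frame[OF image[OF x] f])
  finally show ?thesis
    unfolding A.u2_gradient_norm[OF A.base[OF x]] B.u2_gradient_norm[OF B.base[OF image[OF x]]] z y by simp
qed

end

definition weyl_size :: "(real \<Rightarrow> real) \<Rightarrow> real \<Rightarrow> real" where
  "weyl_size F z = sqrt (w_plus F z ^ 2 + w_minus F z ^ 2)"

lemma weyl_size_square: "weyl_size F z ^ 2 = w_plus F z ^ 2 + w_minus F z ^ 2"
  by (simp add: weyl_size_def)

lemma (in u2) u2_normalized:
  assumes "\<And>z. z \<in> I \<Longrightarrow> 0 < weyl_size F z" shows "u2 I F (weyl_size F)"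
proof
  show "smooth_on I (weyl_size F)"
    unfolding weyl_size_def[abs_def]
    by (rule smooth_on_sqrt[OF I], (intro smooth_intros I w_plus_smooth w_minus_smooth)[1])
      (use assms in \<open>simp add: weyl_size_def\<close>)
qed (use I F_smooth F_pos assms in auto)

lemma homothetic_isometry:
  assumes "u2 I F C" "u2 J G K" "homothetic (I, F, C) (J, G, K)"
  shows "\<exists>\<phi> c. 0 < c \<and> u2_isometry I J F (\<lambda>z. c * C z) G K \<phi>"
proof -
  interpret A: u2 I F C by (rule assms)
  interpret B: u2 J G K by (rule assms)
  obtain \<phi> c where d: "diffeomorphism_on \<phi> (cyl I) (cyl J)" and c: "0 < c"
    and p: "\<And>x. x \<in> cyl I \<Longrightarrow> pullback \<phi> (u2_metric G K) x = c *\<^sub>R u2_metric F C x"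
    using assms(3) by auto
  interpret A': u2 I F "\<lambda>z. c * C z"
    by unfold_locales (use A.I A.F_smooth A.F_pos A.C_pos c in \<open>auto intro!: smooth_intros A.C_smooth\<close>)
  have "u2_isometry I J F (\<lambda>z. c * C z) G K \<phi>"
    by unfold_locales (auto simp: d p u2_metric_scale)
  then show ?thesis using c by blast
qed

text \<open>
  Rescaling both metrics by the norm of their Weyl tensors turns a conformal map into an isometry,
  because that norm scales by the inverse of the conformal factor.
\<close>

lemma conformal_isometry:
  assumes "u2 I F C" "u2 J G K" "conformal (I, F, C) (J, G, K)"
    and F: "\<And>z. z \<in> I \<Longrightarrow> 0 < weyl_size F z" and G: "\<And>z. z \<in> J \<Longrightarrow> 0 < weyl_size G z"
  shows "\<exists>\<phi>. u2_isometry I J F (weyl_size F) G (weyl_size G) \<phi>"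
proof -
  interpret A: u2 I F C by (rule assms)
  interpret B: u2 J G K by (rule assms)
  obtain \<phi> u where d: "diffeomorphism_on \<phi> (cyl I) (cyl J)" and u: "smooth_on (cyl I) u"
    "\<And>x. x \<in> cyl I \<Longrightarrow> 0 < u x"
    and p: "\<And>x. x \<in> cyl I \<Longrightarrow> pullback \<phi> (u2_metric G K) x = u x *\<^sub>R u2_metric F C x"
    using assms(3) by auto
  interpret conformal_change "cyl I" "u2_metric F C" u by unfold_locales (use u in auto)
  have iso: "isometry (cyl I) (cyl J) gc (u2_metric G K) \<phi>"
    by (intro isometry.intro isometry_axioms.intro smooth_metric_gc B.smooth_metric_axioms d) (simp add: p gc_def)
  \<comment> \<open>The map is an isometry from \<open>u g\<close>, whose Weyl operator is that of \<open>g\<close> divided by \<open>u\<close>.\<close>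
  have size: "weyl_size F (zcoord x) / C (zcoord x) = u x * (weyl_size G (zcoord (\<phi> x)) / K (zcoord (\<phi> x)))"
    if x: "x \<in> cyl I" for x
  proof -
    let ?z = "zcoord x" and ?y = "zcoord (\<phi> x)"
    have x': "\<phi> x \<in> cyl J" using d x by (auto simp: diffeomorphism_on_def)
    note zI = A.base[OF x] and yJ = B.base[OF x']
    have tr: "trace ((a *\<^sub>R M) ** (a *\<^sub>R M)) = a ^ 2 * trace (M ** M)" for a and M :: "real^(4\<times>4)^(4\<times>4)"
      by (simp add: trace_def matrix_matrix_mult_def sum_distrib_left power2_eq_square mult_ac)
    have "trace (weyl_op gc x ** weyl_op gc x) = trace (weyl_op (u2_metric G K) (\<phi> x) ** weyl_op (u2_metric G K) (\<phi> x))"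
      by (rule isometry.weyl_op_natural(1)[OF iso x])
    then have "(1 / u x) ^ 2 * (weyl_size F ?z ^ 2 / C ?z ^ 2) = weyl_size G ?y ^ 2 / K ?y ^ 2"
      unfolding weyl_op_conformal[OF x] tr A.trace_weyl_op_frame(1)[OF x] B.trace_weyl_op_frame(1)[OF x']
        A.u2_trace_weyl(1)[OF zI] B.u2_trace_weyl(1)[OF yJ] weyl_size_square[symmetric] by simp
    moreover have "(weyl_size F ?z / C ?z) ^ 2 = u x ^ 2 * ((1 / u x) ^ 2 * (weyl_size F ?z ^ 2 / C ?z ^ 2))"
      using u(2)[OF x] by (simp add: power_divide)
    ultimately have "(weyl_size F ?z / C ?z) ^ 2 = (u x * (weyl_size G ?y / K ?y)) ^ 2"
      by (simp add: power_divide power_mult_distrib)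
    moreover have "0 \<le> weyl_size F ?z / C ?z" "0 \<le> u x * (weyl_size G ?y / K ?y)"
      using u(2)[OF x] F[OF zI] G[OF yJ] A.C_pos[OF zI] B.C_pos[OF yJ] by (simp_all add: less_imp_le)
    ultimately show ?thesis by (rule power2_eq_imp_eq)
  qed
  have norm: "u2_metric F (weyl_size F) x = (weyl_size F (zcoord x) / C (zcoord x)) *\<^sub>R u2_metric F C x"
    if x: "x \<in> cyl I" for x
    using A.C_nz[OF A.base[OF x]] by (simp add: u2_metric_def Let_def vec_eq_iff)
  have norm': "u2_metric G (weyl_size G) y = (weyl_size G (zcoord y) / K (zcoord y)) *\<^sub>R u2_metric G K y"
    if y: "y \<in> cyl J" for y
    using B.C_nz[OF B.base[OF y]] by (simp add: u2_metric_def Let_def vec_eq_iff)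
  interpret A': u2 I F "weyl_size F" by (rule A.u2_normalized[OF F])
  interpret B': u2 J G "weyl_size G" by (rule B.u2_normalized[OF G])
  have "pullback \<phi> (u2_metric G (weyl_size G)) x = u2_metric F (weyl_size F) x" if x: "x \<in> cyl I" for x
  proof -
    have x': "\<phi> x \<in> cyl J" using d x by (auto simp: diffeomorphism_on_def)
    have "pullback \<phi> (u2_metric G (weyl_size G)) x
      = pullback \<phi> (\<lambda>y. (weyl_size G (zcoord y) / K (zcoord y)) *\<^sub>R u2_metric G K y) x"
      by (simp add: pullback_def norm'[OF x'])
    also have "\<dots> = u2_metric F (weyl_size F) x"
      unfolding pullback_scale p[OF x] norm[OF x] size[OF x] by (simp add: mult.commute)
    finally show ?thesis .
  qed
  then have "u2_isometry I J F (weyl_size F) G (weyl_size G) \<phi>"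
    by unfold_locales (auto simp: d)
  then show ?thesis by blast
qed

lemma homothetic_conformal:
  assumes "open I" "homothetic (I, F, C) (J, G, K)" shows "conformal (I, F, C) (J, G, K)"
proof -
  obtain \<phi> c where "diffeomorphism_on \<phi> (cyl I) (cyl J)" "0 < c"
    "\<forall>x\<in>cyl I. pullback \<phi> (u2_metric G K) x = c *\<^sub>R u2_metric F C x" using assms(2) by auto
  then show ?thesis
    using smooth_on_const[OF open_cyl[OF assms(1)], of c]
    unfolding conformal.simps by (intro exI[of _ \<phi>] exI[of _ "\<lambda>x. c"]) simp
qed


section \<open>Translations of the coordinate\<close>

text \<open>In the model \<open>\<real>\<^sup>4 - {0}\<close> of \<open>\<real> \<times> S\<^sup>3\<close> a translation of \<open>z\<close> is a dilation.\<close>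

lemma zcoord_scale: "x \<noteq> 0 \<Longrightarrow> zcoord (exp t *\<^sub>R x) = zcoord x + t"
  by (simp add: zcoord_def ln_mult)

lemma dilation_cyl: "(\<lambda>x. exp t *\<^sub>R x) ` cyl I = cyl ((\<lambda>z. z + t) ` I)"
proof (intro equalityI subsetI)
  fix y assume "y \<in> cyl ((\<lambda>z. z + t) ` I)"
  then obtain z where y: "y \<noteq> 0" "zcoord y = z + t" "z \<in> I" by (auto simp: cyl_def)
  have "exp (- t) *\<^sub>R y \<in> cyl I" using y zcoord_scale[OF y(1), of "- t"] by (simp add: cyl_def)
  moreover have "y = exp t *\<^sub>R (exp (- t) *\<^sub>R y)" by (simp add: exp_minus)
  ultimately show "y \<in> (\<lambda>x. exp t *\<^sub>R x) ` cyl I" by blast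
qed (auto simp: cyl_def zcoord_scale)

lemma smooth_on_dilation: "open U \<Longrightarrow> smooth_on U (\<lambda>x. c *\<^sub>R (x :: real^4))"
  by (rule smooth_on_bounded_linear[OF _ bounded_linear_scaleR_right])

lemma dilation_diffeomorphism:
  assumes "open I" shows "diffeomorphism_on (\<lambda>x. exp t *\<^sub>R x) (cyl I) (cyl ((\<lambda>z. z + t) ` I))"
proof -
  have o: "open ((\<lambda>z. z + t) ` I)" using open_translation[OF assms, of t] by (simp add: add.commute)
  have image_back: "(\<lambda>x. exp (- t) *\<^sub>R x) ` cyl ((\<lambda>z. z + t) ` I) = cyl I"
    unfolding dilation_cyl by (simp add: image_image)
  have inv: "exp (- t) *\<^sub>R exp t *\<^sub>R x = x" "exp t *\<^sub>R exp (- t) *\<^sub>R x = x" for x :: "real^4"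
    by (simp_all add: exp_add[symmetric])
  show ?thesis
    unfolding diffeomorphism_on_def
    by (intro conjI exI[of _ "\<lambda>x. exp (- t) *\<^sub>R x"] ballI dilation_cyl image_back inv smooth_on_dilation
        open_cyl assms o)
qed

lemma dilation_pullback:
  assumes x: "x \<noteq> 0"
  shows "pullback (\<lambda>x. exp t *\<^sub>R x) (u2_metric G K) x = u2_metric (\<lambda>z. G (z + t)) (\<lambda>z. K (z + t)) x"
proof -
  have "frechet_derivative (\<lambda>x::real^4. exp t *\<^sub>R x) (at x) = (\<lambda>x. exp t *\<^sub>R x)"
    by (rule frechet_derivative_at[symmetric], rule bounded_linear_imp_has_derivative, rule bounded_linear_scaleR_right)
  then have D: "matrix (frechet_derivative (\<lambda>x::real^4. exp t *\<^sub>R x) (at x)) = exp t *\<^sub>R (mat 1 :: real^4^4)"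
    by (simp add: matrix_def mat_def vec_eq_iff axis_def)
  have e: "e0 (exp t *\<^sub>R x) = exp t *\<^sub>R e0 x" "e1 (exp t *\<^sub>R x) = exp t *\<^sub>R e1 x"
    "e2 (exp t *\<^sub>R x) = exp t *\<^sub>R e2 x" "e3 (exp t *\<^sub>R x) = exp t *\<^sub>R e3 x"
    by (simp_all add: e0_def e1_def e2_def e3_def vec_eq_iff forall_4 vec4_nth)
  have c: "dz (exp t *\<^sub>R x) = exp (- t) *\<^sub>R dz x" "eta1 (exp t *\<^sub>R x) = exp (- t) *\<^sub>R eta1 x"
    "eta2 (exp t *\<^sub>R x) = exp (- t) *\<^sub>R eta2 x" "eta3 (exp t *\<^sub>R x) = exp (- t) *\<^sub>R eta3 x"
    by (simp_all add: dz_def eta1_def eta2_def eta3_def e exp_minus)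
  have "u2_metric G K (exp t *\<^sub>R x) = exp (- t) *\<^sub>R exp (- t) *\<^sub>R u2_metric (\<lambda>z. G (z + t)) (\<lambda>z. K (z + t)) x"
    using x by (simp add: vec_eq_iff u2_metric_def Let_def c zcoord_scale algebra_simps)
  moreover have "pullback (\<lambda>x. exp t *\<^sub>R x) (u2_metric G K) x = exp t *\<^sub>R exp t *\<^sub>R u2_metric G K (exp t *\<^sub>R x)"
    unfolding pullback_def Let_def D by (simp add: transpose_scalar matrix_scalar_ac scalar_matrix_assoc[symmetric] transpose_mat)
  moreover have "exp t * (exp t * (exp (- t) * exp (- t))) = 1" by (simp add: mult_exp_exp)
  ultimately show ?thesis by simp
qed

lemma translation_conformal:
  assumes "u2 I F C" "u2 ((\<lambda>z. z + t) ` I) G K" "\<And>z. z \<in> I \<Longrightarrow> G (z + t) = F z"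
  shows "conformal (I, F, C) ((\<lambda>z. z + t) ` I, G, K)"
proof -
  interpret A: u2 I F C by (rule assms)
  interpret B: u2 "(\<lambda>z. z + t) ` I" G K by (rule assms)
  let ?u = "\<lambda>x. K (zcoord (exp t *\<^sub>R x)) / C (zcoord x)"
  have Kt: "smooth_on I (\<lambda>z. K (z + t))"
    by (rule smooth_on_compose[OF A.I B.I B.C_smooth]) (use smooth_on_add[OF A.I smooth_on_bounded_linear[OF A.I bounded_linear_ident] smooth_on_const[OF A.I]] in auto)
  have u: "?u x = (\<lambda>z. K (z + t) / C z) (zcoord x)" if "x \<in> cyl I" for x
    using that by (simp add: zcoord_scale cyl_def)
  have "smooth_on (cyl I) ?u"
    by (rule smooth_on_cong[OF open_cyl[OF A.I] u])
      (auto intro!: smooth_on_zcoord_compose A.I smooth_on_divide Kt A.C_smooth A.C_nz)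
  moreover have "0 < ?u x \<and> pullback (\<lambda>x. exp t *\<^sub>R x) (u2_metric G K) x = ?u x *\<^sub>R u2_metric F C x" if x: "x \<in> cyl I" for x
  proof -
    have z: "zcoord x \<in> I" "x \<noteq> 0" using x by (auto simp: cyl_def)
    have "0 < K (zcoord x + t)" using B.C_pos z by blast
    then show ?thesis
      using z A.C_pos[OF z(1)] assms(3)[OF z(1)]
      by (simp add: dilation_pullback zcoord_scale u2_metric_def Let_def vec_eq_iff)
  qed
  ultimately show ?thesis using dilation_diffeomorphism[OF A.I] by auto
qed

lemma translation_homothetic:
  assumes "u2 I F C" "\<And>z. z \<in> I \<Longrightarrow> G (z + t) = F z" "\<And>z. z \<in> I \<Longrightarrow> K (z + t) = c * C z" "0 < c"
  shows "homothetic (I, F, C) ((\<lambda>z. z + t) ` I, G, K)"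
proof -
  interpret A: u2 I F C by (rule assms)
  have "pullback (\<lambda>x. exp t *\<^sub>R x) (u2_metric G K) x = c *\<^sub>R u2_metric F C x" if x: "x \<in> cyl I" for x
  proof -
    have z: "zcoord x \<in> I" "x \<noteq> 0" using x by (auto simp: cyl_def)
    then show ?thesis
      using assms by (simp add: dilation_pullback u2_metric_def Let_def vec_eq_iff)
  qed
  then show ?thesis using dilation_diffeomorphism[OF A.I] assms(4) by auto
qed

section \<open>Rigidity\<close>

text \<open>
  Identities between polynomials in an exponential of \<open>z\<close> on an interval hold for the polynomials; the
  point \<open>z = 0\<close> is left out because the invariant \<open>z\<^sup>2\<close> used below is critical there.
\<close>

lemma poly_eq_on_open:
  fixes P Q :: "real poly"
  assumes "open I" "I \<noteq> {}" "\<And>z. z \<in> I \<Longrightarrow> z \<noteq> 0 \<Longrightarrow> poly P (exp (k * z)) = poly Q (exp (k * z))" "k \<noteq> 0"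
  shows "P = Q"
proof (rule ccontr)
  assume "P \<noteq> Q"
  then have "finite {y. poly (P - Q) y = 0}" by (intro poly_roots_finite) simp
  moreover have "(\<lambda>z. exp (k * z)) ` (I - {0}) \<subseteq> {y. poly (P - Q) y = 0}" using assms(3) by auto
  ultimately have "finite ((\<lambda>z. exp (k * z)) ` (I - {0}))" by (rule rev_finite_subset)
  moreover have "inj_on (\<lambda>z. exp (k * z)) (I - {0})" using assms(4) by (auto simp: inj_on_def)
  ultimately have "finite (I - {0})" by (rule finite_imageD)
  then show False using assms(1,2) finite_imp_not_open[of I] by simp
qed

text \<open>For \<open>\<epsilon> = 1\<close> these metrics have \<open>W\<^sup>+ = 0\<close>, for \<open>\<epsilon> = -1\<close> they have \<open>W\<^sup>- = 0\<close>; both cases are treated at once.\<close>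

definition F_half :: "real \<Rightarrow> real \<Rightarrow> real \<Rightarrow> real" where
  "F_half \<epsilon> p z = 1 + exp (\<epsilon> * z) + p / 2 * exp (\<epsilon> * z) ^ 2"

lemma (in u2) half_flat_weyl:
  assumes F: "F = F_half \<epsilon> p" and \<epsilon>: "\<epsilon> = 1 \<or> \<epsilon> = - 1" and z: "z \<in> I"
  shows "deriv F z = \<epsilon> * (exp (\<epsilon> * z) + p * exp (\<epsilon> * z) ^ 2)"
    "deriv (deriv F) z = exp (\<epsilon> * z) + 2 * p * exp (\<epsilon> * z) ^ 2"
    "w_plus F z = 3 / 2 * (1 - \<epsilon>) * (exp (\<epsilon> * z) + p * exp (\<epsilon> * z) ^ 2)"
    "w_minus F z = 3 / 2 * (1 + \<epsilon>) * (exp (\<epsilon> * z) + p * exp (\<epsilon> * z) ^ 2)"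
    "deriv (w_plus F) z = 3 / 2 * (1 - \<epsilon>) * \<epsilon> * (exp (\<epsilon> * z) + 2 * p * exp (\<epsilon> * z) ^ 2)"
    "deriv (w_minus F) z = 3 / 2 * (1 + \<epsilon>) * \<epsilon> * (exp (\<epsilon> * z) + 2 * p * exp (\<epsilon> * z) ^ 2)"
proof -
  have 1: "deriv F y = \<epsilon> * (exp (\<epsilon> * y) + p * exp (\<epsilon> * y) ^ 2)" for y
    unfolding F F_half_def[abs_def] by (rule DERIV_imp_deriv) (auto intro!: derivative_eq_intros simp: algebra_simps power2_eq_square)
  have 2: "deriv (deriv F) y = exp (\<epsilon> * y) + 2 * p * exp (\<epsilon> * y) ^ 2" for y
    unfolding 1[abs_def] by (rule DERIV_imp_deriv) (use \<epsilon> in \<open>auto intro!: derivative_eq_intros simp: algebra_simps power2_eq_square\<close>)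
  have 3: "w_plus F y = 3 / 2 * (1 - \<epsilon>) * (exp (\<epsilon> * y) + p * exp (\<epsilon> * y) ^ 2)" for y
    unfolding w_plus_def 1 2 by (use \<epsilon> in \<open>auto simp: F F_half_def field_simps\<close>)
  have 4: "w_minus F y = 3 / 2 * (1 + \<epsilon>) * (exp (\<epsilon> * y) + p * exp (\<epsilon> * y) ^ 2)" for y
    unfolding w_minus_def 1 2 by (use \<epsilon> in \<open>auto simp: F F_half_def field_simps\<close>)
  have 5: "deriv (w_plus F) y = 3 / 2 * (1 - \<epsilon>) * \<epsilon> * (exp (\<epsilon> * y) + 2 * p * exp (\<epsilon> * y) ^ 2)" for y
    unfolding 3[abs_def] by (rule DERIV_imp_deriv) (auto intro!: derivative_eq_intros simp: field_simps power2_eq_square)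
  have 6: "deriv (w_minus F) y = 3 / 2 * (1 + \<epsilon>) * \<epsilon> * (exp (\<epsilon> * y) + 2 * p * exp (\<epsilon> * y) ^ 2)" for y
    unfolding 4[abs_def] by (rule DERIV_imp_deriv) (auto intro!: derivative_eq_intros simp: field_simps power2_eq_square)
  show "deriv F z = \<epsilon> * (exp (\<epsilon> * z) + p * exp (\<epsilon> * z) ^ 2)"
    "deriv (deriv F) z = exp (\<epsilon> * z) + 2 * p * exp (\<epsilon> * z) ^ 2"
    "w_plus F z = 3 / 2 * (1 - \<epsilon>) * (exp (\<epsilon> * z) + p * exp (\<epsilon> * z) ^ 2)"
    "w_minus F z = 3 / 2 * (1 + \<epsilon>) * (exp (\<epsilon> * z) + p * exp (\<epsilon> * z) ^ 2)"
    "deriv (w_plus F) z = 3 / 2 * (1 - \<epsilon>) * \<epsilon> * (exp (\<epsilon> * z) + 2 * p * exp (\<epsilon> * z) ^ 2)"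
    "deriv (w_minus F) z = 3 / 2 * (1 + \<epsilon>) * \<epsilon> * (exp (\<epsilon> * z) + 2 * p * exp (\<epsilon> * z) ^ 2)"
    by (rule 1 2 3 4 5 6)+
qed

lemma (in u2) half_flat_size:
  assumes F: "F = F_half \<epsilon> p" and \<epsilon>: "\<epsilon> = 1 \<or> \<epsilon> = - 1" and p: "0 \<le> p" and z: "z \<in> I"
  shows "weyl_size F z = 3 * (exp (\<epsilon> * z) + p * exp (\<epsilon> * z) ^ 2)"
proof -
  have "w_plus F z ^ 2 + w_minus F z ^ 2 = (3 * (exp (\<epsilon> * z) + p * exp (\<epsilon> * z) ^ 2)) ^ 2"
    unfolding half_flat_weyl[OF F \<epsilon> z] using \<epsilon> by (auto simp: field_simps power2_eq_square)
  moreover have "0 \<le> 3 * (exp (\<epsilon> * z) + p * exp (\<epsilon> * z) ^ 2)" using p by (simp add: add_nonneg_nonneg)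
  ultimately show ?thesis unfolding weyl_size_def by (simp only: real_sqrt_abs abs_of_nonneg)
qed

text \<open>
  The invariants of the metric normalized by the norm of its Weyl tensor are polynomials in
  \<open>x = 1 / (1 + p y)\<close>, where \<open>y = exp (\<epsilon> z)\<close>.
\<close>

lemma (in u2) half_flat_invariants:
  assumes F: "F = F_half \<epsilon> p" and \<epsilon>: "\<epsilon> = 1 \<or> \<epsilon> = - 1" and p: "0 < p" and z: "z \<in> I"
    and C: "\<And>z. z \<in> I \<Longrightarrow> C z = weyl_size F z"
    and x: "x = 1 / (1 + p * exp (\<epsilon> * z))"
  shows "Sf z = - 15 + 3 * x - 3 * (2 * p - 1) * x ^ 2 - (2 * p - 1) * x ^ 3"
    "F z * (div_plus z ^ 2 + div_minus z ^ 2) / C z ^ 3 = 3 / 2 * (1 - x) * (1 + (2 * p - 1) * x ^ 2)"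
proof -
  define y where "y = exp (\<epsilon> * z)"
  have y: "0 < y" by (simp add: y_def)
  have py: "0 < p * y" using p y by simp
  have nz: "y \<noteq> 0" "1 + p * y \<noteq> 0" using y py by auto
  have Cz: "C t = 3 * (exp (\<epsilon> * t) + p * exp (\<epsilon> * t) ^ 2)" if "t \<in> I" for t
    using C[OF that] half_flat_size[OF F \<epsilon> _ that] p by simp
  have dl: "dlog C t = \<epsilon> * (1 + 2 * p * exp (\<epsilon> * t)) / (1 + p * exp (\<epsilon> * t))" if t: "t \<in> I" for t
  proof -
    have e: "0 < p * exp (\<epsilon> * t)" using p by simp
    have "deriv C t = 3 * \<epsilon> * (exp (\<epsilon> * t) + 2 * p * exp (\<epsilon> * t) ^ 2)"
      by (rule deriv_eq_on[OF t Cz]) (auto intro!: derivative_eq_intros simp: algebra_simps power2_eq_square)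
    then have "dlog C t = (3 * exp (\<epsilon> * t)) * (\<epsilon> * (1 + 2 * p * exp (\<epsilon> * t))) / ((3 * exp (\<epsilon> * t)) * (1 + p * exp (\<epsilon> * t)))"
      unfolding dlog_def Cz[OF t] by (simp add: algebra_simps power2_eq_square)
    then show ?thesis by simp
  qed
  have ddl: "deriv (dlog C) z = p * y / (1 + p * y) ^ 2"
  proof (rule deriv_eq_on[OF z dl])
    have "((\<lambda>t. \<epsilon> * (1 + 2 * p * exp (\<epsilon> * t)) / (1 + p * exp (\<epsilon> * t))) has_real_derivative
      (\<epsilon> * (2 * p * (y * \<epsilon>)) * (1 + p * y) - \<epsilon> * (1 + 2 * p * y) * (p * (y * \<epsilon>))) / ((1 + p * y) * (1 + p * y))) (at z)"
      unfolding y_def using nz(2)[unfolded y_def] by (auto intro!: derivative_eq_intros)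
    also have "\<epsilon> * (2 * p * (y * \<epsilon>)) * (1 + p * y) - \<epsilon> * (1 + 2 * p * y) * (p * (y * \<epsilon>)) = \<epsilon> * \<epsilon> * (p * y)"
      by (simp add: algebra_simps)
    also have "\<epsilon> * \<epsilon> = 1" using \<epsilon> by auto
    finally show "((\<lambda>t. \<epsilon> * (1 + 2 * p * exp (\<epsilon> * t)) / (1 + p * exp (\<epsilon> * t))) has_real_derivative p * y / (1 + p * y) ^ 2) (at z)"
      by (simp add: power2_eq_square)
  qed
  define q where "q = (1 + 2 * p * y) / (1 + p * y)"
  have dl': "dlog C z = \<epsilon> * q" using dl[OF z] by (simp add: y_def q_def)
  have Fz: "F z = 1 + y + p / 2 * y ^ 2" by (simp add: F F_half_def y_def)
  have C': "C z = 3 * y * (1 + p * y)" using Cz[OF z] by (simp add: y_def algebra_simps power2_eq_square)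
  note w = half_flat_weyl[OF F \<epsilon> z, folded y_def]
  define \<sigma> where "\<sigma> = 1 + p * y"
  have \<sigma>: "\<sigma> \<noteq> 0" using nz by (simp add: \<sigma>_def)
  have x': "x = 1 / (1 + p * y)" using x by (simp add: y_def)
  show "Sf z = - 15 + 3 * x - 3 * (2 * p - 1) * x ^ 2 - (2 * p - 1) * x ^ 3"
  proof -
    have "Sf z = (8 - 2 * F z - 6 * F z * q ^ 2 - 12 * F z * (p * y / (1 + p * y) ^ 2)
      - 12 * (y + p * y ^ 2) * q - 4 * (y + 2 * p * y ^ 2)) / C z"
      unfolding u2_scalar[OF z] dl' ddl w using \<epsilon> by (auto simp: algebra_simps)
    also have "8 - 2 * F z - 6 * F z * q ^ 2 - 12 * F z * (p * y / (1 + p * y) ^ 2) - 12 * (y + p * y ^ 2) * q - 4 * (y + 2 * p * y ^ 2)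
      = ((8 - 2 * F z - 4 * (y + 2 * p * y ^ 2)) * \<sigma> ^ 2 - 6 * F z * (1 + 2 * p * y) ^ 2 - 12 * F z * (p * y)
          - 12 * y * (1 + 2 * p * y) * \<sigma> ^ 2) / \<sigma> ^ 2"
    proof -
      have "y + p * y ^ 2 = y * \<sigma>" by (simp add: \<sigma>_def algebra_simps power2_eq_square)
      then have "12 * (y + p * y ^ 2) * q = 12 * y * (1 + 2 * p * y)" using \<sigma> by (simp add: q_def \<sigma>_def[symmetric])
      then show ?thesis using \<sigma> unfolding q_def \<sigma>_def[symmetric] by (simp add: power_divide diff_divide_distrib)
    qed
    also have "(8 - 2 * F z - 4 * (y + 2 * p * y ^ 2)) * \<sigma> ^ 2 - 6 * F z * (1 + 2 * p * y) ^ 2 - 12 * F z * (p * y)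
          - 12 * y * (1 + 2 * p * y) * \<sigma> ^ 2
      = 3 * y * (- 15 * \<sigma> ^ 3 + 3 * \<sigma> ^ 2 - 3 * (2 * p - 1) * \<sigma> - (2 * p - 1))"
      unfolding Fz \<sigma>_def by (simp add: algebra_simps power2_eq_square power3_eq_cube)
    also have "3 * y * (- 15 * \<sigma> ^ 3 + 3 * \<sigma> ^ 2 - 3 * (2 * p - 1) * \<sigma> - (2 * p - 1)) / \<sigma> ^ 2 / C z
      = - 15 + 3 * x - 3 * (2 * p - 1) * x ^ 2 - (2 * p - 1) * x ^ 3"
    proof -
      have "3 * y * m / \<sigma> ^ 2 / (3 * y * \<sigma>) = m / \<sigma> ^ 3" for m
        using nz(1) \<sigma> by (simp add: power2_eq_square power3_eq_cube)
      then show ?thesis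
        unfolding C' x' \<sigma>_def[symmetric] using \<sigma> by (simp add: diff_divide_distrib add_divide_distrib) (simp add: field_simps power2_eq_square power3_eq_cube)
    qed
    finally show ?thesis .
  qed
  show "F z * (div_plus z ^ 2 + div_minus z ^ 2) / C z ^ 3 = 3 / 2 * (1 - x) * (1 + (2 * p - 1) * x ^ 2)"
  proof -
    have "div_plus z ^ 2 + div_minus z ^ 2 = (3 * q * (y + p * y ^ 2) - 9 * (y + p * y ^ 2) + 6 * (y + 2 * p * y ^ 2)) ^ 2"
      unfolding div_plus_def div_minus_def dl' w using \<epsilon> by (auto simp: field_simps power2_eq_square)
    also have "3 * q * (y + p * y ^ 2) - 9 * (y + p * y ^ 2) + 6 * (y + 2 * p * y ^ 2) = 9 * p * y ^ 2"
      unfolding q_def using nz by (simp add: divide_simps) (simp add: algebra_simps power2_eq_square)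
    finally have "F z * (div_plus z ^ 2 + div_minus z ^ 2) / C z ^ 3 = F z * (9 * p * y ^ 2) ^ 2 / (3 * y * \<sigma>) ^ 3"
      unfolding C' \<sigma>_def by simp
    also have "\<dots> = 3 / 2 * (p * y) * (2 * p * F z) / \<sigma> ^ 3"
      using nz \<sigma> by (simp add: field_simps power2_eq_square power3_eq_cube)
    also have "2 * p * F z = \<sigma> ^ 2 + (2 * p - 1)" unfolding Fz \<sigma>_def by (simp add: algebra_simps power2_eq_square)
    also have "p * y = \<sigma> - 1" by (simp add: \<sigma>_def)
    also have "3 / 2 * (\<sigma> - 1) * (\<sigma> ^ 2 + (2 * p - 1)) / \<sigma> ^ 3 = 3 / 2 * (1 - x) * (1 + (2 * p - 1) * x ^ 2)"
      unfolding x' \<sigma>_def[symmetric] using \<sigma> by (simp add: field_simps power2_eq_square power3_eq_cube)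
    finally show ?thesis .
  qed
qed

text \<open>
  The two invariants at a single point determine \<open>p\<close>: with \<open>m = 2 p - 1\<close>, their combinations \<open>m x\<^sup>3\<close> and
  \<open>x - m x\<^sup>2\<close> are invariant, and for positive \<open>m\<close> and \<open>x\<close> these determine both \<open>x\<close> and \<open>m\<close>.
\<close>

lemma half_flat_rigid:
  assumes A: "u2 I (F_half \<epsilon> p) C" and B: "u2 J (F_half \<epsilon> q) K" and ne: "I \<noteq> {}"
    and \<epsilon>: "\<epsilon> = 1 \<or> \<epsilon> = - 1" and p: "1 / 2 < p" and q: "1 / 2 < q"
    and conf: "conformal (I, F_half \<epsilon> p, C) (J, F_half \<epsilon> q, K)"
  shows "p = q"
proof -
  have pos: "0 < 3 * (exp (\<epsilon> * z) + r * exp (\<epsilon> * z) ^ 2)" if "0 < r" for r z using that by (simp add: add_pos_pos)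
  have "\<exists>\<phi>. u2_isometry I J (F_half \<epsilon> p) (weyl_size (F_half \<epsilon> p)) (F_half \<epsilon> q) (weyl_size (F_half \<epsilon> q)) \<phi>"
    by (rule conformal_isometry[OF A B conf])
      (use u2.half_flat_size[OF A refl \<epsilon>] u2.half_flat_size[OF B refl \<epsilon>] p q pos in auto)
  then obtain \<phi> where iso: "u2_isometry I J (F_half \<epsilon> p) (weyl_size (F_half \<epsilon> p)) (F_half \<epsilon> q) (weyl_size (F_half \<epsilon> q)) \<phi>" ..
  interpret u2_isometry I J "F_half \<epsilon> p" "weyl_size (F_half \<epsilon> p)" "F_half \<epsilon> q" "weyl_size (F_half \<epsilon> q)" \<phi> by (rule iso)
  obtain z where z: "z \<in> I" using ne by blast
  obtain v where v: "v \<in> cyl I" "zcoord v = z" using A.exists_zcoord[OF z] by blast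
  define t where "t = zcoord (\<phi> v)"
  have t: "t \<in> J" using image_coordinate[OF v(1)] by (simp add: t_def)
  define x where "x = 1 / (1 + p * exp (\<epsilon> * z))"
  define w where "w = 1 / (1 + q * exp (\<epsilon> * t))"
  have xw: "0 < x" "0 < w" using p q by (simp_all add: x_def w_def add_pos_pos)
  define m where "m = 2 * p - 1"
  define n where "n = 2 * q - 1"
  have mn: "0 < m" "0 < n" using p q by (simp_all add: m_def n_def)
  have p0: "0 < p" "0 < q" using p q by auto
  have "- 15 + 3 * x - 3 * m * x ^ 2 - m * x ^ 3 = - 15 + 3 * w - 3 * n * w ^ 2 - n * w ^ 3"
    using scalar_invariant[OF v(1)] A.half_flat_invariants(1)[OF refl \<epsilon> p0(1) z refl x_def]
      B.half_flat_invariants(1)[OF refl \<epsilon> p0(2) t refl w_def] v(2) by (simp add: t_def m_def n_def)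
  moreover have "3 / 2 * (1 - x) * (1 + m * x ^ 2) = 3 / 2 * (1 - w) * (1 + n * w ^ 2)"
    using weyl_div_invariant[OF v(1) v(2)[symmetric] t_def] A.half_flat_invariants(2)[OF refl \<epsilon> p0(1) z refl x_def]
      B.half_flat_invariants(2)[OF refl \<epsilon> p0(2) t refl w_def] by (simp only: m_def n_def)
  then have "(1 - x) * (1 + m * x ^ 2) = (1 - w) * (1 + n * w ^ 2)"
    by (simp only: mult.assoc mult_cancel_left) simp
  ultimately have 1: "m * x ^ 3 = n * w ^ 3" and 2: "x - m * x ^ 2 = w - n * w ^ 2"
    by (simp_all add: algebra_simps power2_eq_square power3_eq_cube)
  \<comment> \<open>Eliminating \<open>n\<close> from the two equations.\<close>
  have "(x - w) * (w + m * x ^ 2) = w * (x - m * x ^ 2) + m * x ^ 3 - w ^ 2" by (simp add: algebra_simps power2_eq_square power3_eq_cube)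
  also have "\<dots> = 0" unfolding 1 2 by (simp add: algebra_simps power2_eq_square power3_eq_cube)
  finally have "(x - w) * (w + m * x ^ 2) = 0" .
  moreover have "0 < w + m * x ^ 2" using xw mn by (simp add: add_pos_pos)
  ultimately have "x = w" by simp
  then have "m = n" using 1 xw by simp
  then show ?thesis by (simp add: m_def n_def)
qed

text \<open>
  In terms of \<open>u = r / (1 + r\<^sup>2) \<le> 1/2\<close> the quotient is \<open>1 - 3 u\<^sup>2 + 2 u\<^sup>3\<close>, which is strictly decreasing on
  this range; and \<open>u\<close> determines \<open>r\<close> up to inversion.
\<close>

lemma power_mean_injective:
  fixes r s :: real
  assumes r: "0 < r" and s: "0 < s" and eq: "(1 + r ^ 3) ^ 2 / (1 + r ^ 2) ^ 3 = (1 + s ^ 3) ^ 2 / (1 + s ^ 2) ^ 3"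
  shows "r = s \<or> r * s = 1"
proof -
  define u where "u = r / (1 + r ^ 2)"
  define v where "v = s / (1 + s ^ 2)"
  have half: "0 < x / (1 + x ^ 2)" "x / (1 + x ^ 2) \<le> 1 / 2" if "0 < x" for x :: real
  proof -
    have "0 \<le> (x - 1) * (x - 1)" by simp
    then have "2 * x \<le> 1 + x ^ 2" by (simp add: algebra_simps power2_eq_square)
    moreover have "0 < 1 + x ^ 2" by (simp add: add_pos_nonneg)
    ultimately show "x / (1 + x ^ 2) \<le> 1 / 2" by (simp add: pos_divide_le_eq)
    show "0 < x / (1 + x ^ 2)" using that by (simp add: add_pos_nonneg)
  qed
  have uv: "0 < u" "0 < v" "u \<le> 1 / 2" "v \<le> 1 / 2" using half[OF r] half[OF s] by (simp_all add: u_def v_def)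
  have rat: "(1 + x ^ 3) ^ 2 / (1 + x ^ 2) ^ 3 = 1 - 3 * (x / (1 + x ^ 2)) ^ 2 + 2 * (x / (1 + x ^ 2)) ^ 3" for x :: real
  proof -
    define b where "b = 1 + x ^ 2"
    have b: "b \<noteq> 0" unfolding b_def by (smt (verit) zero_le_power2)
    have "1 - 3 * (x / b) ^ 2 + 2 * (x / b) ^ 3 = (b ^ 3 - 3 * x ^ 2 * b + 2 * x ^ 3) / b ^ 3"
      using b by (simp add: field_simps power2_eq_square power3_eq_cube)
    also have "b ^ 3 - 3 * x ^ 2 * b + 2 * x ^ 3 = (1 + x ^ 3) ^ 2"
      unfolding b_def by (simp add: algebra_simps power2_eq_square power3_eq_cube)
    finally show ?thesis by (simp add: b_def)
  qed
  have "1 - 3 * u ^ 2 + 2 * u ^ 3 = 1 - 3 * v ^ 2 + 2 * v ^ 3" using eq unfolding rat u_def v_def .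
  then have "(u - v) * (3 * (u + v) - 2 * (u ^ 2 + u * v + v ^ 2)) = 0"
    by (simp add: algebra_simps power2_eq_square power3_eq_cube)
  moreover have "2 * (u ^ 2 + u * v + v ^ 2) < 3 * (u + v)"
  proof -
    have "u * u \<le> 1 / 2 * u" "u * v \<le> 1 / 2 * v" "v * v \<le> 1 / 2 * v" using uv by (auto intro!: mult_right_mono)
    moreover have "2 * (x + y + z) < 3 * (u + v)" if "x \<le> 1 / 2 * u" "y \<le> 1 / 2 * v" "z \<le> 1 / 2 * v" for x y z
      using that uv by (simp add: field_simps)
    ultimately show ?thesis unfolding power2_eq_square by blast
  qed
  ultimately have "u = v" by simp
  then have "r * (1 + s ^ 2) = s * (1 + r ^ 2)"
    unfolding u_def v_def by (simp add: frac_eq_eq add_pos_nonneg less_imp_neq[symmetric] add_nonneg_eq_0_iff)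
  then have "(r - s) * (1 - r * s) = 0" by (simp add: algebra_simps power2_eq_square)
  then show ?thesis by simp
qed

text \<open>For \<open>(C1, C2) = (C3, C4) = (c, d)\<close> the quotient of the two Weyl functions is \<open>exp (3 z)\<close>, whatever \<open>c\<close> and \<open>d\<close> are.\<close>

lemma (in u2_interval) bach_pair_weyl:
  assumes F: "F = F_sol c d c d" and z: "z \<in> I"
  shows "w_plus F z = 3 * (c + d * exp z) / exp z ^ 2" "w_minus F z = 3 * (c + d * exp z) * exp z"
proof -
  have e: "exp z \<noteq> 0" by simp
  show "w_plus F z = 3 * (c + d * exp z) / exp z ^ 2" "w_minus F z = 3 * (c + d * exp z) * exp z"
    using e sol_weyl(1,2)[of c d c d z] z unfolding exp_powers
    by (simp_all add: F) (simp_all add: field_simps power2_eq_square)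
qed

lemma (in u2_interval) bach_pair_size:
  assumes F: "F = F_sol c d c d" and cd: "0 \<le> c" "0 < d" and z: "z \<in> I"
  shows "weyl_size F z = 3 * (c + d * exp z) * sqrt (1 + exp z ^ 6) / exp z ^ 2"
proof -
  have "w_plus F z ^ 2 + w_minus F z ^ 2 = (3 * (c + d * exp z) / exp z ^ 2) ^ 2 * (1 + exp z ^ 6)"
    unfolding bach_pair_weyl[OF F z] by (simp add: field_simps power2_eq_square numeral_eq_Suc)
  moreover have "0 \<le> 3 * (c + d * exp z) / exp z ^ 2" using cd by (simp add: add_nonneg_nonneg)
  ultimately show ?thesis
    unfolding weyl_size_def by (simp only: real_sqrt_mult real_sqrt_abs abs_of_nonneg times_divide_eq_left)
qed

text \<open>The formula of \<open>bach_pair_size\<close> after the reflection \<open>z \<mapsto> - z\<close>, which exchanges \<open>c\<close> and \<open>d\<close>.\<close>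

lemma bach_pair_reflect:
  "3 * (c + d * exp (- z)) * sqrt (1 + exp (- z) ^ 6) / exp (- z) ^ 2 = 3 * (d + c * exp z) * sqrt (1 + exp z ^ 6) / exp z ^ 2"
  for z :: real
proof -
  have "1 + exp (- z) ^ 6 = (1 + exp z ^ 6) / (exp z ^ 3) ^ 2" by (simp add: exp_minus field_simps power_mult[symmetric])
  then have sqrt: "sqrt (1 + exp (- z) ^ 6) = sqrt (1 + exp z ^ 6) / exp z ^ 3"
    by (simp only: real_sqrt_divide real_sqrt_abs abs_of_nonneg zero_le_power exp_ge_zero)
  show ?thesis unfolding sqrt unfolding exp_minus by (simp add: field_simps power2_eq_square power3_eq_cube)
qed

lemma F_sol_reflect: "F_sol c1 c2 c3 c4 (- z) = F_sol c4 c3 c2 c1 z"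
  by (simp add: F_sol_def)

lemma (in u2_interval) bach_pair_ratio:
  assumes F: "F = F_sol c d c d" and cd: "0 \<le> c" "0 < d" and z: "z \<in> I"
  shows "((w_plus F z ^ 3 + w_minus F z ^ 3) / weyl_size F z ^ 3) ^ 2 = (1 + (exp z ^ 3) ^ 3) ^ 2 / (1 + (exp z ^ 3) ^ 2) ^ 3"
proof -
  define y where "y = exp z"
  define k where "k = 3 * (c + d * exp z) / exp z ^ 2"
  have k: "k \<noteq> 0" and y: "y \<noteq> 0" using cd by (auto simp: k_def y_def add_nonneg_pos less_imp_neq[symmetric] add_nonneg_eq_0_iff)
  have w: "w_plus F z = k" "w_minus F z = k * y ^ 3"
    using y unfolding bach_pair_weyl[OF F z] k_def y_def by (simp_all add: field_simps power2_eq_square power3_eq_cube)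
  define r where "r = sqrt (1 + y ^ 6)"
  have r2: "r ^ 2 = 1 + (y ^ 3) ^ 2" by (simp add: r_def power_mult[symmetric] add_nonneg_nonneg)
  have s: "weyl_size F z = k * r" unfolding bach_pair_size[OF F cd z] k_def y_def r_def by simp
  have "(w_plus F z ^ 3 + w_minus F z ^ 3) / weyl_size F z ^ 3 = (k ^ 3 * (1 + (y ^ 3) ^ 3)) / (k ^ 3 * r ^ 3)"
    unfolding w s by (simp only: power_mult_distrib distrib_left mult_1_right)
  also have "\<dots> = (1 + (y ^ 3) ^ 3) / r ^ 3" using k by simp
  finally have "((w_plus F z ^ 3 + w_minus F z ^ 3) / weyl_size F z ^ 3) ^ 2 = (1 + (y ^ 3) ^ 3) ^ 2 / (r ^ 2) ^ 3"
    by (simp add: power_divide power_mult[symmetric] mult.commute)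
  then show ?thesis unfolding r2 by (simp add: y_def)
qed

text \<open>
  The traces of the second and third power of the Weyl operator determine \<open>exp (3 z)\<close> up to inversion,
  hence \<open>\<bar>z\<bar>\<close>. So \<open>z\<^sup>2\<close> is preserved, and the length of its gradient determines \<open>F / weyl_size F\<close>, either
  directly or reflected. Comparing coefficients recovers the ordered pair, as \<open>c < d\<close>.
\<close>

lemma bach_rigid:
  assumes A': "u2_interval I (F_sol c d c d) C" and B': "u2_interval J (F_sol a b a b) K"
    and cd: "0 \<le> c" "c < d" and ab: "0 \<le> a" "a < b"
    and conf: "conformal (I, F_sol c d c d, C) (J, F_sol a b a b, K)"
  shows "c = a \<and> d = b"
proof -
  let ?F = "F_sol c d c d" and ?G = "F_sol a b a b"
  have A: "u2 I ?F C" and B: "u2 J ?G K" using A' B' by (auto simp: u2_interval_def)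
  have d: "0 < d" and b: "0 < b" using cd ab by auto
  note szA = u2_interval.bach_pair_size[OF A' refl cd(1) d] and szB = u2_interval.bach_pair_size[OF B' refl ab(1) b]
  have pos: "0 < 3 * (r + s * exp z) * sqrt (1 + exp z ^ 6) / exp z ^ 2" if "0 \<le> r" "0 < s" for r s z :: real
    using that by (simp add: add_nonneg_pos add_pos_pos)
  obtain \<phi> where iso: "u2_isometry I J ?F (weyl_size ?F) ?G (weyl_size ?G) \<phi>"
    using conformal_isometry[OF A B conf] szA szB pos[OF cd(1) d] pos[OF ab(1) b] by auto
  interpret u2_isometry I J ?F "weyl_size ?F" ?G "weyl_size ?G" \<phi> by (rule iso)
  have coord: "zcoord (\<phi> x) = zcoord x \<or> zcoord (\<phi> x) = - zcoord x" if x: "x \<in> cyl I" for x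
  proof -
    let ?z = "zcoord x" and ?t = "zcoord (\<phi> x)"
    have "exp ?z ^ 3 = exp ?t ^ 3 \<or> exp ?z ^ 3 * exp ?t ^ 3 = 1"
      by (rule power_mean_injective)
        (use weyl_trace_invariant(2)[OF x refl refl] u2_interval.bach_pair_ratio[OF A' refl cd(1) d A.base[OF x]]
          u2_interval.bach_pair_ratio[OF B' refl ab(1) b image_coordinate[OF x]] in auto)
    moreover have "exp s ^ 3 = exp (3 * s)" for s :: real using exp_of_nat_mult[of 3 s] by simp
    ultimately have "exp (3 * ?z) = exp (3 * ?t) \<or> exp (3 * ?z + 3 * ?t) = exp 0" by (simp add: exp_add)
    then have "3 * ?z = 3 * ?t \<or> 3 * ?z + 3 * ?t = 0" by (simp only: exp_inj_iff)
    then show ?thesis by auto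
  qed
  have smooth: "smooth_on U (\<lambda>z::real. z ^ 2)" if "open U" for U
    by (intro smooth_intros that smooth_on_bounded_linear bounded_linear_ident)
  define k where "k z = 3 * sqrt (1 + exp z ^ 6) / exp z ^ 2" for z :: real
  have k: "0 < k z" for z by (simp add: k_def add_pos_pos)
  have sz: "3 * (r + s * exp z) * sqrt (1 + exp z ^ 6) / exp z ^ 2 = (r + s * exp z) * k z" for r s z by (simp add: k_def)
  have rel: "F_sol c d c d z * (a + b * exp z) = F_sol a b a b z * (c + d * exp z) \<or>
    F_sol c d c d z * (b + a * exp z) = F_sol b a b a z * (c + d * exp z)" if z: "z \<in> I" "z \<noteq> 0" for z
  proof -
    obtain x where x: "x \<in> cyl I" "zcoord x = z" using A.exists_zcoord[OF z(1)] by blast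
    define t where "t = zcoord (\<phi> x)"
    have t: "t \<in> J" "t = z \<or> t = - z" using image_coordinate[OF x(1)] coord[OF x(1)] x(2) by (auto simp: t_def)
    have dsq: "deriv (\<lambda>z::real. z ^ 2) y = 2 * y" for y
      by (rule DERIV_imp_deriv) (auto intro!: derivative_eq_intros)
    have "?F z * (2 * z) ^ 2 / weyl_size ?F z = ?G t * (2 * t) ^ 2 / weyl_size ?G t"
      using gradient_invariant[OF x(1) x(2)[symmetric] t_def smooth[OF A.I] smooth[OF B.I]] coord
      unfolding dsq by fastforce
    moreover have "(2 * t) ^ 2 = (2 * z) ^ 2" using t(2) by auto
    ultimately have "(2 * z) ^ 2 * (?F z / weyl_size ?F z) = (2 * z) ^ 2 * (?G t / weyl_size ?G t)" by (simp add: mult.commute)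
    then have eq: "?F z / weyl_size ?F z = ?G t / weyl_size ?G t" using z(2) by (simp only: mult_cancel_left) simp
    have nz: "c + d * exp z \<noteq> 0" "a + b * exp z \<noteq> 0" "b + a * exp z \<noteq> 0"
      using cd ab d b by (auto simp: add_nonneg_pos less_imp_neq[symmetric] add_nonneg_eq_0_iff add_pos_nonneg)
    from t(2) show ?thesis
    proof
      assume "t = z"
      then show ?thesis
        using eq szA[OF z(1)] szB[OF t(1)] nz k[of z] unfolding sz by (simp add: frac_eq_eq less_imp_neq[symmetric] mult_ac)
    next
      assume tz: "t = - z"
      have "weyl_size ?G t = (b + a * exp z) * k z" unfolding szB[OF t(1)] unfolding tz unfolding bach_pair_reflect unfolding sz ..
      then show ?thesis
        using eq szA[OF z(1)] nz k[of z] unfolding sz tz F_sol_reflect by (simp add: frac_eq_eq less_imp_neq[symmetric] mult_ac)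
    qed
  qed
  define P where "P r s = [:r / 2, s, 1, r, s / 2:]" for r s :: real
  have P: "F_sol r s r s z * exp z ^ 2 = poly (P r s) (exp z)" for r s z
  proof -
    have "exp z \<noteq> 0" by simp
    then show ?thesis unfolding F_sol_def exp_powers P_def by (simp add: field_simps power2_eq_square)
  qed
  \<comment> \<open>Which of the alternatives holds may depend on \<open>z\<close>, but a product of two polynomials vanishes only if a factor does.\<close>
  have "(P c d * [:a, b:] - P a b * [:c, d:]) * (P c d * [:b, a:] - P b a * [:c, d:]) = 0"
  proof (rule poly_eq_on_open[OF A.I u2_interval.nonempty[OF A']])
    fix z assume z: "z \<in> I" "z \<noteq> 0"
    have "poly (P c d * [:r, s:] - P r s * [:c, d:]) (exp z)
      = exp z ^ 2 * (F_sol c d c d z * (r + s * exp z) - F_sol r s r s z * (c + d * exp z))" for r s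
      by (simp add: P[symmetric] algebra_simps)
    then show "poly ((P c d * [:a, b:] - P a b * [:c, d:]) * (P c d * [:b, a:] - P b a * [:c, d:])) (exp (1 * z)) = poly 0 (exp (1 * z))"
      using rel[OF z] by auto
  qed simp
  then have "P c d * [:a, b:] - P a b * [:c, d:] = 0 \<or> P c d * [:b, a:] - P b a * [:c, d:] = 0" by simp
  then show ?thesis
  proof
    assume "P c d * [:a, b:] - P a b * [:c, d:] = 0"
    then show ?thesis using d b by (simp add: P_def algebra_simps)
  next
    assume "P c d * [:b, a:] - P b a * [:c, d:] = 0"
    then have "c = b \<and> d = a" using d b by (simp add: P_def algebra_simps)
    then show ?thesis using cd ab by simp
  qed
qed

text \<open>
  The scalar curvature is an affine function of \<open>exp (- z)\<close>, so a homothety acts on \<open>exp (- z)\<close> by an affine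
  map \<open>L\<close>. Then \<open>\<bar>\<nabla>s\<bar>\<^sup>2\<close> relates the two functions \<open>F\<close> by a polynomial identity, which forces \<open>L\<close> to be the
  identity: it has no constant term since \<open>p3 \<noteq> 0\<close>, and slope 1 by the normalization \<open>C1 = 1\<close> and by the
  constant term 1 of \<open>F\<close>.
\<close>

lemma extremal_rigid:
  assumes A': "u2_interval I (F_sol 1 p1 p2 p3) (\<lambda>z. exp (- z))" and B': "u2_interval J (F_sol 1 q1 q2 q3) (\<lambda>z. exp (- z))"
    and p3: "p3 \<noteq> 0"
    and hom: "homothetic (I, F_sol 1 p1 p2 p3, \<lambda>z. exp (- z)) (J, F_sol 1 q1 q2 q3, \<lambda>z. exp (- z))"
  shows "p1 = q1 \<and> p2 = q2 \<and> p3 = q3"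
proof -
  let ?F = "F_sol 1 p1 p2 p3" and ?G = "F_sol 1 q1 q2 q3"
  have A: "u2 I ?F (\<lambda>z. exp (- z))" and B: "u2 J ?G (\<lambda>z. exp (- z))" using A' B' by (auto simp: u2_interval_def)
  obtain \<phi> c where c: "0 < c" and iso: "u2_isometry I J ?F (\<lambda>z. c * exp (- z)) ?G (\<lambda>z. exp (- z)) \<phi>"
    using homothetic_isometry[OF A B hom] by blast
  interpret u2_isometry I J ?F "\<lambda>z. c * exp (- z)" ?G "\<lambda>z. exp (- z)" \<phi> by (rule iso)
  have kA: "\<forall>z\<in>I. deriv (\<lambda>z. c * exp (- z)) z = - (c * exp (- z))"
    by (intro ballI DERIV_imp_deriv) (auto intro!: derivative_eq_intros)
  have kB: "\<forall>z\<in>J. deriv (\<lambda>z. exp (- z)) z = - exp (- z)"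
    by (intro ballI DERIV_imp_deriv) (auto intro!: derivative_eq_intros)
  have SA: "A.Sf z = - 24 / c * (exp (- z) + p1)" if z: "z \<in> I" for z
  proof -
    have e: "exp z \<noteq> 0" by simp
    have "A.Sf z = - 8 * (3 * (exp (- 2 * z) + p1 * exp (- z))) / (c * exp (- z))"
      unfolding A.kaehler_scalar[OF kA z] using u2_interval.sol_weyl(1)[OF A' _ z, of 1 p1 p2 p3] by simp
    also have "\<dots> = - 24 / c * (exp (- z) + p1)"
      unfolding exp_powers using e c by (simp add: field_simps power2_eq_square)
    finally show ?thesis .
  qed
  have SB: "B.Sf z = - 24 * (exp (- z) + q1)" if z: "z \<in> J" for z
  proof -
    have e: "exp z \<noteq> 0" by simp
    have "B.Sf z = - 8 * (3 * (exp (- 2 * z) + q1 * exp (- z))) / exp (- z)"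
      unfolding B.kaehler_scalar[OF kB z] using u2_interval.sol_weyl(1)[OF B' _ z, of 1 q1 q2 q3] by simp
    also have "\<dots> = - 24 * (exp (- z) + q1)"
      unfolding exp_powers using e by (simp add: field_simps power2_eq_square)
    finally show ?thesis .
  qed
  have dA: "deriv A.Sf z = 24 / c * exp (- z)" if z: "z \<in> I" for z
    by (rule A.deriv_eq_on[OF z SA]) (use c in \<open>auto intro!: derivative_eq_intros\<close>)
  have dB: "deriv B.Sf z = 24 * exp (- z)" if z: "z \<in> J" for z
    by (rule B.deriv_eq_on[OF z SB]) (auto intro!: derivative_eq_intros)
  define L where "L = [:p1 / c - q1, 1 / c:]"
  define P where "P r1 r2 r3 Y = [:r3 / 2:] + smult r2 Y + Y ^ 2 + smult r1 (Y ^ 3) + smult (1 / 2) (Y ^ 4)"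
    for r1 r2 r3 :: real and Y :: "real poly"
  have P: "F_sol 1 r1 r2 r3 z * exp (- z) ^ 2 = poly (P r1 r2 r3 Y) y" if "poly Y y = exp (- z)" for r1 r2 r3 z Y y
  proof -
    have e: "exp (- z) \<noteq> 0" "exp z = 1 / exp (- z)" "exp (2 * z) = 1 / exp (- z) ^ 2" "exp (- 2 * z) = exp (- z) ^ 2"
      using exp_powers[of "- z"] by simp_all
    show ?thesis unfolding F_sol_def e P_def using e(1) by (simp add: that) (simp add: field_simps numeral_eq_Suc)
  qed
  have "[:0, c ^ 3:] * P q1 q2 q3 L = L * P p1 p2 p3 [:0, 1:]"
  proof (rule poly_eq_on_open[OF A.I u2_interval.nonempty[OF A']])
    fix z assume z: "z \<in> I" "z \<noteq> 0"
    obtain x where x: "x \<in> cyl I" "zcoord x = z" using A.exists_zcoord[OF z(1)] by blast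
    define t where "t = zcoord (\<phi> x)"
    have t: "t \<in> J" using image_coordinate[OF x(1)] by (simp add: t_def)
    have "- 24 / c * (exp (- z) + p1) = - 24 * (exp (- t) + q1)"
      using scalar_invariant[OF x(1)] SA[OF z(1)] SB[OF t] x(2) by (simp add: t_def)
    then have L: "poly L (exp (- z)) = exp (- t)" using c by (simp add: L_def field_simps)
    have "?F z * (24 / c * exp (- z)) ^ 2 / (c * exp (- z)) = ?G t * (24 * exp (- t)) ^ 2 / exp (- t)"
      using gradient_invariant[OF x(1) x(2)[symmetric] t_def A.Sf_smooth B.Sf_smooth scalar_invariant]
      unfolding dA[OF z(1)] dB[OF t] .
    then have "?F z * exp (- z) = c ^ 3 * (?G t * exp (- t))"
      using c by (simp add: power2_eq_square power3_eq_cube divide_simps)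
    then have "exp (- t) * (?F z * exp (- z) ^ 2) = c ^ 3 * exp (- z) * (?G t * exp (- t) ^ 2)"
      by (simp add: power2_eq_square mult_ac)
    then show "poly ([:0, c ^ 3:] * P q1 q2 q3 L) (exp (- 1 * z)) = poly (L * P p1 p2 p3 [:0, 1:]) (exp (- 1 * z))"
      using P[of L "exp (- z)" t q1 q2 q3, OF L] P[of "[:0, 1:]" "exp (- z)" z p1 p2 p3] L by (simp add: mult_ac)
  qed simp
  note id = this
  \<comment> \<open>The constant coefficients give \<open>p3 * (p1 / c - q1) = 0\<close>.\<close>
  have "poly ([:0, c ^ 3:] * P q1 q2 q3 L) 0 = poly (L * P p1 p2 p3 [:0, 1:]) 0" unfolding id ..
  then have L: "L = [:0, 1 / c:]" and p1: "p1 = c * q1" using p3 c by (simp_all add: L_def P_def field_simps)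
  have "[:0, c ^ 3:] * P q1 q2 q3 [:0, 1 / c:] = [:0, 1 / c:] * P p1 p2 p3 [:0, 1:]" using id unfolding L .
  then have e: "c ^ 3 * (q3 / 2) = p3 / 2 / c" "c ^ 3 * (q2 / c) = p2 / c" "c ^ 3 * (1 / c ^ 2) = 1 / c"
    unfolding P_def using c by (simp_all add: power2_eq_square power3_eq_cube numeral_eq_Suc mult_ac)
  have "c * c = 1" using e(3) c by (simp add: power2_eq_square power3_eq_cube field_simps)
  then have "c = 1" using c by (metis abs_of_pos abs_1 power2_eq_square power2_eq_iff_nonneg less_imp_le zero_le_one mult_1)
  then show ?thesis using e p1 by simp
qed

section \<open>Parameter families\<close>

lemma u2_dataD: "(I, F, C) \<in> u2_data \<Longrightarrow> u2_interval I F C"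
  unfolding u2_data_def by unfold_locales auto

lemma smooth_on_ident: "open U \<Longrightarrow> smooth_on U (\<lambda>z::real. z)"
  by (rule smooth_on_bounded_linear[OF _ bounded_linear_ident])

lemma smooth_on_if: "smooth_on U f \<Longrightarrow> smooth_on U h \<Longrightarrow> smooth_on U (\<lambda>x. if P then f x else h x)"
  by (cases P) simp_all

lemma smooth_on_parameter: "open U \<Longrightarrow> smooth_on U (\<lambda>q::(real^'k) \<times> real. fst q $ i)"
  by (rule smooth_on_bounded_linear)
    (auto intro: bounded_linear_compose[OF bounded_linear_vec_nth bounded_linear_fst])

lemma smooth_on_F_sol:
  assumes "open U" "smooth_on U a" "smooth_on U b" "smooth_on U c" "smooth_on U d" "smooth_on U f"
  shows "smooth_on U (\<lambda>x. F_sol (a x) (b x) (c x) (d x) (f x))"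
  unfolding F_sol_def by (intro smooth_intros assms)

lemma F_sol_smooth: "open U \<Longrightarrow> smooth_on U (F_sol a b c d)"
  using smooth_on_F_sol[of U "\<lambda>z. a" "\<lambda>z. b" "\<lambda>z. c" "\<lambda>z. d" "\<lambda>z. z"]
  by (simp add: smooth_on_const smooth_on_ident)

lemma F_sol_isCont: "isCont (F_sol a b c d) z"
  unfolding F_sol_def[abs_def] by (intro continuous_intros)

text \<open>Translation of \<open>z\<close> rescales the four coefficients; this is how one parameter is removed.\<close>

lemma F_sol_translate:
  "F_sol (C1 * exp (2 * t)) (C2 * exp t) (C3 * exp (- t)) (C4 * exp (- 2 * t)) (z + t) = F_sol C1 C2 C3 C4 z"
proof -
  have e: "exp (2 * t) * exp (- 2 * (z + t)) = exp (- 2 * z)" "exp t * exp (- (z + t)) = exp (- z)"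
    "exp (- t) * exp (z + t) = exp z" "exp (- 2 * t) * exp (2 * (z + t)) = exp (2 * z)"
    by (simp_all add: mult_exp_exp algebra_simps)
  have "F_sol (C1 * exp (2 * t)) (C2 * exp t) (C3 * exp (- t)) (C4 * exp (- 2 * t)) (z + t)
    = 1 + 1 / 2 * C1 * (exp (2 * t) * exp (- 2 * (z + t))) + C2 * (exp t * exp (- (z + t)))
      + C3 * (exp (- t) * exp (z + t)) + 1 / 2 * C4 * (exp (- 2 * t) * exp (2 * (z + t)))"
    unfolding F_sol_def by (simp only: mult.assoc)
  then show ?thesis unfolding e F_sol_def .
qed

lemma translated_data:
  assumes m: "(I, F, C) \<in> u2_data" and G: "\<And>z. z \<in> I \<Longrightarrow> F_sol a b c d (z + t) = F z"
    and K: "\<And>U. open U \<Longrightarrow> smooth_on U K" "\<And>z. 0 < K z"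
  shows "((\<lambda>z. z + t) ` I, F_sol a b c d, K) \<in> u2_data"
proof -
  interpret u2_interval I F C by (rule u2_dataD[OF m])
  have "open ((\<lambda>z. z + t) ` I)" using open_translation[OF I, of t] by (simp add: add.commute)
  moreover have "is_interval ((\<lambda>z. z + t) ` I)"
    using interval is_interval_translation[of t I] by (simp add: add.commute is_interval_convex_1 convex_translation)
  ultimately show ?thesis
    using nonempty K G F_pos F_sol_smooth by (auto simp: u2_data_def)
qed

lemma small_interval:
  assumes "0 < F_sol a b c d z" and K: "\<And>U. open U \<Longrightarrow> smooth_on U K" "\<And>z. 0 < K z"
  shows "\<exists>I. (I, F_sol a b c d, K) \<in> u2_data"
proof -
  have "open {y. 0 < F_sol a b c d y}"
    by (intro open_Collect_less continuous_at_imp_continuous_on ballI F_sol_isCont continuous_const continuous_on_const)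
  then obtain e where e: "0 < e" "ball z e \<subseteq> {y. 0 < F_sol a b c d y}"
    using assms(1) by (metis mem_Collect_eq openE)
  have "is_interval (ball z e)" by (simp add: is_interval_convex_1)
  then have "(ball z e, F_sol a b c d, K) \<in> u2_data"
    using e K F_sol_smooth[of "ball z e"] by (auto simp: u2_data_def)
  then show ?thesis by blast
qed

text \<open>
  A family is given by coefficient functions \<open>a, b, c, d\<close> of the parameter, and it suffices to cover the
  functions \<open>F\<close> up to translation. The parameter domain consists of all \<open>p\<close> for which \<open>F\<close> is somewhere
  positive: this set is open, and it contains every parameter that occurs on some interval.
\<close>

lemma parameter_familyI:
  fixes a b c d :: "nat \<Rightarrow> real^'k \<Rightarrow> real" and K :: "real \<Rightarrow> real"
  assumes smooth: "\<And>n. n < N \<Longrightarrow> smooth_on UNIV (\<lambda>q::(real^'k) \<times> real. a n (fst q)) \<and> smooth_on UNIV (\<lambda>q::(real^'k) \<times> real. b n (fst q))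
      \<and> smooth_on UNIV (\<lambda>q::(real^'k) \<times> real. c n (fst q)) \<and> smooth_on UNIV (\<lambda>q::(real^'k) \<times> real. d n (fst q))"
    and K: "K = (\<lambda>z. 1) \<or> K = (\<lambda>z. exp (- z))"
    and member: "\<And>n p I. n < N \<Longrightarrow> (I, F_sol (a n p) (b n p) (c n p) (d n p), K) \<in> u2_data \<Longrightarrow>
      (I, F_sol (a n p) (b n p) (c n p) (d n p), K) \<in> X"
    and data: "X \<subseteq> u2_data"
    and cover: "\<And>I F C. (I, F, C) \<in> X \<Longrightarrow> \<exists>n<N. \<exists>p t. \<forall>z\<in>I. F_sol (a n p) (b n p) (c n p) (d n p) (z + t) = F z"
    and translate: "\<And>I F C t a b c d. (I, F, C) \<in> X \<Longrightarrow> (\<And>z. z \<in> I \<Longrightarrow> F_sol a b c d (z + t) = F z) \<Longrightarrow>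
      ((\<lambda>z. z + t) ` I, F_sol a b c d, K) \<in> u2_data \<Longrightarrow> R (I, F, C) ((\<lambda>z. z + t) ` I, F_sol a b c d, K)"
    and V: "base < N" "open V" "V \<noteq> {}" "\<And>p. p \<in> V \<Longrightarrow> \<exists>z. 0 < F_sol (a base p) (b base p) (c base p) (d base p) z"
    and rigid: "\<And>p q I J. p \<in> V \<Longrightarrow> q \<in> V \<Longrightarrow> (I, F_sol (a base p) (b base p) (c base p) (d base p), K) \<in> X \<Longrightarrow>
      (J, F_sol (a base q) (b base q) (c base q) (d base q), K) \<in> X \<Longrightarrow>
      R (I, F_sol (a base p) (b base p) (c base p) (d base p), K) (J, F_sol (a base q) (b base q) (c base q) (d base q), K) \<Longrightarrow> p = q"
  shows "parameter_family TYPE('k) X R"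
proof -
  define F where "F n p = F_sol (a n p) (b n p) (c n p) (d n p)" for n p
  define P where "P n = {p. \<exists>z. 0 < F n p z}" for n
  have Ksm: "smooth_on U K" if "open U" for U
    using K that by (elim disjE; simp only:; intro smooth_intros smooth_on_ident)
  have Kpos: "0 < K z" for z using K by auto
  have Fsm: "smooth_on UNIV (\<lambda>q. F n (fst q) (snd q))" if "n < N" for n
  proof -
    have "smooth_on UNIV (\<lambda>q::(real^'k) \<times> real. snd q)"
      by (rule smooth_on_bounded_linear[OF open_UNIV bounded_linear_snd])
    then show ?thesis unfolding F_def using smooth[OF that] by (intro smooth_on_F_sol open_UNIV) auto
  qed
  have cont: "continuous_on UNIV (\<lambda>p. F n p z)" if n: "n < N" for n z
  proof -
    have "continuous_on UNIV (\<lambda>q. F n (fst q) (snd q))"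
      by (intro continuous_at_imp_continuous_on ballI differentiable_imp_continuous_within smooth_on_differentiable[OF Fsm[OF n]]) simp
    moreover have "continuous_on UNIV (\<lambda>p::real^'k. (p, z))" by (intro continuous_intros)
    ultimately show ?thesis using continuous_on_compose2[of UNIV "\<lambda>q. F n (fst q) (snd q)" UNIV "\<lambda>p. (p, z)"] by simp
  qed
  have P: "open (P n)" if n: "n < N" for n
  proof -
    have "P n = (\<Union>z. {p. 0 < F n p z})" by (auto simp: P_def)
    then show ?thesis using cont[OF n] by (auto intro!: open_UN open_Collect_less continuous_on_const)
  qed
  have in_P: "p \<in> P n" if "(I, F n p, K) \<in> u2_data" for I n p
    using that by (auto simp: P_def u2_data_def)
  show ?thesis
    unfolding parameter_family_def
  proof (rule exI[of _ N], rule exI[of _ P], rule exI[of _ F], rule exI[of _ "\<lambda>n p. K"], intro conjI allI impI ballI)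
    fix n assume n: "n < N"
    show "open (P n)" by (rule P[OF n])
    show "smooth_on (P n \<times> UNIV) (\<lambda>(p, z). F n p z)"
      using smooth_on_subset[OF Fsm[OF n], of "P n \<times> UNIV"] by (simp add: case_prod_unfold)
    have "smooth_on (P n \<times> UNIV) (\<lambda>q::(real^'k) \<times> real. K (snd q))"
      by (rule smooth_on_compose[OF _ open_UNIV Ksm[OF open_UNIV] smooth_on_bounded_linear[OF _ bounded_linear_snd]])
        (auto intro!: open_Times P[OF n])
    then show "smooth_on (P n \<times> UNIV) (\<lambda>(p, z). K z)" by (simp add: case_prod_unfold)
    fix p assume "p \<in> P n"
    then obtain z where "0 < F n p z" by (auto simp: P_def)
    then show "\<exists>I. (I, F n p, K) \<in> X"
      using small_interval[OF _ Ksm Kpos] member[OF n] unfolding F_def by blast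
  next
    fix m assume m: "m \<in> X"
    obtain I G C where mG: "m = (I, G, C)" by (cases m)
    obtain n p t where n: "n < N" and t: "\<forall>z\<in>I. F n p (z + t) = G z"
      using cover m unfolding mG F_def by blast
    have D: "((\<lambda>z. z + t) ` I, F n p, K) \<in> u2_data"
      using translated_data[OF _ _ Ksm Kpos] m data t unfolding mG F_def by blast
    have "R m ((\<lambda>z. z + t) ` I, F n p, K)"
      using translate m t D unfolding mG F_def by blast
    then show "\<exists>n<N. \<exists>p\<in>P n. \<exists>I. (I, F n p, K) \<in> X \<and> R m (I, F n p, K)"
      using n in_P[OF D] member[OF n] D unfolding F_def by blast
  next
    show "\<exists>n<N. \<exists>V\<subseteq>P n. open V \<and> V \<noteq> {} \<and> (\<forall>p\<in>V. \<forall>q\<in>V. \<forall>I I'. (I, F n p, K) \<in> X \<longrightarrow> (I', F n q, K) \<in> X \<longrightarrow>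
        R (I, F n p, K) (I', F n q, K) \<longrightarrow> p = q)"
    proof (rule exI[of _ base], intro conjI V(1), rule exI[of _ V], intro conjI V(2,3) ballI allI impI)
      show "V \<subseteq> P base" using V(4) by (auto simp: P_def F_def)
      fix p q I I' assume "p \<in> V" "q \<in> V" "(I, F base p, K) \<in> X" "(I', F base q, K) \<in> X" "R (I, F base p, K) (I', F base q, K)"
      then show "p = q" unfolding F_def by (rule rigid)
    qed
  qed
qed

lemma conformal_translate:
  assumes "(I, F, C) \<in> u2_data" "\<And>z. z \<in> I \<Longrightarrow> F_sol a b c d (z + t) = F z"
    "((\<lambda>z. z + t) ` I, F_sol a b c d, K) \<in> u2_data"
  shows "conformal (I, F, C) ((\<lambda>z. z + t) ` I, F_sol a b c d, K)"
  using translation_conformal assms u2_dataD by (auto simp: u2_interval_def)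

text \<open>If \<open>C = C0 exp (- z)\<close>, then a translation by \<open>t\<close> changes the metric only by the constant \<open>exp (- t) / C0\<close>.\<close>

lemma homothetic_translate:
  assumes m: "(I, F, C) \<in> u2_data" "\<And>z. z \<in> I \<Longrightarrow> F_sol a b c d (z + t) = F z"
    and C: "\<exists>C0>0. \<forall>z\<in>I. C z = C0 * exp (- z)"
  shows "homothetic (I, F, C) ((\<lambda>z. z + t) ` I, F_sol a b c d, \<lambda>z. exp (- z))"
proof -
  obtain C0 where C0: "0 < C0" "\<And>z. z \<in> I \<Longrightarrow> C z = C0 * exp (- z)" using C by blast
  show ?thesis
  proof (rule translation_homothetic[where c="exp (- t) / C0"])
    show "u2 I F C" using u2_dataD[OF m(1)] by (simp add: u2_interval_def)
    show "exp (- (z + t)) = exp (- t) / C0 * C z" if "z \<in> I" for z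
      using C0(1) by (simp add: C0(2)[OF that] exp_add[symmetric] exp_minus exp_diff field_simps)
  qed (use m C0 in auto)
qed

text \<open>The values to which a coefficient can be normalized by a translation, according to its sign.\<close>

definition normal_value :: "nat \<Rightarrow> real" where "normal_value n = (if n = 0 then 1 else if n = 1 then - 1 else 0)"

lemma normalize_coefficient:
  fixes k :: real
  assumes "k \<noteq> 0" shows "\<exists>n<3. \<exists>t. C * exp (k * t) = normal_value n"
proof (cases "C = 0")
  case True
  then show ?thesis by (intro exI[of _ 2]) (simp add: normal_value_def)
next
  case False
  have "exp (k * (- ln \<bar>C\<bar> / k)) = exp (- ln \<bar>C\<bar>)" using assms by simp
  also have "\<dots> = 1 / \<bar>C\<bar>" using False by (simp add: exp_minus divide_inverse)
  finally have "exp (k * (- ln \<bar>C\<bar> / k)) = 1 / \<bar>C\<bar>" .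
  then have "C * exp (k * (- ln \<bar>C\<bar> / k)) = normal_value (if 0 < C then 0 else 1)"
    using False by (simp add: normal_value_def abs_if)
  moreover have "(if 0 < C then 0 else 1 :: nat) < 3" by simp
  ultimately show ?thesis by blast
qed

lemma open_component: "open {p::real^'k. l < p $ i \<and> p $ i < u}"
  by (intro open_Collect_conj open_Collect_less continuous_intros)

lemmas parameter_smooth = smooth_on_const smooth_on_parameter smooth_on_if smooth_on_mult smooth_on_minus

lemma extremal_tripleI:
  assumes m: "(I, F_sol a b c d, \<lambda>z. exp (- z)) \<in> u2_data"
  shows "(I, F_sol a b c d, \<lambda>z. exp (- z)) \<in> extremal_triples"
proof -
  interpret u2_interval I "F_sol a b c d" "\<lambda>z. exp (- z)" by (rule u2_dataD[OF m])
  have "\<forall>z\<in>I. L_plus (L_minus (F_sol a b c d)) z - 1 = 0" unfolding extremal_ode_iff by blast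
  moreover have "\<exists>C0>0. \<forall>z\<in>I. exp (- z) = C0 * exp (- z)" by (intro exI[of _ 1]) simp
  ultimately show ?thesis using m extremal_sol_iff by (simp add: extremal_triples_def)
qed

text \<open>The translation normalizes \<open>C1\<close>, which leaves \<open>C2\<close>, \<open>C3\<close> and \<open>C4\<close> as parameters.\<close>

lemma extremal_family: "parameter_family TYPE(3) extremal_triples homothetic"
proof -
  let ?a = "\<lambda>n (p::real^3). normal_value n" and ?b = "\<lambda>(n::nat) (p::real^3). p $ 1" and ?c = "\<lambda>(n::nat) (p::real^3). p $ 2"
    and ?d = "\<lambda>(n::nat) (p::real^3). p $ 3" and ?V = "{p::real^3. 1 < p $ 1 \<and> p $ 1 < 2} \<inter> {p. 1 < p $ 2 \<and> p $ 2 < 2} \<inter> {p. 1 < p $ 3 \<and> p $ 3 < 2}" and ?K = "\<lambda>z::real. exp (- z)"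
  have data: "extremal_triples \<subseteq> u2_data" by (auto simp: extremal_triples_def)
  have char: "(\<exists>C0>0. \<forall>z\<in>I. C z = C0 * exp (- z)) \<and> (\<exists>C1 C2 C3 C4. \<forall>z\<in>I. F z = F_sol C1 C2 C3 C4 z)"
    if "(I, F, C) \<in> extremal_triples" for I F C
  proof -
    have m: "(I, F, C) \<in> u2_data" "extremal_kaehler (cyl I) (u2_metric F C) (Jplus F)"
      using that by (auto simp: extremal_triples_def)
    then show ?thesis
      using u2_interval.extremal_sol_iff[OF u2_dataD[OF m(1)]] u2_interval.extremal_ode_iff[OF u2_dataD[OF m(1)]] by blast
  qed
  show ?thesis
  proof (rule parameter_familyI[where N=3 and a="?a" and b="?b" and c="?c" and d="?d" and K="?K" and base=0
        and V="?V"])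
    fix I F C assume "(I, F, C) \<in> extremal_triples"
    from char[OF this] obtain C1 C2 C3 C4 where F: "\<forall>z\<in>I. F z = F_sol C1 C2 C3 C4 z" by blast
    obtain n t where n: "n < 3" "C1 * exp (2 * t) = normal_value n" using normalize_coefficient[of 2 C1] by auto
    let ?p = "vector [C2 * exp t, C3 * exp (- t), C4 * exp (- 2 * t)] :: real^3"
    have "F_sol (normal_value n) (?p $ 1) (?p $ 2) (?p $ 3) (z + t) = F z" if "z \<in> I" for z
      unfolding vector_3 n(2)[symmetric] F_sol_translate using F that by simp
    then show "\<exists>n<3. \<exists>p t. \<forall>z\<in>I. F_sol (normal_value n) (p $ 1) (p $ 2) ((p::real^3) $ 3) (z + t) = F z"
      using n(1) by blast
  next
    fix I F C t a b c d assume "(I, F, C) \<in> extremal_triples" "\<And>z. z \<in> I \<Longrightarrow> F_sol a b c d (z + t) = F z"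
    then show "homothetic (I, F, C) ((\<lambda>z. z + t) ` I, F_sol a b c d, \<lambda>z. exp (- z))"
      using char data by (intro homothetic_translate) auto
  next
    fix p q :: "real^3" and I J
    assume p: "p \<in> ?V"
      and m: "(I, F_sol (normal_value 0) (p $ 1) (p $ 2) (p $ 3), ?K) \<in> extremal_triples"
        "(J, F_sol (normal_value 0) (q $ 1) (q $ 2) (q $ 3), ?K) \<in> extremal_triples"
      and h: "homothetic (I, F_sol (normal_value 0) (p $ 1) (p $ 2) (p $ 3), ?K) (J, F_sol (normal_value 0) (q $ 1) (q $ 2) (q $ 3), ?K)"
    have k: "normal_value 0 = 1" by (simp add: normal_value_def)
    have "u2_interval I (F_sol 1 (p $ 1) (p $ 2) (p $ 3)) ?K" "u2_interval J (F_sol 1 (q $ 1) (q $ 2) (q $ 3)) ?K"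
      using m u2_dataD data unfolding k by blast+
    from extremal_rigid[OF this _ h[unfolded k]] show "p = q" using p by (auto simp: vec_eq_iff forall_3)
  next
    fix p assume "p \<in> ?V"
    then show "\<exists>z. 0 < F_sol (normal_value 0) (p $ 1) (p $ 2) (p $ 3) z"
      by (intro exI[of _ 0]) (auto simp: F_sol_def normal_value_def)
  next
    have "vector [3/2, 3/2, 3/2] \<in> ?V" by simp
    then show "?V \<noteq> {}" by blast
  qed (use data extremal_tripleI open_component in \<open>auto intro!: parameter_smooth open_Int\<close>)
qed

lemma bach_tripleI:
  "(I, F_sol a b c d, K) \<in> u2_data \<Longrightarrow> a * d - b * c = 0 \<Longrightarrow> (I, F_sol a b c d, K) \<in> bach_flat_triples"
  using u2_interval.bach_flat_sol_iff[OF u2_dataD] unfolding bach_flat_triples_def by blast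

text \<open>
  The vectors \<open>(C1, C2)\<close> and \<open>(C3, C4)\<close> are parallel. If \<open>C4 \<noteq> 0\<close>, it is normalized to \<open>\<plusminus>1\<close> and the first
  vector is a multiple of the second (\<open>n = 1, 2\<close>); otherwise the second vector vanishes (\<open>n = 0\<close>) or both
  have a vanishing second entry (\<open>n = 3\<close>). Inequivalence is proved in the
  family of pairs of equal vectors (\<open>n = 4\<close>).
\<close>

lemma bach_family: "parameter_family TYPE(2) bach_flat_triples conformal"
proof -
  define a b c d :: "nat \<Rightarrow> real^2 \<Rightarrow> real" where
    "a n p = (if n = 1 \<or> n = 2 then p $ 1 * p $ 2 else p $ 1)" and
    "b n p = (if n = 1 then p $ 1 else if n = 2 then - p $ 1 else if n = 3 then 0 else p $ 2)" and
    "c n p = (if n = 0 then 0 else if n = 4 then p $ 1 else p $ 2)" and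
    "d n p = (if n = 0 \<or> n = 3 then 0 else if n = 1 then 1 else if n = 2 then - 1 else p $ 2)" for n p
  note defs = a_def b_def c_def d_def
  have data: "bach_flat_triples \<subseteq> u2_data" by (auto simp: bach_flat_triples_def)
  let ?V = "{p::real^2. 1 < p $ 1 \<and> p $ 1 < 2} \<inter> {p. 3 < p $ 2 \<and> p $ 2 < 4}"
  show ?thesis
  proof (rule parameter_familyI[where N=5 and a=a and b=b and c=c and d=d and K="\<lambda>z. 1" and base=4 and V="?V"])
    fix n p I assume n: "n < 5" and "(I, F_sol (a n p) (b n p) (c n p) (d n p), \<lambda>z. 1) \<in> u2_data"
    moreover have "a n p * d n p - b n p * c n p = 0" using n by (auto simp: defs)
    ultimately show "(I, F_sol (a n p) (b n p) (c n p) (d n p), \<lambda>z. 1) \<in> bach_flat_triples" using bach_tripleI by blast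
  next
    fix I F C assume "(I, F, C) \<in> bach_flat_triples"
    then have m: "(I, F, C) \<in> u2_data" "bach_flat (cyl I) (u2_metric F C)" by (auto simp: bach_flat_triples_def)
    then obtain C1 C2 C3 C4 where F: "\<And>z. z \<in> I \<Longrightarrow> F z = F_sol C1 C2 C3 C4 z" and q: "C1 * C4 - C2 * C3 = 0"
      using u2_interval.bach_flat_sol_iff[OF u2_dataD[OF m(1)]] by blast
    have wit: "\<exists>n<5. \<exists>p t. \<forall>z\<in>I. F_sol (a n p) (b n p) (c n p) (d n p) (z + t) = F z"
      if "n < 5" "a n p = C1 * exp (2 * t)" "b n p = C2 * exp t" "c n p = C3 * exp (- t)" "d n p = C4 * exp (- 2 * t)" for n p t
      by (intro exI[of _ n] conjI that(1) exI[of _ p] exI[of _ t] ballI)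
        (simp only: that F_sol_translate F)
    obtain n t where n: "n < 3" "C4 * exp (- 2 * t) = normal_value n" using normalize_coefficient[of "- 2" C4] by auto
    show "\<exists>n<5. \<exists>p t. \<forall>z\<in>I. F_sol (a n p) (b n p) (c n p) (d n p) (z + t) = F z"
    proof (cases "C4 = 0")
      case True
      then consider "C3 = 0" | "C2 = 0" using q by auto
      then show ?thesis
      proof cases
        case 1 then show ?thesis using True by (intro wit[of 0 "vector [C1, C2]" 0]) (simp_all add: defs)
      next
        case 2 then show ?thesis using True by (intro wit[of 3 "vector [C1, C3]" 0]) (simp_all add: defs)
      qed
    next
      case False
      define s where "s = C2 / C4"
      have C: "C2 = s * C4" "C1 = s * C3" using False q by (simp_all add: s_def field_simps)
      have e: "exp (2 * t) * exp (- t) = exp t" "exp (3 * t) * exp (- t) = exp (2 * t)" "exp (3 * t) * exp (- 2 * t) = exp t"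
        by (simp_all add: mult_exp_exp)
      let ?s = "s * exp (3 * t)"
      have C': "C1 * exp (2 * t) = ?s * (C3 * exp (- t))" "C2 * exp t = ?s * (C4 * exp (- 2 * t))"
        unfolding C e(2,3)[symmetric] by (simp_all only: mult_ac)
      have "normal_value n \<noteq> 0" using n False by auto
      then have "n = 0 \<or> n = 1" using n(1) by (auto simp: normal_value_def split: if_splits)
      then show ?thesis
      proof
        assume "n = 0"
        then show ?thesis using n(2) C' by (intro wit[of 1 "vector [?s, C3 * exp (- t)]" t]) (simp_all add: defs normal_value_def)
      next
        assume "n = 1"
        then show ?thesis using n(2) C' by (intro wit[of 2 "vector [?s, C3 * exp (- t)]" t]) (simp_all add: defs normal_value_def)
      qed
    qed
  next
    fix I F C t a b c d
    assume "(I, F, C) \<in> bach_flat_triples" "\<And>z. z \<in> I \<Longrightarrow> F_sol a b c d (z + t) = F z"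
      "((\<lambda>z. z + t) ` I, F_sol a b c d, \<lambda>z. 1) \<in> u2_data"
    then show "conformal (I, F, C) ((\<lambda>z. z + t) ` I, F_sol a b c d, \<lambda>z. 1)" using conformal_translate data by blast
  next
    fix p q :: "real^2" and I J
    assume pq: "p \<in> ?V" "q \<in> ?V"
      and m: "(I, F_sol (a 4 p) (b 4 p) (c 4 p) (d 4 p), \<lambda>z. 1) \<in> bach_flat_triples"
        "(J, F_sol (a 4 q) (b 4 q) (c 4 q) (d 4 q), \<lambda>z. 1) \<in> bach_flat_triples"
      and h: "conformal (I, F_sol (a 4 p) (b 4 p) (c 4 p) (d 4 p), \<lambda>z. 1) (J, F_sol (a 4 q) (b 4 q) (c 4 q) (d 4 q), \<lambda>z. 1)"
    have v: "a 4 p = p $ 1" "b 4 p = p $ 2" "c 4 p = p $ 1" "d 4 p = p $ 2" for p by (simp_all add: defs)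
    have "u2_interval I (F_sol (p $ 1) (p $ 2) (p $ 1) (p $ 2)) (\<lambda>z. 1)" "u2_interval J (F_sol (q $ 1) (q $ 2) (q $ 1) (q $ 2)) (\<lambda>z. 1)"
      using m u2_dataD data unfolding v by blast+
    from bach_rigid[OF this _ _ _ _ h[unfolded v]] show "p = q" using pq by (auto simp: vec_eq_iff forall_2)
  next
    fix p :: "real^2" assume "p \<in> ?V"
    then show "\<exists>z. 0 < F_sol (a 4 p) (b 4 p) (c 4 p) (d 4 p) z"
      by (intro exI[of _ 0]) (auto simp: F_sol_def defs)
  next
    have "vector [3/2, 7/2] \<in> ?V" by simp
    then show "?V \<noteq> {}" by blast
  qed (use data open_component in \<open>auto simp: defs intro!: parameter_smooth open_Int\<close>)
qed

lemma kaehler_einstein_tripleI: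
  assumes m: "(I, F_sol 0 b 0 d, \<lambda>z. exp (- z)) \<in> u2_data"
  shows "(I, F_sol 0 b 0 d, \<lambda>z. exp (- z)) \<in> kaehler_einstein_triples"
proof -
  interpret u2_interval I "F_sol 0 b 0 d" "\<lambda>z. exp (- z)" by (rule u2_dataD[OF m])
  have "\<exists>C0>0. \<forall>z\<in>I. exp (- z) = C0 * exp (- z)" by (intro exI[of _ 1]) simp
  then show ?thesis using m kaehler_einstein_sol_iff by (auto simp: kaehler_einstein_triples_def)
qed

text \<open>
  Both equivalence relations are treated at once: the covering uses homotheties, and inequivalence is
  proved for conformal maps. For the latter the family with \<open>C2 = C4\<close> is the case \<open>c = 0\<close> of \<open>bach_rigid\<close>.
\<close>

lemma kaehler_einstein_family:
  assumes R: "R = homothetic \<or> R = conformal" shows "parameter_family TYPE(1) kaehler_einstein_triples R"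
proof -
  define b d :: "nat \<Rightarrow> real^1 \<Rightarrow> real" where
    "b n p = (if n = 3 then p $ 1 else normal_value n)" and "d n p = p $ 1" for n p
  note defs = b_def d_def
  let ?K = "\<lambda>z::real. exp (- z)"
  have data: "kaehler_einstein_triples \<subseteq> u2_data" by (auto simp: kaehler_einstein_triples_def)
  have char: "(\<exists>C0>0. \<forall>z\<in>I. C z = C0 * exp (- z)) \<and> (\<exists>C2 C4. \<forall>z\<in>I. F z = F_sol 0 C2 0 C4 z)"
    if "(I, F, C) \<in> kaehler_einstein_triples" for I F C
  proof -
    have m: "(I, F, C) \<in> u2_data" "kaehler_einstein (cyl I) (u2_metric F C) (Jplus F)"
      using that by (auto simp: kaehler_einstein_triples_def)
    then show ?thesis
      using u2_interval.kaehler_einstein_sol_iff[OF u2_dataD[OF m(1)]] by blast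
  qed
  have RC: "conformal (I, F, C) (J, G, K)" if "R (I, F, C) (J, G, K)" "open I" for I J F C G K
    using R that homothetic_conformal by blast
  show ?thesis
  proof (rule parameter_familyI[where N=4 and a="\<lambda>n p. 0" and b=b and c="\<lambda>n p. 0" and d=d and K="?K" and base=3
        and V="{p::real^1. 1 < p $ 1 \<and> p $ 1 < 2}"])
    fix I F C assume "(I, F, C) \<in> kaehler_einstein_triples"
    from char[OF this] obtain C2 C4 where F: "\<forall>z\<in>I. F z = F_sol 0 C2 0 C4 z" by blast
    obtain n t where n: "n < 3" "C2 * exp t = normal_value n" using normalize_coefficient[of 1 C2] by auto
    let ?p = "(\<chi> i. C4 * exp (- 2 * t)) :: real^1"
    have "F_sol 0 (b n ?p) 0 (d n ?p) (z + t) = F z" if "z \<in> I" for z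
      using F_sol_translate[of 0 t C2 0 C4 z] F that n by (simp add: defs)
    then show "\<exists>n<4. \<exists>p t. \<forall>z\<in>I. F_sol 0 (b n p) 0 (d n p) (z + t) = F z"
      using n(1) by (intro exI[of _ n]) auto
  next
    fix I F C t a b c d assume *: "(I, F, C) \<in> kaehler_einstein_triples" "\<And>z. z \<in> I \<Longrightarrow> F_sol a b c d (z + t) = F z"
    have "homothetic (I, F, C) ((\<lambda>z. z + t) ` I, F_sol a b c d, ?K)"
      using char data * by (intro homothetic_translate) auto
    moreover have "open I" using * data by (auto simp: u2_data_def)
    ultimately show "R (I, F, C) ((\<lambda>z. z + t) ` I, F_sol a b c d, ?K)" using R homothetic_conformal by blast
  next
    fix p q :: "real^1" and I J
    assume pq: "p \<in> {p. 1 < p $ 1 \<and> p $ 1 < 2}" "q \<in> {p. 1 < p $ 1 \<and> p $ 1 < 2}"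
      and m: "(I, F_sol 0 (b 3 p) 0 (d 3 p), ?K) \<in> kaehler_einstein_triples" "(J, F_sol 0 (b 3 q) 0 (d 3 q), ?K) \<in> kaehler_einstein_triples"
      and h: "R (I, F_sol 0 (b 3 p) 0 (d 3 p), ?K) (J, F_sol 0 (b 3 q) 0 (d 3 q), ?K)"
    have v: "b 3 p = p $ 1" "d 3 p = p $ 1" for p by (simp_all add: defs)
    have U: "u2_interval I (F_sol 0 (p $ 1) 0 (p $ 1)) ?K" "u2_interval J (F_sol 0 (q $ 1) 0 (q $ 1)) ?K"
      using m u2_dataD data unfolding v by blast+
    then have "open I" by (simp add: u2_interval_def u2_def)
    from bach_rigid[OF U _ _ _ _ RC[OF h this, unfolded v]] show "p = q" using pq by (auto simp: vec_eq_iff)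
  next
    fix p :: "real^1" assume "p \<in> {p. 1 < p $ 1 \<and> p $ 1 < 2}"
    then show "\<exists>z. 0 < F_sol 0 (b 3 p) 0 (d 3 p) z" by (intro exI[of _ 0]) (auto simp: F_sol_def defs)
  next
    have "(\<chi> i. 3/2) \<in> {p::real^1. 1 < p $ 1 \<and> p $ 1 < 2}" by simp
    then show "{p::real^1. 1 < p $ 1 \<and> p $ 1 < 2} \<noteq> {}" by blast
  qed (use data open_component kaehler_einstein_tripleI in \<open>auto simp: defs intro!: parameter_smooth\<close>)
qed

lemma F_half_sol: "F_half 1 p = F_sol 0 0 1 p" "F_half (- 1) p = F_sol p 1 0 0"
  by (auto simp: F_half_def F_sol_def exp_powers fun_eq_iff power_divide)

text \<open>The coefficient of \<open>exp z\<close> is normalized, and that of \<open>exp (2 z)\<close> is the parameter.\<close>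

lemma weyl_plus_family: "parameter_family TYPE(1) weyl_plus_zero_triples conformal"
proof -
  have data: "weyl_plus_zero_triples \<subseteq> u2_data" by (auto simp: weyl_plus_zero_triples_def)
  have k: "normal_value 0 = 1" by (simp add: normal_value_def)
  have char: "(I, F, C) \<in> weyl_plus_zero_triples \<longleftrightarrow> (\<exists>C3 C4. \<forall>z\<in>I. F z = F_sol 0 0 C3 C4 z)"
    if "(I, F, C) \<in> u2_data" for I F C
  proof -
    interpret u2_interval I F C by (rule u2_dataD[OF that])
    show ?thesis using that w_plus_zero_iff weyl_plus_zero_iff by (simp add: weyl_plus_zero_triples_def F_sol_def)
  qed
  show ?thesis
  proof (rule parameter_familyI[where N=3 and a="\<lambda>n p. 0" and b="\<lambda>n p. 0" and c="\<lambda>n (p::real^1). normal_value n" and d="\<lambda>n p. p $ 1"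
        and K="\<lambda>z. 1" and base=0 and V="{p::real^1. 1 < p $ 1 \<and> p $ 1 < 2}"])
    fix I F C assume "(I, F, C) \<in> weyl_plus_zero_triples"
    then obtain C3 C4 where F: "\<forall>z\<in>I. F z = F_sol 0 0 C3 C4 z" using char data by blast
    obtain n t where n: "n < 3" "C3 * exp (- t) = normal_value n" using normalize_coefficient[of "- 1" C3] by auto
    let ?p = "(\<chi> i. C4 * exp (- 2 * t)) :: real^1"
    have "F_sol 0 0 (normal_value n) (?p $ 1) (z + t) = F z" if "z \<in> I" for z
      using F_sol_translate[of 0 t 0 C3 C4 z] F that n by simp
    then show "\<exists>n<3. \<exists>p t. \<forall>z\<in>I. F_sol 0 0 (normal_value n) ((p::real^1) $ 1) (z + t) = F z" using n(1) by blast
  next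
    fix I F C t a b c d
    assume "(I, F, C) \<in> weyl_plus_zero_triples" "\<And>z. z \<in> I \<Longrightarrow> F_sol a b c d (z + t) = F z"
      "((\<lambda>z. z + t) ` I, F_sol a b c d, \<lambda>z. 1) \<in> u2_data"
    then show "conformal (I, F, C) ((\<lambda>z. z + t) ` I, F_sol a b c d, \<lambda>z. 1)" using conformal_translate data by blast
  next
    fix p q :: "real^1" and I J
    assume pq: "p \<in> {p. 1 < p $ 1 \<and> p $ 1 < 2}" "q \<in> {p. 1 < p $ 1 \<and> p $ 1 < 2}"
      and m: "(I, F_sol 0 0 (normal_value 0) (p $ 1), \<lambda>z. 1) \<in> weyl_plus_zero_triples" "(J, F_sol 0 0 (normal_value 0) (q $ 1), \<lambda>z. 1) \<in> weyl_plus_zero_triples"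
      and h: "conformal (I, F_sol 0 0 (normal_value 0) (p $ 1), \<lambda>z. 1) (J, F_sol 0 0 (normal_value 0) (q $ 1), \<lambda>z. 1)"
    have U: "u2_interval I (F_half 1 (p $ 1)) (\<lambda>z. 1)" "u2_interval J (F_half 1 (q $ 1)) (\<lambda>z. 1)"
      using m u2_dataD data unfolding k F_half_sol by blast+
    have "p $ 1 = q $ 1"
      by (rule half_flat_rigid[where \<epsilon>=1 and I=I and J=J and C="\<lambda>z. 1" and K="\<lambda>z. 1"])
        (use U pq h u2_interval.nonempty[OF U(1)] in \<open>auto simp: F_half_sol k u2_interval_def\<close>)
    then show "p = q" by (simp add: vec_eq_iff)
  next
    fix p :: "real^1" assume "p \<in> {p. 1 < p $ 1 \<and> p $ 1 < 2}"
    then show "\<exists>z. 0 < F_sol 0 0 (normal_value 0) (p $ 1) z" by (intro exI[of _ 0]) (auto simp: F_sol_def k)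
  next
    have "(\<chi> i. 3/2) \<in> {p::real^1. 1 < p $ 1 \<and> p $ 1 < 2}" by simp
    then show "{p::real^1. 1 < p $ 1 \<and> p $ 1 < 2} \<noteq> {}" by blast
  qed (use data open_component char in \<open>auto intro!: parameter_smooth\<close>)
qed

lemma weyl_minus_family: "parameter_family TYPE(1) weyl_minus_zero_triples conformal"
proof -
  have data: "weyl_minus_zero_triples \<subseteq> u2_data" by (auto simp: weyl_minus_zero_triples_def)
  have k: "normal_value 0 = 1" by (simp add: normal_value_def)
  have char: "(I, F, C) \<in> weyl_minus_zero_triples \<longleftrightarrow> (\<exists>C1 C2. \<forall>z\<in>I. F z = F_sol C1 C2 0 0 z)"
    if "(I, F, C) \<in> u2_data" for I F C
  proof -
    interpret u2_interval I F C by (rule u2_dataD[OF that])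
    show ?thesis using that w_minus_zero_iff weyl_minus_zero_iff by (simp add: weyl_minus_zero_triples_def F_sol_def)
  qed
  show ?thesis
  proof (rule parameter_familyI[where N=3 and c="\<lambda>n p. 0" and d="\<lambda>n p. 0" and b="\<lambda>n (p::real^1). normal_value n" and a="\<lambda>n p. p $ 1"
        and K="\<lambda>z. 1" and base=0 and V="{p::real^1. 1 < p $ 1 \<and> p $ 1 < 2}"])
    fix I F C assume "(I, F, C) \<in> weyl_minus_zero_triples"
    then obtain C1 C2 where F: "\<forall>z\<in>I. F z = F_sol C1 C2 0 0 z" using char data by blast
    obtain n t where n: "n < 3" "C2 * exp t = normal_value n" using normalize_coefficient[of 1 C2] by auto
    let ?p = "(\<chi> i. C1 * exp (2 * t)) :: real^1"
    have "F_sol (?p $ 1) (normal_value n) 0 0 (z + t) = F z" if "z \<in> I" for z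
      using F_sol_translate[of C1 t C2 0 0 z] F that n by simp
    then show "\<exists>n<3. \<exists>p t. \<forall>z\<in>I. F_sol ((p::real^1) $ 1) (normal_value n) 0 0 (z + t) = F z" using n(1) by blast
  next
    fix I F C t a b c d
    assume "(I, F, C) \<in> weyl_minus_zero_triples" "\<And>z. z \<in> I \<Longrightarrow> F_sol a b c d (z + t) = F z"
      "((\<lambda>z. z + t) ` I, F_sol a b c d, \<lambda>z. 1) \<in> u2_data"
    then show "conformal (I, F, C) ((\<lambda>z. z + t) ` I, F_sol a b c d, \<lambda>z. 1)" using conformal_translate data by blast
  next
    fix p q :: "real^1" and I J
    assume pq: "p \<in> {p. 1 < p $ 1 \<and> p $ 1 < 2}" "q \<in> {p. 1 < p $ 1 \<and> p $ 1 < 2}"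
      and m: "(I, F_sol (p $ 1) (normal_value 0) 0 0, \<lambda>z. 1) \<in> weyl_minus_zero_triples" "(J, F_sol (q $ 1) (normal_value 0) 0 0, \<lambda>z. 1) \<in> weyl_minus_zero_triples"
      and h: "conformal (I, F_sol (p $ 1) (normal_value 0) 0 0, \<lambda>z. 1) (J, F_sol (q $ 1) (normal_value 0) 0 0, \<lambda>z. 1)"
    have U: "u2_interval I (F_half (- 1) (p $ 1)) (\<lambda>z. 1)" "u2_interval J (F_half (- 1) (q $ 1)) (\<lambda>z. 1)"
      using m u2_dataD data unfolding k F_half_sol by blast+
    have "p $ 1 = q $ 1"
      by (rule half_flat_rigid[where \<epsilon>="- 1" and I=I and J=J and C="\<lambda>z. 1" and K="\<lambda>z. 1"])
        (use U pq h u2_interval.nonempty[OF U(1)] in \<open>auto simp: F_half_sol k u2_interval_def\<close>)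
    then show "p = q" by (simp add: vec_eq_iff)
  next
    fix p :: "real^1" assume "p \<in> {p. 1 < p $ 1 \<and> p $ 1 < 2}"
    then show "\<exists>z. 0 < F_sol (p $ 1) (normal_value 0) 0 0 z" by (intro exI[of _ 0]) (auto simp: F_sol_def k)
  next
    have "(\<chi> i. 3/2) \<in> {p::real^1. 1 < p $ 1 \<and> p $ 1 < 2}" by simp
    then show "{p::real^1. 1 < p $ 1 \<and> p $ 1 < 2} \<noteq> {}" by blast
  qed (use data open_component char in \<open>auto intro!: parameter_smooth\<close>)
qed

section \<open>The classification\<close>

lemma bach_flat_extremal:
  assumes "(I, F, C) \<in> bach_flat_triples" shows "\<exists>C'. (I, F, C') \<in> extremal_triples"
proof -
  have m: "(I, F, C) \<in> u2_data" "bach_flat (cyl I) (u2_metric F C)" using assms by (auto simp: bach_flat_triples_def)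
  interpret A: u2_interval I F C by (rule u2_dataD[OF m(1)])
  have "smooth_on I (\<lambda>z. exp (- z))" by (intro smooth_intros A.I smooth_on_ident)
  then have m': "(I, F, \<lambda>z. exp (- z)) \<in> u2_data" using m(1) by (simp add: u2_data_def)
  interpret B: u2_interval I F "\<lambda>z. exp (- z)" by (rule u2_dataD[OF m'])
  have "\<exists>C0>0. \<forall>z\<in>I. exp (- z) = C0 * exp (- z)" by (intro exI[of _ 1]) simp
  moreover have "\<forall>z\<in>I. L_plus (L_minus F) z - 1 = 0"
    using m(2) unfolding A.bach_flat_sol_iff A.extremal_ode_iff by blast
  ultimately have "(I, F, \<lambda>z. exp (- z)) \<in> extremal_triples"
    using m' B.extremal_sol_iff by (simp add: extremal_triples_def)
  then show ?thesis by blast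
qed

lemma bach_flat_subsets:
  "weyl_plus_zero_triples \<subseteq> bach_flat_triples" "weyl_minus_zero_triples \<subseteq> bach_flat_triples"
  "kaehler_einstein_triples \<subseteq> bach_flat_triples"
proof -
  have iff: "bach_flat (cyl I) (u2_metric F C) \<longleftrightarrow> (\<exists>C1 C2 C3 C4. (\<forall>z\<in>I. F z = F_sol C1 C2 C3 C4 z) \<and> C1 * C4 - C2 * C3 = 0)"
    if "(I, F, C) \<in> u2_data" for I F C by (rule u2_interval.bach_flat_sol_iff[OF u2_dataD[OF that]])
  have "bach_flat (cyl I) (u2_metric F C)" if m: "(I, F, C) \<in> u2_data" and W: "weyl_plus_zero (cyl I) (u2_metric F C)" for I F C
  proof -
    interpret u2_interval I F C by (rule u2_dataD[OF m])
    obtain C3 C4 where "\<forall>z\<in>I. F z = 1 + C3 * exp z + 1 / 2 * C4 * exp (2 * z)"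
      using W unfolding weyl_plus_zero_iff w_plus_zero_iff by blast
    then have "\<forall>z\<in>I. F z = F_sol 0 0 C3 C4 z" by (simp add: F_sol_def)
    then show ?thesis
      unfolding iff[OF m] by - (rule exI[of _ 0], rule exI[of _ 0], rule exI[of _ C3], rule exI[of _ C4], simp)
  qed
  then show "weyl_plus_zero_triples \<subseteq> bach_flat_triples"
    by (auto simp: weyl_plus_zero_triples_def bach_flat_triples_def)
  have "bach_flat (cyl I) (u2_metric F C)" if m: "(I, F, C) \<in> u2_data" and W: "weyl_minus_zero (cyl I) (u2_metric F C)" for I F C
  proof -
    interpret u2_interval I F C by (rule u2_dataD[OF m])
    obtain C1 C2 where "\<forall>z\<in>I. F z = 1 + 1 / 2 * C1 * exp (- 2 * z) + C2 * exp (- z)"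
      using W unfolding weyl_minus_zero_iff w_minus_zero_iff by blast
    then have "\<forall>z\<in>I. F z = F_sol C1 C2 0 0 z" by (simp add: F_sol_def)
    then show ?thesis
      unfolding iff[OF m] by - (rule exI[of _ C1], rule exI[of _ C2], rule exI[of _ 0], rule exI[of _ 0], simp)
  qed
  then show "weyl_minus_zero_triples \<subseteq> bach_flat_triples"
    by (auto simp: weyl_minus_zero_triples_def bach_flat_triples_def)
  have "bach_flat (cyl I) (u2_metric F C)" if m: "(I, F, C) \<in> u2_data" and W: "kaehler_einstein (cyl I) (u2_metric F C) (Jplus F)" for I F C
  proof -
    obtain C2 C4 where F: "\<forall>z\<in>I. F z = F_sol 0 C2 0 C4 z"
      using W unfolding u2_interval.kaehler_einstein_sol_iff[OF u2_dataD[OF m]] by blast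
    then show ?thesis
      unfolding iff[OF m] by - (rule exI[of _ 0], rule exI[of _ C2], rule exI[of _ 0], rule exI[of _ C4], simp)
  qed
  then show "kaehler_einstein_triples \<subseteq> bach_flat_triples"
    by (auto simp: kaehler_einstein_triples_def bach_flat_triples_def)
qed

theorem proposition1p2:
  shows
  "(\<forall>I F C. (I, F, C) \<in> u2_data \<longrightarrow>
      (extremal_kaehler (cyl I) (u2_metric F C) (Jplus F) \<longleftrightarrow>
         (\<exists>C0>0. \<forall>z\<in>I. C z = C0 * exp (- z)) \<and> (\<forall>z\<in>I. L_plus (L_minus F) z - 1 = 0)) \<and>
      ((\<forall>z\<in>I. L_plus (L_minus F) z - 1 = 0) \<longleftrightarrow>
         (\<exists>C1 C2 C3 C4. \<forall>z\<in>I. F z = F_sol C1 C2 C3 C4 z)) \<and>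
      (bach_flat (cyl I) (u2_metric F C) \<longleftrightarrow>
         (\<exists>C1 C2 C3 C4. (\<forall>z\<in>I. F z = F_sol C1 C2 C3 C4 z) \<and> C1 * C4 - C2 * C3 = 0)) \<and>
      (kaehler_einstein (cyl I) (u2_metric F C) (Jplus F) \<longleftrightarrow>
         (\<exists>C0>0. \<forall>z\<in>I. C z = C0 * exp (- z)) \<and>
         (\<exists>C1 C2 C3 C4. (\<forall>z\<in>I. F z = F_sol C1 C2 C3 C4 z) \<and> C1 = 0 \<and> C3 = 0)) \<and>
      (weyl_plus_zero (cyl I) (u2_metric F C) \<longleftrightarrow> (\<forall>z\<in>I. L_plus F z - 1 = 0)) \<and>
      ((\<forall>z\<in>I. L_plus F z - 1 = 0) \<longleftrightarrow>
         (\<exists>C3 C4. \<forall>z\<in>I. F z = 1 + C3 * exp z + 1 / 2 * C4 * exp (2 * z))) \<and>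
      (weyl_minus_zero (cyl I) (u2_metric F C) \<longleftrightarrow> (\<forall>z\<in>I. L_minus F z - 1 = 0)) \<and>
      ((\<forall>z\<in>I. L_minus F z - 1 = 0) \<longleftrightarrow>
         (\<exists>C1 C2. \<forall>z\<in>I. F z = 1 + 1 / 2 * C1 * exp (- 2 * z) + C2 * exp (- z)))) \<and>
   parameter_family TYPE(3) extremal_triples homothetic \<and>
   parameter_family TYPE(2) bach_flat_triples conformal \<and>
   (\<forall>I F C. (I, F, C) \<in> bach_flat_triples \<longrightarrow> (\<exists>C'. (I, F, C') \<in> extremal_triples)) \<and>
   weyl_plus_zero_triples \<subseteq> bach_flat_triples \<and>
   parameter_family TYPE(1) weyl_plus_zero_triples conformal \<and>
   weyl_minus_zero_triples \<subseteq> bach_flat_triples \<and>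
   parameter_family TYPE(1) weyl_minus_zero_triples conformal \<and>
   kaehler_einstein_triples \<subseteq> bach_flat_triples \<and>
   parameter_family TYPE(1) kaehler_einstein_triples homothetic \<and>
   parameter_family TYPE(1) kaehler_einstein_triples conformal"
proof (intro conjI allI impI)
  fix I F C assume m: "(I, F, C) \<in> u2_data"
  interpret u2_interval I F C by (rule u2_dataD[OF m])
  show "extremal_kaehler (cyl I) (u2_metric F C) (Jplus F) \<longleftrightarrow>
         (\<exists>C0>0. \<forall>z\<in>I. C z = C0 * exp (- z)) \<and> (\<forall>z\<in>I. L_plus (L_minus F) z - 1 = 0)"
    by (rule extremal_sol_iff)
  show "(\<forall>z\<in>I. L_plus (L_minus F) z - 1 = 0) \<longleftrightarrow> (\<exists>C1 C2 C3 C4. \<forall>z\<in>I. F z = F_sol C1 C2 C3 C4 z)"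
    by (rule extremal_ode_iff)
  show "bach_flat (cyl I) (u2_metric F C) \<longleftrightarrow>
         (\<exists>C1 C2 C3 C4. (\<forall>z\<in>I. F z = F_sol C1 C2 C3 C4 z) \<and> C1 * C4 - C2 * C3 = 0)"
    by (rule bach_flat_sol_iff)
  show "kaehler_einstein (cyl I) (u2_metric F C) (Jplus F) \<longleftrightarrow>
         (\<exists>C0>0. \<forall>z\<in>I. C z = C0 * exp (- z)) \<and>
         (\<exists>C1 C2 C3 C4. (\<forall>z\<in>I. F z = F_sol C1 C2 C3 C4 z) \<and> C1 = 0 \<and> C3 = 0)"
    by (rule kaehler_einstein_sol_iff)
  show "weyl_plus_zero (cyl I) (u2_metric F C) \<longleftrightarrow> (\<forall>z\<in>I. L_plus F z - 1 = 0)"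
    "weyl_minus_zero (cyl I) (u2_metric F C) \<longleftrightarrow> (\<forall>z\<in>I. L_minus F z - 1 = 0)"
    unfolding weyl_plus_zero_iff weyl_minus_zero_iff by (simp_all add: L_plus_w L_minus_w)
  show "(\<forall>z\<in>I. L_plus F z - 1 = 0) \<longleftrightarrow> (\<exists>C3 C4. \<forall>z\<in>I. F z = 1 + C3 * exp z + 1 / 2 * C4 * exp (2 * z))"
    using w_plus_zero_iff by (simp add: L_plus_w)
  show "(\<forall>z\<in>I. L_minus F z - 1 = 0) \<longleftrightarrow> (\<exists>C1 C2. \<forall>z\<in>I. F z = 1 + 1 / 2 * C1 * exp (- 2 * z) + C2 * exp (- z))"
    using w_minus_zero_iff by (simp add: L_minus_w)
qed (use bach_flat_extremal bach_flat_subsets extremal_family bach_family weyl_plus_family weyl_minus_family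
      kaehler_einstein_family in blast)+

end
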